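(* Let $M$ be a Dedekind-finite monoid with group of units $G$ and ideal of singular elements $S=M\setminus G$, and let $K$ be a commutative ring with unit. Then \[\mathrm{Ext}^n_{KM}(K,K_{(G)})\cong H^n(G\backslash\mathcal EM,\,G\backslash S\mathcal EM,\,K)\] for all $n\geq 0$.
   Context: A monoid is Dedekind-finite if each left invertible element is right invertible; equivalently, the nonunits form a two-sided ideal. $KM$ is the monoid algebra and modules are left modules. $K$ denotes the trivial $KM$-module (every $m\in M$ acts as the identity). $K_{(G)}$ denotes the $KM$-module with underlying $K$-module $K$ on which elements of $G$ act as the identity and elements of $S$ act as $0$. For a right $M$-set $X$, $X\rtimes M$ is the category with object set $X$ and arrow set $X\times M$, where $(x,m)$ is an arrow from $xm$ to $x$, with composition $(x,m)(xm,n)=(x,mn)$. $\mathcal B\mathscr C$ is the geometric realization of the nerve of a category $\mathscr C$, with its natural CW structure whose cells correspond to nondegenerate simplices. Let $U(M)$ be the underlying set of $M$ with the right multiplication action; $\mathcal EM=\mathcal B(U(M)\rtimes M)$ and $S\mathcal EM=\mathcal B(S\rtimes M)$, a subcomplex of $\mathcal EM$. $G$ acts on the left of $U(M)\rtimes M$ by $g\cdot x=gx$ on objects and $g(x,m)=(gx,m)$ on arrows, hence cellularly on the pair $(\mathcal EM,S\mathcal EM)$; $G\backslash\mathcal EM$ and $G\backslash S\mathcal EM$ are the orbit spaces, forming a CW pair, and the right-hand side is relative cohomology of this pair with coefficients in $K$. *)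

theory Defs
  imports "HOL-Algebra.Module" "HOL-Algebra.AbelCoset" "HOL-Homology.Homology"
begin

section \<open>Monoids and monoid algebras\<close>

definition dedekind_finite :: "('m, 'x) monoid_scheme \<Rightarrow> bool" where
  "dedekind_finite M \<longleftrightarrow>
     (\<forall>x\<in>carrier M. (\<exists>y\<in>carrier M. y \<otimes>\<^bsub>M\<^esub> x = \<one>\<^bsub>M\<^esub>) \<longrightarrow> (\<exists>z\<in>carrier M. x \<otimes>\<^bsub>M\<^esub> z = \<one>\<^bsub>M\<^esub>))"

definition singular_elements :: "('m, 'x) monoid_scheme \<Rightarrow> 'm set" where
  "singular_elements M = carrier M - Units M"

definition support_in :: "('k, 'x) ring_scheme \<Rightarrow> 'i set \<Rightarrow> ('i \<Rightarrow> 'k) \<Rightarrow> 'i set" where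
  "support_in K I f = {i \<in> I. f i \<noteq> \<zero>\<^bsub>K\<^esub>}"

definition fin_supp_funs :: "('k, 'x) ring_scheme \<Rightarrow> 'i set \<Rightarrow> ('i \<Rightarrow> 'k) set" where
  "fin_supp_funs K I = {f \<in> I \<rightarrow>\<^sub>E carrier K. finite (support_in K I f)}"

definition monoid_algebra ::
  "('k, 'x) ring_scheme \<Rightarrow> ('m, 'y) monoid_scheme \<Rightarrow> ('m \<Rightarrow> 'k) ring" where
  "monoid_algebra K M =
     \<lparr> carrier = fin_supp_funs K (carrier M),
       monoid.mult = (\<lambda>f g. \<lambda>m\<in>carrier M.
          finsum K (\<lambda>(a, b). f a \<otimes>\<^bsub>K\<^esub> g b)
            {(a, b). a \<in> support_in K (carrier M) f \<and> b \<in> support_in K (carrier M) g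
                     \<and> a \<otimes>\<^bsub>M\<^esub> b = m}),
       one = (\<lambda>m\<in>carrier M. if m = \<one>\<^bsub>M\<^esub> then \<one>\<^bsub>K\<^esub> else \<zero>\<^bsub>K\<^esub>),
       zero = (\<lambda>m\<in>carrier M. \<zero>\<^bsub>K\<^esub>),
       add = (\<lambda>f g. \<lambda>m\<in>carrier M. f m \<oplus>\<^bsub>K\<^esub> g m) \<rparr>"

text \<open>The structure map of the \<open>K\<close>-algebra \<open>KM\<close>, sending \<open>k\<close> to \<open>k\<close> times the unit.\<close>

definition monoid_algebra_scalar ::
  "('k, 'x) ring_scheme \<Rightarrow> ('m, 'y) monoid_scheme \<Rightarrow> 'k \<Rightarrow> 'm \<Rightarrow> 'k" where
  "monoid_algebra_scalar K M k = (\<lambda>m\<in>carrier M. if m = \<one>\<^bsub>M\<^esub> then k else \<zero>\<^bsub>K\<^esub>)"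


section \<open>Left modules over arbitrary rings\<close>

text \<open>The locale \<^locale>\<open>module\<close> requires a commutative base ring, so its axioms are restated
  over a ring. As for that locale, the fields \<open>mult\<close> and \<open>one\<close> of a module record are
  irrelevant.\<close>

locale left_module = R?: ring R + M?: abelian_group M
  for R :: "('r, 'x) ring_scheme" (structure) and M :: "('r, 'a, 'y) module_scheme" (structure) +
  assumes smult_closed:
      "\<lbrakk>a \<in> carrier R; x \<in> carrier M\<rbrakk> \<Longrightarrow> a \<odot>\<^bsub>M\<^esub> x \<in> carrier M"
    and smult_l_distr:
      "\<lbrakk>a \<in> carrier R; b \<in> carrier R; x \<in> carrier M\<rbrakk> \<Longrightarrow>
       (a \<oplus>\<^bsub>R\<^esub> b) \<odot>\<^bsub>M\<^esub> x = a \<odot>\<^bsub>M\<^esub> x \<oplus>\<^bsub>M\<^esub> b \<odot>\<^bsub>M\<^esub> x"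
    and smult_r_distr:
      "\<lbrakk>a \<in> carrier R; x \<in> carrier M; y \<in> carrier M\<rbrakk> \<Longrightarrow>
       a \<odot>\<^bsub>M\<^esub> (x \<oplus>\<^bsub>M\<^esub> y) = a \<odot>\<^bsub>M\<^esub> x \<oplus>\<^bsub>M\<^esub> a \<odot>\<^bsub>M\<^esub> y"
    and smult_assoc1:
      "\<lbrakk>a \<in> carrier R; b \<in> carrier R; x \<in> carrier M\<rbrakk> \<Longrightarrow>
       (a \<otimes>\<^bsub>R\<^esub> b) \<odot>\<^bsub>M\<^esub> x = a \<odot>\<^bsub>M\<^esub> (b \<odot>\<^bsub>M\<^esub> x)"
    and smult_one: "x \<in> carrier M \<Longrightarrow> \<one>\<^bsub>R\<^esub> \<odot>\<^bsub>M\<^esub> x = x"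

definition linear_maps ::
  "('r, 'x) ring_scheme \<Rightarrow> ('r, 'a, 'y) module_scheme \<Rightarrow> ('r, 'b, 'z) module_scheme \<Rightarrow> ('a \<Rightarrow> 'b) set"
  where
  "linear_maps R A B = {f \<in> carrier A \<rightarrow> carrier B.
      (\<forall>x\<in>carrier A. \<forall>y\<in>carrier A. f (x \<oplus>\<^bsub>A\<^esub> y) = f x \<oplus>\<^bsub>B\<^esub> f y) \<and>
      (\<forall>r\<in>carrier R. \<forall>x\<in>carrier A. f (r \<odot>\<^bsub>A\<^esub> x) = r \<odot>\<^bsub>B\<^esub> f x)}"

definition modules_isomorphic ::
  "('r, 'x) ring_scheme \<Rightarrow> ('r, 'a, 'y) module_scheme \<Rightarrow> ('r, 'b, 'z) module_scheme \<Rightarrow> bool" where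
  "modules_isomorphic R A B \<longleftrightarrow> (\<exists>f\<in>linear_maps R A B. bij_betw f (carrier A) (carrier B))"

definition free_module :: "('r, 'x) ring_scheme \<Rightarrow> 'i set \<Rightarrow> ('r, 'i \<Rightarrow> 'r) module" where
  "free_module R I =
     \<lparr> carrier = fin_supp_funs R I, monoid.mult = undefined, one = undefined,
       zero = (\<lambda>i\<in>I. \<zero>\<^bsub>R\<^esub>),
       add = (\<lambda>f g. \<lambda>i\<in>I. f i \<oplus>\<^bsub>R\<^esub> g i),
       smult = (\<lambda>r f. \<lambda>i\<in>I. r \<otimes>\<^bsub>R\<^esub> f i) \<rparr>"

text \<open>Projective means: a direct summand (retract) of a free module. Taking the basis \<open>I\<close> to be
  a set of elements of the carrier type of \<open>P\<close> is no restriction, because a projective \<open>P\<close> is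
  a retract of the free module on \<open>carrier P\<close>.\<close>

definition projective_module :: "('r, 'x) ring_scheme \<Rightarrow> ('r, 'p, 'y) module_scheme \<Rightarrow> bool" where
  "projective_module R P \<longleftrightarrow> left_module R P \<and>
     (\<exists>(I :: 'p set) s q. s \<in> linear_maps R P (free_module R I) \<and>
        q \<in> linear_maps R (free_module R I) P \<and> (\<forall>x\<in>carrier P. q (s x) = x))"

definition projective_resolution ::
  "('r, 'x) ring_scheme \<Rightarrow> (nat \<Rightarrow> ('r, 'p, 'y) module_scheme) \<Rightarrow> (nat \<Rightarrow> 'p \<Rightarrow> 'p) \<Rightarrow>
   ('p \<Rightarrow> 'a) \<Rightarrow> ('r, 'a, 'z) module_scheme \<Rightarrow> bool" where
  "projective_resolution R P d \<epsilon> A \<longleftrightarrow>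
     (\<forall>i. projective_module R (P i)) \<and>
     (\<forall>i. d i \<in> linear_maps R (P (Suc i)) (P i)) \<and>
     \<epsilon> \<in> linear_maps R (P 0) A \<and>
     \<epsilon> ` carrier (P 0) = carrier A \<and>
     d 0 ` carrier (P 1) = {x \<in> carrier (P 0). \<epsilon> x = \<zero>\<^bsub>A\<^esub>} \<and>
     (\<forall>i. d (Suc i) ` carrier (P (Suc (Suc i))) =
          {x \<in> carrier (P (Suc i)). d i x = \<zero>\<^bsub>P i\<^esub>})"

definition quotient_module ::
  "('r, 'a, 'x) module_scheme \<Rightarrow> 'a set \<Rightarrow> ('r, 'a set) module" where
  "quotient_module A B =
     \<lparr> carrier = a_rcosets\<^bsub>A\<^esub> B, monoid.mult = undefined, one = undefined,
       zero = B, add = set_add A,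
       smult = (\<lambda>r X. \<Union>x\<in>X. B +>\<^bsub>A\<^esub> (r \<odot>\<^bsub>A\<^esub> x)) \<rparr>"

text \<open>Cohomology of a cochain complex \<open>C 0 \<rightarrow> C 1 \<rightarrow> C 2 \<rightarrow> \<dots>\<close>, where \<open>\<delta> i\<close> maps \<open>C i\<close> to
  \<open>C (i + 1)\<close>.\<close>

definition cocycles ::
  "(nat \<Rightarrow> ('r, 'a, 'x) module_scheme) \<Rightarrow> (nat \<Rightarrow> 'a \<Rightarrow> 'a) \<Rightarrow> nat \<Rightarrow> 'a set" where
  "cocycles C \<delta> n = {x \<in> carrier (C n). \<delta> n x = \<zero>\<^bsub>C (Suc n)\<^esub>}"

definition coboundaries ::
  "(nat \<Rightarrow> ('r, 'a, 'x) module_scheme) \<Rightarrow> (nat \<Rightarrow> 'a \<Rightarrow> 'a) \<Rightarrow> nat \<Rightarrow> 'a set" where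
  "coboundaries C \<delta> n = (case n of 0 \<Rightarrow> {\<zero>\<^bsub>C 0\<^esub>} | Suc i \<Rightarrow> \<delta> i ` carrier (C i))"

definition cohomology_module ::
  "(nat \<Rightarrow> ('r, 'a, 'x) module_scheme) \<Rightarrow> (nat \<Rightarrow> 'a \<Rightarrow> 'a) \<Rightarrow> nat \<Rightarrow> ('r, 'a set) module" where
  "cohomology_module C \<delta> n =
     quotient_module ((C n)\<lparr>carrier := cocycles C \<delta> n\<rparr>) (coboundaries C \<delta> n)"

text \<open>For an algebra \<open>R\<close> over a commutative ring \<open>K\<close> with structure map \<open>\<eta>\<close>, the
  \<open>K\<close>-module of \<open>R\<close>-linear maps from \<open>P\<close> to \<open>N\<close>.\<close>

definition hom_module ::
  "('k \<Rightarrow> 'r) \<Rightarrow> ('r, 'x) ring_scheme \<Rightarrow> ('r, 'p, 'y) module_scheme \<Rightarrow>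
   ('r, 'n, 'z) module_scheme \<Rightarrow> ('k, 'p \<Rightarrow> 'n) module" where
  "hom_module \<eta> R P N =
     \<lparr> carrier = linear_maps R P N \<inter> extensional (carrier P), monoid.mult = undefined, one = undefined,
       zero = (\<lambda>x\<in>carrier P. \<zero>\<^bsub>N\<^esub>),
       add = (\<lambda>f g. \<lambda>x\<in>carrier P. f x \<oplus>\<^bsub>N\<^esub> g x),
       smult = (\<lambda>k f. \<lambda>x\<in>carrier P. \<eta> k \<odot>\<^bsub>N\<^esub> f x) \<rparr>"

text \<open>\<open>Ext_module \<eta> R P d N n\<close> is the \<open>n\<close>-th Ext module of \<open>A\<close> with coefficients in \<open>N\<close>,
  computed by a projective resolution \<open>(P, d)\<close> of \<open>A\<close>; up to isomorphism it does not
  depend on the resolution.\<close>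

definition Ext_module ::
  "('k \<Rightarrow> 'r) \<Rightarrow> ('r, 'x) ring_scheme \<Rightarrow> (nat \<Rightarrow> ('r, 'p, 'y) module_scheme) \<Rightarrow>
   (nat \<Rightarrow> 'p \<Rightarrow> 'p) \<Rightarrow> ('r, 'n, 'z) module_scheme \<Rightarrow> nat \<Rightarrow> ('k, ('p \<Rightarrow> 'n) set) module" where
  "Ext_module \<eta> R P d N =
     cohomology_module (\<lambda>i. hom_module \<eta> R (P i) N)
       (\<lambda>i f. compose (carrier (P (Suc i))) f (d i))"

text \<open>The \<open>KM\<close>-module with underlying \<open>K\<close>-module \<open>K\<close> on which \<open>m \<in> M\<close> acts by \<open>act m\<close>,
  extended linearly.\<close>

definition action_module ::
  "('k, 'x) ring_scheme \<Rightarrow> ('m, 'y) monoid_scheme \<Rightarrow> ('m \<Rightarrow> 'k \<Rightarrow> 'k) \<Rightarrow>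
   ('m \<Rightarrow> 'k, 'k) module" where
  "action_module K M act =
     \<lparr> carrier = carrier K, monoid.mult = monoid.mult K, one = one K, zero = zero K, add = add K,
       smult = (\<lambda>f x. \<Oplus>\<^bsub>K\<^esub>m\<in>support_in K (carrier M) f. f m \<otimes>\<^bsub>K\<^esub> act m x) \<rparr>"

definition trivial_module ::
  "('k, 'x) ring_scheme \<Rightarrow> ('m, 'y) monoid_scheme \<Rightarrow> ('m \<Rightarrow> 'k, 'k) module" where
  "trivial_module K M = action_module K M (\<lambda>m x. x)"

definition units_module ::
  "('k, 'x) ring_scheme \<Rightarrow> ('m, 'y) monoid_scheme \<Rightarrow> ('m \<Rightarrow> 'k, 'k) module" where
  "units_module K M = action_module K M (\<lambda>m x. if m \<in> Units M then x else \<zero>\<^bsub>K\<^esub>)"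


section \<open>Singular cohomology of a pair\<close>

text \<open>Relative cochains are homomorphisms from the singular chain group of \<open>X\<close> to the additive
  group of \<open>K\<close> vanishing on chains in the subspace \<open>A\<close>.\<close>

definition relative_cochain_module ::
  "('k, 'x) ring_scheme \<Rightarrow> 'a topology \<Rightarrow> 'a set \<Rightarrow> nat \<Rightarrow> ('k, 'a chain \<Rightarrow> 'k) module" where
  "relative_cochain_module K X A n =
     \<lparr> carrier = {\<phi> \<in> hom (chain_group n X) (add_monoid K) \<inter> extensional (singular_chain_set n X).
                    \<forall>c\<in>singular_chain_set n (subtopology X A). \<phi> c = \<zero>\<^bsub>K\<^esub>},
       monoid.mult = undefined, one = undefined,
       zero = (\<lambda>c\<in>singular_chain_set n X. \<zero>\<^bsub>K\<^esub>),
       add = (\<lambda>\<phi> \<psi>. \<lambda>c\<in>singular_chain_set n X. \<phi> c \<oplus>\<^bsub>K\<^esub> \<psi> c),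
       smult = (\<lambda>k \<phi>. \<lambda>c\<in>singular_chain_set n X. k \<otimes>\<^bsub>K\<^esub> \<phi> c) \<rparr>"

definition singular_coboundary ::
  "'a topology \<Rightarrow> nat \<Rightarrow> ('a chain \<Rightarrow> 'k) \<Rightarrow> 'a chain \<Rightarrow> 'k" where
  "singular_coboundary X n \<phi> =
     (\<lambda>c\<in>singular_chain_set (Suc n) X. \<phi> (chain_boundary (Suc n) c))"

definition relative_cohomology_module ::
  "('k, 'x) ring_scheme \<Rightarrow> nat \<Rightarrow> 'a topology \<Rightarrow> 'a set \<Rightarrow> ('k, ('a chain \<Rightarrow> 'k) set) module" where
  "relative_cohomology_module K n X A =
     cohomology_module (relative_cochain_module K X A) (singular_coboundary X) n"


section \<open>Quotient spaces\<close>

definition generated_equiv :: "'a set \<Rightarrow> ('a \<times> 'a) set \<Rightarrow> ('a \<times> 'a) set" where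
  "generated_equiv A r = (let s = r \<inter> A \<times> A in (s \<union> s\<inverse>)\<^sup>* \<inter> A \<times> A)"

definition quotient_topology :: "'a topology \<Rightarrow> ('a \<times> 'a) set \<Rightarrow> 'a set topology" where
  "quotient_topology X r =
     topology (\<lambda>U. U \<subseteq> topspace X // generated_equiv (topspace X) r \<and> openin X (\<Union>U))"

lemma equiv_generated_equiv: "equiv A (generated_equiv A r)"
proof (rule equivI)
  let ?s = "r \<inter> A \<times> A"
  show "generated_equiv A r \<subseteq> A \<times> A"
    by (auto simp: generated_equiv_def Let_def)
  show "refl_on A (generated_equiv A r)"
    by (auto simp: generated_equiv_def Let_def refl_on_def)
  show "sym (generated_equiv A r)"
  proof -
    have "sym ((?s \<union> ?s\<inverse>)\<^sup>*)"
      by (intro sym_rtrancl) (auto simp: sym_def)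
    then show ?thesis
      by (auto simp: generated_equiv_def Let_def sym_def)
  qed
  show "trans (generated_equiv A r)"
    by (auto simp: generated_equiv_def Let_def trans_def)
qed

lemma openin_quotient_topology:
  "openin (quotient_topology X r) U \<longleftrightarrow>
     U \<subseteq> topspace X // generated_equiv (topspace X) r \<and> openin X (\<Union>U)"
proof -
  let ?Q = "topspace X // generated_equiv (topspace X) r"
  have int: "\<Union>(U \<inter> V) = \<Union>U \<inter> \<Union>V" if "U \<subseteq> ?Q" "V \<subseteq> ?Q" for U V
  proof
    show "\<Union>U \<inter> \<Union>V \<subseteq> \<Union>(U \<inter> V)"
    proof
      fix x assume "x \<in> \<Union>U \<inter> \<Union>V"
      then obtain a b where ab: "a \<in> U" "b \<in> V" "x \<in> a" "x \<in> b" by blast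
      have "a = b"
        using quotient_disj[OF equiv_generated_equiv, of a "topspace X" r b] ab that by blast
      then show "x \<in> \<Union>(U \<inter> V)" using ab by blast
    qed
  qed blast
  have "istopology (\<lambda>U. U \<subseteq> ?Q \<and> openin X (\<Union>U))"
    unfolding istopology_def
  proof (intro conjI allI impI; (elim conjE)?)
    fix U V assume "U \<subseteq> ?Q" "V \<subseteq> ?Q" "openin X (\<Union>U)" "openin X (\<Union>V)"
    then show "openin X (\<Union>(U \<inter> V))" using int[of U V] by auto
  next
    fix \<K> assume *: "\<forall>U\<in>\<K>. U \<subseteq> ?Q \<and> openin X (\<Union>U)"
    have "\<Union>(\<Union>\<K>) = \<Union>(Union ` \<K>)" by blast
    then show "openin X (\<Union>(\<Union>\<K>))" using * by (metis (no_types, lifting) imageE openin_Union)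
  qed auto
  then show ?thesis by (simp add: quotient_topology_def)
qed

lemma topspace_quotient_topology:
  "topspace (quotient_topology X r) = topspace X // generated_equiv (topspace X) r"
proof -
  let ?Q = "topspace X // generated_equiv (topspace X) r"
  have "openin (quotient_topology X r) ?Q"
    by (simp add: openin_quotient_topology Union_quotient[OF equiv_generated_equiv])
  then have "?Q \<subseteq> topspace (quotient_topology X r)" by (rule openin_subset)
  moreover have "topspace (quotient_topology X r) \<subseteq> ?Q"
    using openin_topspace openin_quotient_topology by metis
  ultimately show ?thesis by blast
qed

lemma quotient_map_quotient_topology:
  "quotient_map X (quotient_topology X r) (\<lambda>x. generated_equiv (topspace X) r `` {x})"
proof -
  let ?E = "generated_equiv (topspace X) r" and ?Q = "topspace X // generated_equiv (topspace X) r"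
  have E: "equiv (topspace X) ?E" by (rule equiv_generated_equiv)
  have pre: "{x \<in> topspace X. ?E `` {x} \<in> U} = \<Union>U" if U: "U \<subseteq> ?Q" for U
  proof (intro equalityI subsetI)
    fix x assume "x \<in> {x \<in> topspace X. ?E `` {x} \<in> U}"
    then show "x \<in> \<Union>U" using equiv_class_self[OF E] by blast
  next
    fix x assume "x \<in> \<Union>U"
    then obtain c where c: "c \<in> U" "x \<in> c" by blast
    then have "c \<in> ?Q" using U by blast
    then obtain y where y: "y \<in> topspace X" "c = ?E `` {y}" by (auto elim: quotientE)
    then have "(y, x) \<in> ?E" using c by blast
    then have "?E `` {x} = c" "x \<in> topspace X"
      using equiv_class_eq[OF E] y by (auto simp: generated_equiv_def Let_def)
    then show "x \<in> {x \<in> topspace X. ?E `` {x} \<in> U}" using c by auto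
  qed
  show ?thesis
    unfolding quotient_map_def topspace_quotient_topology
    using pre by (auto simp: openin_quotient_topology quotient_def)
qed


section \<open>Nerves and geometric realization\<close>

record ('o, 'a) small_category =
  objs :: "'o set"
  arrs :: "'a set"
  src :: "'a \<Rightarrow> 'o"
  tgt :: "'a \<Rightarrow> 'o"
  ident :: "'o \<Rightarrow> 'a"
  cmp :: "'a \<Rightarrow> 'a \<Rightarrow> 'a"  \<comment> \<open>\<open>cmp f g\<close> is \<open>f\<close> after \<open>g\<close>\<close>

text \<open>The category \<open>X \<rtimes> M\<close> of a right \<open>M\<close>-set \<open>X\<close>; the arrow \<open>(x, m)\<close> goes from \<open>x m\<close>
  to \<open>x\<close>.\<close>

definition mset_category ::
  "('m, 'y) monoid_scheme \<Rightarrow> 'x set \<Rightarrow> ('x \<Rightarrow> 'm \<Rightarrow> 'x) \<Rightarrow> ('x, 'x \<times> 'm) small_category" where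
  "mset_category M X act =
     \<lparr> objs = X, arrs = X \<times> carrier M,
       src = (\<lambda>(x, m). act x m), tgt = fst,
       ident = (\<lambda>x. (x, \<one>\<^bsub>M\<^esub>)),
       cmp = (\<lambda>(x, m) (y, n). (x, m \<otimes>\<^bsub>M\<^esub> n)) \<rparr>"

text \<open>A simplicial set: \<open>simplices X n\<close> is the set of \<open>n\<close>-simplices, and \<open>pull X m n \<alpha>\<close> is
  the operator from \<open>n\<close>-simplices to \<open>m\<close>-simplices induced by a weakly monotone map
  \<open>\<alpha> : {0..m} \<rightarrow> {0..n}\<close>.\<close>

record 's simplicial_set =
  simplices :: "nat \<Rightarrow> 's set"
  pull :: "nat \<Rightarrow> nat \<Rightarrow> (nat \<Rightarrow> nat) \<Rightarrow> 's \<Rightarrow> 's"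

definition ordinal_maps :: "nat \<Rightarrow> nat \<Rightarrow> (nat \<Rightarrow> nat) set" where
  "ordinal_maps m n = {\<alpha>. mono_on {..m} \<alpha> \<and> \<alpha> ` {..m} \<subseteq> {..n}}"

definition ordinal_pairs :: "nat \<Rightarrow> (nat \<times> nat) set" where
  "ordinal_pairs n = {(i, j). i \<le> j \<and> j \<le> n}"

text \<open>An \<open>n\<close>-simplex of the nerve is a functor from the ordinal \<open>0 \<le> \<dots> \<le> n\<close> to the category,
  given by its effect on arrows: \<open>F (i, j)\<close> is the image of the arrow \<open>i \<le> j\<close>. The object
  \<open>F i\<close> is recovered as the source of \<open>F (i, i)\<close>.\<close>

definition nerve_simplices :: "('o, 'a) small_category \<Rightarrow> nat \<Rightarrow> (nat \<times> nat \<Rightarrow> 'a) set" where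
  "nerve_simplices C n = {F \<in> ordinal_pairs n \<rightarrow>\<^sub>E arrs C.
     (\<forall>i j. i \<le> j \<longrightarrow> j \<le> n \<longrightarrow>
        src C (F (i, j)) = src C (F (i, i)) \<and> tgt C (F (i, j)) = src C (F (j, j))) \<and>
     (\<forall>i\<le>n. F (i, i) = ident C (src C (F (i, i)))) \<and>
     (\<forall>i j k. i \<le> j \<longrightarrow> j \<le> k \<longrightarrow> k \<le> n \<longrightarrow> F (i, k) = cmp C (F (j, k)) (F (i, j)))}"

definition nerve :: "('o, 'a) small_category \<Rightarrow> (nat \<times> nat \<Rightarrow> 'a) simplicial_set" where
  "nerve C =
     \<lparr> simplices = nerve_simplices C,
       pull = (\<lambda>m n \<alpha> F. \<lambda>(i, j)\<in>ordinal_pairs m. F (\<alpha> i, \<alpha> j)) \<rparr>"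

definition simplex_push :: "nat \<Rightarrow> (nat \<Rightarrow> nat) \<Rightarrow> (nat \<Rightarrow> real) \<Rightarrow> nat \<Rightarrow> real" where
  "simplex_push m \<alpha> t = (\<lambda>j. \<Sum>i | i \<le> m \<and> \<alpha> i = j. t i)"

type_synonym 's realization_point = "(nat \<times> 's \<times> (nat \<Rightarrow> real)) set"

definition simplex_sum_topology :: "'s simplicial_set \<Rightarrow> (nat \<times> 's \<times> (nat \<Rightarrow> real)) topology" where
  "simplex_sum_topology X =
     sum_topology (\<lambda>n. prod_topology (discrete_topology (simplices X n))
                         (subtopology (powertop_real UNIV) (standard_simplex n))) UNIV"

definition realization_rel ::
  "'s simplicial_set \<Rightarrow> ((nat \<times> 's \<times> (nat \<Rightarrow> real)) \<times> (nat \<times> 's \<times> (nat \<Rightarrow> real))) set" where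
  "realization_rel X =
     {((n, x, simplex_push m \<alpha> t), (m, pull X m n \<alpha> x, t)) | m n \<alpha> x t.
        \<alpha> \<in> ordinal_maps m n \<and> x \<in> simplices X n \<and> t \<in> standard_simplex m}"

definition realization :: "'s simplicial_set \<Rightarrow> 's realization_point topology" where
  "realization X = quotient_topology (simplex_sum_topology X) (realization_rel X)"

text \<open>The map into the realization of \<open>Y\<close> induced by a simplicial map \<open>h\<close>: a point
  \<open>[n, x, t]\<close> goes to \<open>[n, h n x, t]\<close>.\<close>

definition realization_map ::
  "'t simplicial_set \<Rightarrow> (nat \<Rightarrow> 's \<Rightarrow> 't) \<Rightarrow> 's realization_point \<Rightarrow> 't realization_point" where
  "realization_map Y h c =
     generated_equiv (topspace (simplex_sum_topology Y)) (realization_rel Y) ``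
       ((\<lambda>(n, x, t). (n, h n x, t)) ` c)"

definition classifying_space ::
  "('o, 'a) small_category \<Rightarrow> (nat \<times> nat \<Rightarrow> 'a) realization_point topology" where
  "classifying_space C = realization (nerve C)"

text \<open>The map into the classifying space of \<open>D\<close> induced by a functor with arrow map \<open>h\<close>.\<close>

definition classifying_map ::
  "('o, 'b) small_category \<Rightarrow> ('a \<Rightarrow> 'b) \<Rightarrow>
   (nat \<times> nat \<Rightarrow> 'a) realization_point \<Rightarrow> (nat \<times> nat \<Rightarrow> 'b) realization_point" where
  "classifying_map D h =
     realization_map (nerve D) (\<lambda>n F. \<lambda>p\<in>ordinal_pairs n. h (F p))"


section \<open>The spaces \<open>EM\<close> and \<open>SEM\<close> and their orbit spaces\<close>

type_synonym 'm EM_point = "(nat \<times> nat \<Rightarrow> 'm \<times> 'm) realization_point"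

definition regular_category :: "('m, 'y) monoid_scheme \<Rightarrow> ('m, 'm \<times> 'm) small_category" where
  "regular_category M = mset_category M (carrier M) (monoid.mult M)"

definition singular_category :: "('m, 'y) monoid_scheme \<Rightarrow> ('m, 'm \<times> 'm) small_category" where
  "singular_category M = mset_category M (singular_elements M) (monoid.mult M)"

definition EM :: "('m, 'y) monoid_scheme \<Rightarrow> 'm EM_point topology" where
  "EM M = classifying_space (regular_category M)"

text \<open>\<open>SEM\<close> is the image in \<open>EM\<close> of the classifying space of the subcategory \<open>S \<rtimes> M\<close>.\<close>

definition SEM :: "('m, 'y) monoid_scheme \<Rightarrow> 'm EM_point set" where
  "SEM M = classifying_map (regular_category M) id `
             topspace (classifying_space (singular_category M))"

definition unit_action :: "('m, 'y) monoid_scheme \<Rightarrow> 'm \<Rightarrow> 'm EM_point \<Rightarrow> 'm EM_point" where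
  "unit_action M g = classifying_map (regular_category M) (\<lambda>(x, m). (g \<otimes>\<^bsub>M\<^esub> x, m))"

definition orbit_rel :: "('m, 'y) monoid_scheme \<Rightarrow> ('m EM_point \<times> 'm EM_point) set" where
  "orbit_rel M = {(c, unit_action M g c) | g c. g \<in> Units M \<and> c \<in> topspace (EM M)}"

definition orbit_EM :: "('m, 'y) monoid_scheme \<Rightarrow> 'm EM_point set topology" where
  "orbit_EM M = quotient_topology (EM M) (orbit_rel M)"

definition orbit_SEM :: "('m, 'y) monoid_scheme \<Rightarrow> 'm EM_point set set" where
  "orbit_SEM M = (\<lambda>c. generated_equiv (topspace (EM M)) (orbit_rel M) `` {c}) ` SEM M"

end

(* The nerve of U(M) >| M modulo G has one n-simplex for each word of length n over M together with
  those lying over S; the former are a basis of the bar resolution B of K over KM, whose n-th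
  differential is the simplicial boundary. A face of such a simplex leaves the basis exactly when its
  coefficient is singular, that is, when it lies in the orbits of SEM on one side and acts on the
  coefficients as zero on the other. Hence Hom(B, K_(G)) is the complex of relative cochains of the
  simplices of the nerve.

  It remains to compare these with relative singular cochains. The simplices of the nerve together
  with all singular simplices of the subspace span a subcomplex modulo which every chain is a
  boundary: by induction over the skeleta, excision reduces this to the pair of a standard simplex
  and its boundary, and compactness of simplices passes to the union of the skeleta. The resulting
  contraction extends cocycles from the subcomplex and shows that cocycles vanishing on it are
  coboundaries. That the orbit space is a cell complex with the expected cells is seen from an
  invariant of points of a realization, the function sending u <= v in [0, 1) to the arrow F (i, j)
  where i and j are the steps containing u and v. *)

theory Submission
 imports Defs "HOL-Analysis.Abstract_Topological_Spaces"
begin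

text \<open>Integral homology of a pair does not yield cohomology with coefficients in
  \<open>K\<close> directly, so the argument stays on chains: acyclicity modulo a family of
  simplices becomes a contraction, and a contraction survives dualising into any coefficient group.
  The group \<open>G\<close> acts freely on simplices whose last vertex is a unit but may fix
  singular elements, so the orbits over \<open>S\<close> need not form convenient cells. Hence
  nothing cellular is asked of the subspace: all its singular simplices enter the family at once,
  and only simplices outside it count as cells. Excision does not apply to the subspace itself; each
  skeleton first gets an open collar. The induction over skeleta needs the simplex modulo its
  boundary, which in turn comes from the same induction for the boundary, a complex of smaller
  dimension. Nothing is normalised: degenerate simplices stay in the family, matching the
  unnormalised bar resolution, and nondegenerate ones serve only to describe open cells.
  Dedekind-finiteness enters once, through the fact that a product is a unit only if both factors
  are.\<close>

abbreviation chain_remainder where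
  "chain_remainder h n c \<equiv> c - chain_boundary (Suc n) (frag_extend (h n) c) - frag_extend (h (n - 1)) (chain_boundary n c)"
abbreviation keys where "keys \<equiv> Poly_Mapping.keys"

abbreviation \<Delta> where "\<Delta> \<equiv> standard_simplex"

section \<open>Families of simplices that are acyclic modulo themselves\<close>

definition face_closed :: "'a topology => (nat => ((nat => real) => 'a) set) => bool" where
 "face_closed X T \<longleftrightarrow>
   (\<forall>n. T n \<subseteq> singular_simplex_set n X) \<and>
   (\<forall>n s i. s \<in> T (Suc n) --> i \<le> Suc n --> singular_face (Suc n) i s \<in> T n)"

text \<open>For a face-closed \<open>T\<close> this is the vanishing, in every degree, of the
  homology of the singular chains of \<open>X\<close> modulo the subcomplex spanned by
  \<open>T\<close>. In degree 0 the boundary is 0, so the condition on \<open>T (n - 1)\<close> is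
  vacuous there.\<close>

definition acyclic_modulo :: "'a topology => (nat => ((nat => real) => 'a) set) => bool" where
 "acyclic_modulo X T \<longleftrightarrow>
   (\<forall>n c. singular_chain n X c --> keys (chain_boundary n c) \<subseteq> T (n - 1) -->
    (\<exists>b. singular_chain (Suc n) X b \<and>
       keys (c - chain_boundary (Suc n) b) \<subseteq> T n))"

lemma keys_add_subset:
 "[|keys a \<subseteq> A; keys b \<subseteq> A|] ==> keys (a + b) \<subseteq> A"
 using keys_add[of a b] by blast

lemma keys_diff_subset:
 "[|keys a \<subseteq> A; keys b \<subseteq> A|] ==> keys (a - b) \<subseteq> A"
 for a b :: "'a \<Rightarrow>\<^sub>0 int" using keys_diff[of a b] by blast

lemma keys_sum_subset:
 "(\<And>i. i \<in> I ==> keys (f i) \<subseteq> A) ==> keys (sum f I) \<subseteq> A"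
 using keys_sum[of f I] by blast

lemma keys_frag_extend_subset:
 assumes "\<And>s. s \<in> keys c ==> keys (f s) \<subseteq> A"
 shows "keys (frag_extend f c) \<subseteq> A" unfolding frag_extend_def using assms keys_cmul by (intro keys_sum_subset) blast

lemma frag_extend_zero:
 assumes "\<And>s. s \<in> keys c ==> f s = 0"
 shows "frag_extend f c = 0" using frag_extend_eq_0 assms by blast

lemma face_closed_chain_boundary:
 assumes T: "face_closed X T" and c: "keys c \<subseteq> T n"
 shows "keys (chain_boundary n c) \<subseteq> T (n - 1)"
proof (cases n)
 case (Suc m)
 have "keys (frag_cmul ((-1) ^ k) (frag_of (singular_face n k s))) \<subseteq> T m"
  if "s \<in> keys c" "k \<le> n" for s k using T c that Suc unfolding face_closed_def by auto
 thus ?thesis unfolding chain_boundary_def using Suc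
  by (auto simp del: sum.atMost_Suc intro!: keys_frag_extend_subset keys_sum_subset)
qed (simp add: chain_boundary_def)

lemma face_closed_singular_chain:
 "[|face_closed X T; keys c \<subseteq> T n|] ==> singular_chain n X c"
 unfolding face_closed_def singular_chain_def by blast

text \<open>The quotient by the span of \<open>T\<close> is free on the remaining singular simplices
  and acyclic, hence contractible; the contraction is built degree by degree, with value 0 on
  \<open>T\<close>. In degree 0 the term with \<open>h (n - 1)\<close> is applied to the zero chain
  and is harmless.\<close>

lemma acyclic_modulo_chain_contraction:
 assumes T: "face_closed X T" and ac: "acyclic_modulo X T"
 obtains h where "\<And>n s. s \<in> T n ==> h n s = 0"
  and "\<And>n s. singular_simplex n X s ==> singular_chain (Suc n) X (h n s)"
  and "\<And>n c. singular_chain n X c ==>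
      keys (chain_remainder h n c) \<subseteq> T n"
proof -
 define good where "good = (\<lambda>n (g :: ((nat => real) => 'a) => 'a chain) f.
   (\<forall>s\<in>T n. f s = 0) \<and>
   (\<forall>s. singular_simplex n X s --> singular_chain (Suc n) X (f s)) \<and>
   (\<forall>c. singular_chain n X c -->
    keys (c - chain_boundary (Suc n) (frag_extend f c)
               - frag_extend g (chain_boundary n c)) \<subseteq> T n))"
 \<comment> \<open>The hypotheses on the lower homotopy \<open>g\<close> are guarded by
   \<open>n > 0\<close>, so that the same step also starts the recursion, where no lower homotopy
   exists.\<close>
 have extend: "\<exists>f. good n g f"
  if g0: "n > 0 ==> \<forall>s\<in>T (n - 1). g s = 0"
  and gs: "n > 0 ==> \<forall>s. singular_simplex (n - 1) X s --> singular_chain n X (g s)"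
  and gk: "n > 0 ==> \<exists>g'. \<forall>c. singular_chain (n - 1) X c -->
    keys (c - chain_boundary n (frag_extend g c)
               - frag_extend g' (chain_boundary (n - 1) c)) \<subseteq> T (n - 1)"
  for n g
 proof -
  have "\<exists>b. singular_chain (Suc n) X b \<and>
     keys (frag_of s - chain_boundary (Suc n) b
                - frag_extend g (chain_boundary n (frag_of s))) \<subseteq> T n \<and>
     (s \<in> T n --> b = 0)"
   if s: "singular_simplex n X s" for s
  proof (cases "s \<in> T n")
   case True
   have "frag_extend g (chain_boundary n (frag_of s)) = 0"
   proof (cases n)
    case (Suc m)
    thus ?thesis using face_closed_chain_boundary[OF T, of "frag_of s" n] True g0 by (intro frag_extend_zero) auto
   qed (simp add: chain_boundary_def)
   thus ?thesis using True by (intro exI[of _ 0]) auto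
  next
   case False
   let ?c = "frag_of s - frag_extend g (chain_boundary n (frag_of s))"
   have sc: "singular_chain n X (frag_of s)" using s by (simp add: singular_chain_of)
   have sb: "singular_chain (n - 1) X (chain_boundary n (frag_of s))" using singular_chain_boundary[OF sc] by simp
   have c: "singular_chain n X ?c"
   proof (cases n)
    case (Suc m)
    have "singular_chain n X (frag_extend g (chain_boundary n (frag_of s)))"
     using sb gs Suc by (intro singular_chain_extend) (auto simp: singular_chain_def)
    thus ?thesis using sc by (rule singular_chain_diff[rotated])
   qed (use sc in \<open>simp add: chain_boundary_def\<close>)
   \<comment> \<open>This boundary is the remainder of the chain
     \<open>chain_boundary n (frag_of s)\<close> in degree \<open>n - 1\<close>: its last term
     disappears because a boundary has boundary 0.\<close>
   have "keys (chain_boundary n ?c) \<subseteq> T (n - 1)"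
   proof (cases n)
    case (Suc m)
    then obtain g' where g': "\<And>c. singular_chain (n - 1) X c ==>
     keys (c - chain_boundary n (frag_extend g c)
               - frag_extend g' (chain_boundary (n - 1) c)) \<subseteq> T (n - 1)" using gk by blast
    have "chain_boundary (n - 1) (chain_boundary n (frag_of s)) = 0" using chain_boundary_boundary[OF sc] by simp
    thus ?thesis using g'[OF sb] by (simp add: chain_boundary_diff)
   qed (simp add: chain_boundary_def)
   then obtain b where "singular_chain (Suc n) X b"
    "keys (?c - chain_boundary (Suc n) b) \<subseteq> T n" using ac c unfolding acyclic_modulo_def by blast
   thus ?thesis using False by (intro exI[of _ b]) (simp add: algebra_simps)
  qed
  then obtain f where f: "\<And>s. singular_simplex n X s ==> singular_chain (Suc n) X (f s)"
   "\<And>s. singular_simplex n X s ==> keys (frag_of s - chain_boundary (Suc n) (f s)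
                - frag_extend g (chain_boundary n (frag_of s))) \<subseteq> T n"
   "\<And>s. singular_simplex n X s ==> s \<in> T n ==> f s = 0" by metis
  have "keys (c - chain_boundary (Suc n) (frag_extend f c)
               - frag_extend g (chain_boundary n c)) \<subseteq> T n"
   if "singular_chain n X c" for c
  proof -
   have "keys c \<subseteq> singular_simplex_set n X" using that by (simp add: singular_chain_def)
   thus ?thesis
   proof (induction c rule: frag_induction)
    case (one x)
    thus ?case using f(2) by simp
   next
    case (diff a b)
    have eq: "a - b - chain_boundary (Suc n) (frag_extend f (a - b))
           - frag_extend g (chain_boundary n (a - b))
      = (a - chain_boundary (Suc n) (frag_extend f a) - frag_extend g (chain_boundary n a))
      - (b - chain_boundary (Suc n) (frag_extend f b) - frag_extend g (chain_boundary n b))"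
     by (simp add: frag_extend_diff chain_boundary_diff)
    show ?case unfolding eq using diff by (rule keys_diff_subset)
   qed auto
  qed
  moreover have "\<forall>s\<in>T n. f s = 0" using f(3) T unfolding face_closed_def by blast
  ultimately have "good n g f" unfolding good_def using f(1) by blast
  thus ?thesis by blast
 qed
 define P where "P = (\<lambda>n f. \<exists>g. good n g f)"
 have "\<exists>f. \<forall>n. P n (f n) \<and> good (Suc n) (f n) (f (Suc n)) \<and> (n = 0 --> good 0 (f 0) (f 0))"
 proof -
  obtain f0 where f0: "good 0 (\<lambda>_. 0) f0" using extend[of 0 "\<lambda>_. 0"] by auto
  have "\<exists>f. \<forall>n. P n (f n) \<and> (n = 0 --> good 0 (\<lambda>_. 0) (f n)) \<and> good (Suc n) (f n) (f (Suc n))"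
  proof -
   have "\<exists>f. \<forall>n. (P n (f n) \<and> (n = 0 --> good 0 (\<lambda>_. 0) (f n))) \<and> good (Suc n) (f n) (f (Suc n))"
   proof (rule dependent_nat_choice)
    show "\<exists>x. P 0 x \<and> (0 = (0::nat) --> good 0 (\<lambda>_. 0) x)" using f0 P_def by blast
   next
    fix x n assume "P n x \<and> (n = 0 --> good 0 (\<lambda>_. 0) x)"
    then obtain g where g: "good n g x" unfolding P_def by blast
    have "\<exists>f. good (Suc n) x f" using g[unfolded good_def] by (intro extend[of "Suc n" x]) auto
    thus "\<exists>y. (P (Suc n) y \<and> (Suc n = 0 --> good 0 (\<lambda>_. 0) y)) \<and> good (Suc n) x y"
     unfolding P_def by blast
   qed
   thus ?thesis by blast
  qed
  then obtain f where f: "\<And>n. P n (f n)" "good 0 (\<lambda>_. 0) (f 0)"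
   "\<And>n. good (Suc n) (f n) (f (Suc n))" by blast
  have "good 0 (f 0) (f 0)" using f(2) unfolding good_def by (simp add: chain_boundary_def)
  thus ?thesis using f by blast
 qed
 then obtain h where "\<And>n. good (Suc n) (h n) (h (Suc n))" "good 0 (h 0) (h 0)" by blast
 hence "good n (h (n - 1)) (h n)" for n by (cases n) auto
 thus ?thesis unfolding good_def by (intro that[of h]) blast+
qed

text \<open>Converse of the construction of a contraction, with the remainder tested on single
  simplices only. This is the form in which acyclicity passes to disjoint unions, where every
  simplex lies in one summand.\<close>

lemma chain_contraction_acyclic_modulo:
 assumes "\<And>n s. s \<in> T n ==> h n s = 0"
  and "\<And>n s. singular_simplex n X s ==> singular_chain (Suc n) X (h n s)"
  and "\<And>n s. singular_simplex n X s ==>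
      keys (frag_of s - chain_boundary (Suc n) (h n s)
                - frag_extend (h (n - 1)) (chain_boundary n (frag_of s))) \<subseteq> T n"
 shows "acyclic_modulo X T" unfolding acyclic_modulo_def
proof (intro allI impI)
 fix n c assume c: "singular_chain n X c" and b: "keys (chain_boundary n c) \<subseteq> T (n - 1)"
 have "keys c \<subseteq> singular_simplex_set n X" using c by (simp add: singular_chain_def)
 hence "keys (chain_remainder h n c) \<subseteq> T n"
 proof (induction c rule: frag_induction)
  case (one x)
  thus ?case using assms(3) by simp
 next
  case (diff a b)
  have eq: "a - b - chain_boundary (Suc n) (frag_extend (h n) (a - b))
         - frag_extend (h (n - 1)) (chain_boundary n (a - b))
    = (a - chain_boundary (Suc n) (frag_extend (h n) a) - frag_extend (h (n - 1)) (chain_boundary n a))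
    - (b - chain_boundary (Suc n) (frag_extend (h n) b) - frag_extend (h (n - 1)) (chain_boundary n b))"
   by (simp add: frag_extend_diff chain_boundary_diff)
  show ?case unfolding eq using diff by (rule keys_diff_subset)
 qed auto
 moreover have "frag_extend (h (n - 1)) (chain_boundary n c) = 0" using b assms(1) by (intro frag_extend_zero) auto
 moreover have "singular_chain (Suc n) X (frag_extend (h n) c)"
  using c assms(2) by (intro singular_chain_extend) (auto simp: singular_chain_def)
 ultimately show "\<exists>b. singular_chain (Suc n) X b \<and>
       keys (c - chain_boundary (Suc n) b) \<subseteq> T n" by auto
qed

section \<open>Attaching cells\<close>

text \<open>Surjectivity of the induced map, brought from homology classes down to relative
  cycles.\<close>

lemma hom_induced_iso_relcycle:
 assumes f: "continuous_map X Y f" "f \<in> S \<rightarrow> T"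
  and iso: "hom_induced (int p) X S Y T f
        \<in> iso (relative_homology_group (int p) X S) (relative_homology_group (int p) Y T)"
  and c: "singular_relcycle p Y T c"
 obtains z where "singular_relcycle p X S z" "homologous_rel p Y T c (chain_map p f z)"
proof -
 have "homologous_rel_set p Y T c \<in> carrier (relative_homology_group (int p) Y T)"
  using c by (auto simp: carrier_relative_homology_group)
 moreover have "hom_induced (int p) X S Y T f ` carrier (relative_homology_group (int p) X S)
          = carrier (relative_homology_group (int p) Y T)" using iso unfolding iso_def bij_betw_def by simp
 ultimately obtain y where y: "y \<in> carrier (relative_homology_group (int p) X S)"
  "homologous_rel_set p Y T c = hom_induced (int p) X S Y T f y" by blast
 then obtain z where z: "singular_relcycle p X S z" "y = homologous_rel_set p X S z"
  by (auto simp: carrier_relative_homology_group)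
 have "homologous_rel_set p Y T c = homologous_rel_set p Y T (chain_map p f z)"
  using y z hom_induced_chain_map[OF f z(1)] by simp
 thus ?thesis using that z(1) by (simp add: homologous_rel_set_eq)
qed

text \<open>Injectivity of the induced map, brought from homology classes down to relative
  cycles.\<close>

lemma hom_induced_iso_relboundary:
 assumes f: "continuous_map X Y f" "f \<in> S \<rightarrow> T"
  and iso: "hom_induced (int p) X S Y T f
        \<in> iso (relative_homology_group (int p) X S) (relative_homology_group (int p) Y T)"
  and z: "singular_relcycle p X S z" and b: "singular_relboundary p Y T (chain_map p f z)"
 shows "singular_relboundary p X S z"
proof -
 have "hom_induced (int p) X S Y T f (homologous_rel_set p X S z)
    = hom_induced (int p) X S Y T f (homologous_rel_set p X S 0)"
 proof -
  have "homologous_rel p Y T (chain_map p f z) 0" using b by (simp add: homologous_rel_def)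
  hence "homologous_rel_set p Y T (chain_map p f z) = homologous_rel_set p Y T 0" by (simp only: homologous_rel_set_eq)
  thus ?thesis using hom_induced_chain_map[OF f z] hom_induced_chain_map[OF f, of p 0] by simp
 qed
 moreover have "homologous_rel_set p X S z \<in> carrier (relative_homology_group (int p) X S)"
  "homologous_rel_set p X S 0 \<in> carrier (relative_homology_group (int p) X S)"
  using z by (auto simp: carrier_relative_homology_group)
 ultimately have "homologous_rel_set p X S z = homologous_rel_set p X S 0"
  using iso by (auto simp: iso_def bij_betw_def dest: inj_onD)
 hence "homologous_rel p X S z 0" by (simp only: homologous_rel_set_eq)
 thus ?thesis by (simp add: homologous_rel_def)
qed

text \<open>Distinct simplices with distinct images cannot cancel. Thus a chain whose simplices are
  all mapped outside \<open>R\<close>, injectively, is zero as soon as its image is a chain of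
  \<open>R\<close>.\<close>

lemma keys_chain_map_inj:
 assumes "inj_on (simplex_map p f) (keys c)"
 shows "keys (chain_map p f c) = simplex_map p f ` keys c"
proof -
 have "Poly_Mapping.lookup (chain_map p f c) (simplex_map p f s) = Poly_Mapping.lookup c s"
  if "s \<in> keys c" for s
 proof -
  have "Poly_Mapping.lookup (chain_map p f c) (simplex_map p f s)
    = (\<Sum>i\<in>keys c. Poly_Mapping.lookup c i *
      (if simplex_map p f s = simplex_map p f i then 1 else 0))"
   unfolding chain_map_def frag_extend_def by (simp add: lookup_sum)
  also have "\<dots> = (\<Sum>i\<in>keys c. if i = s then Poly_Mapping.lookup c i else 0)"
   using assms that by (intro sum.cong) (auto dest: inj_onD)
  also have "\<dots> = Poly_Mapping.lookup c s" using that by simp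
  finally show ?thesis .
 qed
 hence "simplex_map p f ` keys c \<subseteq> keys (chain_map p f c)" by (auto simp: in_keys_iff)
 moreover have "keys (chain_map p f c) \<subseteq> simplex_map p f ` keys c"
  unfolding chain_map_def using keys_frag_extend[of "frag_of \<circ> simplex_map p f" c] by auto
 ultimately show ?thesis by blast
qed

text \<open>A chain of \<open>X\<close> is reduced in two moves. Injectivity on relative homology
  allows it to be corrected by a chain on the family until it is a relative cycle of
  \<open>(X, R)\<close>; surjectivity then makes it homologous to the image of a relative cycle of
  \<open>(D, B)\<close>, where acyclicity is known. The assumptions \<open>inj\<close> and
  \<open>out\<close> say that the images of \<open>N\<close> form a genuine complement to the chains
  of \<open>R\<close>, so that their part of a boundary can be lifted.\<close>

lemma acyclic_modulo_transfer:
 fixes D :: "'b topology" and X :: "'a topology"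
 assumes f: "continuous_map D X f" "f \<in> B \<rightarrow> R"
  and iso: "\<And>p. hom_induced (int p) D B X R f
        \<in> iso (relative_homology_group (int p) D B) (relative_homology_group (int p) X R)"
  and fc: "face_closed D (\<lambda>n. N n \<union> singular_simplex_set n (subtopology D B))"
  and ac: "acyclic_modulo D (\<lambda>n. N n \<union> singular_simplex_set n (subtopology D B))"
  and inj: "\<And>n. inj_on (simplex_map n f) (N n)"
  and out: "\<And>n s. s \<in> N n ==> \<not> singular_simplex n (subtopology X R) (simplex_map n f s)"
 shows "acyclic_modulo X (\<lambda>n. simplex_map n f ` N n \<union> singular_simplex_set n (subtopology X R))"
  (is "acyclic_modulo X ?T") unfolding acyclic_modulo_def
proof (intro allI impI)
 fix n c assume c: "singular_chain n X c" and bc: "keys (chain_boundary n c) \<subseteq> ?T (n - 1)"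
 let ?S = "\<lambda>n. N n \<union> singular_simplex_set n (subtopology D B)"
 have fB: "continuous_map (subtopology D B) (subtopology X R) f"
  using f by (auto simp: continuous_map_in_subtopology continuous_map_from_subtopology)
 have chain_B: "singular_chain m (subtopology X R) (chain_map m f a)"
  if "singular_chain m (subtopology D B) a" for m a using that fB by (rule singular_chain_chain_map)
 have N_simp: "singular_simplex m D s" if "s \<in> N m" for m s using fc that unfolding face_closed_def by blast
 have S_T: "keys (chain_map m f a) \<subseteq> ?T m" if "keys a \<subseteq> ?S m" for m a
 proof -
  have "simplex_map m f s \<in> ?T m" if "s \<in> ?S m" for s using that singular_simplex_simplex_map[OF _ fB] by blast
  thus ?thesis unfolding chain_map_def by (intro keys_frag_extend_subset) (use that in auto)
 qed
 have R_T: "keys a \<subseteq> ?T m" if "singular_chain m (subtopology X R) a" for m a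
  using that by (auto simp: singular_chain_def)
 \<comment> \<open>First move: \<open>x\<close> is the image of a chain of \<open>D\<close> whose
   boundary matches the part of the boundary of \<open>c\<close> outside \<open>R\<close>.\<close>
 have "\<exists>x. keys x \<subseteq> ?T n \<and> singular_relcycle n X R (c - x)"
 proof (cases n)
  case 0
  thus ?thesis using c by (intro exI[of _ 0]) (simp add: singular_relcycle chain_boundary_def)
 next
  case (Suc m)
  obtain u r where u: "keys u \<subseteq> simplex_map m f ` N m"
   and r: "keys r \<subseteq> singular_simplex_set m (subtopology X R)"
   and ur: "u + r = chain_boundary n c" using bc unfolding Suc diff_Suc_1 by (rule frag_split)
  \<comment> \<open>The lift to \<open>D\<close> of the part \<open>u\<close> of the boundary that
    lies on images of \<open>N\<close>.\<close>
  define s where "s = frag_extend (frag_of \<circ> inv_into (N m) (simplex_map m f)) u"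
  have s_N: "keys s \<subseteq> N m" unfolding s_def using u by (intro keys_frag_extend_subset) (auto intro: inv_into_into)
  have "chain_map m f s = frag_extend (frag_of \<circ> (simplex_map m f \<circ> inv_into (N m) (simplex_map m f))) u"
   unfolding s_def chain_map_def by (simp add: frag_extend_compose o_assoc)
  also have "\<dots> = frag_extend frag_of u" using u by (intro frag_extend_eq) (auto simp: f_inv_into_f)
  finally have su: "chain_map m f s = u" by (metis frag_expansion)
  have s_D: "singular_chain m D s" using s_N N_simp by (auto simp: singular_chain_def)
  have rc: "singular_chain m (subtopology X R) r" using r by (simp add: singular_chain_def)
  \<comment> \<open>The boundary of \<open>s\<close> splits into \<open>s1\<close> on
    \<open>N\<close> and a part in \<open>B\<close>. Since \<open>u + r\<close> is a boundary, the
    image of \<open>s1\<close> is a chain of \<open>R\<close>; by \<open>out\<close> and the absence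
    of cancellation \<open>s1\<close> is empty.\<close>
  have s_rel: "singular_relcycle m D B s"
  proof -
   have "keys (chain_boundary m s) \<subseteq> ?S (m - 1)" using face_closed_chain_boundary[OF fc] s_N by blast
   then obtain s1 s2 where s1: "keys s1 \<subseteq> N (m - 1)"
    and s2: "keys s2 \<subseteq> singular_simplex_set (m - 1) (subtopology D B)"
    and s12: "s1 + s2 = chain_boundary m s" by (rule frag_split)
   have "chain_map (m - 1) f s1 + chain_map (m - 1) f s2 = chain_boundary m u"
    using chain_boundary_chain_map[OF s_D, of f] su s12 by (simp flip: chain_map_add)
   also have "\<dots> = - chain_boundary m r"
   proof -
    have "chain_boundary m (u + r) = 0" unfolding ur using chain_boundary_boundary_alt[of m X c] c Suc by simp
    thus ?thesis by (simp add: chain_boundary_add eq_neg_iff_add_eq_0)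
   qed
   finally have "chain_map (m - 1) f s1 = - chain_boundary m r - chain_map (m - 1) f s2" by (simp add: eq_diff_eq)
   moreover have "singular_chain (m - 1) (subtopology X R) (- chain_boundary m r - chain_map (m - 1) f s2)"
    using rc s2 chain_B[of "m - 1" s2] singular_chain_boundary[OF rc]
    by (intro singular_chain_diff) (auto simp: singular_chain_minus singular_chain_def)
   ultimately have "keys (chain_map (m - 1) f s1)
             \<subseteq> singular_simplex_set (m - 1) (subtopology X R)" by (simp add: singular_chain_def)
   moreover have "keys (chain_map (m - 1) f s1)
            = simplex_map (m - 1) f ` keys s1" using s1 inj inj_on_subset by (intro keys_chain_map_inj) blast
   ultimately have "keys s1 = {}" using s1 out by blast
   hence "chain_boundary m s = s2" using s12 by simp
   thus ?thesis using s2 s_D by (simp add: singular_relcycle singular_chain_def)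
  qed
  have "singular_relboundary m X R (chain_map m f s)" unfolding singular_relboundary su
  proof (intro exI conjI)
   show "singular_chain (Suc m) X c" using c Suc by simp
   show "singular_chain m (subtopology X R) (- r)" using rc by (simp add: singular_chain_minus)
   show "chain_boundary (Suc m) c + - r = u" using ur Suc by (simp add: algebra_simps flip: ur)
  qed
  hence "singular_relboundary m D B s" by (rule hom_induced_iso_relboundary[OF f iso s_rel])
  then obtain d e' where d: "singular_chain n D d" and e': "singular_chain m (subtopology D B) e'"
   and de': "chain_boundary n d + e' = s" unfolding singular_relboundary Suc by blast
  define e where "e = - e'"
  have e: "singular_chain m (subtopology D B) e" using e' by (simp add: e_def singular_chain_minus)
  have de: "chain_boundary n d = s + e" using de' by (simp add: e_def algebra_simps)
  have "keys (chain_boundary n d) \<subseteq> ?S (n - 1)"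
   unfolding de using s_N e Suc by (intro keys_add_subset) (auto simp: singular_chain_def)
  then obtain b where b: "singular_chain (Suc n) D b"
   "keys (d - chain_boundary (Suc n) b) \<subseteq> ?S n" using ac d unfolding acyclic_modulo_def by blast
  define s' where "s' = d - chain_boundary (Suc n) b"
  have bs': "chain_boundary n s' = s + e"
   unfolding s'_def using chain_boundary_boundary_alt[OF b(1)] de by (simp add: chain_boundary_diff)
  have s'_D: "singular_chain n D s'" unfolding s'_def using face_closed_singular_chain[OF fc b(2)] .
  have "chain_boundary n (chain_map n f s') = u + chain_map m f e"
   using chain_boundary_chain_map[OF s'_D, of f] bs' su Suc by (simp add: chain_map_add)
  hence "chain_boundary n (c - chain_map n f s') = r - chain_map m f e" by (simp add: chain_boundary_diff flip: ur)
  moreover have "singular_chain m (subtopology X R) (r - chain_map m f e)" using rc chain_B[OF e] by (rule singular_chain_diff)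
  moreover have "singular_chain n X (c - chain_map n f s')"
   using c singular_chain_chain_map[OF s'_D f(1)] by (rule singular_chain_diff)
  ultimately have "singular_relcycle n X R (c - chain_map n f s')" using Suc by (simp add: singular_relcycle)
  moreover have "keys (chain_map n f s') \<subseteq> ?T n" unfolding s'_def using b(2) by (rule S_T)
  ultimately show ?thesis by (intro exI conjI)
 qed
 then obtain x where x: "keys x \<subseteq> ?T n" "singular_relcycle n X R (c - x)" by blast
 \<comment> \<open>Second move: the corrected chain is compared with the image of a relative cycle
   of \<open>(D, B)\<close>.\<close>
 obtain z where z: "singular_relcycle n D B z" "homologous_rel n X R (c - x) (chain_map n f z)"
  using hom_induced_iso_relcycle[OF f iso x(2)] by blast
 obtain d e' where d: "singular_chain (Suc n) X d" and e': "singular_chain n (subtopology X R) e'"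
  and de': "chain_boundary (Suc n) d + e' = c - x - chain_map n f z"
  using z(2) unfolding homologous_rel_def singular_relboundary by blast
 define e where "e = - e'"
 have e: "singular_chain n (subtopology X R) e" using e' by (simp add: e_def singular_chain_minus)
 have de: "chain_boundary (Suc n) d = c - x - chain_map n f z + e" using de' by (simp add: e_def algebra_simps)
 have z_D: "singular_chain n D z" and bz: "singular_chain (n - 1) (subtopology D B) (chain_boundary n z)"
  using z(1) by (auto simp: singular_relcycle)
 hence "keys (chain_boundary n z) \<subseteq> ?S (n - 1)" by (auto simp: singular_chain_def)
 then obtain b where b: "singular_chain (Suc n) D b"
  "keys (z - chain_boundary (Suc n) b) \<subseteq> ?S n" using ac z_D unfolding acyclic_modulo_def by blast
 have cb: "chain_boundary (Suc n) (chain_map (Suc n) f b) = chain_map n f (chain_boundary (Suc n) b)"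
  using chain_boundary_chain_map[OF b(1), of f] by simp
 have "c - chain_boundary (Suc n) (d + chain_map (Suc n) f b)
    = x + chain_map n f (z - chain_boundary (Suc n) b) - e" by (simp add: chain_boundary_add de cb chain_map_diff)
 moreover have "keys (x + chain_map n f (z - chain_boundary (Suc n) b) - e) \<subseteq> ?T n"
  using x(1) S_T[OF b(2)] R_T[OF e] by (intro keys_diff_subset keys_add_subset)
 moreover have "singular_chain (Suc n) X (d + chain_map (Suc n) f b)"
  using d singular_chain_chain_map[OF b(1) f(1)] by (rule singular_chain_add)
 ultimately show "\<exists>b. singular_chain (Suc n) X b \<and> keys (c - chain_boundary (Suc n) b) \<subseteq> ?T n"
  by (intro exI[of _ "d + chain_map (Suc n) f b"]) simp
qed

section \<open>The standard simplex and the deformation pushing towards its boundary\<close>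

abbreviation simplex_top :: "nat => (nat => real) topology" where
 "simplex_top k \<equiv> subtopology (powertop_real UNIV) (\<Delta> k)"

text \<open>The minimum of the barycentric coordinates vanishes exactly on the boundary, so the
  boundary, the open simplex and the collars are all described by one continuous function.\<close>

definition simplex_min :: "nat => (nat => real) => real" where
 "simplex_min k t = Min (t ` {..k})"

lemma simplex_min_le: "i \<le> k ==> simplex_min k t \<le> t i" unfolding simplex_min_def by (intro Min_le) auto

lemma simplex_min_attained: obtains i where "i \<le> k" "simplex_min k t = t i"
proof -
 have "Min (t ` {..k}) \<in> t ` {..k}" by (intro Min_in) auto
 thus ?thesis using that by (metis atMost_iff imageE simplex_min_def)
qed

lemma simplex_min_Suc: "simplex_min (Suc k) t = min (simplex_min k t) (t (Suc k))"
proof -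
 have "t ` {..Suc k} = insert (t (Suc k)) (t ` {..k})" by (simp add: atMost_Suc)
 thus ?thesis by (simp add: simplex_min_def min.commute)
qed

lemma continuous_map_simplex_min: "continuous_map (powertop_real UNIV) euclideanreal (simplex_min k)"
proof (induction k)
 case 0
 have "simplex_min 0 = (\<lambda>t. t 0)" by (auto simp: simplex_min_def)
 thus ?case using continuous_map_product_projection[of 0 UNIV "\<lambda>_. euclideanreal"] by simp
next
 case (Suc k)
 have "continuous_map (powertop_real UNIV) euclideanreal (\<lambda>t. min (simplex_min k t) (t (Suc k)))"
  using Suc by (intro continuous_map_real_min continuous_map_product_projection) auto
 moreover have "simplex_min (Suc k) = (\<lambda>t. min (simplex_min k t) (t (Suc k)))" by (rule ext) (rule simplex_min_Suc)
 ultimately show ?case by simp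
qed

lemma simplex_min_bounds:
 assumes "t \<in> \<Delta> k"
 shows "0 \<le> simplex_min k t" "real (Suc k) * simplex_min k t \<le> 1"
proof -
 obtain i where "i \<le> k" "simplex_min k t = t i" using simplex_min_attained .
 thus "0 \<le> simplex_min k t" using assms by (auto simp: standard_simplex_def)
 have "(\<Sum>i\<le>k. simplex_min k t) \<le> (\<Sum>i\<le>k. t i)" by (intro sum_mono) (auto simp: simplex_min_le)
 thus "real (Suc k) * simplex_min k t \<le> 1" using assms by (simp add: standard_simplex_def)
qed

lemma simplex_min_pos_iff:
 assumes "t \<in> \<Delta> k"
 shows "simplex_min k t > 0 \<longleftrightarrow> (\<forall>i\<le>k. t i > 0)"
 by (metis less_le_trans simplex_min_attained simplex_min_le)

text \<open>Subtracting a multiple of the barycentre and renormalising pushes points away from it;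
 for \<open>u = 1\<close> a collar of the boundary is collapsed onto the boundary.\<close>

definition push_amount :: "nat => real => (nat => real) => real" where
 "push_amount k u t = u * min (simplex_min k t) (1 / (2 * real (Suc k)))"

definition push_out :: "nat => real => (nat => real) => nat => real" where
 "push_out k u t = (\<lambda>i. if i \<le> k then (t i - push_amount k u t) / (1 - real (Suc k) * push_amount k u t) else 0)"

text \<open>The cap \<open>1 / (2 * real (Suc k))\<close> is half a coordinate of the barycentre. It
  keeps the denominator in \<open>push_out\<close> at least 1/2, even at the barycentre, where
  subtracting the full minimum would leave nothing to renormalise.\<close>

lemma push_amount_bounds:
 assumes t: "t \<in> \<Delta> k" and u: "0 \<le> u" "u \<le> 1"
 shows "0 \<le> push_amount k u t" "push_amount k u t \<le> simplex_min k t"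
  "real (Suc k) * push_amount k u t \<le> 1 / 2"
proof -
 let ?m = "min (simplex_min k t) (1 / (2 * real (Suc k)))"
 have m: "0 \<le> ?m" using simplex_min_bounds[OF t] by auto
 thus "0 \<le> push_amount k u t" using u by (simp add: push_amount_def)
 have le: "push_amount k u t \<le> ?m"  unfolding push_amount_def using u m mult_right_mono[of u 1 ?m] by simp
 thus "push_amount k u t \<le> simplex_min k t" by simp
 have "push_amount k u t \<le> 1 / (2 * real (Suc k))" using le by simp
 hence "push_amount k u t * (2 * real (Suc k)) \<le> 1" by (subst (asm) pos_le_divide_eq) auto
 thus "real (Suc k) * push_amount k u t \<le> 1 / 2"
  by (simp only: mult.commute[of _ "real (Suc k)"] mult.assoc[symmetric] mult.left_commute[of _ 2])
qed

lemma push_out_in_simplex: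
 assumes t: "t \<in> \<Delta> k" and u: "0 \<le> u" "u \<le> 1"
 shows "push_out k u t \<in> \<Delta> k"
proof -
 note b = push_amount_bounds[OF assms]
 let ?a = "push_amount k u t"
 have pos: "1 - real (Suc k) * ?a > 0" using b(3) by linarith
 have nn: "0 \<le> push_out k u t i" for i using pos b(2) simplex_min_le[of i k t] by (auto simp: push_out_def)
 have "(\<Sum>i\<le>k. push_out k u t i) = (\<Sum>i\<le>k. t i - ?a) / (1 - real (Suc k) * ?a)"
  by (simp add: push_out_def sum_divide_distrib)
 also have "(\<Sum>i\<le>k. t i - ?a) = 1 - real (Suc k) * ?a" using t by (simp add: sum_subtractf standard_simplex_def)
 finally have s: "(\<Sum>i\<le>k. push_out k u t i) = 1" using pos by simp
 have "push_out k u t i \<le> 1" for i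
 proof (cases "i \<le> k")
  case True
  thus ?thesis using s nn member_le_sum[of i "{..k}" "push_out k u t"] by auto
 qed (simp add: push_out_def)
 thus ?thesis using s nn by (auto simp: standard_simplex_def push_out_def)
qed

lemma simplex_min_push_out:
 assumes t: "t \<in> \<Delta> k" and u: "0 \<le> u" "u \<le> 1"
 shows "simplex_min k (push_out k u t)
      = (simplex_min k t - push_amount k u t) / (1 - real (Suc k) * push_amount k u t)"
proof -
 let ?a = "push_amount k u t"
 have pos: "1 - real (Suc k) * ?a > 0" using push_amount_bounds(3)[OF assms] by linarith
 let ?f = "\<lambda>x. (x - ?a) / (1 - real (Suc k) * ?a)"
 have "push_out k u t ` {..k} = ?f ` (t ` {..k})" unfolding image_image by (intro image_cong) (auto simp: push_out_def)
 moreover have "mono ?f" using pos by (intro monoI divide_right_mono) auto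
 ultimately show ?thesis unfolding simplex_min_def by (simp add: mono_Min_commute[symmetric])
qed

text \<open>With minimum m and amount a the claim is (m - a) / (1 - (k + 1) a) \<le> m, that is, a
  (k + 1) m \<le> a, and (k + 1) m is at most the sum 1 of the coordinates. It keeps collars
  invariant under the flow.\<close>

lemma simplex_min_push_out_le:
 assumes t: "t \<in> \<Delta> k" and u: "0 \<le> u" "u \<le> 1"
 shows "simplex_min k (push_out k u t) \<le> simplex_min k t"
proof -
 note b = push_amount_bounds[OF assms]
 let ?a = "push_amount k u t" and ?m = "simplex_min k t"
 have pos: "1 - real (Suc k) * ?a > 0" using b(3) by linarith
 have "?a * (real (Suc k) * ?m) \<le> ?a * 1" using b(1) simplex_min_bounds[OF t] by (intro mult_left_mono)
 hence "?m - ?a \<le> ?m * (1 - real (Suc k) * ?a)" by (simp add: algebra_simps)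
 thus ?thesis unfolding simplex_min_push_out[OF assms] using pos by (simp add: pos_divide_le_eq)
qed

lemma push_out_boundary:
 assumes t: "t \<in> \<Delta> k" and m: "simplex_min k t = 0"
 shows "push_out k u t = t" using assms by (auto simp: push_out_def push_amount_def standard_simplex_def)

lemma push_out_0:
 assumes t: "t \<in> \<Delta> k"
 shows "push_out k 0 t = t" using assms by (auto simp: push_out_def push_amount_def standard_simplex_def)

lemma push_out_collar:
 assumes t: "t \<in> \<Delta> k" and m: "simplex_min k t < 1 / (2 * real (Suc k))"
 shows "simplex_min k (push_out k 1 t) = 0" using assms simplex_min_push_out[OF t, of 1] by (simp add: push_amount_def)

lemma continuous_map_push_out:
 "continuous_map (prod_topology (top_of_set {0..1}) (simplex_top k)) (simplex_top k)
   (\<lambda>(u, t). push_out k u t)"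
proof -
 let ?P = "prod_topology (top_of_set {0..1::real}) (simplex_top k)"
 have min: "continuous_map ?P euclideanreal (\<lambda>x. simplex_min k (snd x))"
  using continuous_map_compose[OF continuous_map_snd[of "top_of_set {0..1::real}"]
   continuous_map_from_subtopology[OF continuous_map_simplex_min, of "\<Delta> k" k]] by (simp add: o_def)
 have fst: "continuous_map ?P euclideanreal fst" by (rule continuous_map_into_fulltopology[OF continuous_map_fst])
 have proj: "continuous_map ?P euclideanreal (\<lambda>x. snd x i)" for i
 proof -
  have "continuous_map (simplex_top k) euclideanreal (\<lambda>t. t i)"
   using continuous_map_product_projection[of i UNIV "\<lambda>_. euclideanreal"]
   by (intro continuous_map_from_subtopology) simp
  thus ?thesis using continuous_map_compose[OF continuous_map_snd] by (simp add: o_def)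
 qed
 have am: "continuous_map ?P euclideanreal (\<lambda>x. push_amount k (fst x) (snd x))" unfolding push_amount_def using fst min
  by (intro continuous_map_real_mult continuous_map_real_min) auto
 have "continuous_map ?P euclideanreal (\<lambda>x. push_out k (fst x) (snd x) i)" for i
 proof (cases "i \<le> k")
  case True
  have "1 - real (Suc k) * push_amount k (fst x) (snd x) \<noteq> 0" if "x \<in> topspace ?P" for x
  proof -
   have "real (Suc k) * push_amount k (fst x) (snd x) \<le> 1 / 2" using that by (intro push_amount_bounds) auto
   thus ?thesis by linarith
  qed
  hence "continuous_map ?P euclideanreal (\<lambda>x. (snd x i - push_amount k (fst x) (snd x)) /
         (1 - real (Suc k) * push_amount k (fst x) (snd x)))"
   using am proj by (intro continuous_map_real_divide continuous_map_diff continuous_map_real_mult) auto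
  thus ?thesis using True by (simp add: push_out_def)
 qed (simp add: push_out_def)
 hence "continuous_map ?P (powertop_real UNIV) (\<lambda>x. push_out k (fst x) (snd x))"
  by (simp add: continuous_map_componentwise_UNIV)
 moreover have "push_out k (fst x) (snd x) \<in> \<Delta> k" if "x \<in> topspace ?P" for x
  using that by (intro push_out_in_simplex) auto
 ultimately show ?thesis unfolding continuous_map_in_subtopology case_prod_unfold by blast
qed

section \<open>Attaching a family of cells of one dimension\<close>

lemma iso_square_left:
 assumes \<phi>: "\<phi> \<in> hom G H" and a: "a \<in> iso H H'" and b: "b \<in> iso G G'" and \<psi>: "\<psi> \<in> iso G' H'"
  and comm: "\<And>x. x \<in> carrier G ==> a (\<phi> x) = \<psi> (b x)"
 shows "\<phi> \<in> iso G H"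
proof -
 have bij: "bij_betw a (carrier H) (carrier H')" "bij_betw b (carrier G) (carrier G')"
  "bij_betw \<psi> (carrier G') (carrier H')" using a b \<psi> by (auto simp: iso_def)
 have "bij_betw (\<psi> \<circ> b) (carrier G) (carrier H')" using bij(2,3) by (rule bij_betw_trans)
 hence "bij_betw (a \<circ> \<phi>) (carrier G) (carrier H')" by (rule bij_betw_cong[THEN iffD1, rotated]) (simp add: comm)
 moreover have "\<phi> ` carrier G \<subseteq> carrier H" using \<phi> by (auto simp: hom_def)
 ultimately have "bij_betw \<phi> (carrier G) (carrier H)" using bij(1) bij_betw_comp_iff2 by blast
 thus ?thesis using \<phi> by (simp add: iso_def)
qed

lemma iso_square_right:
 assumes \<psi>: "\<psi> \<in> hom G' H'" and a: "a \<in> iso H H'" and b: "b \<in> iso G G'" and \<phi>: "\<phi> \<in> iso G H"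
  and comm: "\<And>x. x \<in> carrier G ==> a (\<phi> x) = \<psi> (b x)"
 shows "\<psi> \<in> iso G' H'"
proof -
 have bij: "bij_betw a (carrier H) (carrier H')" "bij_betw b (carrier G) (carrier G')"
  "bij_betw \<phi> (carrier G) (carrier H)" using a b \<phi> by (auto simp: iso_def)
 have "bij_betw (a \<circ> \<phi>) (carrier G) (carrier H')" using bij(3,1) by (rule bij_betw_trans)
 hence "bij_betw (\<psi> \<circ> b) (carrier G) (carrier H')" by (rule bij_betw_cong[THEN iffD1, rotated]) (simp add: comm)
 hence "bij_betw \<psi> (carrier G') (carrier H')" using bij_betw_comp_iff[OF bij(2)] by blast
 thus ?thesis using \<psi> by (simp add: iso_def)
qed

text \<open>The closed simplices are glued to \<open>R\<close> along arbitrary maps of their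
  boundaries, while the open simplices embed disjointly outside \<open>R\<close>. The assumption
  \<open>closed_criterion\<close> expresses the weak topology with respect to \<open>R\<close> and
  the cells.\<close>

locale cell_attachment =
 fixes X :: "'a topology" and R :: "'a set" and I :: "'i set" and k :: nat
  and e :: "'i => (nat => real) => 'a"
 assumes closed_R: "closedin X R"
  and continuous_cell: "i \<in> I ==> continuous_map (simplex_top k) X (e i)"
  and cell_boundary: "[|i \<in> I; t \<in> \<Delta> k; simplex_min k t = 0|] ==> e i t \<in> R"
  and cell_interior: "[|i \<in> I; t \<in> \<Delta> k; simplex_min k t > 0|] ==> e i t \<notin> R"
  and cell_inj: "[|i \<in> I; t \<in> \<Delta> k; simplex_min k t > 0;
    i' \<in> I; t' \<in> \<Delta> k; simplex_min k t' > 0; e i t = e i' t'|] ==> i = i' \<and> t = t'"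
  and cell_cover: "x \<in> topspace X - R ==> \<exists>i\<in>I. \<exists>t\<in>\<Delta> k. x = e i t"
  and closed_criterion: "[|C \<subseteq> topspace X; closedin X (C \<inter> R);
    \<And>i. i \<in> I ==> closedin (simplex_top k) {t \<in> \<Delta> k. e i t \<in> C}|]
    ==> closedin X C"
begin

lemma R_subset: "R \<subseteq> topspace X" using closed_R by (rule closedin_subset)

lemma cell_in_topspace: "[|i \<in> I; t \<in> \<Delta> k|] ==> e i t \<in> topspace X"
 using continuous_map_image_subset_topspace[OF continuous_cell[of i]] by auto

lemma cell_in_R_iff:
 "[|i \<in> I; t \<in> \<Delta> k|] ==> e i t \<in> R \<longleftrightarrow> simplex_min k t = 0"
 using cell_boundary cell_interior simplex_min_bounds(1)[of t k] by (metis less_eq_real_def)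

text \<open>The disjoint union of \<open>R\<close> and the cells, realised by graphs so that the projection to
 \<open>X\<close> is visibly continuous.\<close>

definition patch_topology :: "('i option \<times> 'a \<times> (nat => real)) topology" where
 "patch_topology = subtopology
   (prod_topology (discrete_topology UNIV) (prod_topology X (powertop_real UNIV)))
   ({None} \<times> R \<times> {\<lambda>_. 0} \<union> {(Some i, e i t, t) | i t. i \<in> I \<and> t \<in> \<Delta> k})"

lemma topspace_patch_topology:
 "topspace patch_topology =
   {None} \<times> R \<times> {\<lambda>_. 0} \<union> {(Some i, e i t, t) | i t. i \<in> I \<and> t \<in> \<Delta> k}"
 using R_subset cell_in_topspace unfolding patch_topology_def by auto

text \<open>This restates \<open>closed_criterion\<close> as a quotient map from a disjoint union,
  so that a homotopy on \<open>X\<close> can be given separately on \<open>R\<close> and on each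
  cell.\<close>

lemma quotient_map_patch: "quotient_map patch_topology X (\<lambda>z. fst (snd z))"
proof -
 let ?p = "\<lambda>z :: 'i option \<times> 'a \<times> (nat => real). fst (snd z)"
 have cont: "continuous_map patch_topology X ?p" unfolding patch_topology_def by (intro continuous_map_from_subtopology
    continuous_map_compose[OF continuous_map_snd continuous_map_fst, unfolded o_def])
 have surj: "?p ` topspace patch_topology = topspace X"
 proof
  show "?p ` topspace patch_topology \<subseteq> topspace X" using continuous_map_image_subset_topspace[OF cont] .
  show "topspace X \<subseteq> ?p ` topspace patch_topology"
  proof
   fix x assume x: "x \<in> topspace X"
   show "x \<in> ?p ` topspace patch_topology"
   proof (cases "x \<in> R")
    case True
    hence "(None, x, \<lambda>_. 0) \<in> topspace patch_topology" by (simp add: topspace_patch_topology)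
    thus ?thesis by (rule rev_image_eqI) simp
   next
    case False
    then obtain i t where it: "i \<in> I" "t \<in> \<Delta> k" "x = e i t" using cell_cover x by blast
    hence "(Some i, x, t) \<in> topspace patch_topology" by (simp add: topspace_patch_topology)
    thus ?thesis by (rule rev_image_eqI) simp
   qed
  qed
 qed
 have "closedin X C" if C: "C \<subseteq> topspace X"
  and cl: "closedin patch_topology {z \<in> topspace patch_topology. ?p z \<in> C}" for C
 proof (rule closed_criterion[OF C])
  have "continuous_map (subtopology X R) patch_topology (\<lambda>x. (None, x, \<lambda>_. 0))"
   unfolding patch_topology_def continuous_map_in_subtopology
   by (auto intro!: continuous_map_pairedI continuous_map_from_subtopology simp: image_subset_iff)
  hence "closedin (subtopology X R) {x \<in> topspace (subtopology X R).
    (None, x, \<lambda>_. 0) \<in> {z \<in> topspace patch_topology. ?p z \<in> C}}"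
   using cl by (rule closedin_continuous_map_preimage)
  also have "{x \<in> topspace (subtopology X R).
    (None, x, \<lambda>_. 0) \<in> {z \<in> topspace patch_topology. ?p z \<in> C}} = C \<inter> R"
   using R_subset by (auto simp: topspace_patch_topology)
  finally show "closedin X (C \<inter> R)" using closed_R closedin_trans_full by blast
 next
  fix i assume i: "i \<in> I"
  have "continuous_map (simplex_top k) patch_topology (\<lambda>t. (Some i, e i t, t))"
   unfolding patch_topology_def continuous_map_in_subtopology
  proof
   show "continuous_map (simplex_top k)
     (prod_topology (discrete_topology UNIV) (prod_topology X (powertop_real UNIV))) (\<lambda>t. (Some i, e i t, t))"
    using continuous_cell[OF i] continuous_map_from_subtopology[OF continuous_map_id, unfolded id_def]
    by (intro continuous_map_pairedI) auto
  qed (use i in auto)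
  hence "closedin (simplex_top k) {t \<in> topspace (simplex_top k).
    (Some i, e i t, t) \<in> {z \<in> topspace patch_topology. ?p z \<in> C}}"
   using cl by (rule closedin_continuous_map_preimage)
  also have "{t \<in> topspace (simplex_top k).
    (Some i, e i t, t) \<in> {z \<in> topspace patch_topology. ?p z \<in> C}} = {t \<in> \<Delta> k. e i t \<in> C}"
   using i by (auto simp: topspace_patch_topology)
  finally show "closedin (simplex_top k) {t \<in> \<Delta> k. e i t \<in> C}" .
 qed
 moreover have "closedin patch_topology {z \<in> topspace patch_topology. ?p z \<in> C}" if "closedin X C" for C
  using cont that by (rule closedin_continuous_map_preimage)
 ultimately show ?thesis unfolding quotient_map_closedin using surj by blast
qed

definition cell_coords :: "'a => 'i \<times> (nat => real)" where
 "cell_coords x = (SOME p. fst p \<in> I \<and> snd p \<in> \<Delta> k \<and> x = e (fst p) (snd p))"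

text \<open>Off \<open>R\<close> the coordinates chosen by \<open>cell_coords\<close> are unique by
  \<open>cell_inj\<close>. On \<open>R\<close> the flow rests, which agrees with
  \<open>push_out\<close> on boundary points.\<close>

definition flow :: "real => 'a => 'a" where
 "flow u x = (if x \<in> topspace X - R
   then e (fst (cell_coords x)) (push_out k u (snd (cell_coords x))) else x)"

lemma flow_cell:
 assumes i: "i \<in> I" and t: "t \<in> \<Delta> k"
 shows "flow u (e i t) = e i (push_out k u t)"
proof (cases "simplex_min k t = 0")
 case True
 thus ?thesis using assms by (simp add: flow_def cell_in_R_iff push_out_boundary)
next
 case False
 hence pos: "simplex_min k t > 0" using simplex_min_bounds(1)[OF t] by simp
 let ?p = "cell_coords (e i t)"
 have "\<exists>p. fst p \<in> I \<and> snd p \<in> \<Delta> k \<and> e i t = e (fst p) (snd p)"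
  using i t by (intro exI[of _ "(i, t)"]) auto
 hence p: "fst ?p \<in> I" "snd ?p \<in> \<Delta> k" "e i t = e (fst ?p) (snd ?p)"
  unfolding cell_coords_def using someI_ex by (smt (verit, best))+
 have "simplex_min k (snd ?p) > 0"
  using cell_in_R_iff[OF p(1,2)] cell_in_R_iff[OF i t] p False simplex_min_bounds(1)[OF p(2)] by simp
 hence "i = fst ?p" "t = snd ?p" using cell_inj[OF i t pos p(1,2) _ p(3)] by auto
 moreover have "e i t \<in> topspace X - R" using cell_in_topspace cell_interior i t pos by blast
 ultimately show ?thesis by (simp add: flow_def)
qed

lemma flow_R: "x \<in> R ==> flow u x = x" by (simp add: flow_def)

lemma flow_0: "flow 0 x = x"
proof (cases "x \<in> topspace X - R")
 case True
 then obtain i t where "i \<in> I" "t \<in> \<Delta> k" "x = e i t" using cell_cover by blast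
 thus ?thesis by (simp add: flow_cell push_out_0)
qed (auto simp: flow_def)

text \<open>The unit interval is locally compact and Hausdorff, so its product with the quotient map
  from the patches is again a quotient map, and continuity can be checked before passing to the
  quotient.\<close>

lemma continuous_map_flow:
 "continuous_map (prod_topology (top_of_set {0..1}) X) X (\<lambda>(u, x). flow u x)"
proof -
 let ?I = "top_of_set {0..1::real}"
 let ?p = "\<lambda>z :: 'i option \<times> 'a \<times> (nat => real). fst (snd z)"
 let ?q = "\<lambda>(u::real, z). (u, ?p z)"
 let ?P = "prod_topology ?I patch_topology"
 have q: "quotient_map ?P (prod_topology ?I X) ?q"
 proof (rule quotient_map_prod_right[OF _ _ quotient_map_patch])
  have "compact_space ?I" by (simp add: compact_space_subtopology)
  moreover have "Hausdorff_space ?I" by (simp add: Hausdorff_space_subtopology)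
  ultimately show "locally_compact_space ?I" "Hausdorff_space ?I \<or> regular_space ?I"
   using compact_imp_locally_compact_space by auto
 qed
 let ?g = "(\<lambda>(u, x). flow u x) \<circ> ?q"
 \<comment> \<open>The first component of a patch is discrete, so the pieces \<open>?T j\<close> are
   open and continuity may be pasted from \<open>R\<close> and the single cells.\<close>
 let ?T = "\<lambda>j. {y \<in> topspace ?P. fst (snd y) = j}"
 have cfst: "continuous_map ?P (discrete_topology UNIV) (\<lambda>y. fst (snd y))"
  by (rule continuous_map_compose[OF continuous_map_snd, unfolded o_def])
   (simp add: patch_topology_def continuous_map_from_subtopology continuous_map_fst)
 have cX: "continuous_map ?P X (\<lambda>y. fst (snd (snd y)))"
  by (rule continuous_map_compose[OF continuous_map_snd, unfolded o_def])
   (rule quotient_imp_continuous_map[OF quotient_map_patch])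
 have ct: "continuous_map ?P (powertop_real UNIV) (\<lambda>y. snd (snd (snd y)))"
  by (rule continuous_map_compose[OF continuous_map_snd, unfolded o_def])
   (simp add: patch_topology_def continuous_map_from_subtopology
    continuous_map_compose[OF continuous_map_snd continuous_map_snd, unfolded o_def])
 have "continuous_map ?P X ?g"
 proof (rule pasting_lemma[where I = UNIV and T = ?T and f = "\<lambda>_. ?g"])
  fix j :: "'i option"
  show "openin ?P (?T j)" using openin_continuous_map_preimage[OF cfst, of "{j}"] by simp
  show "continuous_map (subtopology ?P (?T j)) X ?g"
  proof (cases j)
   case None
   have "continuous_map (subtopology ?P (?T j)) X (\<lambda>y. fst (snd (snd y)))"
    using cX by (rule continuous_map_from_subtopology)
   thus ?thesis by (rule continuous_map_eq) (use None in \<open>auto simp: topspace_patch_topology flow_R\<close>)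
  next
   case (Some i)
   show ?thesis
   proof (cases "i \<in> I")
    case True
    have "continuous_map (subtopology ?P (?T j)) (prod_topology ?I (simplex_top k))
        (\<lambda>y. (fst y, snd (snd (snd y))))"
    proof (intro continuous_map_pairedI)
     show "continuous_map (subtopology ?P (?T j)) ?I fst" by (intro continuous_map_from_subtopology continuous_map_fst)
     have "continuous_map (subtopology ?P (?T j)) (powertop_real UNIV) (\<lambda>y. snd (snd (snd y)))"
      using ct by (rule continuous_map_from_subtopology)
     moreover have "snd (snd (snd y)) \<in> \<Delta> k" if "y \<in> ?T j" for y
      using that Some by (auto simp: topspace_patch_topology)
     ultimately show "continuous_map (subtopology ?P (?T j)) (simplex_top k) (\<lambda>y. snd (snd (snd y)))"
      unfolding continuous_map_in_subtopology by (auto simp: image_subset_iff)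
    qed
    hence "continuous_map (subtopology ?P (?T j)) X
      (e i \<circ> (\<lambda>(u, t). push_out k u t) \<circ> (\<lambda>y. (fst y, snd (snd (snd y)))))"
     by (intro continuous_map_compose[OF _ continuous_map_compose[OF continuous_map_push_out
       continuous_cell[OF True]]])
    thus ?thesis by (rule continuous_map_eq) (use Some in \<open>auto simp: topspace_patch_topology flow_cell\<close>)
   next
    case False
    hence "topspace (subtopology ?P (?T j)) = {}" using Some by (auto simp: topspace_patch_topology)
    thus ?thesis by (simp add: continuous_map_def openin_subset)
   qed
  qed
 qed auto
 thus ?thesis using continuous_compose_quotient_map[OF q] by blast
qed

text \<open>The bound is the cap in \<open>push_amount\<close>: below it the full minimum is
  subtracted at time 1, so the collar lands on the boundary.\<close>

definition collar :: "'a set" where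
 "collar = R \<union> (\<Union>i\<in>I. e i ` {t \<in> \<Delta> k. simplex_min k t < 1 / (2 * real (Suc k))})"

lemma cell_in_collar_iff:
 assumes "i \<in> I" "t \<in> \<Delta> k"
 shows "e i t \<in> collar \<longleftrightarrow> simplex_min k t < 1 / (2 * real (Suc k))"
proof
 assume "e i t \<in> collar"
 then consider "e i t \<in> R"
  | i' t' where "i' \<in> I" "t' \<in> \<Delta> k" "simplex_min k t' < 1 / (2 * real (Suc k))" "e i t = e i' t'"
  unfolding collar_def by blast
 thus "simplex_min k t < 1 / (2 * real (Suc k))"
 proof cases
  case 1
  thus ?thesis using assms by (simp add: cell_in_R_iff)
 next
  case 2
  thus ?thesis
  proof (cases "simplex_min k t = 0")
   case False
   hence "e i t \<notin> R" using assms by (simp add: cell_in_R_iff)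
   hence "simplex_min k t' \<noteq> 0" using 2 cell_boundary by auto
   thus ?thesis using cell_inj[of i t i' t'] assms 2 False simplex_min_bounds(1)[of t k] simplex_min_bounds(1)[of t' k] by auto
  qed simp
 qed
qed (use assms in \<open>auto simp: collar_def\<close>)

lemma collar_subset: "collar \<subseteq> topspace X" using R_subset cell_in_topspace by (auto simp: collar_def)

lemma openin_collar: "openin X collar"
proof -
 have "closedin X (topspace X - collar)"
 proof (rule closed_criterion)
  have "(topspace X - collar) \<inter> R = {}" by (auto simp: collar_def)
  thus "closedin X ((topspace X - collar) \<inter> R)" by simp
 next
  fix i assume i: "i \<in> I"
  have "{t \<in> \<Delta> k. e i t \<in> topspace X - collar}
    = {t \<in> topspace (simplex_top k). simplex_min k t \<in> {1 / (2 * real (Suc k))..}}"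
   using i cell_in_topspace cell_in_collar_iff by auto
  moreover have "closedin (simplex_top k) \<dots>"
   by (intro closedin_continuous_map_preimage[where Y = euclideanreal] continuous_map_from_subtopology continuous_map_simplex_min)
    auto
  ultimately show "closedin (simplex_top k) {t \<in> \<Delta> k. e i t \<in> topspace X - collar}" by simp
 qed auto
 thus ?thesis using openin_closedin[OF collar_subset] by simp
qed

lemma flow_in_collar:
 assumes "0 \<le> u" "u \<le> 1" "x \<in> collar"
 shows "flow u x \<in> collar"
proof (cases "x \<in> R")
 case False
 then obtain i t where it: "i \<in> I" "t \<in> \<Delta> k" "simplex_min k t < 1 / (2 * real (Suc k))"
  "x = e i t" using assms(3) unfolding collar_def by blast
 thus ?thesis using simplex_min_push_out_le[OF it(2) assms(1,2)] push_out_in_simplex[OF it(2) assms(1,2)]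
  by (simp add: flow_cell cell_in_collar_iff)
qed (use assms in \<open>simp add: flow_R\<close>)

lemma flow_1_collar:
 assumes "x \<in> collar"
 shows "flow 1 x \<in> R"
proof (cases "x \<in> R")
 case False
 then obtain i t where it: "i \<in> I" "t \<in> \<Delta> k" "simplex_min k t < 1 / (2 * real (Suc k))"
  "x = e i t" using assms unfolding collar_def by blast
 thus ?thesis using push_out_collar[OF it(2,3)] push_out_in_simplex[OF it(2), of 1] by (simp add: flow_cell cell_in_R_iff)
qed (simp add: flow_R)

text \<open>The flow fixes \<open>R\<close> pointwise, maps the collar to itself at all times and
  into \<open>R\<close> at time 1. Hence \<open>flow 1\<close> is a homotopy inverse of the
  inclusion of pairs.\<close>

lemma iso_collar:
 "hom_induced p X R X collar id \<in> iso (relative_homology_group p X R) (relative_homology_group p X collar)"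
proof -
 have c1: "continuous_map X X (flow 1)"
 proof -
  have "continuous_map X (prod_topology (top_of_set {0..1::real}) X) (\<lambda>x. (1, x))"
   by (intro continuous_map_pairedI) auto
  from continuous_map_compose[OF this continuous_map_flow] show ?thesis by (simp add: o_def)
 qed
 have hom: "homotopic_with (\<lambda>h. h \<in> S \<rightarrow> S) X X (flow 1) id"
  if "S = R \<or> S = collar" for S
 proof -
  have "homotopic_with (\<lambda>h. h \<in> S \<rightarrow> S) X X id (flow 1)" unfolding homotopic_with_def
  proof (intro exI conjI allI ballI)
   show "continuous_map (prod_topology (top_of_set {0..1}) X) X (\<lambda>(u, x). flow u x)" by (rule continuous_map_flow)
   show "(\<lambda>x. case (u, x) of (u, x) => flow u x) \<in> S \<rightarrow> S" if "u \<in> {0..1}" for u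
    using that \<open>S = R \<or> S = collar\<close> flow_in_collar[of u] flow_R by auto
  qed (simp_all add: flow_0)
  thus ?thesis by (rule homotopic_with_symD)
 qed
 have "group_isomorphisms (relative_homology_group p X R) (relative_homology_group p X collar)
     (hom_induced p X R X collar id) (hom_induced p X collar X R (flow 1))"
 proof (rule homotopy_equivalence_relative_homology_group_isomorphisms)
  show "id \<in> R \<rightarrow> collar" by (auto simp: collar_def)
  show "flow 1 \<in> collar \<rightarrow> R" using flow_1_collar by blast
  show "homotopic_with (\<lambda>h. h \<in> R \<rightarrow> R) X X (flow 1 \<circ> id) id"
   "homotopic_with (\<lambda>k. k \<in> collar \<rightarrow> collar) X X (id \<circ> flow 1) id" using hom by simp_all
 qed (use c1 in simp_all)
 thus ?thesis by (rule group_isomorphisms_imp_iso)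
qed

text \<open>\<open>R\<close> is closed and the collar is an open neighbourhood of it, so
  \<open>R\<close> may be excised from the pair of \<open>X\<close> and its collar; excising it from
  the pair of \<open>X\<close> and \<open>R\<close> would require \<open>R\<close> to be
  open.\<close>

lemma iso_excise:
 "hom_induced p (subtopology X (topspace X - R)) (collar - R) X collar id
   \<in> iso (relative_homology_group p (subtopology X (topspace X - R)) (collar - R))
      (relative_homology_group p X collar)"
proof -
 have "X closure_of R \<subseteq> X interior_of collar"
  unfolding closure_of_closedin[OF closed_R] interior_of_openin[OF openin_collar] by (simp add: collar_def)
 thus ?thesis using homology_excision_axiom[of X R collar "topspace X" p] collar_subset by simp
qed

end

definition cell_sum :: "'i set => nat => ('i \<times> (nat => real)) topology" where
 "cell_sum I k = prod_topology (discrete_topology I) (simplex_top k)"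

definition boundary_sum :: "'i set => nat => ('i \<times> (nat => real)) set" where
 "boundary_sum I k = I \<times> {t \<in> \<Delta> k. simplex_min k t = 0}"

lemma topspace_cell_sum [simp]: "topspace (cell_sum I k) = I \<times> \<Delta> k" by (simp add: cell_sum_def)

lemma continuous_map_Pair_cell_sum:
 "i \<in> I ==> continuous_map (simplex_top k) (cell_sum I k) (Pair i)" unfolding cell_sum_def
 by (intro continuous_map_pairedI[of _ _ "\<lambda>_. i" _ "\<lambda>t. t", unfolded]) auto

lemma openin_cell_sum:
 "openin (cell_sum I k) W \<longleftrightarrow>
   W \<subseteq> I \<times> \<Delta> k \<and> (\<forall>i\<in>I. openin (simplex_top k) {t. (i, t) \<in> W})"
proof
 assume W: "openin (cell_sum I k) W"
 have "openin (simplex_top k) {t. (i, t) \<in> W}" if "i \<in> I" for i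
 proof -
  have "openin (simplex_top k) {t \<in> topspace (simplex_top k). (i, t) \<in> W}"
   by (rule openin_continuous_map_preimage[OF continuous_map_Pair_cell_sum[OF that] W])
  moreover have "{t \<in> topspace (simplex_top k). (i, t) \<in> W} = {t. (i, t) \<in> W}" using openin_subset[OF W] by auto
  ultimately show ?thesis by simp
 qed
 thus "W \<subseteq> I \<times> \<Delta> k \<and> (\<forall>i\<in>I. openin (simplex_top k) {t. (i, t) \<in> W})"
  using openin_subset[OF W] by auto
next
 assume R: "W \<subseteq> I \<times> \<Delta> k \<and> (\<forall>i\<in>I. openin (simplex_top k) {t. (i, t) \<in> W})"
 show "openin (cell_sum I k) W" unfolding cell_sum_def openin_prod_topology_alt
 proof (intro allI impI)
  fix i t assume it: "(i, t) \<in> W"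
  hence "i \<in> I" using R by auto
  thus "\<exists>U V. openin (discrete_topology I) U \<and> openin (simplex_top k) V \<and>
         i \<in> U \<and> t \<in> V \<and> U \<times> V \<subseteq> W"
   using R it by (intro exI[of _ "{i}"] exI[of _ "{t. (i, t) \<in> W}"]) auto
 qed
qed

text \<open>The disjoint union of closed simplices is itself an attachment, to the union of their
  boundaries, with the same collar bound. This makes the collar and excision isomorphisms available
  on both sides of the comparison.\<close>

lemma cell_attachment_cell_sum:
 "cell_attachment (cell_sum I k) (boundary_sum I k) I k Pair"
proof
 have crit: "closedin (cell_sum I k) C" if C: "C \<subseteq> topspace (cell_sum I k)"
  and cl: "\<And>i. i \<in> I ==> closedin (simplex_top k) {t \<in> \<Delta> k. (i, t) \<in> C}" for C
 proof -
  have "openin (simplex_top k) {t. (i, t) \<in> I \<times> \<Delta> k - C}" if i: "i \<in> I" for i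
  proof -
   have "{t. (i, t) \<in> I \<times> \<Delta> k - C}
     = topspace (simplex_top k) - {t \<in> \<Delta> k. (i, t) \<in> C}" using i by auto
   thus ?thesis using cl[OF i] by (simp only: openin_diff openin_topspace)
  qed
  hence "openin (cell_sum I k) (topspace (cell_sum I k) - C)" by (auto simp: openin_cell_sum)
  thus ?thesis using C by (simp add: closedin_def)
 qed
 show "closedin (cell_sum I k) (boundary_sum I k)"
 proof (rule crit)
  fix i assume i: "i \<in> I"
  have "closedin (simplex_top k) {t \<in> topspace (simplex_top k). simplex_min k t \<in> {0}}"
   by (intro closedin_continuous_map_preimage[where Y = euclideanreal] continuous_map_from_subtopology
     continuous_map_simplex_min) auto
  moreover have "{t \<in> topspace (simplex_top k). simplex_min k t \<in> {0}}
    = {t \<in> \<Delta> k. (i, t) \<in> boundary_sum I k}" using i by (auto simp: boundary_sum_def)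
  ultimately show "closedin (simplex_top k) {t \<in> \<Delta> k. (i, t) \<in> boundary_sum I k}" by simp
 qed (auto simp: boundary_sum_def)
 show "\<And>C. [|C \<subseteq> topspace (cell_sum I k);
    closedin (cell_sum I k) (C \<inter> boundary_sum I k);
    \<And>i. i \<in> I ==> closedin (simplex_top k) {t \<in> \<Delta> k. (i, t) \<in> C}|]
    ==> closedin (cell_sum I k) C" using crit by blast
qed (auto simp: boundary_sum_def continuous_map_Pair_cell_sum)

context cell_attachment
begin

definition cells_map :: "'i \<times> (nat => real) => 'a" where
 "cells_map = (\<lambda>(i, t). e i t)"

lemma continuous_map_cells_map: "continuous_map (cell_sum I k) X cells_map" unfolding continuous_map_def
proof (intro conjI allI impI)
 show "cells_map \<in> topspace (cell_sum I k) \<rightarrow> topspace X" using cell_in_topspace by (auto simp: cells_map_def)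
 fix U assume U: "openin X U"
 have "openin (simplex_top k) {t \<in> topspace (simplex_top k). e i t \<in> U}" if "i \<in> I" for i
  by (rule openin_continuous_map_preimage[OF continuous_cell[OF that] U])
 thus "openin (cell_sum I k) {z \<in> topspace (cell_sum I k). cells_map z \<in> U}"
  by (auto simp: openin_cell_sum cells_map_def)
qed

lemma boundary_sum_iff:
 "z \<in> topspace (cell_sum I k) ==> z \<in> boundary_sum I k \<longleftrightarrow> cells_map z \<in> R"
 by (auto simp: boundary_sum_def cells_map_def cell_in_R_iff)

lemma cells_map_boundaries: "cells_map \<in> boundary_sum I k \<rightarrow> R"
 by (auto simp: boundary_sum_def cells_map_def cell_in_R_iff)

lemma inj_on_cells_map:
 "inj_on cells_map (topspace (cell_sum I k) - boundary_sum I k)"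
proof (rule inj_onI; clarify)
 fix i t i' t'
 assume a: "(i, t) \<in> topspace (cell_sum I k)" "(i, t) \<notin> boundary_sum I k"
  "(i', t') \<in> topspace (cell_sum I k)" "(i', t') \<notin> boundary_sum I k"
  "cells_map (i, t) = cells_map (i', t')"
 hence "i \<in> I" "t \<in> \<Delta> k" "i' \<in> I" "t' \<in> \<Delta> k"
  "simplex_min k t \<noteq> 0" "simplex_min k t' \<noteq> 0" "e i t = e i' t'" by (auto simp: boundary_sum_def cells_map_def)
 thus "i = i' \<and> t = t'" using cell_inj[of i t i' t'] simplex_min_bounds(1)[of t k] simplex_min_bounds(1)[of t' k] by auto
qed

text \<open>The image of an open set of open cells has a complement containing all of
  \<open>R\<close> and meeting each cell in a closed set, so the weak topology makes the image
  open.\<close>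

lemma homeomorphic_map_open_cells:
 "homeomorphic_map
   (subtopology (cell_sum I k) (topspace (cell_sum I k) - boundary_sum I k))
   (subtopology X (topspace X - R)) cells_map"
proof (rule bijective_open_imp_homeomorphic_map)
 let ?D = "cell_sum I k" and ?B = "boundary_sum I k"
 have oB: "openin ?D (topspace ?D - ?B)" using cell_attachment.closed_R[OF cell_attachment_cell_sum] by blast
 have oX: "openin X (topspace X - R)" using closed_R by blast
 show "continuous_map (subtopology ?D (topspace ?D - ?B)) (subtopology X (topspace X - R)) cells_map"
  unfolding continuous_map_in_subtopology
 proof
  show "continuous_map (subtopology ?D (topspace ?D - ?B)) X cells_map"
   by (intro continuous_map_from_subtopology continuous_map_cells_map)
 qed (use boundary_sum_iff cell_in_topspace in \<open>auto simp: cells_map_def\<close>)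
 show "inj_on cells_map (topspace (subtopology ?D (topspace ?D - ?B)))" using inj_on_cells_map by (rule inj_on_subset) auto
 show "cells_map ` topspace (subtopology ?D (topspace ?D - ?B)) = topspace (subtopology X (topspace X - R))"
 proof
  show "cells_map ` topspace (subtopology ?D (topspace ?D - ?B)) \<subseteq> topspace (subtopology X (topspace X - R))"
   using boundary_sum_iff cell_in_topspace by (auto simp: cells_map_def)
  show "topspace (subtopology X (topspace X - R)) \<subseteq> cells_map ` topspace (subtopology ?D (topspace ?D - ?B))"
  proof
   fix x assume "x \<in> topspace (subtopology X (topspace X - R))"
   hence x: "x \<in> topspace X - R" by auto
   then obtain i t where it: "i \<in> I" "t \<in> \<Delta> k" "x = e i t" using cell_cover by blast
   hence "(i, t) \<in> topspace (subtopology ?D (topspace ?D - ?B))"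
    using x boundary_sum_iff[of "(i, t)"] by (simp add: cells_map_def)
   moreover have "x = cells_map (i, t)" using it by (simp add: cells_map_def)
   ultimately show "x \<in> cells_map ` topspace (subtopology ?D (topspace ?D - ?B))" by blast
  qed
 qed
 show "open_map (subtopology ?D (topspace ?D - ?B)) (subtopology X (topspace X - R)) cells_map" unfolding open_map_def
 proof (intro allI impI)
  fix W assume "openin (subtopology ?D (topspace ?D - ?B)) W"
  hence W: "openin ?D W" "W \<subseteq> topspace ?D - ?B" using openin_open_subtopology[OF oB] by auto
  have im: "cells_map ` W \<subseteq> topspace X - R"
  proof
   fix x assume "x \<in> cells_map ` W"
   then obtain z where z: "z \<in> W" "x = cells_map z" by blast
   hence "z \<in> topspace ?D" "z \<notin> ?B" using W(2) by auto
   thus "x \<in> topspace X - R"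
    using z boundary_sum_iff[of z] continuous_map_image_subset_topspace[OF continuous_map_cells_map] by auto
  qed
  have "closedin X (topspace X - cells_map ` W)"
  proof (rule closed_criterion)
   have "(topspace X - cells_map ` W) \<inter> R = R" using im R_subset by auto
   thus "closedin X ((topspace X - cells_map ` W) \<inter> R)" using closed_R by simp
  next
   fix i assume i: "i \<in> I"
   have "e i t \<in> cells_map ` W \<longleftrightarrow> (i, t) \<in> W" if t: "t \<in> \<Delta> k" for t
   proof
    assume "e i t \<in> cells_map ` W"
    then obtain z where z: "z \<in> W" "cells_map (i, t) = cells_map z" by (auto simp: cells_map_def)
    have it: "(i, t) \<in> topspace ?D" using i t by simp
    have "cells_map z \<notin> R" using im z(1) by auto
    hence "(i, t) \<in> topspace ?D - ?B" using boundary_sum_iff[OF it] z(2) it by simp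
    hence "(i, t) = z" using inj_onD[OF inj_on_cells_map z(2)] z(1) W(2) by blast
    thus "(i, t) \<in> W" using z by simp
   next
    assume "(i, t) \<in> W"
    hence "cells_map (i, t) \<in> cells_map ` W" by blast
    thus "e i t \<in> cells_map ` W" by (simp add: cells_map_def)
   qed
   hence "{t \<in> \<Delta> k. e i t \<in> topspace X - cells_map ` W}
     = topspace (simplex_top k) - {t. (i, t) \<in> W}" using i cell_in_topspace by auto
   moreover have "openin (simplex_top k) {t. (i, t) \<in> W}" using openin_cell_sum[THEN iffD1, OF W(1)] i by simp
   ultimately show "closedin (simplex_top k) {t \<in> \<Delta> k. e i t \<in> topspace X - cells_map ` W}"
    by (simp only: closedin_diff closedin_topspace)
  qed auto
  moreover have "cells_map ` W \<subseteq> topspace X" using im by blast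
  ultimately have "openin X (cells_map ` W)" using openin_closedin by blast
  thus "openin (subtopology X (topspace X - R)) (cells_map ` W)" using openin_open_subtopology[OF oX] im by simp
 qed
qed

text \<open>On both sides the subspace is enlarged to the collar and then excised; what remains are
  the open cells with their collars, which \<open>cells_map\<close> identifies homeomorphically. Two
  commuting squares carry this isomorphism back to the original pairs.\<close>

theorem iso_cells:
 "hom_induced p (cell_sum I k) (boundary_sum I k) X R cells_map
   \<in> iso (relative_homology_group p (cell_sum I k) (boundary_sum I k))
      (relative_homology_group p X R)"
proof -
 interpret D: cell_attachment "cell_sum I k" "boundary_sum I k" I k Pair by (rule cell_attachment_cell_sum)
 let ?D = "cell_sum I k" and ?B = "boundary_sum I k"
 let ?D' = "subtopology ?D (topspace ?D - ?B)" and ?X' = "subtopology X (topspace X - R)"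
 have col: "cells_map \<in> D.collar \<rightarrow> collar"
 proof
  fix z assume z: "z \<in> D.collar"
  obtain i t where it: "z = (i, t)" by (cases z)
  have "i \<in> I" "t \<in> \<Delta> k" using z D.collar_subset it by auto
  thus "cells_map z \<in> collar" using z it D.cell_in_collar_iff cell_in_collar_iff by (simp add: cells_map_def)
 qed
 have col_iff: "cells_map z \<in> collar \<longleftrightarrow> z \<in> D.collar" if "z \<in> topspace ?D" for z
  using that D.cell_in_collar_iff cell_in_collar_iff by (auto simp: cells_map_def)
 have cont': "continuous_map ?D' ?X' cells_map" using homeomorphic_map_open_cells homeomorphic_imp_continuous_map by blast
 have surj': "cells_map ` (topspace ?D - ?B) = topspace X - R"
  using homeomorphic_imp_surjective_map[OF homeomorphic_map_open_cells] by (simp add: Int_absorb1 Diff_subset)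
 have im: "cells_map ` (D.collar - ?B) = collar - R"
 proof
  show "cells_map ` (D.collar - ?B) \<subseteq> collar - R" using col D.collar_subset boundary_sum_iff by blast
  show "collar - R \<subseteq> cells_map ` (D.collar - ?B)"
  proof
   fix x assume x: "x \<in> collar - R"
   then obtain z where z: "z \<in> topspace ?D - ?B" "x = cells_map z" using surj' collar_subset by blast
   thus "x \<in> cells_map ` (D.collar - ?B)" using x col_iff by blast
  qed
 qed
 have sub: "D.collar - ?B \<subseteq> topspace ?D'" using D.collar_subset by auto
 have iso': "hom_induced p ?D' (D.collar - ?B) ?X' (collar - R) cells_map
   \<in> iso (relative_homology_group p ?D' (D.collar - ?B)) (relative_homology_group p ?X' (collar - R))"
  by (rule homeomorphic_map_relative_homology_iso[OF homeomorphic_map_open_cells sub im])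
 have mid: "hom_induced p ?D D.collar X collar cells_map
   \<in> iso (relative_homology_group p ?D D.collar) (relative_homology_group p X collar)"
 proof (rule iso_square_right[OF hom_induced_hom iso_excise D.iso_excise iso'])
  fix x
  have cX: "continuous_map ?X' X id" by (simp add: continuous_map_from_subtopology)
  have cD: "continuous_map ?D' ?D id" by (simp add: continuous_map_from_subtopology)
  have "hom_induced p ?X' (collar - R) X collar id (hom_induced p ?D' (D.collar - ?B) ?X' (collar - R) cells_map x)
    = hom_induced p ?D' (D.collar - ?B) X collar (id \<circ> cells_map) x"
   using im by (intro hom_induced_compose' cont' cX) auto
  also have "\<dots> = hom_induced p ?D' (D.collar - ?B) X collar (cells_map \<circ> id) x" by simp
  also have "\<dots> = hom_induced p ?D D.collar X collar cells_map (hom_induced p ?D' (D.collar - ?B) ?D D.collar id x)"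
   by (rule hom_induced_compose'[symmetric, OF cD _ continuous_map_cells_map col]) auto
  finally show "hom_induced p ?X' (collar - R) X collar id (hom_induced p ?D' (D.collar - ?B) ?X' (collar - R) cells_map x)
    = hom_induced p ?D D.collar X collar cells_map (hom_induced p ?D' (D.collar - ?B) ?D D.collar id x)" .
 qed
 show ?thesis
 proof (rule iso_square_left[OF hom_induced_hom iso_collar D.iso_collar mid])
  fix x
  have "hom_induced p X R X collar id (hom_induced p ?D ?B X R cells_map x)
    = hom_induced p ?D ?B X collar (id \<circ> cells_map) x"
   by (intro hom_induced_compose' continuous_map_cells_map cells_map_boundaries)
    (auto simp: collar_def)
  also have "\<dots> = hom_induced p ?D ?B X collar (cells_map \<circ> id) x" by simp
  also have "\<dots> = hom_induced p ?D D.collar X collar cells_map (hom_induced p ?D ?B ?D D.collar id x)"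
   by (rule hom_induced_compose'[symmetric, OF _ _ continuous_map_cells_map col])
    (auto simp: D.collar_def)
  finally show "hom_induced p X R X collar id (hom_induced p ?D ?B X R cells_map x)
    = hom_induced p ?D D.collar X collar cells_map (hom_induced p ?D ?B ?D D.collar id x)" .
 qed
qed

end

section \<open>Simplicial cell structures\<close>

lemma ordinal_maps_le: "[|a \<in> ordinal_maps m n; i \<le> m|] ==> a i \<le> n"
 by (auto simp: ordinal_maps_def)

lemma ordinal_maps_mono: "[|a \<in> ordinal_maps m n; i \<le> j; j \<le> m|] ==> a i \<le> a j"
 by (auto simp: ordinal_maps_def mono_on_def)

lemma ordinal_mapsI:
 "[|\<And>i j. [|i \<le> j; j \<le> m|] ==> a i \<le> a j; a m \<le> n|] ==> a \<in> ordinal_maps m n"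
 by (fastforce simp: ordinal_maps_def mono_on_def)

lemma ordinal_maps_compose:
 "[|b \<in> ordinal_maps l m; a \<in> ordinal_maps m n|] ==> a \<circ> b \<in> ordinal_maps l n"
 by (rule ordinal_mapsI) (auto simp: ordinal_maps_le ordinal_maps_mono)

definition coface :: "nat => nat => nat" where
 "coface k i = (if i < k then i else Suc i)"

definition codegeneracy :: "nat => nat => nat" where
 "codegeneracy k i = (if i \<le> k then i else i - 1)"

lemma coface_in_ordinal_maps: "coface k \<in> ordinal_maps n (Suc n)" by (rule ordinal_mapsI) (auto simp: coface_def)

lemma codegeneracy_in_ordinal_maps: "k \<le> n ==> codegeneracy k \<in> ordinal_maps (Suc n) n"
 by (rule ordinal_mapsI) (auto simp: codegeneracy_def)

lemma ordinal_map_factors_coface: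
 assumes f: "f \<in> ordinal_maps m n" and i: "i \<le> n" "i \<notin> f ` {..m}"
 obtains n' g where "n = Suc n'" "g \<in> ordinal_maps m n'" "\<And>j. j \<le> m ==> f j = coface i (g j)"
proof -
 have ne: "f j \<noteq> i" if "j \<le> m" for j using i(2) that by auto
 have "f 0 \<noteq> i" "f 0 \<le> n" using ne ordinal_maps_le[OF f] by auto
 then obtain n' where n': "n = Suc n'" using i(1) by (cases n) auto
 let ?g = "\<lambda>j. if f j < i then f j else f j - 1"
 have "?g \<in> ordinal_maps m n'"
 proof (rule ordinal_mapsI)
  fix a b assume "a \<le> b" "b \<le> m"
  thus "?g a \<le> ?g b" using ordinal_maps_mono[OF f, of a b] by auto
 next
  show "?g m \<le> n'" using ordinal_maps_le[OF f, of m] n' i(1) by auto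
 qed
 moreover have "f j = coface i (?g j)" if "j \<le> m" for j using ne[OF that] by (auto simp: coface_def)
 ultimately show ?thesis using that n' by blast
qed

lemma ordinal_map_factors_codegeneracy:
 assumes f: "f \<in> ordinal_maps n k" and ni: "\<not> inj_on f {..n}"
 obtains n' i where "n = Suc n'" "i \<le> n'" "f \<circ> coface i \<in> ordinal_maps n' k"
  "\<And>j. j \<le> n ==> f j = f (coface (Suc i) (codegeneracy i j))"
  "f \<circ> coface (Suc i) \<in> ordinal_maps n' k"
proof -
 obtain a b where ab: "a \<le> n" "b \<le> n" "a < b" "f a = f b"
  using ni unfolding inj_on_def by (metis atMost_iff linorder_neqE_nat)
 then obtain n' where n': "n = Suc n'" by (cases n) auto
 \<comment> \<open>Monotonicity squeezes the values between two equal ones, so a repetition occurs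
   at neighbours and a single degeneracy can be split off.\<close>
 have "f a = f (Suc a)" using ordinal_maps_mono[OF f, of a "Suc a"] ordinal_maps_mono[OF f, of "Suc a" b] ab by simp
 hence "f j = f (coface (Suc a) (codegeneracy a j))" if "j \<le> n" for j
  by (cases "j = Suc a") (auto simp: coface_def codegeneracy_def)
 moreover have "f \<circ> coface i \<in> ordinal_maps n' k" for i
  using ordinal_maps_compose[OF coface_in_ordinal_maps] f n' by blast
 moreover have "a \<le> n'" using ab n' by simp
 ultimately show ?thesis using that n' by blast
qed

lemma surj_ordinal_map_le:
 fixes a :: "nat => nat"
 assumes "a ` {..n} = {..m}"
 shows "m \<le> n"
proof -
 have "card {..m} \<le> card {..n}" unfolding assms[symmetric] by (rule card_image_le) simp
 thus ?thesis by simp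
qed

lemma simplex_push_sum:
 assumes "finite A"
 shows "(\<Sum>j\<in>A. simplex_push m a t j) = (\<Sum>i | i \<le> m \<and> a i \<in> A. t i)"
proof -
 have "(\<Sum>j\<in>A. simplex_push m a t j) = (\<Sum>j\<in>A. \<Sum>i | i \<in> {i. i \<le> m \<and> a i \<in> A} \<and> a i = j. t i)"
  unfolding simplex_push_def by (intro sum.cong) auto
 also have "\<dots> = sum t {i. i \<le> m \<and> a i \<in> A}" using assms by (intro sum.group) auto
 finally show ?thesis .
qed

lemma simplex_push_in_simplex:
 assumes a: "a \<in> ordinal_maps m n" and t: "t \<in> \<Delta> m"
 shows "simplex_push m a t \<in> \<Delta> n"
proof -
 have nn: "0 \<le> simplex_push m a t j" for j using t by (auto simp: simplex_push_def standard_simplex_def intro: sum_nonneg)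
 have z: "simplex_push m a t j = 0" if "n < j" for j
 proof -
  have "{i. i \<le> m \<and> a i = j} = {}" using ordinal_maps_le[OF a] that by force
  thus ?thesis unfolding simplex_push_def by (simp only: sum.empty)
 qed
 have "{i. i \<le> m \<and> a i \<in> {..n}} = {..m}" using ordinal_maps_le[OF a] by auto
 hence s: "(\<Sum>j\<le>n. simplex_push m a t j) = 1"
  using t simplex_push_sum[of "{..n}" m a t] by (simp add: standard_simplex_def)
 have "simplex_push m a t j \<le> 1" for j
 proof (cases "j \<le> n")
  case True
  thus ?thesis using s nn member_le_sum[of j "{..n}" "simplex_push m a t"] by auto
 qed (simp add: z)
 thus ?thesis using nn z s by (simp add: standard_simplex_def)
qed

lemma continuous_map_simplex_push:
 assumes a: "a \<in> ordinal_maps m n"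
 shows "continuous_map (simplex_top m) (simplex_top n) (simplex_push m a)" unfolding continuous_map_in_subtopology
proof
 have "continuous_map (powertop_real UNIV) euclideanreal (\<lambda>t. \<Sum>i | i \<le> m \<and> a i = j. t i)" for j
  by (intro continuous_map_sum continuous_map_product_projection) auto
 hence "continuous_map (powertop_real UNIV) (powertop_real UNIV) (simplex_push m a)"
  by (simp add: continuous_map_componentwise_UNIV simplex_push_def)
 thus "continuous_map (simplex_top m) (powertop_real UNIV) (simplex_push m a)" by (rule continuous_map_from_subtopology)
 show "simplex_push m a \<in> topspace (simplex_top m) \<rightarrow> \<Delta> n" using simplex_push_in_simplex[OF a] by auto
qed

lemma simplex_push_compose:
 assumes b: "b \<in> ordinal_maps l m"
 shows "simplex_push m a (simplex_push l b t) = simplex_push l (a \<circ> b) t"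
proof
 fix j
 have "simplex_push m a (simplex_push l b t) j = (\<Sum>i | i \<le> l \<and> b i \<in> {i. i \<le> m \<and> a i = j}. t i)"
  unfolding simplex_push_def[of m] by (rule simplex_push_sum) simp
 also have "{i. i \<le> l \<and> b i \<in> {i. i \<le> m \<and> a i = j}} = {i. i \<le> l \<and> (a \<circ> b) i = j}"
  using ordinal_maps_le[OF b] by auto
 finally show "simplex_push m a (simplex_push l b t) j = simplex_push l (a \<circ> b) t j" by (simp add: simplex_push_def)
qed

lemma simplex_push_cong:
 assumes "\<And>i. i \<le> m ==> a i = b i"
 shows "simplex_push m a t = simplex_push m b t"
proof
 fix j
 have "{i. i \<le> m \<and> a i = j} = {i. i \<le> m \<and> b i = j}" using assms by auto
 thus "simplex_push m a t j = simplex_push m b t j" unfolding simplex_push_def by simp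
qed

lemma simplex_push_ident:
 assumes "t \<in> \<Delta> n"
 shows "simplex_push n (\<lambda>i. i) t = t"
proof
 fix j
 have "{i. i \<le> n \<and> i = j} = (if j \<le> n then {j} else {})" by auto
 thus "simplex_push n (\<lambda>i. i) t j = t j" using assms unfolding simplex_push_def by (auto simp: standard_simplex_def)
qed

lemma simplical_face_eq_simplex_push:
 assumes k: "k \<le> Suc n" and t: "t \<in> \<Delta> n"
 shows "simplical_face k t = simplex_push n (coface k) t"
proof
 fix j
 have z: "t i = 0" if "i > n" for i using t that by (simp add: standard_simplex_def)
 consider "j < k" | "j = k" | "j > k" by linarith
 thus "simplical_face k t j = simplex_push n (coface k) t j"
 proof cases
  case 1
  hence "{i. i \<le> n \<and> coface k i = j} = {j}" using k by (auto simp: coface_def)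
  thus ?thesis using 1 by (simp add: simplical_face_def simplex_push_def)
 next
  case 2
  hence "{i. i \<le> n \<and> coface k i = j} = {}" by (auto simp: coface_def)
  hence "simplex_push n (coface k) t j = 0" unfolding simplex_push_def by (simp only: sum.empty)
  thus ?thesis using 2 by (simp add: simplical_face_def)
 next
  case 3
  hence "{i. i \<le> n \<and> coface k i = j} = (if j - 1 \<le> n then {j - 1} else {})" by (auto simp: coface_def)
  thus ?thesis using 3 z[of "j - 1"] by (simp add: simplical_face_def simplex_push_def)
 qed
qed

lemma simplex_push_interior:
 assumes a: "a \<in> ordinal_maps m n" "a ` {..m} = {..n}"
  and t: "t \<in> \<Delta> m" "simplex_min m t > 0"
 shows "simplex_min n (simplex_push m a t) > 0"
proof -
 have "simplex_push m a t j > 0" if "j \<le> n" for j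
 proof -
  obtain i where i: "i \<le> m" "a i = j" using a(2) \<open>j \<le> n\<close> by (metis atMost_iff imageE)
  thus ?thesis unfolding simplex_push_def using t simplex_min_pos_iff[OF t(1)]
   by (intro sum_pos) (auto simp: standard_simplex_def)
 qed
 thus ?thesis using simplex_min_pos_iff[OF simplex_push_in_simplex[OF a(1) t(1)]] by simp
qed

lemma simplex_push_boundary:
 assumes a: "a \<in> ordinal_maps m n" and i: "i \<le> n" "i \<notin> a ` {..m}" and t: "t \<in> \<Delta> m"
 shows "simplex_min n (simplex_push m a t) = 0"
proof -
 have "{l. l \<le> m \<and> a l = i} = {}" using i by auto
 hence "simplex_push m a t i = 0" unfolding simplex_push_def by (simp only: sum.empty)
 thus ?thesis using simplex_min_le[OF i(1), of "simplex_push m a t"]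
   simplex_min_bounds(1)[OF simplex_push_in_simplex[OF a t]] by simp
qed

lemma boundary_in_face:
 assumes t: "t \<in> \<Delta> n" and m: "simplex_min n t = 0"
 obtains n' i t' where "n = Suc n'" "i \<le> n" "t' \<in> \<Delta> n'" "t = simplex_push n' (coface i) t'"
proof -
 obtain i where i: "i \<le> n" "t i = 0" using simplex_min_attained[of n t] m by metis
 have "n \<noteq> 0"
 proof
  assume "n = 0"
  thus False using t i by (simp add: standard_simplex_def)
 qed
 then obtain n' where n': "n = Suc n'" by (cases n) auto
 let ?t = "\<lambda>j. t (coface i j)"
 have sum: "(\<Sum>j\<le>n'. ?t j) = (\<Sum>j\<le>n. t j)"
 proof -
  have inj: "inj_on (coface i) {..n'}" by (auto simp: inj_on_def coface_def split: if_splits)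
  have "(\<Sum>j\<le>n'. ?t j) = sum t (coface i ` {..n'})" by (simp add: sum.reindex[OF inj])
  also have "\<dots> = (\<Sum>j\<le>n. t j)"
  proof (rule sum.mono_neutral_left)
   have "j \<in> coface i ` {..n'}" if "j \<le> n" "j \<noteq> i" for j
   proof (cases "j < i")
    case True
    thus ?thesis using i n' by (intro image_eqI[of _ _ j]) (auto simp: coface_def)
   next
    case False
    thus ?thesis using that n' by (intro image_eqI[of _ _ "j - 1"]) (auto simp: coface_def)
   qed
   thus "\<forall>j\<in>{..n} - coface i ` {..n'}. t j = 0" using i by auto
  qed (use i n' in \<open>auto simp: coface_def\<close>)
  finally show ?thesis .
 qed
 have t': "?t \<in> \<Delta> n'" using t sum n' i(1) by (auto simp: standard_simplex_def coface_def)
 have "t = simplical_face i ?t" using i by (auto simp: simplical_face_def coface_def fun_eq_iff)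
 thus ?thesis using that[OF n' i(1) t'] simplical_face_eq_simplex_push[OF _ t'] i n' by simp
qed

text \<open>A boundary point lies on a facet of smaller dimension; descent stops at the face that
  has the point in its interior.\<close>

lemma standard_simplex_carrier_face:
 assumes "t \<in> \<Delta> n"
 obtains m a t' where "m \<le> n" "a \<in> ordinal_maps m n" "t' \<in> \<Delta> m"
  "simplex_min m t' > 0" "t = simplex_push m a t'" using assms
proof (induction n arbitrary: t thesis rule: less_induct)
 case (less n)
 show ?case
 proof (cases "simplex_min n t = 0")
  case True
  obtain n' i t1 where n': "n = Suc n'" "i \<le> n" "t1 \<in> \<Delta> n'" "t = simplex_push n' (coface i) t1"
   using boundary_in_face[OF less.prems(2) True] by metis
  obtain m a t' where m: "m \<le> n'" "a \<in> ordinal_maps m n'" "t' \<in> \<Delta> m"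
   "simplex_min m t' > 0" "t1 = simplex_push m a t'" using less.IH[of n' t1] n' by auto
  show ?thesis
  proof (rule less.prems(1))
   show "coface i \<circ> a \<in> ordinal_maps m n"
    unfolding n'(1) by (rule ordinal_maps_compose[OF m(2) coface_in_ordinal_maps])
   show "t = simplex_push m (coface i \<circ> a) t'" by (simp add: n'(4) m(5) simplex_push_compose[OF m(2)])
  qed (use m n' in auto)
 next
  case False
  show ?thesis
  proof (rule less.prems(1)[of n "\<lambda>i. i" t])
   show "simplex_min n t > 0" using False simplex_min_bounds(1)[OF less.prems(2)] by simp
   show "t = simplex_push n (\<lambda>i. i) t" using simplex_push_ident[OF less.prems(2)] by simp
  qed (use less.prems in \<open>auto intro: ordinal_mapsI\<close>)
 qed
qed

lemma standard_simplex_interior: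
 obtains t where "t \<in> \<Delta> n" "simplex_min n t > 0"
proof -
 let ?b = "\<lambda>i. if i \<le> n then 1 / real (Suc n) else 0"
 have b: "?b \<in> \<Delta> n" by (auto simp: standard_simplex_def)
 thus ?thesis using that[OF b] simplex_min_pos_iff[OF b] by simp
qed

section \<open>Simplicial operators on singular simplices and abstract cell structures\<close>

definition singular_pull :: "nat => (nat => nat) => ((nat => real) => 'a) => (nat => real) => 'a" where
 "singular_pull m f s = restrict (s \<circ> simplex_push m f) (\<Delta> m)"

lemma singular_pull_apply: "t \<in> \<Delta> m ==> singular_pull m a s t = s (simplex_push m a t)"
 by (simp add: singular_pull_def)

lemma singular_pull_compose:
 assumes b: "b \<in> ordinal_maps l m"
 shows "singular_pull l b (singular_pull m a s) = singular_pull l (a \<circ> b) s"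
 by (rule ext) (auto simp: singular_pull_def simplex_push_in_simplex[OF b] simplex_push_compose[OF b])

lemma singular_pull_cong:
 "(\<And>i. i \<le> m ==> a i = b i) ==> singular_pull m a s = singular_pull m b s"
 unfolding singular_pull_def comp_def using simplex_push_cong[of m a b] by simp

lemma singular_pull_ident:
 assumes "s \<in> extensional (\<Delta> n)"
 shows "singular_pull n (\<lambda>i. i) s = s"
 using assms by (intro ext) (auto simp: singular_pull_def simplex_push_ident extensional_def)

lemma singular_simplex_singular_pull:
 assumes s: "singular_simplex n X s" and a: "a \<in> ordinal_maps m n"
 shows "singular_simplex m X (singular_pull m a s)" unfolding singular_simplex_def
proof
 have "continuous_map (simplex_top m) X (s \<circ> simplex_push m a)"
  using s continuous_map_simplex_push[OF a] by (auto simp: singular_simplex_def intro: continuous_map_compose)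
 thus "continuous_map (simplex_top m) X (singular_pull m a s)" by (rule continuous_map_eq) (simp add: singular_pull_def)
qed (simp add: singular_pull_def)

lemma singular_face_eq_singular_pull:
 "i \<le> Suc n ==> singular_face (Suc n) i s = singular_pull n (coface i) s"
 by (rule ext) (auto simp: singular_face_def singular_pull_def simplical_face_eq_simplex_push)

text \<open>\<open>S\<close> holds the characteristic maps of all simplices outside
  \<open>A\<close>, degenerate ones included, and \<open>N\<close> the nondegenerate ones. Faces may
  fall into \<open>A\<close>, on which no cell structure is imposed: \<open>closed_criterion\<close>
  uses its subspace topology as it is. The same locale serves the orbit space and, with empty
  \<open>A\<close>, the boundary of a simplex.\<close>

locale simplicial_cells =
 fixes X :: "'a topology" and A :: "'a set"
  and S N :: "nat => ((nat => real) => 'a) set"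
 assumes A_subset: "A \<subseteq> topspace X"
  and singular: "s \<in> S n ==> singular_simplex n X s"
  and nondegenerate: "N n \<subseteq> S n"
  and pull: "[|s \<in> S n; f \<in> ordinal_maps m n|] ==>
    singular_pull m f s \<in> S m \<or> singular_pull m f s ` \<Delta> m \<subseteq> A"
  and degenerate: "[|s \<in> S n; s \<notin> N n|] ==>
    \<exists>m<n. \<exists>s'\<in>S m. \<exists>f\<in>ordinal_maps n m. s = singular_pull n f s'"
  and interior_inj: "[|s \<in> N n; s' \<in> N m; t \<in> \<Delta> n; simplex_min n t > 0;
    t' \<in> \<Delta> m; simplex_min m t' > 0; s t = s' t'|] ==> n = m \<and> s = s' \<and> t = t'"
  and interior_notin_A: "[|s \<in> N n; t \<in> \<Delta> n; simplex_min n t > 0|] ==> s t \<notin> A"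
  and cover: "x \<in> topspace X - A ==> \<exists>n. \<exists>s\<in>S n. \<exists>t\<in>\<Delta> n. x = s t"
  and closed_criterion: "[|C \<subseteq> topspace X; closedin (subtopology X A) (C \<inter> A);
    \<And>n s. s \<in> S n ==> closedin (simplex_top n) {t \<in> \<Delta> n. s t \<in> C}|]
    ==> closedin X C"
begin

lemma singular_continuous: "s \<in> S n ==> continuous_map (simplex_top n) X s"
 using singular by (simp add: singular_simplex_def)

lemma singular_in_topspace: "[|s \<in> S n; t \<in> \<Delta> n|] ==> s t \<in> topspace X"
 using continuous_map_image_subset_topspace[OF singular_continuous] by auto

definition normal_form :: "nat => ((nat => real) => 'a) => bool" where
 "normal_form n s \<longleftrightarrow> s ` \<Delta> n \<subseteq> A \<or>
   (\<exists>m e f. e \<in> N m \<and> f \<in> ordinal_maps n m \<and> f ` {..n} = {..m} \<and> s = singular_pull n f e)"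

text \<open>Existence half of the Eilenberg-Zilber lemma, by descent on the dimension. A degenerate
  simplex is replaced by its source, a non-surjective operator is factored through a coface, and the
  descent also ends when that face lies in \<open>A\<close>.\<close>

lemma normal_form_pull:
 "[|s \<in> S m; f \<in> ordinal_maps n m|] ==> normal_form n (singular_pull n f s)"
proof (induction m arbitrary: s f rule: less_induct)
 case (less m)
 show ?case
 proof (cases "s \<in> N m")
  case False
  then obtain l s' b where l: "l < m" "s' \<in> S l" "b \<in> ordinal_maps m l" "s = singular_pull m b s'"
   using degenerate less.prems(1) by blast
  show ?thesis
   using less.IH[OF l(1,2) ordinal_maps_compose[OF less.prems(2) l(3)]] by (metis l(4) singular_pull_compose[OF less.prems(2)])
 next
  case True
  show ?thesis
  proof (cases "f ` {..n} = {..m}")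
   case surj: True
   thus ?thesis unfolding normal_form_def using True less.prems by blast
  next
   case False
   moreover have "f ` {..n} \<subseteq> {..m}" using ordinal_maps_le[OF less.prems(2)] by auto
   ultimately obtain i where i: "i \<le> m" "i \<notin> f ` {..n}" by auto
   obtain m' g where m': "m = Suc m'" "g \<in> ordinal_maps n m'" "\<And>j. j \<le> n ==> f j = coface i (g j)"
    using ordinal_map_factors_coface[OF less.prems(2) i] by metis
   have c: "coface i \<in> ordinal_maps m' m" unfolding m'(1) by (rule coface_in_ordinal_maps)
   have eq: "singular_pull n f s = singular_pull n g (singular_pull m' (coface i) s)"
    unfolding singular_pull_compose[OF m'(2)] by (rule singular_pull_cong) (simp add: m'(3))
   from pull[OF less.prems(1) c] show ?thesis
   proof
    assume "singular_pull m' (coface i) s \<in> S m'"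
    thus ?thesis unfolding eq using less.IH m' by blast
   next
    assume a: "singular_pull m' (coface i) s ` \<Delta> m' \<subseteq> A"
    have "singular_pull n f s ` \<Delta> n \<subseteq> A"
     unfolding eq using a simplex_push_in_simplex[OF m'(2)] by (auto simp: singular_pull_apply)
    thus ?thesis by (simp add: normal_form_def)
   qed
  qed
 qed
qed

lemma normal_form: "s \<in> S n ==> normal_form n s"
 using normal_form_pull[of s n "\<lambda>i. i" n] singular[of s n] singular_pull_ident[of s n]
 by (auto simp: singular_simplex_def intro: ordinal_mapsI)

lemma point_in_cell:
 assumes s: "s \<in> S m" and t: "t \<in> \<Delta> m" and nA: "s t \<notin> A"
 obtains j e t' where "j \<le> m" "e \<in> N j" "t' \<in> \<Delta> j" "simplex_min j t' > 0" "s t = e t'"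
proof -
 obtain l a u where l: "l \<le> m" "a \<in> ordinal_maps l m" "u \<in> \<Delta> l"
  "simplex_min l u > 0" "t = simplex_push l a u" using standard_simplex_carrier_face[OF t] by metis
 have st: "s t = singular_pull l a s u" by (simp add: l singular_pull_apply)
 then obtain j e b where j: "e \<in> N j" "b \<in> ordinal_maps l j" "b ` {..l} = {..j}"
  "singular_pull l a s = singular_pull l b e" using nA l(3) normal_form_pull[OF s l(2)] unfolding normal_form_def by blast
 show ?thesis
 proof (rule that)
  show "j \<le> m" using surj_ordinal_map_le[OF j(3)] l(1) by simp
  show "s t = e (simplex_push l b u)" using st j(4) l(3) by (simp add: singular_pull_apply)
 qed (use j l simplex_push_in_simplex simplex_push_interior in auto)
qed

text \<open>The index is shifted: only cells of dimension below \<open>k\<close> are included, so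
  that \<open>skeleton 0\<close> is \<open>A\<close> and passing from \<open>k\<close> to
  \<open>Suc k\<close> attaches the \<open>k\<close>-cells.\<close>

definition skeleton :: "nat => 'a set" where
 "skeleton k = A \<union> (\<Union>j\<in>{..<k}. \<Union>e\<in>N j. e ` \<Delta> j)"

lemma skeleton_0: "skeleton 0 = A" by (simp add: skeleton_def)

lemma skeleton_Suc: "skeleton (Suc k) = skeleton k \<union> (\<Union>e\<in>N k. e ` \<Delta> k)"
 unfolding skeleton_def lessThan_Suc by auto

lemma skeleton_mono: "k \<le> l ==> skeleton k \<subseteq> skeleton l" unfolding skeleton_def by fastforce

lemma skeleton_subset: "skeleton k \<subseteq> topspace X"
 unfolding skeleton_def using A_subset singular_in_topspace nondegenerate by blast

lemma skeleton_point:
 assumes x: "x \<in> skeleton k" "x \<notin> A"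
 obtains j e t where "j < k" "e \<in> N j" "t \<in> \<Delta> j" "simplex_min j t > 0" "x = e t"
proof -
 obtain j e t where j: "j < k" "e \<in> N j" "t \<in> \<Delta> j" "x = e t" using x unfolding skeleton_def by blast
 hence eS: "e \<in> S j" using nondegenerate by blast
 obtain l e' t' where l: "l \<le> j" "e' \<in> N l" "t' \<in> \<Delta> l" "simplex_min l t' > 0" "e t = e' t'"
  using x(2) j(4) point_in_cell[OF eS j(3)] by metis
 show ?thesis by (rule that[OF _ l(2-4)]) (use l j in auto)
qed

lemma interior_notin_skeleton:
 assumes "e \<in> N j" "t \<in> \<Delta> j" "simplex_min j t > 0" "k \<le> j"
 shows "e t \<notin> skeleton k"
proof
 assume "e t \<in> skeleton k"
 moreover have "e t \<notin> A" using assms interior_notin_A by blast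
 ultimately obtain l e' t' where "l < k" "e' \<in> N l" "t' \<in> \<Delta> l" "simplex_min l t' > 0" "e t = e' t'"
  using skeleton_point by metis
 thus False using interior_inj[of e j e' l t t'] assms by auto
qed

lemma simplex_in_skeleton: "s \<in> S n ==> s ` \<Delta> n \<subseteq> skeleton (Suc n)"
proof
 fix x assume s: "s \<in> S n" and "x \<in> s ` \<Delta> n"
 then obtain t where t: "t \<in> \<Delta> n" "x = s t" by blast
 show "x \<in> skeleton (Suc n)"
 proof (cases "x \<in> A")
  case False
  then obtain j e t' where j: "j \<le> n" "e \<in> N j" "t' \<in> \<Delta> j" "s t = e t'"
   using point_in_cell[OF s t(1)] t(2) by metis
  hence "x \<in> e ` \<Delta> j" "j < Suc n" using t(2) by auto
  thus ?thesis unfolding skeleton_def using j(2) by blast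
 qed (simp add: skeleton_def)
qed

lemma boundary_in_skeleton:
 assumes s: "s \<in> S n" and t: "t \<in> \<Delta> n" "simplex_min n t = 0"
 shows "s t \<in> skeleton n"
proof -
 obtain n' i t' where n': "n = Suc n'" "i \<le> n" "t' \<in> \<Delta> n'" "t = simplex_push n' (coface i) t'"
  using boundary_in_face[OF t] by metis
 have st: "s t = singular_pull n' (coface i) s t'" using n' by (simp add: singular_pull_apply)
 from pull[OF s, of "coface i" n'] n'(1) coface_in_ordinal_maps
 have "singular_pull n' (coface i) s \<in> S n' \<or> singular_pull n' (coface i) s ` \<Delta> n' \<subseteq> A" by blast
 thus ?thesis using simplex_in_skeleton[of "singular_pull n' (coface i) s" n'] n' st by (auto simp: skeleton_def)
qed

lemma cover_skeleton:
 assumes "x \<in> topspace X"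
 obtains k where "x \<in> skeleton k" using cover[of x] assms simplex_in_skeleton skeleton_0 by (metis DiffI imageI subsetD)

text \<open>A subset of a skeleton needs to be tested only on the cells of that skeleton: higher
 simplices meet it in the images of their faces.\<close>

lemma closedin_skeleton_subset:
 assumes C: "C \<subseteq> skeleton k" and CA: "closedin (subtopology X A) (C \<inter> A)"
  and cl: "\<And>j e. [|j < k; e \<in> N j|] ==> closedin (simplex_top j) {t \<in> \<Delta> j. e t \<in> C}"
 shows "closedin X C"
proof (rule closed_criterion[OF _ CA])
 show "C \<subseteq> topspace X" using C skeleton_subset by blast
 fix n s assume "s \<in> S n"
 thus "closedin (simplex_top n) {t \<in> \<Delta> n. s t \<in> C}"
 proof (induction n arbitrary: s rule: less_induct)
  case (less n)
  consider "s \<notin> N n" | "s \<in> N n" "n < k" | "s \<in> N n" "k \<le> n" by linarith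
  thus ?case
  proof cases
   case 1
   then obtain l s' b where l: "l < n" "s' \<in> S l" "b \<in> ordinal_maps n l" "s = singular_pull n b s'"
    using degenerate less.prems(1) by blast
   have "closedin (simplex_top n) {t \<in> topspace (simplex_top n).
       simplex_push n b t \<in> {t \<in> \<Delta> l. s' t \<in> C}}"
    using closedin_continuous_map_preimage[OF continuous_map_simplex_push[OF l(3)] less.IH[OF l(1,2)]] .
   also have "{t \<in> topspace (simplex_top n). simplex_push n b t \<in> {t \<in> \<Delta> l. s' t \<in> C}}
     = {t \<in> \<Delta> n. s t \<in> C}" using simplex_push_in_simplex[OF l(3)] by (auto simp: l(4) singular_pull_apply)
   finally show ?thesis .
  next
   case 2
   thus ?thesis using cl by blast
  next
   case 3
   \<comment> \<open>The interior of a nondegenerate simplex of dimension at least \<open>k\<close>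
     avoids \<open>skeleton k\<close>, so \<open>C\<close> is met on the boundary only.\<close>
   have bd: "simplex_min n t = 0" if "t \<in> \<Delta> n" "s t \<in> C" for t
   proof (rule ccontr)
    assume "simplex_min n t \<noteq> 0"
    thus False using simplex_min_bounds(1)[OF that(1)] interior_notin_skeleton[OF 3(1) that(1) _ 3(2)] that(2) C by auto
   qed
   show ?thesis
   proof (cases n)
    case 0
    have "{t \<in> \<Delta> n. s t \<in> C} = {}"
    proof -
     have "t \<notin> \<Delta> n \<or> s t \<notin> C" for t
      using bd[of t] boundary_in_face[of t n] 0 by (metis nat.distinct(1))
     thus ?thesis by blast
    qed
    thus ?thesis by (simp only: closedin_empty)
   next
    case (Suc n')
    let ?F = "\<lambda>i. {t \<in> \<Delta> n'. singular_pull n' (coface i) s t \<in> C}"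
    have co: "coface i \<in> ordinal_maps n' n" for i unfolding Suc by (rule coface_in_ordinal_maps)
    have F: "closedin (simplex_top n') (?F i)" for i using pull[OF less.prems co[of i]]
    proof
     assume "singular_pull n' (coface i) s \<in> S n'"
     thus ?thesis using less.IH Suc by blast
    next
     assume a: "singular_pull n' (coface i) s ` \<Delta> n' \<subseteq> A"
     have "continuous_map (simplex_top n') (subtopology X A) (singular_pull n' (coface i) s)"
      using singular_simplex_singular_pull[OF singular[OF less.prems] co] a
      by (auto simp: continuous_map_in_subtopology singular_simplex_def)
     hence "closedin (simplex_top n')
       {t \<in> topspace (simplex_top n'). singular_pull n' (coface i) s t \<in> C \<inter> A}"
      using CA by (rule closedin_continuous_map_preimage)
     also have "{t \<in> topspace (simplex_top n'). singular_pull n' (coface i) s t \<in> C \<inter> A} = ?F i"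
      using a by auto
     finally show ?thesis .
    qed
    \<comment> \<open>Facets are compact and the simplex is Hausdorff; hence closed sets of the
      finitely many facets have closed images.\<close>
    have "closed_map (simplex_top n') (simplex_top n) (simplex_push n' (coface i))" for i
     by (rule continuous_imp_closed_map[OF continuous_map_simplex_push[OF co]])
      (simp_all add: compact_space_subtopology compactin_standard_simplex Hausdorff_space_subtopology
       Hausdorff_space_product_topology)
    hence "closedin (simplex_top n) (simplex_push n' (coface i) ` ?F i)" for i using F unfolding closed_map_def by blast
    hence "closedin (simplex_top n) (\<Union>i\<in>{..n}. simplex_push n' (coface i) ` ?F i)" by (intro closedin_Union) auto
    also have "(\<Union>i\<in>{..n}. simplex_push n' (coface i) ` ?F i) = {t \<in> \<Delta> n. s t \<in> C}"
    proof
     show "(\<Union>i\<in>{..n}. simplex_push n' (coface i) ` ?F i) \<subseteq> {t \<in> \<Delta> n. s t \<in> C}"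
      using simplex_push_in_simplex[OF co] by (auto simp: singular_pull_apply)
     show "{t \<in> \<Delta> n. s t \<in> C} \<subseteq> (\<Union>i\<in>{..n}. simplex_push n' (coface i) ` ?F i)"
     proof
      fix t assume "t \<in> {t \<in> \<Delta> n. s t \<in> C}"
      hence t: "t \<in> \<Delta> n" "s t \<in> C" by auto
      obtain m i t' where m: "n = Suc m" "i \<le> n" "t' \<in> \<Delta> m" "t = simplex_push m (coface i) t'"
       using boundary_in_face[OF t(1) bd[OF t]] by metis
      have "m = n'" using m(1) Suc by simp
      hence "t' \<in> ?F i" using m t by (simp add: singular_pull_apply)
      thus "t \<in> (\<Union>i\<in>{..n}. simplex_push n' (coface i) ` ?F i)" using m \<open>m = n'\<close> by blast
     qed
    qed
    finally show ?thesis .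
   qed
  qed
 qed
qed

lemma continuous_preimage_closed:
 "[|s \<in> S n; closedin X C|] ==> closedin (simplex_top n) {t \<in> \<Delta> n. s t \<in> C}"
 using closedin_continuous_map_preimage[OF singular_continuous, of s n C] by simp

lemma closedin_skeleton: "closedin X (skeleton k)"
proof (rule closedin_skeleton_subset[where k = k])
 have "skeleton k \<inter> A = topspace (subtopology X A)" using A_subset by (auto simp: skeleton_def)
 thus "closedin (subtopology X A) (skeleton k \<inter> A)" by (simp only: closedin_topspace)
 fix j e assume "j < k" "e \<in> N j"
 hence "{t \<in> \<Delta> j. e t \<in> skeleton k} = topspace (simplex_top j)" by (auto simp: skeleton_def)
 thus "closedin (simplex_top j) {t \<in> \<Delta> j. e t \<in> skeleton k}" by (simp only: closedin_topspace)
qed simp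

lemma cell_attachment_skeleton:
 "cell_attachment (subtopology X (skeleton (Suc k))) (skeleton k) (N k) k (\<lambda>e. e)"
proof
 show "closedin (subtopology X (skeleton (Suc k))) (skeleton k)"
  using closedin_skeleton skeleton_mono[of k "Suc k"] by (simp add: closedin_closed_subtopology)
 show "continuous_map (simplex_top k) (subtopology X (skeleton (Suc k))) i" if "i \<in> N k" for i
 proof -
  have i: "i \<in> S k" using that nondegenerate by blast
  show ?thesis unfolding continuous_map_in_subtopology using singular_continuous[OF i] simplex_in_skeleton[OF i] by auto
 qed
 show "i t \<in> skeleton k" if "i \<in> N k" "t \<in> \<Delta> k" "simplex_min k t = 0" for i t
  using boundary_in_skeleton that nondegenerate by blast
 show "i t \<notin> skeleton k" if "i \<in> N k" "t \<in> \<Delta> k" "0 < simplex_min k t" for i t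
  using interior_notin_skeleton that by blast
 show "i = i' \<and> t = t'" if "i \<in> N k" "t \<in> \<Delta> k" "0 < simplex_min k t"
   "i' \<in> N k" "t' \<in> \<Delta> k" "0 < simplex_min k t'" "i t = i' t'" for i t i' t'
  using interior_inj[of i k i' k t t'] that by blast
 show "\<exists>i\<in>N k. \<exists>t\<in>\<Delta> k. x = i t"
  if "x \<in> topspace (subtopology X (skeleton (Suc k))) - skeleton k" for x using that unfolding skeleton_Suc by auto
next
 fix C assume C: "C \<subseteq> topspace (subtopology X (skeleton (Suc k)))"
  and CR: "closedin (subtopology X (skeleton (Suc k))) (C \<inter> skeleton k)"
  and cl: "\<And>i. i \<in> N k ==> closedin (simplex_top k) {t \<in> \<Delta> k. i t \<in> C}"
 have CR': "closedin X (C \<inter> skeleton k)" using CR closedin_skeleton[of "Suc k"] by (simp add: closedin_closed_subtopology)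
 have "closedin X C"
 proof (rule closedin_skeleton_subset[where k = "Suc k"])
  show "C \<subseteq> skeleton (Suc k)" using C by auto
  have "C \<inter> A = A \<inter> (C \<inter> skeleton k)" by (auto simp: skeleton_def)
  thus "closedin (subtopology X A) (C \<inter> A)" using closedin_subtopology_Int_closed[OF CR'] by simp
  fix j e assume j: "j < Suc k" "e \<in> N j"
  show "closedin (simplex_top j) {t \<in> \<Delta> j. e t \<in> C}"
  proof (cases "j = k")
   case False
   hence "j < k" using j(1) by simp
   hence "e ` \<Delta> j \<subseteq> skeleton k" using j(2) unfolding skeleton_def by blast
   hence "{t \<in> \<Delta> j. e t \<in> C} = {t \<in> \<Delta> j. e t \<in> C \<inter> skeleton k}" by blast
   moreover have "e \<in> S j" using j(2) nondegenerate by blast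
   ultimately show ?thesis using continuous_preimage_closed[OF _ CR', of e j] by simp
  qed (use cl j in blast)
 qed
 thus "closedin (subtopology X (skeleton (Suc k))) C"
  using C closedin_skeleton[of "Suc k"] by (simp add: closedin_closed_subtopology)
qed

text \<open>The point is interior to a unique cell, so each cell up to that dimension meets it in
  nothing or in one point. The restriction to points off \<open>A\<close> is essential, as no
  separation property of \<open>A\<close> is assumed.\<close>

lemma closedin_point:
 assumes x: "x \<in> topspace X - A"
 shows "closedin X {x}"
proof -
 obtain K where "x \<in> skeleton K" using cover_skeleton[of x] x by auto
 then obtain j0 e0 t0 where j0: "e0 \<in> N j0" "t0 \<in> \<Delta> j0" "simplex_min j0 t0 > 0" "x = e0 t0"
  using skeleton_point x by (metis DiffE)
 show ?thesis
 proof (rule closedin_skeleton_subset[where k = "Suc j0"])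
  show "{x} \<subseteq> skeleton (Suc j0)" using j0 by (auto simp: skeleton_def)
  show "closedin (subtopology X A) ({x} \<inter> A)" using x by auto
  fix j e assume j: "j < Suc j0" "e \<in> N j"
  have "j = j0 \<and> e = e0 \<and> t = t0" if t: "t \<in> \<Delta> j" "e t = x" for t
  proof -
   have xs: "x \<notin> skeleton j0" using interior_notin_skeleton j0 by blast
   have eS: "e \<in> S j" using j nondegenerate by blast
   hence "x \<in> skeleton (Suc j)" using simplex_in_skeleton t by blast
   hence jj: "j = j0" using xs skeleton_mono[of "Suc j" j0] j by (metis Suc_leI less_SucE subsetD)
   have "simplex_min j t \<noteq> 0" using boundary_in_skeleton[OF eS t(1)] xs t(2) jj by blast
   thus ?thesis using simplex_min_bounds(1)[OF t(1)] interior_inj[of e j e0 j0 t t0] j j0 t by auto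
  qed
  hence "{t \<in> \<Delta> j. e t \<in> {x}} = {} \<or>
    (j = j0 \<and> {t \<in> \<Delta> j. e t \<in> {x}} = {t0})" by blast
  moreover have "closedin (simplex_top j0) {t0}"
   using j0(2) by (simp add: closedin_Hausdorff_sing_eq Hausdorff_space_subtopology Hausdorff_space_product_topology)
  ultimately show "closedin (simplex_top j) {t \<in> \<Delta> j. e t \<in> {x}}"
   by (elim disjE conjE) (simp_all only: closedin_empty)
 qed
qed

text \<open>Otherwise a sequence leaving every skeleton can be chosen in \<open>C\<close>. All its
  tails are closed, and their complements form an open cover without a finite subcover.\<close>

lemma compactin_skeleton:
 assumes C: "compactin X C"
 obtains k where "C \<subseteq> skeleton k"
proof -
 have "\<exists>k. C \<subseteq> skeleton k"
 proof (rule ccontr)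
  assume "\<not> (\<exists>k. C \<subseteq> skeleton k)"
  hence "\<forall>k. \<exists>y. y \<in> C \<and> y \<notin> skeleton k" by blast
  then obtain y where y: "\<And>k. y k \<in> C" "\<And>k. y k \<notin> skeleton k" by metis
  have yX: "y k \<in> topspace X - A" for k
   using y(1)[of k] y(2)[of k] compactin_subset_topspace[OF C] skeleton_mono[of 0 k] by (auto simp: skeleton_0)
  have closed: "closedin X (y ` {k..})" for k
  proof (rule closed_criterion)
   show "y ` {k..} \<subseteq> topspace X" using yX by auto
   have "y ` {k..} \<inter> A = {}" using yX by auto
   thus "closedin (subtopology X A) (y ` {k..} \<inter> A)" by (simp only: closedin_empty)
   fix m s assume s: "s \<in> S m"
   \<comment> \<open>A simplex of dimension \<open>m\<close> stays in
     \<open>skeleton (Suc m)\<close>, so it contains \<open>y j\<close> for at most finitely many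
     \<open>j\<close>, and the preimage of a tail is a finite union of preimages of closed
     points.\<close>
   have "j \<le> m" if "y j \<in> s ` \<Delta> m" for j
    using that simplex_in_skeleton[OF s] y(2)[of j] skeleton_mono[of "Suc m" j] by (meson not_less_eq_eq subsetD)
   hence "j \<le> m" if "t \<in> \<Delta> m" "s t = y j" for j t using that by (metis imageI)
   hence "{t \<in> \<Delta> m. s t \<in> y ` {k..}} = (\<Union>j\<in>{k..m}. {t \<in> \<Delta> m. s t \<in> {y j}})"
    by (auto simp del: ex_simps) (metis atLeastAtMost_iff)
   moreover have "closedin (simplex_top m) (\<Union>j\<in>{k..m}. {t \<in> \<Delta> m. s t \<in> {y j}})"
   proof (rule closedin_Union)
    fix Z assume "Z \<in> (\<lambda>j. {t \<in> \<Delta> m. s t \<in> {y j}}) ` {k..m}"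
    then obtain j where "Z = {t \<in> \<Delta> m. s t \<in> {y j}}" by blast
    thus "closedin (simplex_top m) Z" using continuous_preimage_closed[OF s closedin_point[OF yX[of j]]] by simp
   qed simp
   ultimately show "closedin (simplex_top m) {t \<in> \<Delta> m. s t \<in> y ` {k..}}" by simp
  qed
  let ?U = "\<lambda>k. topspace X - y ` {k..}"
  have "C \<subseteq> \<Union> (range ?U)"
  proof
   fix x assume x: "x \<in> C"
   hence xX: "x \<in> topspace X" using compactin_subset_topspace[OF C] by blast
   then obtain k where k: "x \<in> skeleton k" using cover_skeleton[of x] by metis
   have "x \<noteq> y j" if "k \<le> j" for j using y(2)[of j] skeleton_mono[OF that] k by auto
   thus "x \<in> \<Union> (range ?U)" using xX by blast
  qed
  moreover have "\<forall>W\<in>range ?U. openin X W" using closed by (auto intro: openin_diff)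
  ultimately obtain F where F: "finite F" "F \<subseteq> range ?U" "C \<subseteq> \<Union>F"
   using C unfolding compactin_def by (metis (no_types, lifting))
  then obtain J where J: "finite J" "F = ?U ` J" using finite_subset_image[OF F(1,2)] by auto
  let ?m = "Max (insert 0 J)"
  obtain j where "j \<in> J" "y ?m \<notin> y ` {j..}" using F(3) y(1) J(2) by blast
  moreover have "j \<le> ?m" using J(1) \<open>j \<in> J\<close> by simp
  ultimately show False by auto
 qed
 thus ?thesis using that by blast
qed

end

section \<open>Combining acyclic families along a subspace\<close>

lemma singular_chain_from_subtopology:
 "singular_chain n (subtopology X R) c ==> singular_chain n X c" by (simp add: singular_chain_subtopology)

text \<open>After the first reduction a chain is a sum of a chain on \<open>T\<close> and a chain of
  \<open>R\<close>; the boundary of the latter lies in \<open>T\<close> as well as in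
  \<open>R\<close>, so it can be reduced further without leaving \<open>R\<close>.\<close>

lemma acyclic_modulo_filtration:
 assumes T: "face_closed X T"
  and ac: "acyclic_modulo X (\<lambda>n. T n \<union> singular_simplex_set n (subtopology X R))"
  and acR: "acyclic_modulo (subtopology X R) (\<lambda>n. T n \<inter> singular_simplex_set n (subtopology X R))"
 shows "acyclic_modulo X T" unfolding acyclic_modulo_def
proof (intro allI impI)
 fix n c assume c: "singular_chain n X c" and bc: "keys (chain_boundary n c) \<subseteq> T (n - 1)"
 then obtain b where b: "singular_chain (Suc n) X b"
  "keys (c - chain_boundary (Suc n) b) \<subseteq> T n \<union> singular_simplex_set n (subtopology X R)"
  using ac unfolding acyclic_modulo_def by blast
 obtain y r where y: "keys y \<subseteq> T n"
  and r: "keys r \<subseteq> singular_simplex_set n (subtopology X R)"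
  and yr: "y + r = c - chain_boundary (Suc n) b" using b(2) by (rule frag_split)
 have rR: "singular_chain n (subtopology X R) r" using r by (simp add: singular_chain_def)
 have "chain_boundary n (y + r) = chain_boundary n c"
  unfolding yr using chain_boundary_boundary_alt[OF b(1)] by (simp add: chain_boundary_diff)
 hence "chain_boundary n r = chain_boundary n c - chain_boundary n y" by (simp add: chain_boundary_add algebra_simps)
 hence "keys (chain_boundary n r) \<subseteq> T (n - 1)"
  using bc face_closed_chain_boundary[OF T y] by (simp add: keys_diff_subset)
 moreover have "keys (chain_boundary n r) \<subseteq> singular_simplex_set (n - 1) (subtopology X R)"
  using singular_chain_boundary[OF rR] by (simp add: singular_chain_def)
 ultimately obtain d where d: "singular_chain (Suc n) (subtopology X R) d"
  "keys (r - chain_boundary (Suc n) d) \<subseteq> T n \<inter> singular_simplex_set n (subtopology X R)"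
  using acR rR unfolding acyclic_modulo_def by blast
 have "c - chain_boundary (Suc n) (b + d) = y + (r - chain_boundary (Suc n) d)"
  using yr by (simp add: chain_boundary_add algebra_simps)
 moreover have "keys (y + (r - chain_boundary (Suc n) d)) \<subseteq> T n" using y d(2) by (intro keys_add_subset) auto
 moreover have "singular_chain (Suc n) X (b + d)"
  using b(1) singular_chain_from_subtopology[OF d(1)] by (rule singular_chain_add)
 ultimately show "\<exists>b. singular_chain (Suc n) X b \<and> keys (c - chain_boundary (Suc n) b) \<subseteq> T n"
  by (intro exI[of _ "b + d"]) simp
qed

text \<open>Passes from absolute statements about \<open>X\<close> and \<open>R\<close> to the
  relative one. The part of the boundary of \<open>c\<close> in \<open>R\<close> is first moved onto
  \<open>T\<close> by a chain of \<open>R\<close>; after subtracting that chain the acyclicity of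
  \<open>X\<close> modulo \<open>T\<close> applies.\<close>

lemma acyclic_modulo_union:
 assumes T: "face_closed X T" and ac: "acyclic_modulo X T"
  and acR: "acyclic_modulo (subtopology X R) (\<lambda>n. T n \<inter> singular_simplex_set n (subtopology X R))"
 shows "acyclic_modulo X (\<lambda>n. T n \<union> singular_simplex_set n (subtopology X R))" unfolding acyclic_modulo_def
proof (intro allI impI)
 fix n c assume c: "singular_chain n X c" and bc: "keys (chain_boundary n c)
   \<subseteq> T (n - 1) \<union> singular_simplex_set (n - 1) (subtopology X R)"
 \<comment> \<open>The summand \<open>a\<close> in \<open>R\<close> has boundary minus that of
   \<open>s\<close>, hence on \<open>T\<close>, so \<open>acR\<close> rewrites \<open>a\<close> as a
   boundary in \<open>R\<close> plus a chain on \<open>T\<close>.\<close>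
 obtain b where b: "singular_chain n (subtopology X R) b"
  "keys (chain_boundary n c - chain_boundary n b) \<subseteq> T (n - 1)"
 proof (cases n)
  case 0
  thus ?thesis using that[of 0] by (simp add: chain_boundary_def)
 next
  case (Suc m)
  obtain s a where s: "keys s \<subseteq> T m"
   and a: "keys a \<subseteq> singular_simplex_set m (subtopology X R)"
   and sa: "s + a = chain_boundary n c" using bc unfolding Suc diff_Suc_1 by (rule frag_split)
  have aR: "singular_chain m (subtopology X R) a" using a by (simp add: singular_chain_def)
  have "chain_boundary m a = - chain_boundary m s"
   using chain_boundary_boundary_alt[of m X c] c Suc by (metis sa chain_boundary_add eq_neg_iff_add_eq_0 add.commute)
  hence "keys (chain_boundary m a) \<subseteq> T (m - 1)" using face_closed_chain_boundary[OF T s] by simp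
  moreover have "keys (chain_boundary m a) \<subseteq> singular_simplex_set (m - 1) (subtopology X R)"
   using singular_chain_boundary[OF aR] by (simp add: singular_chain_def)
  ultimately obtain b where b: "singular_chain n (subtopology X R) b"
   "keys (a - chain_boundary n b) \<subseteq> T m \<inter> singular_simplex_set m (subtopology X R)"
   using acR aR unfolding acyclic_modulo_def Suc by blast
  have "chain_boundary n c - chain_boundary n b = s + (a - chain_boundary n b)" using sa by (simp add: algebra_simps)
  moreover have "keys (s + (a - chain_boundary n b)) \<subseteq> T m" using s b(2) by (intro keys_add_subset) auto
  ultimately have "keys (chain_boundary n c - chain_boundary n b) \<subseteq> T m" by (simp only:)
  thus ?thesis using that b(1) Suc by simp
 qed
 have "keys (chain_boundary n (c - b)) \<subseteq> T (n - 1)" using b(2) by (simp add: chain_boundary_diff)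
 moreover have "singular_chain n X (c - b)" using c singular_chain_from_subtopology[OF b(1)] by (rule singular_chain_diff)
 ultimately obtain x where x: "singular_chain (Suc n) X x"
  "keys (c - b - chain_boundary (Suc n) x) \<subseteq> T n" using ac unfolding acyclic_modulo_def by blast
 have "keys ((c - b - chain_boundary (Suc n) x) + b) \<subseteq> T n \<union> singular_simplex_set n (subtopology X R)"
  using x(2) b(1) by (intro keys_add_subset) (auto simp: singular_chain_def)
 thus "\<exists>b. singular_chain (Suc n) X b \<and> keys (c - chain_boundary (Suc n) b)
   \<subseteq> T n \<union> singular_simplex_set n (subtopology X R)"
  using x(1) by (intro exI[of _ x]) (simp add: algebra_simps)
qed

section \<open>Ordinal simplices of a simplex and of a disjoint union of simplices\<close>

definition simplex_boundary :: "nat => (nat => real) set" where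
 "simplex_boundary k = {t \<in> \<Delta> k. simplex_min k t = 0}"

abbreviation sphere_topology :: "nat => (nat => real) topology" where
 "sphere_topology k \<equiv> subtopology (simplex_top k) (simplex_boundary k)"

definition ord_simplex :: "nat => (nat => nat) => (nat => real) => nat => real" where
 "ord_simplex n a = restrict (simplex_push n a) (\<Delta> n)"

text \<open>The simplicial set represented by the ordinal \<open>0 \<le> \<dots> \<le> k\<close>,
  degenerate simplices included, realised by affine singular simplices of the standard
  simplex.\<close>

definition ord_simplices :: "nat => nat => ((nat => real) => nat => real) set" where
 "ord_simplices k n = ord_simplex n ` ordinal_maps n k"

lemma singular_simplex_ord_simplex:
 "a \<in> ordinal_maps n k ==> singular_simplex n (simplex_top k) (ord_simplex n a)"
 unfolding singular_simplex_def ord_simplex_def using continuous_map_simplex_push[of a n k] by (auto intro: continuous_map_eq)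

lemma singular_pull_ord_simplex:
 assumes "b \<in> ordinal_maps m n"
 shows "singular_pull m b (ord_simplex n a) = ord_simplex m (a \<circ> b)"
 by (rule ext) (auto simp: singular_pull_def ord_simplex_def simplex_push_compose[OF assms]
   simplex_push_in_simplex[OF assms])

lemma face_closed_ord_simplices: "face_closed (simplex_top k) (ord_simplices k)" unfolding face_closed_def
proof (intro conjI allI impI)
 show "ord_simplices k n \<subseteq> singular_simplex_set n (simplex_top k)" for n
  by (auto simp: ord_simplices_def singular_simplex_ord_simplex)
 fix n s i assume "s \<in> ord_simplices k (Suc n)" "i \<le> Suc n"
 then obtain a where a: "a \<in> ordinal_maps (Suc n) k" "s = ord_simplex (Suc n) a" "i \<le> Suc n"
  by (auto simp: ord_simplices_def)
 hence "singular_face (Suc n) i s = ord_simplex n (a \<circ> coface i)"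
  by (simp add: singular_face_eq_singular_pull singular_pull_ord_simplex[OF coface_in_ordinal_maps])
 moreover have "a \<circ> coface i \<in> ordinal_maps n k" by (rule ordinal_maps_compose[OF coface_in_ordinal_maps a(1)])
 ultimately show "singular_face (Suc n) i s \<in> ord_simplices k n" by (simp add: ord_simplices_def)
qed

lemma ord_simplex_in_boundary_iff:
 assumes a: "a \<in> ordinal_maps n k"
 shows "ord_simplex n a ` \<Delta> n \<subseteq> simplex_boundary k \<longleftrightarrow> a ` {..n} \<noteq> {..k}"
proof
 assume sub: "ord_simplex n a ` \<Delta> n \<subseteq> simplex_boundary k"
 show "a ` {..n} \<noteq> {..k}"
 proof
  assume surj: "a ` {..n} = {..k}"
  obtain b where b: "b \<in> \<Delta> n" "simplex_min n b > 0" by (rule standard_simplex_interior)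
  hence "simplex_min k (simplex_push n a b) > 0" by (intro simplex_push_interior[OF a surj])
  thus False using sub b(1) by (auto simp: ord_simplex_def simplex_boundary_def image_subset_iff)
 qed
next
 assume "a ` {..n} \<noteq> {..k}"
 moreover have "a ` {..n} \<subseteq> {..k}" using ordinal_maps_le[OF a] by auto
 ultimately obtain i where "i \<le> k" "i \<notin> a ` {..n}" by auto
 thus "ord_simplex n a ` \<Delta> n \<subseteq> simplex_boundary k"
  using simplex_push_boundary[OF a] simplex_push_in_simplex[OF a] by (auto simp: ord_simplex_def simplex_boundary_def)
qed

lemma face_closed_union:
 assumes "face_closed X T" "face_closed X U"
 shows "face_closed X (\<lambda>n. T n \<union> U n)" using assms unfolding face_closed_def by blast

lemma face_closed_singular:
 "face_closed X (\<lambda>n. singular_simplex_set n (subtopology X R))" unfolding face_closed_def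
proof (intro conjI allI impI)
 show "singular_simplex_set n (subtopology X R) \<subseteq> singular_simplex_set n X" for n
  by (auto simp: singular_simplex_subtopology)
 fix n s i assume "s \<in> singular_simplex_set (Suc n) (subtopology X R)" "i \<le> Suc n"
 thus "singular_face (Suc n) i s \<in> singular_simplex_set n (subtopology X R)"
  using singular_simplex_singular_face[of "Suc n" "subtopology X R" s i] by simp
qed

definition cell_simplex :: "nat => 'i => (nat => nat) => (nat => real) => 'i \<times> (nat => real)" where
 "cell_simplex n i a = simplex_map n (Pair i) (ord_simplex n a)"

text \<open>Only surjective operators are listed: the remaining ordinal simplices lie in the
  boundary and are already among the singular simplices of the boundary.\<close>

definition cell_simplices :: "'i set => nat => nat => ((nat => real) => 'i \<times> (nat => real)) set" where
 "cell_simplices I k n = {cell_simplex n i a | i a. i \<in> I \<and> a \<in> ordinal_maps n k \<and> a ` {..n} = {..k}}"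

lemma simplex_map_Pair_boundary:
 assumes "i \<in> I" "singular_simplex n (sphere_topology k) s"
 shows "singular_simplex n (subtopology (cell_sum I k) (boundary_sum I k)) (simplex_map n (Pair i) s)"
proof (rule singular_simplex_simplex_map[OF assms(2)])
 show "continuous_map (sphere_topology k)
   (subtopology (cell_sum I k) (boundary_sum I k)) (Pair i)" unfolding continuous_map_in_subtopology
  using continuous_map_Pair_cell_sum[OF assms(1)] assms(1)
  by (auto simp: continuous_map_from_subtopology simplex_boundary_def boundary_sum_def)
qed

lemma simplex_map_Pair_ordered:
 assumes i: "i \<in> I" and s: "s \<in> ord_simplices k n \<union>
   singular_simplex_set n (sphere_topology k)"
 shows "simplex_map n (Pair i) s \<in> cell_simplices I k n \<union>
   singular_simplex_set n (subtopology (cell_sum I k) (boundary_sum I k))"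
 using s ord_simplex_in_boundary_iff singular_simplex_ord_simplex simplex_map_Pair_boundary[OF i] i
 by (fastforce simp: cell_simplices_def cell_simplex_def ord_simplices_def singular_simplex_subtopology)

lemma face_closed_cell_simplices:
 "face_closed (cell_sum I k) (\<lambda>n. cell_simplices I k n \<union>
   singular_simplex_set n (subtopology (cell_sum I k) (boundary_sum I k)))" unfolding face_closed_def
proof (intro conjI allI impI)
 show "cell_simplices I k n \<union> singular_simplex_set n (subtopology (cell_sum I k) (boundary_sum I k))
   \<subseteq> singular_simplex_set n (cell_sum I k)" for n
  using singular_simplex_simplex_map[OF singular_simplex_ord_simplex continuous_map_Pair_cell_sum]
  by (auto simp: cell_simplices_def cell_simplex_def singular_simplex_subtopology)
 fix n s i assume s: "s \<in> cell_simplices I k (Suc n) \<union>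
   singular_simplex_set (Suc n) (subtopology (cell_sum I k) (boundary_sum I k))" and i: "i \<le> Suc n"
 then consider "s \<in> singular_simplex_set (Suc n) (subtopology (cell_sum I k) (boundary_sum I k))"
  | j a where "j \<in> I" "a \<in> ordinal_maps (Suc n) k" "s = simplex_map (Suc n) (Pair j) (ord_simplex (Suc n) a)"
  unfolding cell_simplices_def cell_simplex_def by blast
 thus "singular_face (Suc n) i s \<in> cell_simplices I k n \<union>
   singular_simplex_set n (subtopology (cell_sum I k) (boundary_sum I k))"
 proof cases
  case 1
  thus ?thesis using face_closed_singular i unfolding face_closed_def by blast
 next
  case 2
  have "singular_face (Suc n) i (ord_simplex (Suc n) a) \<in> ord_simplices k n"
   using face_closed_ord_simplices 2(2) i unfolding face_closed_def ord_simplices_def by blast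
  moreover have "singular_face (Suc n) i s = simplex_map n (Pair j) (singular_face (Suc n) i (ord_simplex (Suc n) a))"
   unfolding 2(3) using simplical_face_in_standard_simplex[of "Suc n" i] i
   by (auto simp: singular_face_def simplex_map_def fun_eq_iff)
  ultimately show ?thesis using simplex_map_Pair_ordered[OF 2(1)] by simp
 qed
qed

text \<open>A simplex is connected, so its projection to the discrete index set is constant.\<close>

lemma singular_simplex_cell_sum:
 assumes s: "singular_simplex n (cell_sum I k) s"
 obtains i s' where "i \<in> I" "singular_simplex n (simplex_top k) s'" "s = simplex_map n (Pair i) s'"
proof -
 have cont: "continuous_map (simplex_top n) (cell_sum I k) s"
  and ext: "s \<in> extensional (\<Delta> n)" using s by (auto simp: singular_simplex_def)
 have c1: "continuous_map (simplex_top n) (discrete_topology I) (fst \<circ> s)"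
  and c2: "continuous_map (simplex_top n) (simplex_top k) (snd \<circ> s)" using cont unfolding cell_sum_def
  by (auto intro: continuous_map_compose continuous_map_fst continuous_map_snd)
 have "connectedin (discrete_topology I) ((fst \<circ> s) ` \<Delta> n)" by (rule connectedin_continuous_map_image[OF c1])
   (simp add: connectedin_subtopology connectedin_standard_simplex)
 hence sub: "(fst \<circ> s) ` \<Delta> n \<subseteq> I" "\<exists>i. (fst \<circ> s) ` \<Delta> n \<subseteq> {i}"
  by (auto simp: connectedin_discrete_topology)
 then obtain i where i': "(fst \<circ> s) ` \<Delta> n \<subseteq> {i}" by blast
 have i: "\<And>t. t \<in> \<Delta> n ==> fst (s t) = i" "i \<in> I"
  using i' sub(1) nonempty_standard_simplex[of n] by auto
 show ?thesis
 proof (rule that[OF i(2)])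
  show "singular_simplex n (simplex_top k) (restrict (snd \<circ> s) (\<Delta> n))"
   using c2 by (auto simp: singular_simplex_def intro: continuous_map_eq)
  show "s = simplex_map n (Pair i) (restrict (snd \<circ> s) (\<Delta> n))"
  proof
   fix t
   show "s t = simplex_map n (Pair i) (restrict (snd \<circ> s) (\<Delta> n)) t"
    using i(1)[of t] ext by (cases "t \<in> \<Delta> n") (auto simp: simplex_map_def extensional_def prod_eq_iff)
  qed
 qed
qed

text \<open>One contraction for a single simplex is copied into every summand; naturality of
  boundaries under the inclusions gives the remainder condition.\<close>

lemma acyclic_modulo_cell_simplices:
 assumes "acyclic_modulo (simplex_top k) (\<lambda>n. ord_simplices k n \<union>
   singular_simplex_set n (sphere_topology k))"
 shows "acyclic_modulo (cell_sum I k) (\<lambda>n. cell_simplices I k n \<union>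
   singular_simplex_set n (subtopology (cell_sum I k) (boundary_sum I k)))"
  (is "acyclic_modulo ?D ?T")
proof -
 let ?S = "\<lambda>n. ord_simplices k n \<union>
   singular_simplex_set n (sphere_topology k)"
 have fcS: "face_closed (simplex_top k) ?S" by (intro face_closed_union face_closed_ord_simplices face_closed_singular)
 obtain h where h0: "\<And>n s. s \<in> ?S n ==> h n s = 0"
  and hs: "\<And>n s. singular_simplex n (simplex_top k) s ==> singular_chain (Suc n) (simplex_top k) (h n s)"
  and hb: "\<And>n c. singular_chain n (simplex_top k) c ==>
      keys (chain_remainder h n c) \<subseteq> ?S n" using acyclic_modulo_chain_contraction[OF fcS assms] by blast
 \<comment> \<open>Any point of the simplex would do: the first component of a singular simplex of
   the sum is constant, and its value at this vertex names the summand.\<close>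
 let ?v = "\<lambda>j. if j = (0::nat) then 1 else (0::real)"
 define H where "H = (\<lambda>n (s :: (nat => real) => 'a \<times> (nat => real)).
   chain_map (Suc n) (Pair (fst (s ?v))) (h n (restrict (snd \<circ> s) (\<Delta> n))))"
 have H_eq: "H n (simplex_map n (Pair i) s) = chain_map (Suc n) (Pair i) (h n s)"
  if "singular_simplex n (simplex_top k) s" for n i s
 proof -
  have "restrict (snd \<circ> simplex_map n (Pair i) s) (\<Delta> n) = s"
   using that by (auto simp: simplex_map_def singular_simplex_def extensional_def fun_eq_iff)
  moreover have "fst (simplex_map n (Pair i) s ?v) = i" by (simp add: simplex_map_def)
  ultimately show ?thesis by (simp add: H_def)
 qed
 have H_ext: "frag_extend (H n) (chain_map n (Pair i) c) = chain_map (Suc n) (Pair i) (frag_extend (h n) c)"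
  if "singular_chain n (simplex_top k) c" for n i c using that unfolding singular_chain_def
 proof (induction c rule: frag_induction)
  case (one x)
  thus ?case using H_eq by simp
 qed (simp_all add: chain_map_diff frag_extend_diff)
 have PT: "keys (chain_map n (Pair i) c) \<subseteq> ?T n"
  if "i \<in> I" "keys c \<subseteq> ?S n" for n i c
 proof -
  have "simplex_map n (Pair i) s \<in> ?T n" if "s \<in> keys c" for s
   using simplex_map_Pair_ordered[OF \<open>i \<in> I\<close>] that \<open>keys c \<subseteq> ?S n\<close> by blast
  thus ?thesis unfolding chain_map_def by (intro keys_frag_extend_subset) auto
 qed
 show ?thesis
 proof (rule chain_contraction_acyclic_modulo[where h = H])
  fix n s assume s: "s \<in> ?T n"
  hence "singular_simplex n ?D s" using face_closed_cell_simplices unfolding face_closed_def by blast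
  then obtain i s' where i: "i \<in> I" "singular_simplex n (simplex_top k) s'" "s = simplex_map n (Pair i) s'"
   using singular_simplex_cell_sum by blast
  have "s' \<in> ?S n"
  proof (cases "s \<in> cell_simplices I k n")
   case True
   then obtain j f where j: "f \<in> ordinal_maps n k" "s = simplex_map n (Pair j) (ord_simplex n f)"
    by (auto simp: cell_simplices_def cell_simplex_def)
   have "s' t = ord_simplex n f t" for t
   proof (cases "t \<in> \<Delta> n")
    case t: True
    have "s t = (i, s' t)" unfolding i(3) using t by (simp add: simplex_map_def)
    moreover have "s t = (j, ord_simplex n f t)" unfolding j(2) using t by (simp add: simplex_map_def)
    ultimately show ?thesis by simp
   next
    case False
    thus ?thesis using i(2) by (simp add: singular_simplex_def extensional_def ord_simplex_def)
   qed
   hence "s' = ord_simplex n f" by (rule ext)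
   thus ?thesis using j(1) by (simp add: ord_simplices_def)
  next
   case False
   hence sb: "s ` \<Delta> n \<subseteq> boundary_sum I k" using s by (simp add: singular_simplex_subtopology)
   have "s' t \<in> simplex_boundary k" if t: "t \<in> \<Delta> n" for t
   proof -
    have "s t = (i, s' t)" using t i(3) by (simp add: simplex_map_def)
    moreover have "s t \<in> boundary_sum I k" using sb t by blast
    ultimately show ?thesis by (simp add: boundary_sum_def simplex_boundary_def)
   qed
   hence "singular_simplex n (sphere_topology k) s'" using i(2) by (auto simp: singular_simplex_subtopology)
   thus ?thesis by simp
  qed
  thus "H n s = 0" using H_eq[OF i(2)] i(3) h0 by simp
 next
  fix n s assume "singular_simplex n ?D s"
  then obtain i s' where i: "i \<in> I" "singular_simplex n (simplex_top k) s'" "s = simplex_map n (Pair i) s'"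
   using singular_simplex_cell_sum by blast
  show "singular_chain (Suc n) ?D (H n s)" unfolding i(3) H_eq[OF i(2)]
   by (rule singular_chain_chain_map[OF hs[OF i(2)] continuous_map_Pair_cell_sum[OF i(1)]])
  have c: "singular_chain n (simplex_top k) (frag_of s')" using i(2) by (simp add: singular_chain_of)
  have bc: "singular_chain (n - 1) (simplex_top k) (chain_boundary n (frag_of s'))" using singular_chain_boundary[OF c] by simp
  have e1: "chain_boundary (Suc n) (H n s) = chain_map n (Pair i) (chain_boundary (Suc n) (h n s'))"
   unfolding i(3) H_eq[OF i(2)] using chain_boundary_chain_map[OF hs[OF i(2)]] by simp
  have e2: "frag_extend (H (n - 1)) (chain_boundary n (frag_of s))
    = chain_map n (Pair i) (frag_extend (h (n - 1)) (chain_boundary n (frag_of s')))"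
  proof (cases n)
   case (Suc m)
   have "chain_boundary n (frag_of s) = chain_map m (Pair i) (chain_boundary n (frag_of s'))"
    using chain_boundary_chain_map[OF c, of "Pair i"] Suc by (simp add: i(3))
   thus ?thesis using H_ext bc Suc by simp
  qed (simp add: chain_boundary_def)
  have "frag_of s - chain_boundary (Suc n) (H n s) - frag_extend (H (n - 1)) (chain_boundary n (frag_of s))
   = chain_map n (Pair i) (frag_of s' - chain_boundary (Suc n) (frag_extend (h n) (frag_of s'))
                - frag_extend (h (n - 1)) (chain_boundary n (frag_of s')))"
   unfolding e1 e2 by (simp add: chain_map_diff i(3))
  thus "keys (frag_of s - chain_boundary (Suc n) (H n s)
    - frag_extend (H (n - 1)) (chain_boundary n (frag_of s))) \<subseteq> ?T n" using PT[OF i(1) hb[OF c]] by (simp only:)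
 qed
qed

section \<open>Induction over the skeleta\<close>

context simplicial_cells
begin

text \<open>Taking every singular simplex of \<open>A\<close> makes the family face-closed, since a
  face of a simplex in \<open>S\<close> is again in \<open>S\<close> or lies in \<open>A\<close>;
  relative cochains vanish on the added simplices.\<close>

definition simplex_family :: "nat => ((nat => real) => 'a) set" where
 "simplex_family n = S n \<union> singular_simplex_set n (subtopology X A)"

lemma simplex_family_singular: "s \<in> simplex_family n ==> singular_simplex n X s"
 using singular by (auto simp: simplex_family_def singular_simplex_subtopology)

lemma face_closed_simplex_family: "face_closed X simplex_family" unfolding face_closed_def
proof (intro conjI allI impI)
 show "simplex_family n \<subseteq> singular_simplex_set n X" for n using simplex_family_singular by blast
 fix n s i assume s: "s \<in> simplex_family (Suc n)" and i: "i \<le> Suc n"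
 show "singular_face (Suc n) i s \<in> simplex_family n"
 proof (cases "s \<in> S (Suc n)")
  case True
  have "singular_simplex n X (singular_face (Suc n) i s)" using singular_simplex_singular_face[OF singular[OF True] _ i] by simp
  thus ?thesis using pull[OF True coface_in_ordinal_maps, of i] i
   by (auto simp: simplex_family_def singular_face_eq_singular_pull singular_simplex_subtopology)
 next
  case False
  hence "s \<in> singular_simplex_set (Suc n) (subtopology X A)" using s by (simp add: simplex_family_def)
  thus ?thesis using face_closed_singular[of X A] i unfolding face_closed_def simplex_family_def by blast
 qed
qed

lemma face_closed_subtopology:
 assumes "face_closed X T"
 shows "face_closed (subtopology X R) (\<lambda>n. T n \<inter> singular_simplex_set n (subtopology X R))"
 using assms singular_simplex_singular_face[of "Suc n" "subtopology X R" for n]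
 unfolding face_closed_def by (auto simp: singular_simplex_singular_face)

abbreviation (input) skeleton_family :: "nat => nat => ((nat => real) => 'a) set" where
 "skeleton_family k n \<equiv> simplex_family n \<inter> singular_simplex_set n (subtopology X (skeleton k))"

lemma simplex_map_ord_simplex:
 "simplex_map n (\<lambda>(e, t). e t) (cell_simplex n e a) = singular_pull n a e"
 by (rule ext) (simp add: cell_simplex_def simplex_map_def ord_simplex_def singular_pull_def)

lemma pull_interior:
 assumes "a \<in> ordinal_maps n k" "a ` {..n} = {..k}"
 obtains t where "t \<in> \<Delta> n" "simplex_min k (simplex_push n a t) > 0"
proof -
 obtain b where b: "b \<in> \<Delta> n" "simplex_min n b > 0" by (rule standard_simplex_interior)
 thus ?thesis using that[OF b(1)] simplex_push_interior[OF assms b] by simp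
qed

lemma pull_cell_notin_skeleton:
 assumes e: "e \<in> N k" and a: "a \<in> ordinal_maps n k" "a ` {..n} = {..k}" and j: "j \<le> k"
 shows "\<not> singular_pull n a e ` \<Delta> n \<subseteq> skeleton j"
proof -
 obtain t where t: "t \<in> \<Delta> n" "simplex_min k (simplex_push n a t) > 0" using pull_interior[OF a] .
 hence "e (simplex_push n a t) \<notin> skeleton j"
  using interior_notin_skeleton[OF e simplex_push_in_simplex[OF a(1)] _ j] by blast
 thus ?thesis using t(1) by (auto simp: singular_pull_def image_subset_iff)
qed

text \<open>The normal form rests on a nondegenerate cell of some dimension \<open>m\<close>. If
  \<open>m < k\<close> the simplex lies in \<open>skeleton k\<close>; if \<open>m > k\<close> its
  interior leaves \<open>skeleton (Suc k)\<close>. Only \<open>m = k\<close> remains.\<close>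

lemma simplex_family_skeleton_Suc:
 assumes "s \<in> skeleton_family (Suc k) n"
 shows "s \<in> simplex_map n (\<lambda>(e, t). e t) ` cell_simplices (N k) k n
   \<or> singular_simplex n (subtopology X (skeleton k)) s"
proof (cases "s ` \<Delta> n \<subseteq> skeleton k")
 case True
 thus ?thesis using assms simplex_family_singular by (auto simp: singular_simplex_subtopology)
next
 case False
 hence nA: "\<not> s ` \<Delta> n \<subseteq> A" by (auto simp: skeleton_def)
 hence "s \<in> S n" using assms by (auto simp: simplex_family_def singular_simplex_subtopology)
 then obtain m e a where m: "e \<in> N m" "a \<in> ordinal_maps n m" "a ` {..n} = {..m}" "s = singular_pull n a e"
  using normal_form nA unfolding normal_form_def by blast
 have "s ` \<Delta> n \<subseteq> skeleton (Suc m)"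
  using m simplex_push_in_simplex[OF m(2)] by (auto simp: singular_pull_apply skeleton_Suc)
 hence "\<not> Suc m \<le> k" using False skeleton_mono[of "Suc m" k] by blast
 moreover have "\<not> Suc k \<le> m"
  using pull_cell_notin_skeleton[OF m(1-3)] m(4) assms by (auto simp: singular_simplex_subtopology)
 ultimately have "m = k" by simp
 hence "cell_simplex n e a \<in> cell_simplices (N k) k n" using m by (auto simp: cell_simplices_def)
 moreover have "s = simplex_map n (\<lambda>(e, t). e t) (cell_simplex n e a)"
  unfolding m(4) by (rule simplex_map_ord_simplex[symmetric])
 ultimately show ?thesis by blast
qed

text \<open>Uniqueness half of the Eilenberg-Zilber lemma: an interior point determines the cell and
  its pushed coordinates, and a suitably weighted interior point then reveals the operator.\<close>

lemma inj_on_cell_simplices: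
 "inj_on (simplex_map n (\<lambda>(e, t). e t)) (cell_simplices (N k) k n)"
proof (rule inj_onI)
 fix x y assume "x \<in> cell_simplices (N k) k n" "y \<in> cell_simplices (N k) k n"
  and eq: "simplex_map n (\<lambda>(e, t). e t) x = simplex_map n (\<lambda>(e, t). e t) y"
 then obtain e a e' a' where x: "e \<in> N k" "a \<in> ordinal_maps n k" "a ` {..n} = {..k}" "x = cell_simplex n e a"
  and y: "e' \<in> N k" "a' \<in> ordinal_maps n k" "a' ` {..n} = {..k}" "y = cell_simplex n e' a'"
  unfolding cell_simplices_def by blast
 have eq': "singular_pull n a e = singular_pull n a' e'" using eq by (simp add: x y simplex_map_ord_simplex)
 have int: "e = e' \<and> simplex_push n a t = simplex_push n a' t"
  if t: "t \<in> \<Delta> n" "simplex_min n t > 0" for t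
 proof -
  have "e (simplex_push n a t) = e' (simplex_push n a' t)" using fun_cong[OF eq', of t] t(1) by (simp add: singular_pull_def)
  thus ?thesis using interior_inj[OF x(1) y(1) simplex_push_in_simplex[OF x(2) t(1)] simplex_push_interior[OF x(2,3) t]
    simplex_push_in_simplex[OF y(2) t(1)] simplex_push_interior[OF y(2,3) t]] by blast
 qed
 have e: "e = e'"
 proof -
  obtain w where "w \<in> \<Delta> n" "simplex_min n w > 0" by (rule standard_simplex_interior)
  thus ?thesis using int by blast
 qed
 have "a i = a' i" if i: "i \<le> n" for i
 proof (rule ccontr)
  assume ne: "a i \<noteq> a' i"
  \<comment> \<open>Weight \<open>c\<close> on every vertex uses up one half of the total and keeps
    the point interior; the other half goes to vertex \<open>i\<close>. The coordinate receiving
    vertex \<open>i\<close> then exceeds 1/2, so it cannot be reached without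
    \<open>i\<close>.\<close>
  define c where "c = 1 / (2 * real (Suc n))"
  have c: "c > 0" "real (Suc n) * c = 1 / 2" by (simp_all add: c_def field_simps)
  let ?t = "\<lambda>j. if j \<le> n then c + (if j = i then 1 / 2 else 0) else 0"
  have sm: "(\<Sum>j\<le>n. ?t j) = 1"
  proof -
   have "(\<Sum>j\<le>n. ?t j) = (\<Sum>j\<le>n. c) + (\<Sum>j\<le>n. if j = i then 1 / 2 else 0)"
    unfolding sum.distrib[symmetric] by (intro sum.cong) auto
   thus ?thesis using i c(2) by simp
  qed
  have t: "?t \<in> \<Delta> n"
   unfolding standard_simplex_def using sm c(1) member_le_sum[of _ "{..n}" ?t] by (auto split: if_splits)
  have "simplex_min n ?t > 0" using simplex_min_pos_iff[OF t] c(1) by simp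
  hence eqp: "simplex_push n a ?t (a i) = simplex_push n a' ?t (a i)" using int[OF t] by simp
  have "?t i \<le> simplex_push n a ?t (a i)" unfolding simplex_push_def using i c(1) by (intro member_le_sum) auto
  moreover have "simplex_push n a' ?t (a i) \<le> sum ?t ({..n} - {i})"
   unfolding simplex_push_def using ne c(1) by (intro sum_mono2) auto
  moreover have "sum ?t ({..n} - {i}) = 1 - ?t i" using sm sum_diff1[of "{..n}" ?t i] i by simp
  moreover have "?t i > 1 / 2" using i c(1) by simp
  ultimately show False using eqp by linarith
 qed
 hence "ord_simplex n a = ord_simplex n a'"
  unfolding ord_simplex_def using simplex_push_cong[of n a a'] by (simp add: fun_eq_iff restrict_def)
 thus "x = y" using e by (simp add: x y cell_simplex_def)
qed

text \<open>The open cells are handled by transferring acyclicity along the attaching isomorphism,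
  which gives acyclicity modulo the family together with all simplices of \<open>skeleton k\<close>;
  the filtration lemma then removes the latter.\<close>

lemma acyclic_skeleton_step:
 assumes simplex: "acyclic_modulo (simplex_top k) (\<lambda>n. ord_simplices k n \<union>
   singular_simplex_set n (sphere_topology k))"
  and ac: "acyclic_modulo (subtopology X (skeleton k)) (skeleton_family k)"
 shows "acyclic_modulo (subtopology X (skeleton (Suc k))) (skeleton_family (Suc k))"
proof -
 interpret cell_attachment "subtopology X (skeleton (Suc k))" "skeleton k" "N k" k "\<lambda>e. e"
  by (rule cell_attachment_skeleton)
 let ?Y = "subtopology X (skeleton (Suc k))"
 have sub: "subtopology ?Y (skeleton k) = subtopology X (skeleton k)"
  using skeleton_mono[of k "Suc k"] by (simp add: subtopology_subtopology Int_absorb1)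
 have cm: "cells_map = (\<lambda>(e, t). e t)" by (simp add: cells_map_def)
 let ?T = "\<lambda>n. simplex_map n cells_map ` cell_simplices (N k) k n \<union> singular_simplex_set n (subtopology ?Y (skeleton k))"
 have T: "acyclic_modulo ?Y ?T"
 proof (rule acyclic_modulo_transfer[OF continuous_map_cells_map cells_map_boundaries iso_cells
    face_closed_cell_simplices acyclic_modulo_cell_simplices[OF simplex]])
  show "inj_on (simplex_map n cells_map) (cell_simplices (N k) k n)" for n unfolding cm by (rule inj_on_cell_simplices)
  fix n s assume "s \<in> cell_simplices (N k) k n"
  then obtain e a where "e \<in> N k" "a \<in> ordinal_maps n k" "a ` {..n} = {..k}" "s = cell_simplex n e a"
   unfolding cell_simplices_def by blast
  thus "\<not> singular_simplex n (subtopology ?Y (skeleton k)) (simplex_map n cells_map s)"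
   unfolding sub cm using pull_cell_notin_skeleton[of e k a n k]
   by (simp add: simplex_map_ord_simplex singular_simplex_subtopology)
 qed
 have eq: "?T n = skeleton_family (Suc k) n \<union> singular_simplex_set n (subtopology ?Y (skeleton k))" for n
 proof -
  have "s \<in> skeleton_family (Suc k) n \<union> singular_simplex_set n (subtopology ?Y (skeleton k))"
   if c: "s \<in> simplex_map n cells_map ` cell_simplices (N k) k n" for s
  proof -
   obtain e a where e: "e \<in> N k" "a \<in> ordinal_maps n k" "s = singular_pull n a e"
    using c unfolding cm cell_simplices_def by (auto simp: simplex_map_ord_simplex)
   have eS: "e \<in> S k" using e nondegenerate by blast
   have ss: "singular_simplex n X s" unfolding e(3) using singular_simplex_singular_pull[OF singular[OF eS] e(2)] .
   have "s ` \<Delta> n \<subseteq> skeleton (Suc k)"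
    using simplex_in_skeleton[OF eS] simplex_push_in_simplex[OF e(2)] by (auto simp: e(3) singular_pull_apply)
   moreover have "s \<in> simplex_family n"
    using pull[OF eS e(2)] ss by (auto simp: e(3) simplex_family_def singular_simplex_subtopology)
   ultimately show ?thesis using ss by (simp add: singular_simplex_subtopology)
  qed
  moreover have "s \<in> ?T n" if "s \<in> skeleton_family (Suc k) n" for s
   using simplex_family_skeleton_Suc[OF that] unfolding sub cm by blast
  ultimately show ?thesis by blast
 qed
 show ?thesis
 proof (rule acyclic_modulo_filtration[where R = "skeleton k"])
  show "face_closed ?Y (skeleton_family (Suc k))" by (rule face_closed_subtopology[OF face_closed_simplex_family])
  show "acyclic_modulo ?Y (\<lambda>n. skeleton_family (Suc k) n \<union> singular_simplex_set n (subtopology ?Y (skeleton k)))"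
   using T unfolding eq .
  have "skeleton_family (Suc k) n \<inter> singular_simplex_set n (subtopology ?Y (skeleton k)) = skeleton_family k n" for n
  proof -
   have "singular_simplex_set n (subtopology X (skeleton k)) \<subseteq> singular_simplex_set n (subtopology X (skeleton (Suc k)))"
    using skeleton_mono[of k "Suc k"] singular_simplex_mono[of n X "skeleton k" _ "skeleton (Suc k)"] by auto
   thus ?thesis unfolding sub by blast
  qed
  thus "acyclic_modulo (subtopology ?Y (skeleton k))
    (\<lambda>n. skeleton_family (Suc k) n \<inter> singular_simplex_set n (subtopology ?Y (skeleton k)))"
   unfolding sub using ac by simp
 qed
qed

text \<open>Only dimensions below \<open>k\<close> occur in the hypothesis. This permits applying
  the statement to the boundary of a \<open>k\<close>-simplex inside the induction that establishes
  the hypothesis.\<close>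

lemma acyclic_skeleton:
 assumes "\<And>j. j < k ==> acyclic_modulo (simplex_top j) (\<lambda>n. ord_simplices j n \<union>
   singular_simplex_set n (sphere_topology j))"
 shows "acyclic_modulo (subtopology X (skeleton k)) (skeleton_family k)" using assms
proof (induction k)
 case 0
 have "skeleton_family 0 n = singular_simplex_set n (subtopology X A)" for n by (auto simp: skeleton_0 simplex_family_def)
 thus ?case unfolding acyclic_modulo_def skeleton_0 by (auto intro!: exI[of _ 0] simp: singular_chain_def)
next
 case (Suc k)
 thus ?case using acyclic_skeleton_step by simp
qed

text \<open>A singular chain has compact support, hence lies in some skeleton.\<close>

lemma acyclic_simplex_family:
 assumes "\<And>j. acyclic_modulo (simplex_top j) (\<lambda>n. ord_simplices j n \<union>
   singular_simplex_set n (sphere_topology j))"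
 shows "acyclic_modulo X simplex_family" unfolding acyclic_modulo_def
proof (intro allI impI)
 fix n c assume c: "singular_chain n X c" and bc: "keys (chain_boundary n c) \<subseteq> simplex_family (n - 1)"
 have "\<exists>k. s ` \<Delta> n \<subseteq> skeleton k" if "s \<in> keys c" for s
 proof -
  have "continuous_map (simplex_top n) X s" using c that by (auto simp: singular_chain_def singular_simplex_def)
  moreover have "compactin (simplex_top n) (\<Delta> n)" by (simp add: compactin_subtopology compactin_standard_simplex)
  ultimately show ?thesis using compactin_skeleton image_compactin by metis
 qed
 then obtain f where f: "\<And>s. s \<in> keys c ==> s ` \<Delta> n \<subseteq> skeleton (f s)" by metis
 define k where "k = Max (insert 0 (f ` keys c))"
 have "s ` \<Delta> n \<subseteq> skeleton k" if "s \<in> keys c" for s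
 proof -
  have "f s \<le> k" unfolding k_def using that by (intro Max_ge) auto
  thus ?thesis using f[OF that] skeleton_mono by blast
 qed
 hence ck: "singular_chain n (subtopology X (skeleton k)) c" using c by (simp add: singular_chain_subtopology)
 hence "keys (chain_boundary n c) \<subseteq> skeleton_family k (n - 1)"
  using bc singular_chain_boundary[OF ck] by (simp add: singular_chain_def)
 then obtain b where b: "singular_chain (Suc n) (subtopology X (skeleton k)) b"
  "keys (c - chain_boundary (Suc n) b) \<subseteq> skeleton_family k n"
  using acyclic_skeleton[of k] assms ck unfolding acyclic_modulo_def by meson
 thus "\<exists>b. singular_chain (Suc n) X b \<and> keys (c - chain_boundary (Suc n) b) \<subseteq> simplex_family n"
  using singular_chain_from_subtopology[OF b(1)] by (intro exI[of _ b]) auto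
qed

end

section \<open>A standard simplex is acyclic modulo its ordinal simplices and boundary\<close>

lemma ord_simplex_eq_oriented_simplex:
 "ord_simplex n f = oriented_simplex n (\<lambda>j i. if i = f j then 1 else 0)"
proof -
 have "simplex_push n f x i = (\<Sum>j\<le>n. (if i = f j then 1 else 0) * x j)" for x :: "nat => real" and i
 proof -
  have "simplex_push n f x i = (\<Sum>j\<in>{..n} \<inter> {j. i = f j}. x j)"
   unfolding simplex_push_def by (rule sum.cong) auto
  also have "\<dots> = (\<Sum>j\<le>n. if i = f j then x j else 0)" by (simp add: sum.inter_restrict)
  finally show ?thesis by (simp add: if_distrib[of "\<lambda>a. a * _"] cong: if_cong)
 qed
 thus ?thesis by (simp add: ord_simplex_def oriented_simplex_def restrict_def fun_eq_iff)
qed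

lemma ord_simplex_cong:
 "(\<And>i. i \<le> n ==> a i = b i) ==> ord_simplex n a = ord_simplex n b"
 unfolding ord_simplex_def by (intro restrict_ext simplex_push_cong) auto

text \<open>The apex is vertex 0 because prepending the least vertex keeps the list of vertices
  weakly increasing.\<close>

lemma simplex_cone_ord_simplices:
 assumes "s \<in> ord_simplices k n"
 shows "simplex_cone n (\<lambda>i. if i = 0 then 1 else 0) s \<in> ord_simplices k (Suc n)"
proof -
 obtain a where a: "a \<in> ordinal_maps n k" "s = ord_simplex n a" using assms by (auto simp: ord_simplices_def)
 let ?a = "\<lambda>j. if j = 0 then 0 else a (j - 1)"
 have "?a \<in> ordinal_maps (Suc n) k" using ordinal_maps_le[OF a(1)] ordinal_maps_mono[OF a(1)] by (intro ordinal_mapsI) auto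
 moreover have "simplex_cone n (\<lambda>i. if i = 0 then 1 else 0) s = ord_simplex (Suc n) ?a"
  unfolding a(2) ord_simplex_eq_oriented_simplex simplex_cone unfolding oriented_simplex_eq by auto
 ultimately show ?thesis by (simp add: ord_simplices_def)
qed

lemma homotopic_simplex_vertex:
 "homotopic_with (\<lambda>h. h \<in> {} \<rightarrow> {}) (simplex_top k) (simplex_top k) id (\<lambda>_ i. if i = 0 then 1 else 0)"
proof -
 let ?v = "\<lambda>i::nat. if i = 0 then 1 else (0::real)"
 let ?P = "prod_topology (top_of_set {0..1::real}) (simplex_top k)"
 let ?h = "\<lambda>(u, t) i. (1 - u) * t i + u * ?v i"
 have fst: "continuous_map ?P euclideanreal fst" by (rule continuous_map_into_fulltopology[OF continuous_map_fst])
 have proj: "continuous_map ?P euclideanreal (\<lambda>x. snd x i)" for i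
 proof -
  have "continuous_map (simplex_top k) euclideanreal (\<lambda>t. t i)"
   using continuous_map_product_projection[of i UNIV "\<lambda>_. euclideanreal"]
   by (intro continuous_map_from_subtopology) simp
  thus ?thesis using continuous_map_compose[OF continuous_map_snd] by (simp add: o_def)
 qed
 have "continuous_map ?P euclideanreal (\<lambda>x. (1 - fst x) * snd x i + fst x * ?v i)" for i
  using fst proj by (intro continuous_map_add continuous_map_real_mult continuous_map_diff) auto
 hence "continuous_map ?P (powertop_real UNIV) ?h" by (simp add: continuous_map_componentwise_UNIV case_prod_unfold)
 moreover have "?h (u, t) \<in> \<Delta> k" if "u \<in> {0..1}" "t \<in> \<Delta> k" for u t
  using convex_standard_simplex[of t k ?v u] that by simp
 ultimately have "continuous_map ?P (simplex_top k) ?h" unfolding continuous_map_in_subtopology by auto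
 thus ?thesis unfolding homotopic_with_def by (intro exI[of _ ?h]) (auto simp: fun_eq_iff)
qed

text \<open>The cone from vertex 0 fills the boundary of \<open>c\<close> by an ordinal chain
  \<open>y\<close>. The cycle \<open>c - y\<close> is homologous, by contracting the simplex, to its
  image under the constant map, and constant simplices at vertex 0 are ordinal simplices
  themselves.\<close>

lemma acyclic_ord_simplices: "acyclic_modulo (simplex_top k) (ord_simplices k)" unfolding acyclic_modulo_def
proof (intro allI impI)
 fix n c assume c: "singular_chain n (simplex_top k) c"
  and bc: "keys (chain_boundary n c) \<subseteq> ord_simplices k (n - 1)"
 let ?v = "\<lambda>i::nat. if i = 0 then 1 else (0::real)"
 let ?const = "\<lambda>_ :: nat => real. ?v"
 have cmap: "continuous_map (simplex_top k) (simplex_top k) ?const" by simp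
 have "\<exists>y. keys y \<subseteq> ord_simplices k n \<and> chain_boundary n y = chain_boundary n c"
 proof (cases n)
  case 0
  thus ?thesis by (intro exI[of _ 0]) (simp add: chain_boundary_def)
 next
  case (Suc m)
  let ?s = "chain_boundary n c"
  let ?y = "simplicial_cone m ?v ?s"
  have s: "keys ?s \<subseteq> ord_simplices k m" using bc Suc by simp
  have "simplicial_simplex m (\<Delta> k) x" if x: "x \<in> ord_simplices k m" for x unfolding simplicial_simplex
  proof
   obtain a where a: "a \<in> ordinal_maps m k" "x = ord_simplex m a" using x by (auto simp: ord_simplices_def)
   thus "x ` \<Delta> m \<subseteq> \<Delta> k" using simplex_push_in_simplex[OF a(1)] by (auto simp: ord_simplex_def)
   show "\<exists>l. x = oriented_simplex m l" using a ord_simplex_eq_oriented_simplex by metis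
  qed
  hence simp: "simplicial_chain m (\<Delta> k) ?s" using s unfolding simplicial_chain_def by blast
  have y: "keys ?y \<subseteq> ord_simplices k n" unfolding simplicial_cone_def Suc
   using s[unfolded Suc] simplex_cone_ord_simplices[of _ k m] by (intro keys_frag_extend_subset) auto
  have bs: "chain_boundary m ?s = 0" using chain_boundary_boundary_alt[of m] c Suc by simp
  \<comment> \<open>Over a 0-chain the boundary of a cone has an extra multiple of the apex. The
    multiple is zero because \<open>?s\<close> is a boundary: both faces of a constant 1-simplex
    coincide.\<close>
  have "frag_extend (\<lambda>f. frag_of (\<lambda>u\<in>\<Delta> 0. ?v)) ?s = 0" if "m = 0"
  proof -
   have c1: "singular_chain 1 (simplex_top k) c" using c Suc that by simp
   have "frag_extend (\<lambda>f. frag_of (\<lambda>u\<in>\<Delta> 0. ?v)) ?s = chain_map 0 ?const ?s"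
    unfolding chain_map_def simplex_map_def by (simp add: o_def)
   also have "\<dots> = chain_boundary 1 (chain_map 1 ?const c)"
    using chain_boundary_chain_map[OF c1, of ?const] Suc that by simp
   also have "chain_map 1 ?const c = frag_extend (\<lambda>f. frag_of (\<lambda>u\<in>\<Delta> 1. ?v)) c"
    unfolding chain_map_def simplex_map_def by (simp add: o_def)
   also have "chain_boundary 1 \<dots> = 0"
   proof -
    have "singular_face 1 i (\<lambda>u\<in>\<Delta> 1. ?v) = (\<lambda>u\<in>\<Delta> 0. ?v)" if "i \<le> 1" for i
     using simplical_face_in_standard_simplex[of 1 i] that by (auto simp: singular_face_def fun_eq_iff)
    hence "chain_boundary 1 (frag_of (\<lambda>u\<in>\<Delta> 1. ?v)) = 0" unfolding chain_boundary_of by simp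
    thus ?thesis unfolding frag_extend_def by (simp add: chain_boundary_sum chain_boundary_cmul o_def)
   qed
   finally show ?thesis .
  qed
  hence "chain_boundary n ?y = ?s"
   using chain_boundary_simplicial_cone[OF simp, of ?v] bs Suc by (simp add: simplicial_cone_def)
  thus ?thesis using y by (intro exI[of _ ?y]) simp
 qed
 then obtain y where y: "keys y \<subseteq> ord_simplices k n" "chain_boundary n y = chain_boundary n c" by blast
 let ?z = "c - y"
 have z: "singular_relcycle n (simplex_top k) {} ?z" using c y face_closed_singular_chain[OF face_closed_ord_simplices y(1)]
  by (simp add: singular_cycle singular_chain_diff chain_boundary_diff)
 have "homologous_rel n (simplex_top k) {} (chain_map n id ?z) (chain_map n ?const ?z)"
  by (rule homotopic_imp_homologous_rel_chain_maps[OF homotopic_simplex_vertex z])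
 moreover have "chain_map n id ?z = ?z" using z chain_map_id_gen[of n "simplex_top k" ?z id] by (simp add: singular_cycle)
 ultimately obtain b where b: "singular_chain (Suc n) (simplex_top k) b"
  "chain_boundary (Suc n) b = ?z - chain_map n ?const ?z" unfolding homologous_rel_def singular_boundary by auto
 have "simplex_map n ?const s \<in> ord_simplices k n" for s
 proof -
  have "simplex_map n ?const s = ord_simplex n (\<lambda>_. 0)"
  proof
   fix t
   have "simplex_push n (\<lambda>_. 0) t = ?v" if "t \<in> \<Delta> n"
    using that by (auto simp: simplex_push_def standard_simplex_def fun_eq_iff atMost_def)
   thus "simplex_map n ?const s t = ord_simplex n (\<lambda>_. 0) t" by (simp add: simplex_map_def ord_simplex_def)
  qed
  moreover have "(\<lambda>_. 0) \<in> ordinal_maps n k" by (intro ordinal_mapsI) auto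
  ultimately show ?thesis by (simp add: ord_simplices_def)
 qed
 hence "keys (chain_map n ?const ?z) \<subseteq> ord_simplices k n"
  unfolding chain_map_def by (intro keys_frag_extend_subset) auto
 hence "keys (chain_map n ?const ?z + y) \<subseteq> ord_simplices k n" using y(1) by (rule keys_add_subset)
 moreover have "c - chain_boundary (Suc n) b = chain_map n ?const ?z + y" using b(2) by simp
 ultimately show "\<exists>b. singular_chain (Suc n) (simplex_top k) b \<and>
   keys (c - chain_boundary (Suc n) b) \<subseteq> ord_simplices k n" using b(1) by (intro exI[of _ b]) simp
qed

lemma strict_ordinal_maps_unique:
 assumes "a \<in> ordinal_maps n k" "inj_on a {..n}" "b \<in> ordinal_maps m k" "inj_on b {..m}"
  and im: "a ` {..n} = b ` {..m}"
 shows "n = m \<and> (\<forall>i\<le>n. a i = b i)"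
proof -
 have list: "sorted (map g [0..<Suc l]) \<and> distinct (map g [0..<Suc l]) \<and> set (map g [0..<Suc l]) = g ` {..l}"
  if "g \<in> ordinal_maps l k" "inj_on g {..l}" for g l
 proof -
  have "sorted (map g [0..<Suc l])" using ordinal_maps_mono[OF that(1)] by (auto simp: sorted_iff_nth_mono simp del: upt_Suc)
  moreover have "set [0..<Suc l] = {..l}" by (auto simp: atLeast0LessThan lessThan_Suc_atMost simp del: upt_Suc)
  ultimately show ?thesis using that(2) by (simp add: distinct_map del: upt_Suc)
 qed
 have "map a [0..<Suc n] = map b [0..<Suc m]"
  using list[OF assms(1,2)] list[OF assms(3,4)] im by (intro sorted_distinct_set_unique) auto
 moreover from this have "n = m" by (metis diff_zero length_map length_upt nat.inject)
 ultimately show ?thesis by (auto simp: map_eq_conv simp del: upt_Suc)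
qed

text \<open>Here \<open>A\<close> is empty; simplices are the non-surjective ordinal maps, and the
  nondegenerate ones are those that are also injective, one for each nonempty proper set of
  vertices.\<close>

lemma simplicial_cells_boundary:
 "simplicial_cells (sphere_topology k) {}
   (\<lambda>n. {ord_simplex n a | a. a \<in> ordinal_maps n k \<and> a ` {..n} \<noteq> {..k}})
   (\<lambda>n. {ord_simplex n a | a. a \<in> ordinal_maps n k \<and> a ` {..n} \<noteq> {..k} \<and> inj_on a {..n}})"
  (is "simplicial_cells ?X {} ?S ?N")
proof
 show "singular_simplex n ?X s" if "s \<in> ?S n" for n s
 proof -
  obtain a where a: "a \<in> ordinal_maps n k" "a ` {..n} \<noteq> {..k}" "s = ord_simplex n a"
   using \<open>s \<in> ?S n\<close> by blast
  thus ?thesis using ord_simplex_in_boundary_iff[OF a(1)] singular_simplex_ord_simplex[OF a(1)]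
   unfolding singular_simplex_subtopology[of n _ "simplex_boundary k"] by simp
 qed
 show "singular_pull m b s \<in> ?S m \<or> singular_pull m b s ` \<Delta> m \<subseteq> {}"
  if s: "s \<in> ?S n" and b: "b \<in> ordinal_maps m n" for m n s b
 proof -
  obtain a where a: "a \<in> ordinal_maps n k" "a ` {..n} \<noteq> {..k}" "s = ord_simplex n a" using s by blast
  have c: "a \<circ> b \<in> ordinal_maps m k" using ordinal_maps_compose[OF b a(1)] .
  have "(a \<circ> b) ` {..m} \<subseteq> a ` {..n}" using ordinal_maps_le[OF b] by auto
  moreover have "a ` {..n} \<subseteq> {..k}" using ordinal_maps_le[OF a(1)] by auto
  ultimately have "(a \<circ> b) ` {..m} \<noteq> {..k}" using a(2) by blast
  thus ?thesis using c unfolding a(3) singular_pull_ord_simplex[OF b] by blast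
 qed
 show "\<exists>m<n. \<exists>s'\<in>?S m. \<exists>b\<in>ordinal_maps n m. s = singular_pull n b s'" if s: "s \<in> ?S n" "s \<notin> ?N n" for n s
 proof -
  obtain a where a': "a \<in> ordinal_maps n k" "a ` {..n} \<noteq> {..k}" "s = ord_simplex n a" using s(1) by blast
  moreover from this have "\<not> inj_on a {..n}" using s(2) by blast
  ultimately have a: "a \<in> ordinal_maps n k" "a ` {..n} \<noteq> {..k}" "s = ord_simplex n a" "\<not> inj_on a {..n}"
   by simp_all
  obtain n' i where n': "n = Suc n'" "i \<le> n'" "\<And>j. j \<le> n ==> a j = a (coface (Suc i) (codegeneracy i j))"
   "a \<circ> coface (Suc i) \<in> ordinal_maps n' k" using ordinal_map_factors_codegeneracy[OF a(1,4)] by metis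
  have cd: "codegeneracy i \<in> ordinal_maps n n'" unfolding n'(1) by (rule codegeneracy_in_ordinal_maps[OF n'(2)])
  have "(a \<circ> coface (Suc i)) ` {..n'} \<subseteq> a ` {..n}"
   using ordinal_maps_le[OF coface_in_ordinal_maps, of _ n' "Suc i"] n'(1) by auto
  moreover have "a ` {..n} \<subseteq> {..k}" using ordinal_maps_le[OF a(1)] by auto
  ultimately have "(a \<circ> coface (Suc i)) ` {..n'} \<noteq> {..k}" using a(2) by blast
  hence "ord_simplex n' (a \<circ> coface (Suc i)) \<in> ?S n'" using n'(4) by blast
  moreover have "s = singular_pull n (codegeneracy i) (ord_simplex n' (a \<circ> coface (Suc i)))"
   unfolding singular_pull_ord_simplex[OF cd] a(3) by (rule ord_simplex_cong) (simp add: n'(3))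
  ultimately show ?thesis using cd n'(1) by blast
 qed
 show "n = m \<and> s = s' \<and> t = t'"
  if s: "s \<in> ?N n" "s' \<in> ?N m" and t: "t \<in> \<Delta> n" "0 < simplex_min n t"
   and t': "t' \<in> \<Delta> m" "0 < simplex_min m t'" and eq: "s t = s' t'" for s n s' m t t'
 proof -
  obtain a where a: "a \<in> ordinal_maps n k" "inj_on a {..n}" "s = ord_simplex n a"
   using s(1) unfolding mem_Collect_eq by (elim exE conjE) (rule that)
  obtain b where b: "b \<in> ordinal_maps m k" "inj_on b {..m}" "s' = ord_simplex m b"
   using s(2) unfolding mem_Collect_eq by (elim exE conjE) (rule that)
  \<comment> \<open>For an injective operator the coordinates can be read back; together with the
    support, which is the set of vertices of the face, this separates interior points.\<close>
  have val: "simplex_push l g u (g i) = u i" if "inj_on g {..l}" "i \<le> l" for l g u i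
  proof -
   have "{j. j \<le> l \<and> g j = g i} = {i}" using that by (auto dest: inj_onD)
   thus ?thesis by (simp add: simplex_push_def)
  qed
  have supp: "{j. simplex_push l g u j \<noteq> 0} = g ` {..l}"
   if "inj_on g {..l}" "u \<in> \<Delta> l" "0 < simplex_min l u" for l g u
  proof -
   have "simplex_push l g u j = 0" if "j \<notin> g ` {..l}" for j
   proof -
    have "{i. i \<le> l \<and> g i = j} = {}" using that by auto
    thus ?thesis unfolding simplex_push_def by (simp only: sum.empty)
   qed
   moreover have "simplex_push l g u (g i) \<noteq> 0" if "i \<le> l" for i
    using val[OF \<open>inj_on g {..l}\<close> that] simplex_min_pos_iff[OF \<open>u \<in> \<Delta> l\<close>]
     \<open>0 < simplex_min l u\<close> that by auto
   ultimately show ?thesis by blast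
  qed
  have pe: "simplex_push n a t = simplex_push m b t'" using eq t(1) t'(1) by (simp add: a(3) b(3) ord_simplex_def)
  have "a ` {..n} = b ` {..m}" using supp[OF a(2) t] supp[OF b(2) t'] pe by simp
  hence nm: "n = m" "\<And>i. i \<le> n ==> a i = b i" using strict_ordinal_maps_unique a b by blast+
  have "t i = t' i" for i
  proof (cases "i \<le> n")
   case True
   thus ?thesis using val[OF a(2) True, of t] val[OF b(2), of i t'] pe nm by simp
  next
   case False
   thus ?thesis using t(1) t'(1) nm(1) by (simp add: standard_simplex_def)
  qed
  moreover have "s = s'" unfolding a(3) b(3) nm(1)[symmetric] by (rule ord_simplex_cong) (rule nm(2))
  ultimately show ?thesis using nm(1) by blast
 qed
 have faces: "\<exists>n'. k = Suc n' \<and> (\<exists>i\<le>k. \<exists>t'\<in>\<Delta> n'. x = simplex_push n' (coface i) t')"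
  if x: "x \<in> simplex_boundary k" for x
  using boundary_in_face[of x k] x unfolding simplex_boundary_def by (metis (mono_tags, lifting) mem_Collect_eq)
 have face_S: "ord_simplex n' (coface i) \<in> ?S n'" if "k = Suc n'" "i \<le> k" for n' i
 proof -
  have "coface i \<in> ordinal_maps n' k" unfolding that(1) by (rule coface_in_ordinal_maps)
  moreover have "i \<notin> coface i ` {..n'}" by (auto simp: coface_def)
  ultimately show ?thesis using that(2) by blast
 qed
 show "\<exists>n. \<exists>s\<in>?S n. \<exists>t\<in>\<Delta> n. x = s t" if "x \<in> topspace ?X - {}" for x
 proof -
  have "x \<in> simplex_boundary k" using that by auto
  then obtain n' i t' where f: "k = Suc n'" "i \<le> k" "t' \<in> \<Delta> n'" "x = simplex_push n' (coface i) t'"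
   using faces by blast
  hence "x = ord_simplex n' (coface i) t'" by (simp add: ord_simplex_def)
  thus ?thesis using face_S[OF f(1,2)] f(3) by blast
 qed
 fix C assume C: "C \<subseteq> topspace ?X"
  and cl: "\<And>n s. s \<in> ?S n ==> closedin (simplex_top n) {t \<in> \<Delta> n. s t \<in> C}"
 have "closedin (simplex_top k) C"
 proof (cases k)
  case 0
  hence "simplex_boundary k = {}" using faces by auto
  hence "C = {}" using C by auto
  thus ?thesis by simp
 next
  case (Suc n')
  let ?F = "\<lambda>i. {t \<in> \<Delta> n'. ord_simplex n' (coface i) t \<in> C}"
  have co: "coface i \<in> ordinal_maps n' k" for i unfolding Suc by (rule coface_in_ordinal_maps)
  have "closed_map (simplex_top n') (simplex_top k) (simplex_push n' (coface i))" for i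
   by (rule continuous_imp_closed_map[OF continuous_map_simplex_push[OF co]])
    (simp_all add: compact_space_subtopology compactin_standard_simplex Hausdorff_space_subtopology
     Hausdorff_space_product_topology)
  hence "closedin (simplex_top k) (simplex_push n' (coface i) ` ?F i)" if "i \<le> k" for i
   using cl[OF face_S[OF Suc that]] unfolding closed_map_def by blast
  hence "closedin (simplex_top k) (\<Union>i\<in>{..k}. simplex_push n' (coface i) ` ?F i)" by (intro closedin_Union) auto
  also have "(\<Union>i\<in>{..k}. simplex_push n' (coface i) ` ?F i) = C"
  proof
   show "(\<Union>i\<in>{..k}. simplex_push n' (coface i) ` ?F i) \<subseteq> C" by (auto simp: ord_simplex_def)
   show "C \<subseteq> (\<Union>i\<in>{..k}. simplex_push n' (coface i) ` ?F i)"
   proof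
    fix x assume x: "x \<in> C"
    hence "x \<in> simplex_boundary k" using C by auto
    then obtain i t' where f: "i \<le> k" "t' \<in> \<Delta> n'" "x = simplex_push n' (coface i) t'" using faces Suc by blast
    hence "t' \<in> ?F i" using x by (simp add: ord_simplex_def)
    thus "x \<in> (\<Union>i\<in>{..k}. simplex_push n' (coface i) ` ?F i)" using f by blast
   qed
  qed
  finally show ?thesis .
 qed
 moreover have "C \<subseteq> simplex_boundary k" using C by auto
 ultimately show "closedin ?X C" by (metis closedin_subset_topspace)
qed auto

text \<open>The boundary has cells of dimension below \<open>k\<close> only, so the induction
  hypothesis makes it acyclic modulo its ordinal simplices. Combined with the acyclicity of the full
  simplex this gives the relative statement.\<close>

theorem acyclic_modulo_simplex_boundary:
 "acyclic_modulo (simplex_top k) (\<lambda>n. ord_simplices k n \<union>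
   singular_simplex_set n (sphere_topology k))"
proof (induction k rule: less_induct)
 case (less k)
 let ?X = "sphere_topology k"
 let ?S = "\<lambda>n. {ord_simplex n a | a. a \<in> ordinal_maps n k \<and> a ` {..n} \<noteq> {..k}}"
 let ?N = "\<lambda>n. {ord_simplex n a | a. a \<in> ordinal_maps n k \<and> a ` {..n} \<noteq> {..k} \<and> inj_on a {..n}}"
 interpret simplicial_cells ?X "{}" ?S ?N by (rule simplicial_cells_boundary)
 \<comment> \<open>An injective operator missing some vertex of \<open>{..k}\<close> has fewer than
   \<open>k + 1\<close> vertices, hence dimension below \<open>k\<close>: the filtration stops at
   stage \<open>k\<close>.\<close>
 have sub: "topspace ?X \<subseteq> skeleton k"
 proof
  fix x assume x: "x \<in> topspace ?X"
  obtain l where "x \<in> skeleton l" using cover_skeleton[OF x] .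
  then obtain j e t where j: "e \<in> ?N j" "t \<in> \<Delta> j" "x = e t" by (rule skeleton_point) auto
  obtain a where a: "a \<in> ordinal_maps j k" "a ` {..j} \<noteq> {..k}" "inj_on a {..j}"
   using j(1) unfolding mem_Collect_eq by (elim exE conjE) (rule that)
  have "a ` {..j} \<subset> {..k}" using a(2) ordinal_maps_le[OF a(1)] by auto
  hence "card (a ` {..j}) < card {..k}" by (intro psubset_card_mono) auto
  hence "j < k" using card_image[OF a(3)] by simp
  thus "x \<in> skeleton k" using j unfolding skeleton_def by blast
 qed
 hence sk: "subtopology ?X (skeleton k) = ?X" by (simp add: subtopology_superset)
 have fam: "simplex_family n \<inter> singular_simplex_set n ?X = ord_simplices k n \<inter> singular_simplex_set n ?X" for n
 proof -
  have "singular_simplex_set n (subtopology ?X {}) = {}" by (simp add: singular_simplex_empty)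
  moreover have "s \<in> ?S n" if "s \<in> ord_simplices k n" "singular_simplex n ?X s" for s
   using that ord_simplex_in_boundary_iff by (auto simp: ord_simplices_def singular_simplex_subtopology)
  ultimately show ?thesis unfolding simplex_family_def by (auto simp: ord_simplices_def)
 qed
 have "acyclic_modulo ?X (\<lambda>n. ord_simplices k n \<inter> singular_simplex_set n ?X)"
  using acyclic_skeleton[of k, OF less.IH] unfolding sk fam by simp
 thus ?case by (rule acyclic_modulo_union[OF face_closed_ord_simplices acyclic_ord_simplices])
qed

theorem (in simplicial_cells) acyclic_modulo_simplex_family: "acyclic_modulo X simplex_family"
 by (rule acyclic_simplex_family) (rule acyclic_modulo_simplex_boundary)

section \<open>Realizations and the orbit space\<close>

text \<open>Points of a generated quotient are told apart by functions constant on generating pairs;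
  every injectivity statement about cells rests on this.\<close>

lemma generated_equiv_invariant:
 assumes inv: "\<And>x y. [|(x, y) \<in> r; x \<in> A; y \<in> A|] ==> f x = f y"
  and xy: "(x, y) \<in> generated_equiv A r"
 shows "f x = f y"
proof -
 let ?s = "r \<inter> A \<times> A"
 have "(x, y) \<in> (?s \<union> ?s\<inverse>)\<^sup>*" using xy by (simp add: generated_equiv_def Let_def)
 thus ?thesis
 proof (induction rule: rtrancl_induct)
  case (step y z)
  thus ?case using inv[of y z] inv[of z y] by auto
 qed simp
qed

lemma generated_equivI: "[|(x, y) \<in> r; x \<in> A; y \<in> A|] ==> (x, y) \<in> generated_equiv A r"
 by (auto simp: generated_equiv_def Let_def)

lemma generated_equiv_map:
 assumes f: "\<And>x. x \<in> A ==> f x \<in> B"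
  and rel: "\<And>x y. [|(x, y) \<in> r; x \<in> A; y \<in> A|] ==> (f x, f y) \<in> generated_equiv B r'"
  and xy: "(x, y) \<in> generated_equiv A r"
 shows "(f x, f y) \<in> generated_equiv B r'"
proof -
 let ?E = "generated_equiv B r'"
 have E: "equiv B ?E" by (rule equiv_generated_equiv)
 have "?E `` {f x} = ?E `` {f y}"
 proof (rule generated_equiv_invariant[OF _ xy])
  show "?E `` {f x} = ?E `` {f y}" if "(x, y) \<in> r" "x \<in> A" "y \<in> A" for x y using equiv_class_eq[OF E rel[OF that]] .
 qed
 moreover have "y \<in> A" using xy by (auto simp: generated_equiv_def Let_def)
 ultimately show ?thesis using eq_equiv_class[OF _ E, of "f x" "f y"] f by simp
qed

section \<open>Points of a realization and invariants separating them\<close>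

lemma topspace_simplex_sum_topology:
 "topspace (simplex_sum_topology X) = {(n, x, t). x \<in> simplices X n \<and> t \<in> \<Delta> n}"
 unfolding simplex_sum_topology_def by (auto simp: o_def)

definition realization_point :: "'s simplicial_set => nat => 's => (nat => real) => 's realization_point" where
 "realization_point X n x t =
   generated_equiv (topspace (simplex_sum_topology X)) (realization_rel X) `` {(n, x, t)}"

lemma topspace_realization:
 "topspace (realization X) = {realization_point X n x t | n x t. x \<in> simplices X n \<and> t \<in> \<Delta> n}"
 unfolding realization_def topspace_quotient_topology
 by (auto simp: quotient_def realization_point_def topspace_simplex_sum_topology)

lemma quotient_map_realization:
 "quotient_map (simplex_sum_topology X) (realization X) (\<lambda>(n, x, t). realization_point X n x t)"
proof -
 have "(\<lambda>(n, x, t). realization_point X n x t)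
   = (\<lambda>p. generated_equiv (topspace (simplex_sum_topology X)) (realization_rel X) `` {p})"
  by (auto simp: realization_point_def fun_eq_iff)
 thus ?thesis unfolding realization_def using quotient_map_quotient_topology by simp
qed

lemma realization_point_pull:
 assumes "a \<in> ordinal_maps m n" "x \<in> simplices X n" "pull X m n a x \<in> simplices X m" "t \<in> \<Delta> m"
 shows "realization_point X n x (simplex_push m a t) = realization_point X m (pull X m n a x) t" unfolding realization_point_def
proof (rule equiv_class_eq[OF equiv_generated_equiv])
 show "((n, x, simplex_push m a t), (m, pull X m n a x, t))
   \<in> generated_equiv (topspace (simplex_sum_topology X)) (realization_rel X)"
  using assms simplex_push_in_simplex[OF assms(1,4)]
  by (intro generated_equivI) (auto simp: realization_rel_def topspace_simplex_sum_topology)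
qed

text \<open>The definition saturates the image of a whole equivalence class. Compatibility with the
  operators sends equivalent triples to equivalent triples, so the result is one class, computed
  from any representative.\<close>

lemma realization_map_point:
 assumes h: "\<And>n x. x \<in> simplices X n ==> h n x \<in> simplices Y n"
  and pull: "\<And>m n a x. [|a \<in> ordinal_maps m n; x \<in> simplices X n|] ==> pull Y m n a (h n x) = h m (pull X m n a x)"
  and x: "x \<in> simplices X n" "t \<in> \<Delta> n"
 shows "realization_map Y h (realization_point X n x t) = realization_point Y n (h n x) t"
proof -
 let ?E = "generated_equiv (topspace (simplex_sum_topology X)) (realization_rel X)"
 let ?E' = "generated_equiv (topspace (simplex_sum_topology Y)) (realization_rel Y)"
 let ?f = "\<lambda>(n, x, t). (n, h n x, t)"
 have E': "equiv (topspace (simplex_sum_topology Y)) ?E'" by (rule equiv_generated_equiv)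
 have map: "(?f p, ?f p') \<in> ?E'" if pp: "(p, p') \<in> ?E" for p p'
 proof (rule generated_equiv_map[OF _ _ pp])
  show "?f p \<in> topspace (simplex_sum_topology Y)" if "p \<in> topspace (simplex_sum_topology X)" for p
   using that h by (auto simp: topspace_simplex_sum_topology)
  show "(?f p, ?f p') \<in> ?E'"
   if r: "(p, p') \<in> realization_rel X" "p \<in> topspace (simplex_sum_topology X)" "p' \<in> topspace (simplex_sum_topology X)" for p p'
  proof -
   obtain n m x a t where p: "p = (n, x, simplex_push m a t)" "p' = (m, pull X m n a x, t)"
    "a \<in> ordinal_maps m n" "x \<in> simplices X n" "t \<in> \<Delta> m" using r(1) unfolding realization_rel_def by blast
   have px: "pull X m n a x \<in> simplices X m" using r(3) p(2) by (simp add: topspace_simplex_sum_topology)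
   have "((n, h n x, simplex_push m a t), (m, h m (pull X m n a x), t)) \<in> ?E'"
   proof (rule generated_equivI)
    show "((n, h n x, simplex_push m a t), (m, h m (pull X m n a x), t)) \<in> realization_rel Y"
     unfolding pull[OF p(3,4), symmetric] realization_rel_def using p h by blast
   qed (use h p px simplex_push_in_simplex[OF p(3,5)] in \<open>auto simp: topspace_simplex_sum_topology\<close>)
   thus ?thesis by (simp add: p)
  qed
 qed
 have self: "(n, x, t) \<in> realization_point X n x t" unfolding realization_point_def using x
  by (intro equiv_class_self[OF equiv_generated_equiv]) (simp add: topspace_simplex_sum_topology)
 have "?E' `` (?f ` realization_point X n x t) = ?E' `` {?f (n, x, t)}"
 proof
  show "?E' `` (?f ` realization_point X n x t) \<subseteq> ?E' `` {?f (n, x, t)}"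
  proof
   fix y assume "y \<in> ?E' `` (?f ` realization_point X n x t)"
   then obtain p where p: "(( n, x, t), p) \<in> ?E" "(?f p, y) \<in> ?E'" unfolding realization_point_def by blast
   hence "(?f (n, x, t), y) \<in> ?E'" using map E' by (meson equivE transE)
   thus "y \<in> ?E' `` {?f (n, x, t)}" by blast
  qed
  show "?E' `` {?f (n, x, t)} \<subseteq> ?E' `` (?f ` realization_point X n x t)" using self by blast
 qed
 thus ?thesis by (simp add: realization_map_def realization_point_def)
qed

text \<open>The cumulative sums of a point \<open>t\<close> of the simplex cut \<open>[0, 1)\<close> into intervals of length
 \<open>t i\<close>; \<open>step t u\<close> is the index of the interval containing \<open>u\<close>. It is compatible with the
 maps \<open>simplex_push\<close>, which makes it possible to read off invariants of points of a realization.\<close>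

definition step :: "(nat => real) => real => nat" where
 "step t u = (LEAST i. u < (\<Sum>j\<le>i. t j))"

lemma step_bounds:
 assumes t: "t \<in> \<Delta> n" and u: "0 \<le> u" "u < 1"
 shows "step t u \<le> n" "u < (\<Sum>j\<le>step t u. t j)" "(\<Sum>j<step t u. t j) \<le> u"
proof -
 have n: "u < (\<Sum>j\<le>n. t j)" using t u by (simp add: standard_simplex_def)
 thus "step t u \<le> n" unfolding step_def by (rule Least_le)
 show "u < (\<Sum>j\<le>step t u. t j)" unfolding step_def using n by (rule LeastI)
 show "(\<Sum>j<step t u. t j) \<le> u"
 proof (cases "step t u")
  case (Suc i)
  hence "i < (LEAST i. u < (\<Sum>j\<le>i. t j))" by (simp add: step_def)
  hence "\<not> u < (\<Sum>j\<le>i. t j)" by (rule not_less_Least)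
  thus ?thesis using Suc by (simp add: lessThan_Suc_atMost)
 qed (use u in simp)
qed

lemma step_unique:
 assumes t: "t \<in> \<Delta> n" and i: "u < (\<Sum>j\<le>i. t j)" "(\<Sum>j<i. t j) \<le> u"
 shows "step t u = i" unfolding step_def
proof (rule Least_equality)
 show "u < (\<Sum>j\<le>i. t j)" by (rule i(1))
 fix l assume l: "u < (\<Sum>j\<le>l. t j)"
 show "i \<le> l"
 proof (rule ccontr)
  assume "\<not> i \<le> l"
  hence "(\<Sum>j\<le>l. t j) \<le> (\<Sum>j<i. t j)" using t by (intro sum_mono2) (auto simp: standard_simplex_def)
  thus False using l i(2) by linarith
 qed
qed

lemma step_mono:
 assumes t: "t \<in> \<Delta> n" and u: "0 \<le> u" "u \<le> v" "v < 1"
 shows "step t u \<le> step t v"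
proof -
 have "u < (\<Sum>j\<le>step t v. t j)" using step_bounds(2)[OF t, of v] u by linarith
 thus ?thesis unfolding step_def[of t u] by (rule Least_le)
qed

text \<open>As \<open>a\<close> is monotone, pushing forward joins consecutive intervals and inserts
  intervals of length 0, which contain no \<open>u\<close>.\<close>

lemma step_push:
 assumes a: "a \<in> ordinal_maps m n" and t: "t \<in> \<Delta> m" and u: "0 \<le> u" "u < 1"
 shows "step (simplex_push m a t) u = a (step t u)"
proof (rule step_unique[OF simplex_push_in_simplex[OF a t]])
 let ?i = "step t u"
 note b = step_bounds[OF t u]
 have nn: "0 \<le> t j" for j using t by (simp add: standard_simplex_def)
 have "(\<Sum>j\<le>?i. t j) \<le> (\<Sum>l | l \<le> m \<and> a l \<in> {..a ?i}. t l)"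
  using b(1) nn ordinal_maps_mono[OF a] by (intro sum_mono2) auto
 thus "u < (\<Sum>j\<le>a ?i. simplex_push m a t j)" using b(2) by (simp only: simplex_push_sum finite_atMost)
 have "l < ?i" if "l \<le> m" "a l < a ?i" for l using ordinal_maps_mono[OF a, of ?i l] that by (meson leD not_le_imp_less)
 hence "(\<Sum>l | l \<le> m \<and> a l \<in> {..<a ?i}. t l) \<le> (\<Sum>j<?i. t j)" using nn by (intro sum_mono2) auto
 thus "(\<Sum>j<a ?i. simplex_push m a t j) \<le> u" using b(3) by (simp only: simplex_push_sum finite_lessThan)
qed

lemma step_surj:
 assumes t: "t \<in> \<Delta> n" and i: "i \<le> n" "t i > 0"
 shows "0 \<le> (\<Sum>j<i. t j)" "(\<Sum>j<i. t j) < 1" "step t (\<Sum>j<i. t j) = i"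
proof -
 have nn: "0 \<le> t j" for j using t by (simp add: standard_simplex_def)
 show "0 \<le> (\<Sum>j<i. t j)" using nn by (simp add: sum_nonneg)
 have lt: "(\<Sum>j<i. t j) < (\<Sum>j\<le>i. t j)" using i by (simp add: lessThan_Suc_atMost[symmetric])
 have "(\<Sum>j\<le>i. t j) \<le> (\<Sum>j\<le>n. t j)" using i nn by (intro sum_mono2) auto
 thus "(\<Sum>j<i. t j) < 1" using lt t by (simp add: standard_simplex_def)
 show "step t (\<Sum>j<i. t j) = i" by (rule step_unique[OF t lt]) simp
qed

lemma step_less:
 assumes t: "t \<in> \<Delta> n" "simplex_min n t > 0" and i: "i \<le> n" and u: "0 \<le> u" "u < 1" "step t u < i"
 shows "u < (\<Sum>j<i. t j)"
proof (rule ccontr)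
 have ti: "t i > 0" using t i simplex_min_pos_iff by blast
 assume "\<not> u < (\<Sum>j<i. t j)"
 hence "step t (\<Sum>j<i. t j) \<le> step t u" using step_surj[OF t(1) i ti] u by (intro step_mono[OF t(1)]) auto
 thus False using step_surj(3)[OF t(1) i ti] u(3) by simp
qed

text \<open>By \<open>fib\<close>, whenever \<open>step t\<close> changes between two arguments so
  does \<open>step t'\<close>. All indices of an interior point \<open>t\<close> occur, so
  \<open>step t'\<close> has jumped at least as often as \<open>step t\<close>.\<close>

lemma step_le_aux:
 assumes t: "t \<in> \<Delta> n" "simplex_min n t > 0"
  and t': "t' \<in> \<Delta> m"
  and fib: "\<And>u v. [|0 \<le> u; u \<le> v; v < 1; step t' u = step t' v|] ==> step t u = step t v"
  and u: "0 \<le> u" "u < 1"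
 shows "step t u \<le> step t' u" using u
proof (induction "step t u" arbitrary: u rule: less_induct)
 case less
 show ?case
 proof (cases "step t u")
  case (Suc i)
  \<comment> \<open>The left end of the interval just before the one containing \<open>u\<close>; at
    this argument the index of \<open>t\<close> is \<open>i\<close>.\<close>
  let ?b = "\<Sum>j<i. t j"
  have i: "i \<le> n" using step_bounds(1)[OF t(1) less.prems] Suc by simp
  have ti: "t i > 0" using t i simplex_min_pos_iff by blast
  note b = step_surj[OF t(1) i ti]
  have le: "?b \<le> u"
  proof -
   have "?b \<le> (\<Sum>j<Suc i. t j)" using ti by simp
   also have "\<dots> \<le> u" using step_bounds(3)[OF t(1) less.prems] Suc by simp
   finally show ?thesis .
  qed
  have "i \<le> step t' ?b" using less.hyps[of ?b] b Suc by simp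
  also have "step t' ?b < step t' u"
  proof -
   have "step t' ?b \<noteq> step t' u" using fib[OF b(1) le less.prems(2)] b(3) Suc by auto
   moreover have "step t' ?b \<le> step t' u" by (rule step_mono[OF t' b(1) le less.prems(2)])
   ultimately show ?thesis by simp
  qed
  finally show ?thesis using Suc by simp
 qed simp
qed

text \<open>No interval of an interior point is empty, so the partition of \<open>[0, 1)\<close>
  into fibres of \<open>step\<close> fixes the number of intervals and all partial sums.\<close>

lemma step_determines:
 assumes t: "t \<in> \<Delta> n" "simplex_min n t > 0"
  and t': "t' \<in> \<Delta> m" "simplex_min m t' > 0"
  and fib: "\<And>u v. [|0 \<le> u; u \<le> v; v < 1|] ==> step t' u = step t' v \<longleftrightarrow> step t u = step t v"
 shows "n = m" "t = t'"
proof -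
 have eq: "step t u = step t' u" if "0 \<le> u" "u < 1" for u
  using step_le_aux[OF t t'(1) _ that] step_le_aux[OF t' t(1) _ that] fib by (metis le_antisym)
 have le: "l \<le> l'" if s: "s \<in> \<Delta> l" "simplex_min l s > 0" and s': "s' \<in> \<Delta> l'"
  and e: "\<And>u. [|0 \<le> u; u < 1|] ==> step s u = step s' u" for s s' l l'
 proof -
  have "s l > 0" using s simplex_min_pos_iff by blast
  note b = step_surj[OF s(1) order_refl this]
  show ?thesis using step_bounds(1)[OF s' b(1,2)] e[OF b(1,2)] b(3) by simp
 qed
 show nm: "n = m" using le[OF t t'(1)] le[OF t' t(1)] eq by (simp add: le_antisym)
 have sums: "\<not> (\<Sum>j\<le>i. s j) < (\<Sum>j\<le>i. s' j)"
  if s: "s \<in> \<Delta> l" and s': "s' \<in> \<Delta> l"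
   and e: "\<And>u. [|0 \<le> u; u < 1|] ==> step s u = step s' u" for s s' l i
 proof
  let ?u = "\<Sum>j\<le>i. s j"
  assume lt: "?u < (\<Sum>j\<le>i. s' j)"
  have u0: "0 \<le> ?u" using s by (auto simp: standard_simplex_def intro: sum_nonneg)
  have "(\<Sum>j\<le>i. s' j) \<le> 1"
  proof -
   have "s' j = 0" if "\<not> j \<le> l" for j using s' that by (simp add: standard_simplex_def)
   hence "(\<Sum>j\<le>i. s' j) = (\<Sum>j\<in>{..i} \<inter> {..l}. s' j)" by (intro sum.mono_neutral_right) auto
   also have "\<dots> \<le> (\<Sum>j\<le>l. s' j)" using s' by (intro sum_mono2) (auto simp: standard_simplex_def)
   finally show ?thesis using s' by (simp add: standard_simplex_def)
  qed
  hence u1: "?u < 1" using lt by linarith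
  have "step s' ?u \<le> i" unfolding step_def using lt by (rule Least_le)
  hence i: "step s ?u \<le> i" using e[OF u0 u1] by simp
  have "(\<Sum>j\<le>step s ?u. s j) \<le> ?u" using i s by (intro sum_mono2) (auto simp: standard_simplex_def)
  thus False using step_bounds(2)[OF s u0 u1] by linarith
 qed
 have psum: "(\<Sum>j\<le>i. t j) = (\<Sum>j\<le>i. t' j)" for i
 proof -
  have t'n: "t' \<in> \<Delta> n" using t'(1) nm by simp
  have "\<not> (\<Sum>j\<le>i. t j) < (\<Sum>j\<le>i. t' j)" by (rule sums[OF t(1) t'n eq])
  moreover have "\<not> (\<Sum>j\<le>i. t' j) < (\<Sum>j\<le>i. t j)" by (rule sums[OF t'n t(1)]) (simp add: eq)
  ultimately show ?thesis by linarith
 qed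
 show "t = t'"
 proof
  fix i
  show "t i = t' i"
  proof (cases i)
   case 0
   thus ?thesis using psum[of 0] by simp
  next
   case (Suc l)
   thus ?thesis using psum[of i] psum[of l] by simp
  qed
 qed
qed

section \<open>The nerve of the regular category and its orbit space\<close>

locale dedekind_monoid = monoid M for M :: "('m, 'y) monoid_scheme" (structure) +
 assumes dedekind_finite: "dedekind_finite M"
begin

text \<open>If \<open>x \<otimes> y\<close> is a unit, then
  \<open>y \<otimes> inv (x \<otimes> y)\<close> is a right inverse of \<open>x\<close>. Having the
  left inverse \<open>x\<close>, it has a right inverse by Dedekind-finiteness, and that must be
  \<open>x\<close> again. The equivalence makes the singular elements an ideal and the coefficients
  a module.\<close>

lemma Units_mult_iff:
 assumes x: "x \<in> carrier M" and y: "y \<in> carrier M"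
 shows "x \<otimes> y \<in> Units M \<longleftrightarrow> x \<in> Units M \<and> y \<in> Units M"
proof
 assume u: "x \<otimes> y \<in> Units M"
 let ?r = "inv (x \<otimes> y)"
 have r: "?r \<in> carrier M" using u by (rule Units_inv_closed)
 let ?z = "y \<otimes> ?r"
 have z: "?z \<in> carrier M" using y r by simp
 have xz: "x \<otimes> ?z = \<one>" using Units_r_inv[OF u] x y r by (simp add: m_assoc)
 then obtain w where w: "w \<in> carrier M" "?z \<otimes> w = \<one>"
  using dedekind_finite z x unfolding dedekind_finite_def by blast
 have "w = (x \<otimes> ?z) \<otimes> w" using xz w by simp
 also have "\<dots> = x \<otimes> (?z \<otimes> w)" by (rule m_assoc[OF x z w(1)])
 also have "\<dots> = x" using w x by simp
 finally have "?z \<otimes> x = \<one>" using w(2) by simp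
 hence xU: "x \<in> Units M" unfolding Units_def using x z xz by blast
 have y': "inv x \<otimes> (x \<otimes> y) = y" using xU x y by (simp add: m_assoc[symmetric])
 have "inv x \<otimes> (x \<otimes> y) \<in> Units M" by (rule Units_m_closed[OF Units_inv_Units[OF xU] u])
 hence "y \<in> Units M" by (simp only: y')
 thus "x \<in> Units M \<and> y \<in> Units M" using xU by blast
qed (auto intro: Units_m_closed)

lemma singular_mult_right: "[|x \<in> singular_elements M; y \<in> carrier M|] ==> x \<otimes> y \<in> singular_elements M"
 by (auto simp: singular_elements_def Units_mult_iff)

abbreviation EM_simplices :: "nat => (nat \<times> nat => 'm \<times> 'm) set" where
 "EM_simplices \<equiv> nerve_simplices (regular_category M)"

text \<open>An \<open>n\<close>-simplex \<open>F\<close> of the nerve of \<open>U(M) \<rtimes> M\<close> is determined by its vertices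
 \<open>vertex F i\<close> and its labels \<open>label F i j\<close>, where \<open>vertex F j \<otimes> label F i j = vertex F i\<close>.\<close>

definition vertex :: "(nat \<times> nat => 'm \<times> 'm) => nat => 'm" where
 "vertex F i = fst (F (i, i))"

definition label :: "(nat \<times> nat => 'm \<times> 'm) => nat => nat => 'm" where
 "label F i j = snd (F (i, j))"

lemma EM_simplices_iff:
 "F \<in> EM_simplices n \<longleftrightarrow> F \<in> extensional (ordinal_pairs n) \<and>
   (\<forall>i\<le>n. vertex F i \<in> carrier M \<and> label F i i = \<one>) \<and>
   (\<forall>i j. i \<le> j --> j \<le> n --> F (i, j) = (vertex F j, label F i j) \<and> label F i j \<in> carrier M \<and>
    vertex F j \<otimes> label F i j = vertex F i) \<and>
   (\<forall>i j k. i \<le> j --> j \<le> k --> k \<le> n --> label F i k = label F j k \<otimes> label F i j)"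
 (is "_ \<longleftrightarrow> ?R")
proof
 assume "F \<in> EM_simplices n"
 note R = this[unfolded nerve_simplices_def regular_category_def mset_category_def mem_Collect_eq
   small_category.simps case_prod_unfold]
 hence F: "F \<in> ordinal_pairs n \<rightarrow>\<^sub>E carrier M \<times> carrier M"
  and e: "\<And>i j. [|i \<le> j; j \<le> n|] ==> fst (F (i, j)) \<otimes> snd (F (i, j)) = fst (F (i, i)) \<otimes> snd (F (i, i))"
   "\<And>i j. [|i \<le> j; j \<le> n|] ==> fst (F (i, j)) = fst (F (j, j)) \<otimes> snd (F (j, j))"
   "\<And>i. i \<le> n ==> F (i, i) = (fst (F (i, i)) \<otimes> snd (F (i, i)), \<one>)"
   "\<And>i j k. [|i \<le> j; j \<le> k; k \<le> n|] ==> F (i, k) = (fst (F (j, k)), snd (F (j, k)) \<otimes> snd (F (i, j)))"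
  by blast+
 have c: "fst (F (i, j)) \<in> carrier M \<and> snd (F (i, j)) \<in> carrier M" if "i \<le> j" "j \<le> n" for i j
 proof -
  have "F (i, j) \<in> carrier M \<times> carrier M" using F that by (intro PiE_mem[OF F]) (simp add: ordinal_pairs_def)
  thus ?thesis by auto
 qed
 have one: "snd (F (i, i)) = \<one>" if "i \<le> n" for i using e(3)[OF that] by (metis snd_conv)
 have v: "fst (F (i, j)) = fst (F (j, j))" if "i \<le> j" "j \<le> n" for i j
  using e(2)[OF that] one[of j] c[of j j] that by simp
 have s: "fst (F (j, j)) \<otimes> snd (F (i, j)) = fst (F (i, i))" if "i \<le> j" "j \<le> n" for i j
  using e(1)[OF that] one[of i] c[of i i] v[OF that] that by simp
 have l: "snd (F (i, k)) = snd (F (j, k)) \<otimes> snd (F (i, j))" if "i \<le> j" "j \<le> k" "k \<le> n" for i j k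
  using e(4)[OF that] by (metis snd_conv)
 show ?R unfolding vertex_def label_def
 proof (intro conjI allI impI)
  show "F \<in> extensional (ordinal_pairs n)" using F by (simp add: PiE_def)
  show "F (i, j) = (fst (F (j, j)), snd (F (i, j)))" if "i \<le> j" "j \<le> n" for i j
   using v[OF that] by (simp add: prod_eq_iff)
  show "snd (F (i, k)) = snd (F (j, k)) \<otimes> snd (F (i, j))" if "i \<le> j" "j \<le> k" "k \<le> n" for i j k
   using l[OF that] .
 qed (use c one s in simp_all)
next
 assume R: ?R
 have ext: "F \<in> extensional (ordinal_pairs n)"
  and vc: "\<And>i. i \<le> n ==> vertex F i \<in> carrier M \<and> label F i i = \<one>"
  and e: "\<And>i j. [|i \<le> j; j \<le> n|] ==> F (i, j) = (vertex F j, label F i j) \<and> label F i j \<in> carrier M \<and>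
    vertex F j \<otimes> label F i j = vertex F i"
  and c: "\<And>i j k. [|i \<le> j; j \<le> k; k \<le> n|] ==> label F i k = label F j k \<otimes> label F i j"
  using R by blast+
 have v: "F (i, j) = (vertex F j, label F i j)" if "i \<le> j" "j \<le> n" for i j using e[OF that] by blast
 show "F \<in> EM_simplices n" unfolding nerve_simplices_def regular_category_def mset_category_def mem_Collect_eq
   small_category.simps case_prod_unfold
 proof (intro conjI allI impI)
  show "F \<in> ordinal_pairs n \<rightarrow>\<^sub>E carrier M \<times> carrier M"
  proof (rule PiE_I)
   fix p assume "p \<in> ordinal_pairs n"
   then obtain i j where p: "p = (i, j)" "i \<le> j" "j \<le> n" by (auto simp: ordinal_pairs_def)
   thus "F p \<in> carrier M \<times> carrier M" using e[OF p(2,3)] vc[OF p(3)] by simp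
  qed (rule extensional_arb[OF ext])
 next
  show "F (i, k) = (fst (F (j, k)), snd (F (j, k)) \<otimes> snd (F (i, j)))" if "i \<le> j" "j \<le> k" "k \<le> n" for i j k
   using that v[of i k] v[of j k] v[of i j] c[OF that] by simp
  show "F (i, i) = (fst (F (i, i)) \<otimes> snd (F (i, i)), \<one>)" if "i \<le> n" for i using that v[of i i] vc by simp
  show "fst (F (i, j)) \<otimes> snd (F (i, j)) = fst (F (i, i)) \<otimes> snd (F (i, i))" if "i \<le> j" "j \<le> n" for i j
   using that v[of i i] v[of i j] vc[of i] e[OF that] by simp
  show "fst (F (i, j)) = fst (F (j, j)) \<otimes> snd (F (j, j))" if "i \<le> j" "j \<le> n" for i j
   using that v[of j j] v[of i j] vc[of j] by simp
 qed
qed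

lemma EM_simplexD:
 assumes "F \<in> EM_simplices n"
 shows "F \<in> extensional (ordinal_pairs n)"
  and "i \<le> n ==> vertex F i \<in> carrier M"
  and "i \<le> n ==> label F i i = \<one>"
  and "[|i \<le> j; j \<le> n|] ==> F (i, j) = (vertex F j, label F i j)"
  and "[|i \<le> j; j \<le> n|] ==> label F i j \<in> carrier M"
  and "[|i \<le> j; j \<le> n|] ==> vertex F j \<otimes> label F i j = vertex F i"
  and "[|i \<le> j; j \<le> k; k \<le> n|] ==> label F i k = label F j k \<otimes> label F i j"
 using assms unfolding EM_simplices_iff by blast+

definition EM_pull :: "nat => (nat => nat) => (nat \<times> nat => 'm \<times> 'm) => nat \<times> nat => 'm \<times> 'm" where
 "EM_pull m a F = (\<lambda>(i, j)\<in>ordinal_pairs m. F (a i, a j))"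

abbreviation translate_arrow :: "'m => 'm \<times> 'm => 'm \<times> 'm" where
 "translate_arrow g p \<equiv> (g \<otimes> fst p, snd p)"

definition translate :: "nat => 'm => (nat \<times> nat => 'm \<times> 'm) => nat \<times> nat => 'm \<times> 'm" where
 "translate n g F = (\<lambda>p\<in>ordinal_pairs n. (\<lambda>(x, m). (g \<otimes> x, m)) (F p))"

lemma EM_pull_apply:
 "[|i \<le> j; j \<le> m|] ==> EM_pull m a F (i, j) = F (a i, a j)"
 by (simp add: EM_pull_def ordinal_pairs_def)

lemma EM_pull_vertex: "i \<le> m ==> vertex (EM_pull m a F) i = vertex F (a i)"
 by (simp add: vertex_def EM_pull_apply)

lemma EM_pull_label: "[|i \<le> j; j \<le> m|] ==> label (EM_pull m a F) i j = label F (a i) (a j)"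
 by (simp add: label_def EM_pull_apply)

lemma EM_pull_closed:
 assumes F: "F \<in> EM_simplices n" and a: "a \<in> ordinal_maps m n"
 shows "EM_pull m a F \<in> EM_simplices m" unfolding EM_simplices_iff
proof (intro conjI allI impI)
 show "EM_pull m a F \<in> extensional (ordinal_pairs m)" by (simp add: EM_pull_def)
 fix i j assume ij: "i \<le> j" "j \<le> m"
 note aij = ordinal_maps_mono[OF a ij] ordinal_maps_le[OF a ij(2)]
 show "EM_pull m a F (i, j) = (vertex (EM_pull m a F) j, label (EM_pull m a F) i j)"
  using ij EM_simplexD(4)[OF F aij] by (simp add: EM_pull_apply EM_pull_vertex EM_pull_label)
 show "label (EM_pull m a F) i j \<in> carrier M" using ij EM_simplexD(5)[OF F aij] by (simp add: EM_pull_label)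
 show "vertex (EM_pull m a F) j \<otimes> label (EM_pull m a F) i j = vertex (EM_pull m a F) i"
  using ij EM_simplexD(6)[OF F aij] by (simp add: EM_pull_vertex EM_pull_label)
next
 fix i j k assume ijk: "i \<le> j" "j \<le> k" "k \<le> m"
 thus "label (EM_pull m a F) i k = label (EM_pull m a F) j k \<otimes> label (EM_pull m a F) i j"
  using EM_simplexD(7)[OF F ordinal_maps_mono[OF a, of i j] ordinal_maps_mono[OF a, of j k]
   ordinal_maps_le[OF a, of k]] by (simp add: EM_pull_label)
qed (use EM_simplexD(2,3)[OF F] ordinal_maps_le[OF a] in \<open>simp_all add: EM_pull_vertex EM_pull_label\<close>)

lemma translate_apply:
 "[|i \<le> j; j \<le> n|] ==> translate n g F (i, j) = (g \<otimes> fst (F (i, j)), snd (F (i, j)))"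
 by (simp add: translate_def ordinal_pairs_def case_prod_unfold)

lemma translate_vertex: "i \<le> n ==> vertex (translate n g F) i = g \<otimes> vertex F i"
 by (simp add: vertex_def translate_apply)

lemma translate_label: "[|i \<le> j; j \<le> n|] ==> label (translate n g F) i j = label F i j"
 by (simp add: label_def translate_apply)

lemma translate_closed:
 assumes F: "F \<in> EM_simplices n" and g: "g \<in> carrier M"
 shows "translate n g F \<in> EM_simplices n" unfolding EM_simplices_iff
proof (intro conjI allI impI)
 show "translate n g F \<in> extensional (ordinal_pairs n)" by (simp add: translate_def)
 fix i j assume ij: "i \<le> j" "j \<le> n"
 hence i: "i \<le> n" by simp
 show "translate n g F (i, j) = (vertex (translate n g F) j, label (translate n g F) i j)"
  using ij EM_simplexD(4)[OF F ij] by (simp add: translate_apply translate_vertex translate_label)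
 show "label (translate n g F) i j \<in> carrier M" using ij EM_simplexD(5)[OF F ij] by (simp add: translate_label)
 show "vertex (translate n g F) j \<otimes> label (translate n g F) i j = vertex (translate n g F) i"
  using ij i EM_simplexD(2)[OF F] EM_simplexD(5,6)[OF F ij] g by (simp add: translate_vertex translate_label m_assoc)
next
 fix i j k assume "i \<le> j" "j \<le> k" "k \<le> n"
 thus "label (translate n g F) i k = label (translate n g F) j k \<otimes> label (translate n g F) i j"
  using EM_simplexD(7)[OF F, of i j k] by (simp add: translate_label)
qed (use EM_simplexD(2,3)[OF F] g in \<open>simp_all add: translate_vertex translate_label\<close>)

lemma translate_pull:
 assumes "a \<in> ordinal_maps m n"
 shows "EM_pull m a (translate n g F) = translate m g (EM_pull m a F)"
proof
 fix p
 show "EM_pull m a (translate n g F) p = translate m g (EM_pull m a F) p"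
 proof (cases "p \<in> ordinal_pairs m")
  case True
  then obtain i j where p: "p = (i, j)" "i \<le> j" "j \<le> m" by (auto simp: ordinal_pairs_def)
  thus ?thesis using ordinal_maps_mono[OF assms p(2,3)] ordinal_maps_le[OF assms p(3)]
   by (simp add: EM_pull_apply translate_apply)
 qed (simp add: EM_pull_def translate_def)
qed

lemma nerve_EM: "simplices (nerve (regular_category M)) n = EM_simplices n"
 "pull (nerve (regular_category M)) m n a F = EM_pull m a F" by (simp_all add: nerve_def EM_pull_def)

text \<open>Every vertex is a right multiple of the last one and singular elements absorb
  multiplication, so the last vertex decides whether a simplex lies over \<open>S\<close>.\<close>

lemma nerve_SEM: "simplices (nerve (singular_category M)) n = {F \<in> EM_simplices n. vertex F n \<in> singular_elements M}"
 "pull (nerve (singular_category M)) m n a F = EM_pull m a F"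
proof -
 have "nerve_simplices (singular_category M) n = {F \<in> EM_simplices n. \<forall>i j. i \<le> j --> j \<le> n --> fst (F (i, j)) \<in> singular_elements M}"
 proof -
  have "F \<in> ordinal_pairs n \<rightarrow>\<^sub>E singular_elements M \<times> carrier M \<longleftrightarrow>
    F \<in> ordinal_pairs n \<rightarrow>\<^sub>E carrier M \<times> carrier M \<and>
    (\<forall>i j. i \<le> j --> j \<le> n --> fst (F (i, j)) \<in> singular_elements M)" for F
   by (auto simp: PiE_def Pi_def ordinal_pairs_def singular_elements_def mem_Times_iff)
  thus ?thesis unfolding nerve_simplices_def regular_category_def singular_category_def mset_category_def by auto
 qed
 also have "\<dots> = {F \<in> EM_simplices n. vertex F n \<in> singular_elements M}"
 proof (intro Collect_cong conj_cong refl)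
  fix F assume F: "F \<in> EM_simplices n"
  show "(\<forall>i j. i \<le> j --> j \<le> n --> fst (F (i, j)) \<in> singular_elements M) \<longleftrightarrow> vertex F n \<in> singular_elements M"
  proof
   assume n: "vertex F n \<in> singular_elements M"
   show "\<forall>i j. i \<le> j --> j \<le> n --> fst (F (i, j)) \<in> singular_elements M"
   proof (intro allI impI)
    fix i j assume ij: "i \<le> j" "j \<le> n"
    have "vertex F j = vertex F n \<otimes> label F j n" using EM_simplexD(6)[OF F ij(2)] by simp
    also have "\<dots> \<in> singular_elements M" using n EM_simplexD(5)[OF F ij(2)] by (intro singular_mult_right) auto
    finally show "fst (F (i, j)) \<in> singular_elements M" using EM_simplexD(4)[OF F ij] by simp
   qed
  qed (simp add: vertex_def)
 qed
 finally show "simplices (nerve (singular_category M)) n = {F \<in> EM_simplices n. vertex F n \<in> singular_elements M}"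
  by (simp add: nerve_def)
qed (simp add: nerve_def EM_pull_def)

definition EM_point :: "nat => (nat \<times> nat => 'm \<times> 'm) => (nat => real) => 'm EM_point" where
 "EM_point = realization_point (nerve (regular_category M))"

definition orbit_point :: "nat => (nat \<times> nat => 'm \<times> 'm) => (nat => real) => 'm EM_point set" where
 "orbit_point n F t = generated_equiv (topspace (EM M)) (orbit_rel M) `` {EM_point n F t}"

lemma topspace_EM: "topspace (EM M) = {EM_point n F t | n F t. F \<in> EM_simplices n \<and> t \<in> \<Delta> n}"
 unfolding EM_def classifying_space_def topspace_realization EM_point_def nerve_EM by simp

lemma EM_point_pull:
 "[|a \<in> ordinal_maps m n; F \<in> EM_simplices n; t \<in> \<Delta> m|]
   ==> EM_point n F (simplex_push m a t) = EM_point m (EM_pull m a F) t" unfolding EM_point_def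
 using realization_point_pull[of a m n F "nerve (regular_category M)" t] EM_pull_closed by (simp add: nerve_EM)

lemma orbit_point_pull:
 "[|a \<in> ordinal_maps m n; F \<in> EM_simplices n; t \<in> \<Delta> m|]
   ==> orbit_point n F (simplex_push m a t) = orbit_point m (EM_pull m a F) t"
 by (simp add: orbit_point_def EM_point_pull)

lemma unit_action_EM_point:
 assumes "g \<in> Units M" "F \<in> EM_simplices n" "t \<in> \<Delta> n"
 shows "unit_action M g (EM_point n F t) = EM_point n (translate n g F) t"
 unfolding unit_action_def classifying_map_def EM_point_def using realization_map_point[of "nerve (regular_category M)"
   "\<lambda>n F. \<lambda>p\<in>ordinal_pairs n. (\<lambda>(x, m). (g \<otimes> x, m)) (F p)" "nerve (regular_category M)" F n t]
  assms translate_closed translate_pull by (simp add: nerve_EM translate_def[symmetric] Units_closed)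

lemma orbit_point_translate:
 assumes "g \<in> Units M" "F \<in> EM_simplices n" "t \<in> \<Delta> n"
 shows "orbit_point n (translate n g F) t = orbit_point n F t"
proof -
 have "(EM_point n F t, EM_point n (translate n g F) t) \<in> generated_equiv (topspace (EM M)) (orbit_rel M)"
 proof (rule generated_equivI)
  show "EM_point n F t \<in> topspace (EM M)" "EM_point n (translate n g F) t \<in> topspace (EM M)"
   unfolding topspace_EM using assms translate_closed[OF assms(2) Units_closed[OF assms(1)]] by blast+
  thus "(EM_point n F t, EM_point n (translate n g F) t) \<in> orbit_rel M"
   unfolding orbit_rel_def unit_action_EM_point[OF assms, symmetric] using assms(1) by blast
 qed
 thus ?thesis unfolding orbit_point_def by (rule equiv_class_eq[OF equiv_generated_equiv, symmetric])
qed

lemma topspace_orbit_EM: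
 "topspace (orbit_EM M) = {orbit_point n F t | n F t. F \<in> EM_simplices n \<and> t \<in> \<Delta> n}"
 unfolding orbit_EM_def topspace_quotient_topology quotient_def orbit_point_def topspace_EM by blast

text \<open>The two quotients are composed so that the topology of the orbit space can be tested
  directly on the simplices of the nerve.\<close>

lemma quotient_map_orbit_EM:
 "quotient_map (simplex_sum_topology (nerve (regular_category M))) (orbit_EM M) (\<lambda>(n, F, t). orbit_point n F t)"
proof -
 have "(\<lambda>(n, F, t). orbit_point n F t)
   = (\<lambda>x. generated_equiv (topspace (EM M)) (orbit_rel M) `` {x}) \<circ> (\<lambda>(n, F, t). EM_point n F t)"
  by (auto simp: orbit_point_def)
 moreover have "quotient_map (simplex_sum_topology (nerve (regular_category M))) (EM M) (\<lambda>(n, F, t). EM_point n F t)"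
  unfolding EM_def classifying_space_def EM_point_def by (rule quotient_map_realization)
 moreover have "quotient_map (EM M) (orbit_EM M) (\<lambda>x. generated_equiv (topspace (EM M)) (orbit_rel M) `` {x})"
  unfolding orbit_EM_def by (rule quotient_map_quotient_topology)
 ultimately show ?thesis using quotient_map_compose by fastforce
qed

lemma SEM_eq: "SEM M = {EM_point n F t | n F t. F \<in> EM_simplices n \<and> vertex F n \<in> singular_elements M \<and> t \<in> \<Delta> n}"
proof -
 have "realization_map (nerve (regular_category M)) (\<lambda>n F. \<lambda>p\<in>ordinal_pairs n. id (F p))
   (realization_point (nerve (singular_category M)) n F t) = EM_point n F t"
  if F: "F \<in> EM_simplices n" "vertex F n \<in> singular_elements M" and t: "t \<in> \<Delta> n" for n F t
 proof -
  have id: "(\<lambda>p\<in>ordinal_pairs n. id (F p)) = F" if "F \<in> EM_simplices n" for n F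
   using EM_simplexD(1)[OF that] by (simp add: extensional_restrict)
  have "realization_map (nerve (regular_category M)) (\<lambda>n F. \<lambda>p\<in>ordinal_pairs n. id (F p))
    (realization_point (nerve (singular_category M)) n F t)
    = realization_point (nerve (regular_category M)) n (\<lambda>p\<in>ordinal_pairs n. id (F p)) t"
   using id EM_pull_closed F t by (intro realization_map_point; auto simp: nerve_SEM nerve_EM)
  thus ?thesis unfolding id[OF F(1)] EM_point_def .
 qed
 note pt = this
 show ?thesis unfolding SEM_def classifying_map_def classifying_space_def topspace_realization nerve_SEM
 proof (intro equalityI subsetI; clarify)
  fix n F t assume a: "F \<in> EM_simplices n" "vertex F n \<in> singular_elements M" "t \<in> \<Delta> n"
  show "\<exists>n' F' t'. realization_map (nerve (regular_category M)) (\<lambda>n F. \<lambda>p\<in>ordinal_pairs n. id (F p))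
    (realization_point (nerve (singular_category M)) n F t) = EM_point n' F' t' \<and>
    F' \<in> EM_simplices n' \<and> vertex F' n' \<in> singular_elements M \<and> t' \<in> \<Delta> n'"
   unfolding pt[OF a] using a by blast
  show "EM_point n F t \<in> realization_map (nerve (regular_category M)) (\<lambda>n F. \<lambda>p\<in>ordinal_pairs n. id (F p)) `
    {realization_point (nerve (singular_category M)) n x t | n x t.
     x \<in> {F \<in> EM_simplices n. vertex F n \<in> singular_elements M} \<and> t \<in> \<Delta> n}"
   unfolding pt[OF a, symmetric] using a by blast
 qed
qed

lemma orbit_SEM_eq: "orbit_SEM M = {orbit_point n F t | n F t. F \<in> EM_simplices n \<and> vertex F n \<in> singular_elements M \<and> t \<in> \<Delta> n}"
 unfolding orbit_SEM_def SEM_eq orbit_point_def by blast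

end

section \<open>Separating orbit points by profiles\<close>

context dedekind_monoid
begin

definition profile :: "(nat \<times> nat => 'm \<times> 'm) => (nat => real) => real \<times> real => 'm \<times> 'm" where
 "profile F t = (\<lambda>(u, v)\<in>{(u, v). 0 \<le> u \<and> u \<le> v \<and> v < 1}. F (step t u, step t v))"

text \<open>The orbit of the profile under the units. Passing to this set removes the choice of a
  representative in the \<open>G\<close>-orbit and yields an invariant on the orbit space.\<close>

definition profiles :: "(nat \<times> nat => 'm \<times> 'm) => (nat => real) => (real \<times> real => 'm \<times> 'm) set" where
 "profiles F t = {(\<lambda>p\<in>{(u, v). 0 \<le> u \<and> u \<le> v \<and> v < 1}. (g \<otimes> fst (profile F t p), snd (profile F t p))) | g. g \<in> Units M}"

lemma profile_apply:
 "[|0 \<le> u; u \<le> v; v < 1|] ==> profile F t (u, v) = F (step t u, step t v)"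
 by (simp add: profile_def)

lemma profile_pull:
 assumes a: "a \<in> ordinal_maps m n" and t: "t \<in> \<Delta> m"
 shows "profile (EM_pull m a F) t = profile F (simplex_push m a t)"
proof
 fix p :: "real \<times> real"
 obtain u v where p: "p = (u, v)" by (cases p)
 show "profile (EM_pull m a F) t p = profile F (simplex_push m a t) p"
 proof (cases "0 \<le> u \<and> u \<le> v \<and> v < 1")
  case True
  thus ?thesis using step_mono[OF t, of u v] step_bounds(1)[OF t, of v]
   by (simp add: p profile_apply step_push[OF a t] EM_pull_apply)
 next
  case False
  thus ?thesis unfolding p profile_def by (simp only: restrict_def) auto
 qed
qed

lemma profile_EM_point:
 assumes F: "F \<in> EM_simplices n" "t \<in> \<Delta> n"
  and F': "F' \<in> EM_simplices n'" "t' \<in> \<Delta> n'"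
  and eq: "EM_point n F t = EM_point n' F' t'"
 shows "profile F t = profile F' t'"
proof -
 let ?X = "nerve (regular_category M)"
 have top: "(n, F, t) \<in> topspace (simplex_sum_topology ?X)" "(n', F', t') \<in> topspace (simplex_sum_topology ?X)"
  using F F' by (simp_all add: topspace_simplex_sum_topology nerve_EM)
 have "((n, F, t), (n', F', t')) \<in> generated_equiv (topspace (simplex_sum_topology ?X)) (realization_rel ?X)"
  using eq_equiv_class[OF _ equiv_generated_equiv top(2)] eq unfolding EM_point_def realization_point_def by blast
 hence "(\<lambda>(n, F, t). profile F t) (n, F, t) = (\<lambda>(n, F, t). profile F t) (n', F', t')"
 proof (rule generated_equiv_invariant[rotated])
  fix x y assume "(x, y) \<in> realization_rel ?X"
  then obtain n m F a t where xy: "x = (n, F, simplex_push m a t)" "y = (m, EM_pull m a F, t)"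
   "a \<in> ordinal_maps m n" "t \<in> \<Delta> m" unfolding realization_rel_def nerve_EM by blast
  thus "(\<lambda>(n, F, t). profile F t) x = (\<lambda>(n, F, t). profile F t) y" using profile_pull by simp
 qed
 thus ?thesis by simp
qed

lemma profile_translate:
 assumes F: "F \<in> EM_simplices n" and t: "t \<in> \<Delta> n"
 shows "profile (translate n g F) t
  = (\<lambda>p\<in>{(u, v). 0 \<le> u \<and> u \<le> v \<and> v < 1}. (g \<otimes> fst (profile F t p), snd (profile F t p)))"
proof
 fix p :: "real \<times> real"
 obtain u v where p: "p = (u, v)" by (cases p)
 show "profile (translate n g F) t p = (\<lambda>p\<in>{(u, v). 0 \<le> u \<and> u \<le> v \<and> v < 1}.
   (g \<otimes> fst (profile F t p), snd (profile F t p))) p"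
  using step_mono[OF t, of u v] step_bounds(1)[OF t, of v] by (auto simp: p profile_apply translate_apply profile_def)
qed

lemma profiles_translate:
 assumes g: "g \<in> Units M" and F: "F \<in> EM_simplices n" and t: "t \<in> \<Delta> n"
 shows "profiles (translate n g F) t = profiles F t"
proof -
 let ?D = "{(u, v). 0 \<le> u \<and> u \<le> v \<and> v < (1::real)}"
 have car: "fst (profile F t p) \<in> carrier M" if p: "p \<in> ?D" for p
 proof -
  obtain u v where uv: "p = (u, v)" "0 \<le> u" "u \<le> v" "v < 1" using p by blast
  have b: "step t u \<le> step t v" "step t v \<le> n" using step_mono[OF t uv(2-4)] step_bounds(1)[OF t] uv by auto
  show ?thesis using EM_simplexD(2)[OF F b(2)] EM_simplexD(4)[OF F b] uv by (simp add: profile_apply)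
 qed
 have eq: "(\<lambda>p\<in>?D. (h \<otimes> fst (profile (translate n g F) t p), snd (profile (translate n g F) t p)))
   = (\<lambda>p\<in>?D. ((h \<otimes> g) \<otimes> fst (profile F t p), snd (profile F t p)))" if h: "h \<in> Units M" for h
 proof (rule restrict_ext)
  fix p assume p: "p \<in> ?D"
  hence "profile (translate n g F) t p = (g \<otimes> fst (profile F t p), snd (profile F t p))"
   unfolding profile_translate[OF F t] by (rule restrict_apply')
  thus "(h \<otimes> fst (profile (translate n g F) t p), snd (profile (translate n g F) t p))
    = ((h \<otimes> g) \<otimes> fst (profile F t p), snd (profile F t p))"
   using car[OF p] g h by (simp add: m_assoc Units_closed)
 qed
 show ?thesis
 proof
  show "profiles (translate n g F) t \<subseteq> profiles F t"
   unfolding profiles_def using eq g by (auto intro!: Units_m_closed)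
  show "profiles F t \<subseteq> profiles (translate n g F) t"
  proof
   fix x assume "x \<in> profiles F t"
   then obtain h where h: "h \<in> Units M" "x = (\<lambda>p\<in>?D. (h \<otimes> fst (profile F t p), snd (profile F t p)))"
    unfolding profiles_def by blast
   let ?h = "h \<otimes> inv g"
   have u: "?h \<in> Units M" using h g by (intro Units_m_closed Units_inv_Units)
   have "x = (\<lambda>p\<in>?D. (?h \<otimes> fst (profile (translate n g F) t p), snd (profile (translate n g F) t p)))"
    using h g eq[OF u] h(2) by (simp add: m_assoc Units_closed)
   thus "x \<in> profiles (translate n g F) t" unfolding profiles_def using u by blast
  qed
 qed
qed

lemma orbit_point_eqD:
 assumes F: "F \<in> EM_simplices n" "t \<in> \<Delta> n"
  and F': "F' \<in> EM_simplices n'" "t' \<in> \<Delta> n'"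
  and eq: "orbit_point n F t = orbit_point n' F' t'"
 obtains g where "g \<in> Units M"
  "\<And>u v. [|0 \<le> u; u \<le> v; v < 1|] ==> F' (step t' u, step t' v)
    = translate_arrow g (F (step t u, step t v))"
proof -
 \<comment> \<open>A point of \<open>EM\<close> is an equivalence class without a preferred
   representative, so the invariant is collected over all triples representing it; profiles of
   equivalent triples agree, hence so do the collected sets.\<close>
 define J where "J = (\<lambda>c. {\<phi>. \<exists>n F t. F \<in> EM_simplices n \<and> t \<in> \<Delta> n \<and> c = EM_point n F t \<and> \<phi> \<in> profiles F t})"
 have J: "J (EM_point n F t) = profiles F t" if "F \<in> EM_simplices n" "t \<in> \<Delta> n" for n F t
 proof
  show "profiles F t \<subseteq> J (EM_point n F t)" unfolding J_def using that by blast
  show "J (EM_point n F t) \<subseteq> profiles F t"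
  proof
   fix \<phi> assume "\<phi> \<in> J (EM_point n F t)"
   then obtain n1 F1 t1 where 1: "F1 \<in> EM_simplices n1" "t1 \<in> \<Delta> n1"
    "EM_point n F t = EM_point n1 F1 t1" "\<phi> \<in> profiles F1 t1" unfolding J_def by blast
   have "profile F t = profile F1 t1" using profile_EM_point[OF that 1(1,2,3)] .
   thus "\<phi> \<in> profiles F t" using 1(4) unfolding profiles_def by simp
  qed
 qed
 have top: "EM_point n F t \<in> topspace (EM M)" "EM_point n' F' t' \<in> topspace (EM M)"
  unfolding topspace_EM using F F' by blast+
 have "(EM_point n F t, EM_point n' F' t') \<in> generated_equiv (topspace (EM M)) (orbit_rel M)"
  using eq_equiv_class[OF _ equiv_generated_equiv top(2)] eq unfolding orbit_point_def by blast
 hence "J (EM_point n F t) = J (EM_point n' F' t')"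
 proof (rule generated_equiv_invariant[rotated])
  fix x y assume "(x, y) \<in> orbit_rel M"
  then obtain g n F t where xy: "g \<in> Units M" "F \<in> EM_simplices n" "t \<in> \<Delta> n"
   "x = EM_point n F t" "y = unit_action M g x" unfolding orbit_rel_def topspace_EM by blast
  have y: "y = EM_point n (translate n g F) t" using xy unit_action_EM_point by simp
  show "J x = J y" unfolding y xy(4) J[OF xy(2,3)] J[OF translate_closed[OF xy(2) Units_closed[OF xy(1)]] xy(3)]
   by (rule profiles_translate[OF xy(1-3), symmetric])
 qed
 hence "profiles F' t' = profiles F t" using J F F' by simp
 moreover have "profile F' t' \<in> profiles F' t'"
 proof -
  have car: "fst (F' (step t' u, step t' v)) \<in> carrier M" if "0 \<le> u" "u \<le> v" "v < 1" for u v
   using that EM_simplexD(2)[OF F'(1)] EM_simplexD(4)[OF F'(1)] step_mono[OF F'(2) that]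
    step_bounds(1)[OF F'(2), of v] by simp
  have "profile F' t' = (\<lambda>p\<in>{(u, v). 0 \<le> u \<and> u \<le> v \<and> v < 1}. (\<one> \<otimes> fst (profile F' t' p), snd (profile F' t' p)))"
  proof
   fix p :: "real \<times> real"
   show "profile F' t' p = (\<lambda>p\<in>{(u, v). 0 \<le> u \<and> u \<le> v \<and> v < 1}. (\<one> \<otimes> fst (profile F' t' p), snd (profile F' t' p))) p"
   proof (cases "p \<in> {(u, v). 0 \<le> u \<and> u \<le> v \<and> v < 1}")
    case True
    then obtain u v where "p = (u, v)" "0 \<le> u" "u \<le> v" "v < 1" by blast
    thus ?thesis using car[of u v] by (simp add: profile_apply)
   next
    case False
    thus ?thesis unfolding profile_def by (simp only: restrict_def if_False)
   qed
  qed
  thus ?thesis unfolding profiles_def by blast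
 qed
 ultimately obtain g where g: "g \<in> Units M"
  "profile F' t' = (\<lambda>p\<in>{(u, v). 0 \<le> u \<and> u \<le> v \<and> v < 1}. (g \<otimes> fst (profile F t p), snd (profile F t p)))"
  unfolding profiles_def by blast
 show ?thesis
 proof (rule that[OF g(1)])
  fix u v :: real assume uv: "0 \<le> u" "u \<le> v" "v < 1"
  thus "F' (step t' u, step t' v)
    = translate_arrow g (F (step t u, step t v))" using fun_cong[OF g(2), of "(u, v)"] by (simp add: profile_apply)
 qed
qed

lemma step_interior:
 assumes "t \<in> \<Delta> n" "simplex_min n t > 0" "i \<le> n"
 obtains u where "0 \<le> u" "u < 1" "step t u = i"
 using step_surj[OF assms(1,3)] simplex_min_pos_iff[OF assms(1)] assms that by blast

text \<open>For interior \<open>t\<close> every index of the simplex occurs as a value of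
  \<open>step t\<close>, so equality of profiles up to \<open>g\<close> is equality of all arrows up
  to \<open>g\<close>.\<close>

lemma translate_eqI:
 assumes F: "F \<in> EM_simplices n" and F': "F' \<in> EM_simplices n" and t: "t \<in> \<Delta> n" "simplex_min n t > 0"
  and eq: "\<And>u v. [|0 \<le> u; u \<le> v; v < 1|] ==> F' (step t u, step t v)
    = translate_arrow g (F (step t u, step t v))"
 shows "F' = translate n g F"
proof
 fix p
 show "F' p = translate n g F p"
 proof (cases "p \<in> ordinal_pairs n")
  case True
  then obtain i j where p: "p = (i, j)" "i \<le> j" "j \<le> n" by (auto simp: ordinal_pairs_def)
  have ti: "t l > 0" if "l \<le> n" for l using that t simplex_min_pos_iff by blast
  have i: "i \<le> n" using p by simp
  let ?u = "\<Sum>l<i. t l" and ?v = "\<Sum>l<j. t l"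
  have "?u \<le> ?v" using p t(1) by (intro sum_mono2) (auto simp: standard_simplex_def)
  hence "F' (step t ?u, step t ?v)
    = translate_arrow g (F (step t ?u, step t ?v))"
   by (intro eq step_surj(1)[OF t(1) i ti[OF i]] step_surj(2)[OF t(1) p(3) ti[OF p(3)]])
  thus ?thesis using step_surj(3)[OF t(1) i ti[OF i]] step_surj(3)[OF t(1) p(3) ti[OF p(3)]] p by (simp add: translate_apply)
 next
  case False
  thus ?thesis using extensional_arb[OF EM_simplexD(1)[OF F'] False] by (simp add: translate_def)
 qed
qed

section \<open>The cells of the orbit space\<close>

definition orbit_cell :: "nat => (nat \<times> nat => 'm \<times> 'm) => (nat => real) => 'm EM_point set" where
 "orbit_cell n F = restrict (orbit_point n F) (\<Delta> n)"

definition orbit_cells :: "nat => ((nat => real) => 'm EM_point set) set" where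
 "orbit_cells n = {orbit_cell n F | F. F \<in> EM_simplices n \<and> vertex F n \<in> Units M}"

text \<open>An arrow of the category is an identity exactly when its label is 1, so this is
  nondegeneracy in the nerve. The condition is invariant under translation because units act on
  vertices only.\<close>

definition nondegenerate_cells :: "nat => ((nat => real) => 'm EM_point set) set" where
 "nondegenerate_cells n = {orbit_cell n F | F. F \<in> EM_simplices n \<and> vertex F n \<in> Units M \<and>
   (\<forall>i<n. label F i (Suc i) \<noteq> \<one>)}"

lemma continuous_map_orbit_point:
 assumes F: "F \<in> EM_simplices n"
 shows "continuous_map (simplex_top n) (orbit_EM M) (orbit_point n F)"
proof -
 have "continuous_map (simplex_top n) (simplex_sum_topology (nerve (regular_category M))) (\<lambda>t. (n, F, t))"
  unfolding continuous_map_def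
 proof (intro conjI allI impI)
  show "(\<lambda>t. (n, F, t)) \<in> topspace (simplex_top n) \<rightarrow> topspace (simplex_sum_topology (nerve (regular_category M)))"
   using F by (auto simp: topspace_simplex_sum_topology nerve_EM)
  fix U assume "openin (simplex_sum_topology (nerve (regular_category M))) U"
  hence U: "openin (cell_sum (EM_simplices n) n) {x. (n, x) \<in> U}"
   unfolding simplex_sum_topology_def openin_sum_topology nerve_EM cell_sum_def by blast
  have "openin (simplex_top n) {t \<in> topspace (simplex_top n). (F, t) \<in> {x. (n, x) \<in> U}}"
   by (rule openin_continuous_map_preimage[OF continuous_map_Pair_cell_sum[OF F] U])
  thus "openin (simplex_top n) {t \<in> topspace (simplex_top n). (n, F, t) \<in> U}" by simp
 qed
 from continuous_map_compose[OF this quotient_imp_continuous_map[OF quotient_map_orbit_EM]]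
 show ?thesis by (simp add: o_def)
qed

lemma singular_simplex_orbit_cell:
 "F \<in> EM_simplices n ==> singular_simplex n (orbit_EM M) (orbit_cell n F)"
 unfolding singular_simplex_def orbit_cell_def using continuous_map_orbit_point[of F n] by (auto intro: continuous_map_eq)

lemma singular_pull_orbit_cell:
 assumes "F \<in> EM_simplices n" "a \<in> ordinal_maps m n"
 shows "singular_pull m a (orbit_cell n F) = orbit_cell m (EM_pull m a F)"
 using simplex_push_in_simplex[OF assms(2)] orbit_point_pull[OF assms(2,1)]
 by (auto simp: singular_pull_def orbit_cell_def fun_eq_iff)

lemma orbit_cell_translate:
 "[|g \<in> Units M; F \<in> EM_simplices n|] ==> orbit_cell n (translate n g F) = orbit_cell n F"
 unfolding orbit_cell_def by (intro restrict_ext orbit_point_translate)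

lemma vertex_units_or_singular:
 "[|F \<in> EM_simplices n; i \<le> n|] ==> vertex F i \<in> Units M \<or> vertex F i \<in> singular_elements M"
 using EM_simplexD(2) by (auto simp: singular_elements_def)

lemma vertex_singular:
 assumes "F \<in> EM_simplices n" "vertex F n \<in> singular_elements M" "i \<le> n"
 shows "vertex F i \<in> singular_elements M"
 using EM_simplexD(6)[OF assms(1,3)] singular_mult_right[OF assms(2) EM_simplexD(5)[OF assms(1,3)]] by auto

text \<open>The profile at an argument with index \<open>n\<close> shows the last vertex of
  \<open>F\<close> up to a unit, hence a unit, whereas a simplex over \<open>S\<close> has singular
  vertices throughout.\<close>

lemma orbit_point_notin_orbit_SEM:
 assumes F: "F \<in> EM_simplices n" "vertex F n \<in> Units M" and t: "t \<in> \<Delta> n" "simplex_min n t > 0"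
 shows "orbit_point n F t \<notin> orbit_SEM M"
proof
 assume "orbit_point n F t \<in> orbit_SEM M"
 then obtain n' F' t' where F': "F' \<in> EM_simplices n'" "vertex F' n' \<in> singular_elements M" "t' \<in> \<Delta> n'"
  "orbit_point n F t = orbit_point n' F' t'" unfolding orbit_SEM_eq by blast
 obtain g where g: "g \<in> Units M"
  "\<And>u v. [|0 \<le> u; u \<le> v; v < 1|] ==> F' (step t' u, step t' v)
    = translate_arrow g (F (step t u, step t v))" using orbit_point_eqD[OF F(1) t(1) F'(1,3,4)] by metis
 obtain u where u: "0 \<le> u" "u < 1" "step t u = n" using step_interior[OF t order_refl] by metis
 have "vertex F' (step t' u) = g \<otimes> vertex F n" unfolding vertex_def using g(2)[OF u(1) order_refl u(2)] u(3) by simp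
 also have "\<dots> \<in> Units M" using g(1) F(2) by (rule Units_m_closed)
 finally show False using vertex_singular[OF F'(1,2) step_bounds(1)[OF F'(3) u(1,2)]] by (simp add: singular_elements_def)
qed

text \<open>The intervals of a nondegenerate simplex are recovered from labels alone, which
  translation leaves unchanged. All intermediate pairs must be tested, since a product of nontrivial
  labels may be 1.\<close>

lemma step_eq_iff_labels:
 assumes F: "F \<in> EM_simplices n" and nd: "\<And>i. i < n ==> label F i (Suc i) \<noteq> \<one>"
  and t: "t \<in> \<Delta> n" "simplex_min n t > 0" and uv: "0 \<le> u" "u \<le> v" "v < 1"
 shows "step t u = step t v \<longleftrightarrow>
  (\<forall>a b. u \<le> a --> a \<le> b --> b \<le> v --> snd (F (step t a, step t b)) = \<one>)"
proof
 assume eq: "step t u = step t v"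
 show "\<forall>a b. u \<le> a --> a \<le> b --> b \<le> v --> snd (F (step t a, step t b)) = \<one>"
 proof (intro allI impI)
  fix a b assume ab: "u \<le> a" "a \<le> b" "b \<le> v"
  have "step t u \<le> step t a" "step t a \<le> step t b" "step t b \<le> step t v"
   using uv ab by (auto intro!: step_mono[OF t(1)])
  hence "step t a = step t b" using eq by simp
  moreover have "step t b \<le> n" using ab uv by (intro step_bounds(1)[OF t(1)]) auto
  ultimately show "snd (F (step t a, step t b)) = \<one>" using EM_simplexD(3)[OF F] by (simp add: label_def)
 qed
next
 assume triv: "\<forall>a b. u \<le> a --> a \<le> b --> b \<le> v --> snd (F (step t a, step t b)) = \<one>"
 show "step t u = step t v"
 proof (rule ccontr)
  assume ne: "step t u \<noteq> step t v"
  let ?i = "step t u"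
  have lt: "?i < step t v" using ne step_mono[OF t(1) uv] by simp
  have vn: "step t v \<le> n" using uv by (intro step_bounds(1)[OF t(1)]) auto
  have Sn: "Suc ?i \<le> n" using lt vn by simp
  \<comment> \<open>The left end of the next interval: the pair of \<open>u\<close> and
    \<open>?b\<close> exhibits the label between two consecutive vertices, which is not 1.\<close>
  let ?b = "\<Sum>j<Suc ?i. t j"
  have ti: "t (Suc ?i) > 0" using Sn t simplex_min_pos_iff by blast
  have sb: "step t ?b = Suc ?i" by (rule step_surj(3)[OF t(1) Sn ti])
  have ub: "u \<le> ?b" using step_less[OF t Sn uv(1)] uv by simp
  have bv: "?b \<le> v"
  proof -
   have "?b \<le> (\<Sum>j<step t v. t j)" using lt t(1) by (intro sum_mono2) (auto simp: standard_simplex_def)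
   also have "\<dots> \<le> v" using uv by (intro step_bounds(3)[OF t(1)]) auto
   finally show ?thesis .
  qed
  have "label F ?i (Suc ?i) = \<one>"  using triv[rule_format, OF order_refl ub bv] unfolding sb label_def .
  thus False using nd[of ?i] Sn by simp
 qed
qed

text \<open>Equal orbit points have equal labels at all arguments, hence equal intervals and equal
  coordinates; the simplices then differ by translation with a unit.\<close>

lemma nondegenerate_cell_inj:
 assumes F: "F \<in> EM_simplices n" "\<And>i. i < n ==> label F i (Suc i) \<noteq> \<one>"
  and F': "F' \<in> EM_simplices m" "\<And>i. i < m ==> label F' i (Suc i) \<noteq> \<one>"
  and t: "t \<in> \<Delta> n" "simplex_min n t > 0" and t': "t' \<in> \<Delta> m" "simplex_min m t' > 0"
  and eq: "orbit_point n F t = orbit_point m F' t'"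
 shows "n = m" "t = t'" "orbit_cell n F = orbit_cell m F'"
proof -
 obtain g where g: "g \<in> Units M"
  "\<And>u v. [|0 \<le> u; u \<le> v; v < 1|] ==> F' (step t' u, step t' v)
    = translate_arrow g (F (step t u, step t v))" using orbit_point_eqD[OF F(1) t(1) F'(1) t'(1) eq] by metis
 have fib: "step t' u = step t' v \<longleftrightarrow> step t u = step t v" if uv: "0 \<le> u" "u \<le> v" "v < 1" for u v
 proof -
  have "snd (F' (step t' a, step t' b)) = snd (F (step t a, step t b))"
   if "u \<le> a" "a \<le> b" "b \<le> v" for a b using g(2)[of a b] that uv by simp
  thus ?thesis using step_eq_iff_labels[OF F t uv] step_eq_iff_labels[OF F' t' uv] by metis
 qed
 show nm: "n = m" and tt: "t = t'" using step_determines[OF t t' fib] by blast+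
 have "F' = translate n g F" by (rule translate_eqI[OF F(1) _ t]) (use F'(1) nm tt g(2) in auto)
 thus "orbit_cell n F = orbit_cell m F'" using orbit_cell_translate[OF g(1) F(1)] nm by simp
qed

lemma orbit_cell_eqD:
 assumes F: "F \<in> EM_simplices n" and F': "F' \<in> EM_simplices n" and eq: "orbit_cell n F = orbit_cell n F'"
 obtains g where "g \<in> Units M" "F' = translate n g F"
proof -
 obtain t where t: "t \<in> \<Delta> n" "simplex_min n t > 0" by (rule standard_simplex_interior)
 have "orbit_point n F t = orbit_point n F' t" using fun_cong[OF eq, of t] t(1) by (simp add: orbit_cell_def)
 then obtain g where g: "g \<in> Units M"
  "\<And>u v. [|0 \<le> u; u \<le> v; v < 1|] ==> F' (step t u, step t v)
    = translate_arrow g (F (step t u, step t v))" using orbit_point_eqD[OF F t(1) F' t(1)] by metis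
 thus ?thesis using that translate_eqI[OF F F' t] by blast
qed

lemma closedin_orbit_EM:
 assumes C: "C \<subseteq> topspace (orbit_EM M)"
  and cl: "\<And>n F. F \<in> EM_simplices n ==> closedin (simplex_top n) {t \<in> \<Delta> n. orbit_point n F t \<in> C}"
 shows "closedin (orbit_EM M) C"
proof -
 let ?S = "simplex_sum_topology (nerve (regular_category M))"
 let ?q = "\<lambda>(n, F, t). orbit_point n F t"
 let ?P = "{p \<in> topspace ?S. ?q p \<in> C}"
 have "openin ?S (topspace ?S - ?P)"
  unfolding simplex_sum_topology_def[of "nerve (regular_category M)"] openin_sum_topology cell_sum_def[symmetric]
 proof (intro conjI ballI)
  show "topspace (sum_topology (\<lambda>n. cell_sum (simplices (nerve (regular_category M)) n) n) UNIV)
    - {p \<in> topspace (sum_topology (\<lambda>n. cell_sum (simplices (nerve (regular_category M)) n) n) UNIV). ?q p \<in> C}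
    \<subseteq> Sigma UNIV (topspace \<circ> (\<lambda>n. cell_sum (simplices (nerve (regular_category M)) n) n))" by auto
  fix n :: nat
  have "openin (simplex_top n) (topspace (simplex_top n) - {t \<in> \<Delta> n. orbit_point n F t \<in> C})"
   if "F \<in> EM_simplices n" for F using cl[OF that] by (intro openin_diff openin_topspace)
  thus "openin (cell_sum (simplices (nerve (regular_category M)) n) n) {x. (n, x) \<in>
    topspace (sum_topology (\<lambda>n. cell_sum (simplices (nerve (regular_category M)) n) n) UNIV)
    - {p \<in> topspace (sum_topology (\<lambda>n. cell_sum (simplices (nerve (regular_category M)) n) n) UNIV). ?q p \<in> C}}"
   unfolding openin_cell_sum nerve_EM by (auto simp: set_diff_eq elim!: back_subst[of "openin (simplex_top n)"])
 qed
 thus ?thesis using quotient_map_orbit_EM C unfolding quotient_map_closedin by (auto simp: closedin_def case_prod_unfold)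
qed

lemma simplicial_cells_orbit_EM:
 "simplicial_cells (orbit_EM M) (orbit_SEM M) orbit_cells nondegenerate_cells"
proof
 show "orbit_SEM M \<subseteq> topspace (orbit_EM M)" unfolding orbit_SEM_eq topspace_orbit_EM by blast
 show "singular_simplex n (orbit_EM M) s" if "s \<in> orbit_cells n" for n s
  using that singular_simplex_orbit_cell unfolding orbit_cells_def by blast
 show "nondegenerate_cells n \<subseteq> orbit_cells n" for n unfolding nondegenerate_cells_def orbit_cells_def by blast
 show "singular_pull m f s \<in> orbit_cells m \<or> singular_pull m f s ` \<Delta> m \<subseteq> orbit_SEM M"
  if s: "s \<in> orbit_cells n" and f: "f \<in> ordinal_maps m n" for m n s f
 proof -
  obtain F where F: "F \<in> EM_simplices n" "s = orbit_cell n F" using s unfolding orbit_cells_def by blast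
  have P: "EM_pull m f F \<in> EM_simplices m" by (rule EM_pull_closed[OF F(1) f])
  from vertex_units_or_singular[OF P order_refl] show ?thesis unfolding F(2) singular_pull_orbit_cell[OF F(1) f]
   using P by (auto simp: orbit_cell_def orbit_cells_def orbit_SEM_eq)
 qed
 show "\<exists>m<n. \<exists>s'\<in>orbit_cells m. \<exists>f\<in>ordinal_maps n m. s = singular_pull n f s'"
  if s: "s \<in> orbit_cells n" "s \<notin> nondegenerate_cells n" for n s
 proof -
  obtain F where F: "F \<in> EM_simplices n" "vertex F n \<in> Units M" "s = orbit_cell n F"
   using s(1) unfolding orbit_cells_def by blast
  then obtain i where i: "i < n" "label F i (Suc i) = \<one>" using s(2) unfolding nondegenerate_cells_def by blast
  then obtain n' where n': "n = Suc n'" by (cases n) auto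
  let ?\<sigma> = "codegeneracy i" and ?\<delta> = "coface (Suc i)"
  have \<sigma>: "?\<sigma> \<in> ordinal_maps n n'" unfolding n' using i n' by (intro codegeneracy_in_ordinal_maps) simp
  have \<delta>: "?\<delta> \<in> ordinal_maps n' n" unfolding n' by (rule coface_in_ordinal_maps)
  \<comment> \<open>Deleting vertex \<open>Suc i\<close> and repeating vertex \<open>i\<close> only
    redirects \<open>Suc i\<close> to \<open>i\<close>. As the label between them is 1, this changes
    no arrow of \<open>F\<close>.\<close>
  have \<delta>\<sigma>: "?\<delta> (?\<sigma> j) = (if j = Suc i then i else j)" for j by (auto simp: coface_def codegeneracy_def)
  have vi: "vertex F i = vertex F (Suc i)"
   using EM_simplexD(2)[OF F(1), of "Suc i"] EM_simplexD(6)[OF F(1), of i "Suc i"] i by simp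
  have eq: "F (?\<delta> (?\<sigma> a), ?\<delta> (?\<sigma> b)) = F (a, b)" if ab: "a \<le> b" "b \<le> n" for a b
  proof -
   have c: "label F a b = label F (?\<delta> (?\<sigma> a)) (?\<delta> (?\<sigma> b))"
   proof -
    consider "a = Suc i" "b = Suc i" | "a = Suc i" "b > Suc i" | "b = Suc i" "a \<le> i" | "a \<noteq> Suc i" "b \<noteq> Suc i"
     using ab by linarith
    thus ?thesis
    proof cases
     case 1
     thus ?thesis using EM_simplexD(3)[OF F(1)] i by (simp add: \<delta>\<sigma>)
    next
     case 2
     thus ?thesis
      using EM_simplexD(7)[OF F(1), of i "Suc i" b] EM_simplexD(5)[OF F(1), of "Suc i" b] i ab by (simp add: \<delta>\<sigma>)
    next
     case 3
     thus ?thesis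
      using EM_simplexD(7)[OF F(1), of a i "Suc i"] EM_simplexD(5)[OF F(1), of a i] i ab by (simp add: \<delta>\<sigma>)
    qed (simp add: \<delta>\<sigma>)
   qed
   have le: "?\<delta> (?\<sigma> a) \<le> ?\<delta> (?\<sigma> b)" "?\<delta> (?\<sigma> b) \<le> n" using ab by (auto simp: \<delta>\<sigma>)
   show ?thesis using EM_simplexD(4)[OF F(1) le] EM_simplexD(4)[OF F(1) ab] c vi by (auto simp: \<delta>\<sigma>)
  qed
  have P: "EM_pull n' ?\<delta> F \<in> EM_simplices n'" by (rule EM_pull_closed[OF F(1) \<delta>])
  have "EM_pull n ?\<sigma> (EM_pull n' ?\<delta> F) = F"
  proof
   fix p
   show "EM_pull n ?\<sigma> (EM_pull n' ?\<delta> F) p = F p"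
   proof (cases "p \<in> ordinal_pairs n")
    case True
    then obtain a b where p: "p = (a, b)" "a \<le> b" "b \<le> n" by (auto simp: ordinal_pairs_def)
    thus ?thesis using ordinal_maps_mono[OF \<sigma> p(2,3)] ordinal_maps_le[OF \<sigma> p(3)] eq[OF p(2,3)]
     by (simp add: EM_pull_apply)
   next
    case False
    thus ?thesis using extensional_arb[OF EM_simplexD(1)[OF F(1)] False] by (simp add: EM_pull_def)
   qed
  qed
  hence "s = singular_pull n ?\<sigma> (orbit_cell n' (EM_pull n' ?\<delta> F))"
   unfolding F(3) singular_pull_orbit_cell[OF P \<sigma>] by simp
  moreover have "orbit_cell n' (EM_pull n' ?\<delta> F) \<in> orbit_cells n'"
  proof -
   \<comment> \<open>The deleted vertex may be the last one; then vertex \<open>i\<close>, which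
     equals it, takes over, and the unit condition persists.\<close>
   have "vertex (EM_pull n' ?\<delta> F) n' = vertex F n"
   proof (cases "Suc i \<le> n'")
    case True
    thus ?thesis by (simp add: EM_pull_vertex coface_def n')
   next
    case False
    hence "i = n'" using i n' by simp
    thus ?thesis using vi by (simp add: EM_pull_vertex coface_def n')
   qed
   thus ?thesis unfolding orbit_cells_def using P F(2) by force
  qed
  ultimately show ?thesis using \<sigma> n' by blast
 qed
 show "n = m \<and> s = s' \<and> t = t'"
  if s: "s \<in> nondegenerate_cells n" and s': "s' \<in> nondegenerate_cells m"
   and t: "t \<in> \<Delta> n" "0 < simplex_min n t"
   and t': "t' \<in> \<Delta> m" "0 < simplex_min m t'" and eq: "s t = s' t'" for s n s' m t t'
 proof -
  obtain F where F: "F \<in> EM_simplices n" "\<And>i. i < n ==> label F i (Suc i) \<noteq> \<one>" "s = orbit_cell n F"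
   using s unfolding nondegenerate_cells_def by blast
  obtain F' where F': "F' \<in> EM_simplices m" "\<And>i. i < m ==> label F' i (Suc i) \<noteq> \<one>" "s' = orbit_cell m F'"
   using s' unfolding nondegenerate_cells_def by blast
  have "orbit_point n F t = orbit_point m F' t'" using eq t(1) t'(1) by (simp add: F(3) F'(3) orbit_cell_def)
  thus ?thesis using nondegenerate_cell_inj[OF F(1,2) F'(1,2) t t'] by (simp add: F(3) F'(3))
 qed
 show "s t \<notin> orbit_SEM M"
  if s: "s \<in> nondegenerate_cells n" and t: "t \<in> \<Delta> n" "0 < simplex_min n t" for s n t
  using s orbit_point_notin_orbit_SEM t by (auto simp: orbit_cell_def nondegenerate_cells_def)
 show "\<exists>n. \<exists>s\<in>orbit_cells n. \<exists>t\<in>\<Delta> n. x = s t" if x: "x \<in> topspace (orbit_EM M) - orbit_SEM M" for x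
 proof -
  obtain n F t where F: "F \<in> EM_simplices n" "t \<in> \<Delta> n" "x = orbit_point n F t"
   using x unfolding topspace_orbit_EM by blast
  have "vertex F n \<notin> singular_elements M" using x F unfolding orbit_SEM_eq by blast
  hence "orbit_cell n F \<in> orbit_cells n"
   using vertex_units_or_singular[OF F(1) order_refl] F(1) unfolding orbit_cells_def by blast
  moreover have "x = orbit_cell n F t" using F by (simp add: orbit_cell_def)
  ultimately show ?thesis using F(2) by blast
 qed
 show "closedin (orbit_EM M) C"
  if C: "C \<subseteq> topspace (orbit_EM M)" and CA: "closedin (subtopology (orbit_EM M) (orbit_SEM M)) (C \<inter> orbit_SEM M)"
   and cl: "\<And>n s. s \<in> orbit_cells n ==> closedin (simplex_top n) {t \<in> \<Delta> n. s t \<in> C}" for C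
 proof (rule closedin_orbit_EM[OF C])
  fix n F assume F: "F \<in> EM_simplices n"
  from vertex_units_or_singular[OF F order_refl]
  show "closedin (simplex_top n) {t \<in> \<Delta> n. orbit_point n F t \<in> C}"
  proof
   assume "vertex F n \<in> Units M"
   hence "orbit_cell n F \<in> orbit_cells n" using F unfolding orbit_cells_def by blast
   moreover have "{t \<in> \<Delta> n. orbit_point n F t \<in> C} = {t \<in> \<Delta> n. orbit_cell n F t \<in> C}"
    by (auto simp: orbit_cell_def)
   ultimately show ?thesis using cl by simp
  next
   assume v: "vertex F n \<in> singular_elements M"
   have im: "orbit_point n F t \<in> orbit_SEM M" if "t \<in> \<Delta> n" for t unfolding orbit_SEM_eq using F v that by blast
   hence "continuous_map (simplex_top n) (subtopology (orbit_EM M) (orbit_SEM M)) (orbit_point n F)"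
    using continuous_map_orbit_point[OF F] unfolding continuous_map_in_subtopology by auto
   hence "closedin (simplex_top n) {t \<in> topspace (simplex_top n). orbit_point n F t \<in> C \<inter> orbit_SEM M}"
    using CA by (rule closedin_continuous_map_preimage)
   also have "{t \<in> topspace (simplex_top n). orbit_point n F t \<in> C \<inter> orbit_SEM M}
     = {t \<in> \<Delta> n. orbit_point n F t \<in> C}" using im by auto
   finally show ?thesis .
  qed
 qed
qed

end

section \<open>Modules and cohomology of cochain complexes\<close>

lemma linearD:
 assumes "f \<in> linear_maps R A B"
 shows "x \<in> carrier A ==> f x \<in> carrier B"
  and "[|x \<in> carrier A; y \<in> carrier A|] ==> f (x \<oplus>\<^bsub>A\<^esub> y) = f x \<oplus>\<^bsub>B\<^esub> f y"
  and "[|r \<in> carrier R; x \<in> carrier A|] ==> f (r \<odot>\<^bsub>A\<^esub> x) = r \<odot>\<^bsub>B\<^esub> f x"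
 using assms by (auto simp: linear_maps_def)

lemma linearI:
 assumes "\<And>x. x \<in> carrier A ==> f x \<in> carrier B"
  and "\<And>x y. [|x \<in> carrier A; y \<in> carrier A|] ==> f (x \<oplus>\<^bsub>A\<^esub> y) = f x \<oplus>\<^bsub>B\<^esub> f y"
  and "\<And>r x. [|r \<in> carrier R; x \<in> carrier A|] ==> f (r \<odot>\<^bsub>A\<^esub> x) = r \<odot>\<^bsub>B\<^esub> f x"
 shows "f \<in> linear_maps R A B" using assms by (auto simp: linear_maps_def)

lemma linear_maps_compose:
 assumes "f \<in> linear_maps R A B" "g \<in> linear_maps R B C"
 shows "(\<lambda>x. g (f x)) \<in> linear_maps R A C" using linearD[OF assms(1)] linearD[OF assms(2)] by (intro linearI) auto

text \<open>Additivity alone is assumed, because this is also applied to scalar multiplication in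
  either argument and to the contraction of the bar resolution, which is not linear over the monoid
  algebra.\<close>

lemma additive_map_zero:
 assumes A: "abelian_group A" and B: "abelian_group B"
  and f: "f \<in> carrier A \<rightarrow> carrier B" "\<And>x y. [|x \<in> carrier A; y \<in> carrier A|] ==> f (x \<oplus>\<^bsub>A\<^esub> y) = f x \<oplus>\<^bsub>B\<^esub> f y"
 shows "f \<zero>\<^bsub>A\<^esub> = \<zero>\<^bsub>B\<^esub>"
proof -
 interpret A: abelian_group A by fact
 interpret B: abelian_group B by fact
 have c: "f \<zero>\<^bsub>A\<^esub> \<in> carrier B" using f(1) by auto
 show ?thesis using f(2)[of "\<zero>\<^bsub>A\<^esub>" "\<zero>\<^bsub>A\<^esub>"] c by simp
qed

lemma additive_map_minus:
 assumes A: "abelian_group A" and B: "abelian_group B"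
  and f: "f \<in> carrier A \<rightarrow> carrier B" "\<And>x y. [|x \<in> carrier A; y \<in> carrier A|] ==> f (x \<oplus>\<^bsub>A\<^esub> y) = f x \<oplus>\<^bsub>B\<^esub> f y"
  and x: "x \<in> carrier A"
 shows "f (\<ominus>\<^bsub>A\<^esub> x) = \<ominus>\<^bsub>B\<^esub> f x"
proof -
 interpret A: abelian_group A by fact
 interpret B: abelian_group B by fact
 have "f (\<ominus>\<^bsub>A\<^esub> x) \<oplus>\<^bsub>B\<^esub> f x = \<zero>\<^bsub>B\<^esub>"
  using f(2)[of "\<ominus>\<^bsub>A\<^esub> x" x] x additive_map_zero[OF A B f] by (simp add: A.l_neg)
 thus ?thesis using f(1) x by (intro B.minus_equality[symmetric]) auto
qed

lemma additive_map_finsum: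
 assumes A: "abelian_group A" and B: "abelian_group B"
  and f: "f \<in> carrier A \<rightarrow> carrier B" "\<And>x y. [|x \<in> carrier A; y \<in> carrier A|] ==> f (x \<oplus>\<^bsub>A\<^esub> y) = f x \<oplus>\<^bsub>B\<^esub> f y"
  and g: "g \<in> I \<rightarrow> carrier A"
 shows "f (finsum A g I) = finsum B (\<lambda>i. f (g i)) I"
proof -
 interpret A: abelian_group A by fact
 interpret B: abelian_group B by fact
 show ?thesis using g
 proof (induction I rule: infinite_finite_induct)
  case (infinite I)
  thus ?case by (simp add: A.finsum_infinite B.finsum_infinite additive_map_zero[OF A B f])
 next
  case empty
  thus ?case by (simp add: additive_map_zero[OF A B f])
 next
  case (insert i I)
  hence gi: "g i \<in> carrier A" "g \<in> I \<rightarrow> carrier A" by auto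
  hence "f (g i) \<in> carrier B" "(\<lambda>i. f (g i)) \<in> I \<rightarrow> carrier B" using f(1) by auto
  thus ?case using insert gi f(2) by simp
 qed
qed

text \<open>A common source for the group structure of free modules, modules of linear maps and
  relative cochains, all of which are extensional functions added pointwise.\<close>

lemma abelian_group_pointwise:
 assumes N: "abelian_group N" and sub: "carrier H \<subseteq> I \<rightarrow>\<^sub>E carrier N"
  and add: "\<And>f g. f \<oplus>\<^bsub>H\<^esub> g = (\<lambda>i\<in>I. f i \<oplus>\<^bsub>N\<^esub> g i)" and zero: "\<zero>\<^bsub>H\<^esub> = (\<lambda>i\<in>I. \<zero>\<^bsub>N\<^esub>)"
  and closed: "\<And>f g. [|f \<in> carrier H; g \<in> carrier H|] ==> (\<lambda>i\<in>I. f i \<oplus>\<^bsub>N\<^esub> g i) \<in> carrier H"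
   "(\<lambda>i\<in>I. \<zero>\<^bsub>N\<^esub>) \<in> carrier H" "\<And>f. f \<in> carrier H ==> (\<lambda>i\<in>I. \<ominus>\<^bsub>N\<^esub> f i) \<in> carrier H"
 shows "abelian_group H"
  and "[|f \<in> carrier H; g \<in> carrier H; i \<in> I|] ==> (f \<ominus>\<^bsub>H\<^esub> g) i = f i \<ominus>\<^bsub>N\<^esub> g i"
proof -
 interpret N: abelian_group N by fact
 have c: "f i \<in> carrier N" if "f \<in> carrier H" "i \<in> I" for f i using that sub by auto
 have neg: "(\<lambda>i\<in>I. \<ominus>\<^bsub>N\<^esub> f i) \<oplus>\<^bsub>H\<^esub> f = \<zero>\<^bsub>H\<^esub>" if "f \<in> carrier H" for f
  unfolding add zero by (rule restrict_ext) (simp add: c[OF that] N.l_neg)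
 show H: "abelian_group H"
 proof (rule abelian_groupI)
  fix f assume f: "f \<in> carrier H"
  have "f \<in> extensional I" using subsetD[OF sub f] by (simp add: PiE_def)
  thus "\<zero>\<^bsub>H\<^esub> \<oplus>\<^bsub>H\<^esub> f = f" unfolding add zero by (intro extensionalityI[of _ I]) (auto simp: c[OF f])
  show "\<exists>g\<in>carrier H. g \<oplus>\<^bsub>H\<^esub> f = \<zero>\<^bsub>H\<^esub>" using closed(3)[OF f] neg[OF f] by blast
  fix g assume g: "g \<in> carrier H"
  show "f \<oplus>\<^bsub>H\<^esub> g \<in> carrier H" unfolding add by (rule closed(1)[OF f g])
  show "f \<oplus>\<^bsub>H\<^esub> g = g \<oplus>\<^bsub>H\<^esub> f"
   unfolding add by (rule restrict_ext) (simp add: c[OF f] c[OF g] N.a_comm)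
  fix h assume h: "h \<in> carrier H"
  show "f \<oplus>\<^bsub>H\<^esub> g \<oplus>\<^bsub>H\<^esub> h = f \<oplus>\<^bsub>H\<^esub> (g \<oplus>\<^bsub>H\<^esub> h)"
   unfolding add by (rule restrict_ext) (simp add: c[OF f] c[OF g] c[OF h] N.a_assoc)
 qed (simp add: zero closed(2))
 interpret H: abelian_group H by fact
 assume f: "f \<in> carrier H" and g: "g \<in> carrier H" and i: "i \<in> I"
 have "\<ominus>\<^bsub>H\<^esub> g = (\<lambda>i\<in>I. \<ominus>\<^bsub>N\<^esub> g i)" by (rule H.minus_equality[OF neg[OF g] g closed(3)[OF g]])
 thus "(f \<ominus>\<^bsub>H\<^esub> g) i = f i \<ominus>\<^bsub>N\<^esub> g i" using i by (simp add: a_minus_def add)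
qed

lemma linear_maps_zero:
 "[|abelian_group A; abelian_group B; f \<in> linear_maps R A B|] ==> f \<zero>\<^bsub>A\<^esub> = \<zero>\<^bsub>B\<^esub>"
 using additive_map_zero[of A B f] linearD[of f R A B] by auto

lemma linear_maps_minus:
 "[|abelian_group A; abelian_group B; f \<in> linear_maps R A B; x \<in> carrier A|] ==> f (\<ominus>\<^bsub>A\<^esub> x) = \<ominus>\<^bsub>B\<^esub> f x"
 using additive_map_minus[of A B f x] linearD[of f R A B] by auto

lemma linear_maps_diff:
 assumes "abelian_group A" "abelian_group B" "f \<in> linear_maps R A B" "x \<in> carrier A" "y \<in> carrier A"
 shows "f (x \<ominus>\<^bsub>A\<^esub> y) = f x \<ominus>\<^bsub>B\<^esub> f y"
 using linearD(2)[OF assms(3,4)] linear_maps_minus[OF assms(1-3,5)]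
  abelian_group.a_inv_closed[OF assms(1,5)] by (simp add: a_minus_def)

lemma linear_maps_finsum:
 "[|abelian_group A; abelian_group B; f \<in> linear_maps R A B; g \<in> I \<rightarrow> carrier A|]
   ==> f (finsum A g I) = finsum B (\<lambda>i. f (g i)) I"
 using additive_map_finsum[of A B f g I] linearD[of f R A B] by auto

context left_module
begin

lemma smult_r_zero: "a \<in> carrier R ==> a \<odot>\<^bsub>M\<^esub> \<zero>\<^bsub>M\<^esub> = \<zero>\<^bsub>M\<^esub>"
 by (rule additive_map_zero[OF M.abelian_group_axioms M.abelian_group_axioms])
  (auto simp: smult_closed smult_r_distr)

lemma smult_r_minus: "[|a \<in> carrier R; x \<in> carrier M|] ==> a \<odot>\<^bsub>M\<^esub> (\<ominus>\<^bsub>M\<^esub> x) = \<ominus>\<^bsub>M\<^esub> (a \<odot>\<^bsub>M\<^esub> x)"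
 by (rule additive_map_minus[OF M.abelian_group_axioms M.abelian_group_axioms])
  (auto simp: smult_closed smult_r_distr)

lemma smult_r_finsum:
 "[|a \<in> carrier R; g \<in> I \<rightarrow> carrier M|] ==> a \<odot>\<^bsub>M\<^esub> finsum M g I = (\<Oplus>\<^bsub>M\<^esub>i\<in>I. a \<odot>\<^bsub>M\<^esub> g i)"
 by (rule additive_map_finsum[OF M.abelian_group_axioms M.abelian_group_axioms])
  (auto simp: smult_closed smult_r_distr)

lemma smult_l_zero: "x \<in> carrier M ==> \<zero>\<^bsub>R\<^esub> \<odot>\<^bsub>M\<^esub> x = \<zero>\<^bsub>M\<^esub>"
 by (rule additive_map_zero[OF R.is_abelian_group M.abelian_group_axioms, of "\<lambda>a. a \<odot>\<^bsub>M\<^esub> x"])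
  (auto simp: smult_closed smult_l_distr)

end

section \<open>Free and projective modules\<close>

lemma (in abelian_monoid) finsum_mono_neutral:
 assumes "finite J" "I \<subseteq> J" "g \<in> I \<rightarrow> carrier G" "\<And>i. i \<in> J - I ==> g i = \<zero>\<^bsub>G\<^esub>"
 shows "finsum G g I = finsum G g J" by (rule add.finprod_mono_neutral_cong_left) (use assms in auto)

definition basis_vector :: "('r, 'x) ring_scheme => 'i set => 'i => 'r => 'i => 'r" where
 "basis_vector R I i r = (\<lambda>j\<in>I. if j = i then r else \<zero>\<^bsub>R\<^esub>)"

definition free_extend :: "('r, 'x) ring_scheme => 'i set => ('r, 'a, 'y) module_scheme => ('i => 'a) => ('i => 'r) => 'a" where
 "free_extend R I N \<phi> f = (\<Oplus>\<^bsub>N\<^esub>i\<in>support_in R I f. f i \<odot>\<^bsub>N\<^esub> \<phi> i)"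

lemma free_module_simps [simp]:
 "carrier (free_module R I) = fin_supp_funs R I"
 "\<zero>\<^bsub>free_module R I\<^esub> = (\<lambda>i\<in>I. \<zero>\<^bsub>R\<^esub>)"
 "f \<oplus>\<^bsub>free_module R I\<^esub> g = (\<lambda>i\<in>I. f i \<oplus>\<^bsub>R\<^esub> g i)"
 "r \<odot>\<^bsub>free_module R I\<^esub> f = (\<lambda>i\<in>I. r \<otimes>\<^bsub>R\<^esub> f i)"
 by (simp_all add: free_module_def)

lemma fin_supp_funsD:
 assumes "f \<in> fin_supp_funs R I"
 shows "i \<in> I ==> f i \<in> carrier R" "finite (support_in R I f)" "f \<in> extensional I"
 using assms by (auto simp: fin_supp_funs_def PiE_def)

lemma fin_supp_funsI:
 assumes "\<And>i. i \<in> I ==> f i \<in> carrier R" "f \<in> extensional I" "finite J" "\<And>i. [|i \<in> I; i \<notin> J|] ==> f i = \<zero>\<^bsub>R\<^esub>"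
 shows "f \<in> fin_supp_funs R I"
proof -
 have "support_in R I f \<subseteq> J" using assms(4) by (auto simp: support_in_def)
 thus ?thesis using assms finite_subset by (auto simp: fin_supp_funs_def PiE_def)
qed

lemma fin_supp_funs_eqI:
 "[|f \<in> fin_supp_funs R I; g \<in> fin_supp_funs R I; \<And>i. i \<in> I ==> f i = g i|] ==> f = g"
 using fin_supp_funsD(3)[of f R I] fin_supp_funsD(3)[of g R I] extensionalityI[of f I g] by blast

context ring
begin

lemma basis_vector_closed: "r \<in> carrier R ==> basis_vector R I i r \<in> fin_supp_funs R I"
 by (rule fin_supp_funsI[of _ _ _ "{i}"]) (auto simp: basis_vector_def)

lemma zero_fun_closed: "(\<lambda>i\<in>I. \<zero>) \<in> fin_supp_funs R I" by (rule fin_supp_funsI[of _ _ _ "{}"]) auto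

lemma add_fun_closed:
 assumes "f \<in> fin_supp_funs R I" "g \<in> fin_supp_funs R I"
 shows "(\<lambda>i\<in>I. f i \<oplus> g i) \<in> fin_supp_funs R I"
 by (rule fin_supp_funsI[of _ _ _ "support_in R I f \<union> support_in R I g"])
  (use fin_supp_funsD[OF assms(1)] fin_supp_funsD[OF assms(2)] in \<open>auto simp: support_in_def\<close>)

lemma smult_fun_closed:
 assumes "r \<in> carrier R" "f \<in> fin_supp_funs R I"
 shows "(\<lambda>i\<in>I. r \<otimes> f i) \<in> fin_supp_funs R I" by (rule fin_supp_funsI[of _ _ _ "support_in R I f"])
  (use fin_supp_funsD[OF assms(2)] assms(1) in \<open>auto simp: support_in_def\<close>)

lemma minus_fun_closed:
 assumes "f \<in> fin_supp_funs R I"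
 shows "(\<lambda>i\<in>I. \<ominus> f i) \<in> fin_supp_funs R I" by (rule fin_supp_funsI[of _ _ _ "support_in R I f"])
  (use fin_supp_funsD[OF assms] in \<open>auto simp: support_in_def\<close>)

lemma abelian_group_free_module: "abelian_group (free_module R I)"
proof (rule abelian_group_pointwise(1)[OF is_abelian_group, of _ I])
 show "carrier (free_module R I) \<subseteq> I \<rightarrow>\<^sub>E carrier R" by (auto simp: fin_supp_funs_def)
qed (auto simp: add_fun_closed zero_fun_closed minus_fun_closed)

lemma left_module_free_module: "left_module R (free_module R I)"
proof -
 have one: "\<one> \<odot>\<^bsub>free_module R I\<^esub> x = x" if x: "x \<in> carrier (free_module R I)" for x
 proof (rule extensionalityI[of _ I])
  have x': "x \<in> fin_supp_funs R I" using x by simp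
  show "x \<in> extensional I" by (rule fin_supp_funsD(3)[OF x'])
  show "(\<one> \<odot>\<^bsub>free_module R I\<^esub> x) i = x i" if "i \<in> I" for i
   using fin_supp_funsD(1)[OF x' that] that by simp
 qed simp
 show ?thesis using smult_fun_closed
  by (intro left_module.intro[OF ring_axioms abelian_group_free_module left_module_axioms.intro] one; auto simp: fin_supp_funsD l_distr r_distr m_assoc)
qed

lemma fin_supp_funs_induct [consumes 1, case_names zero add basis]:
 assumes f: "f \<in> fin_supp_funs R I"
  and zero: "P (\<lambda>i\<in>I. \<zero>)"
  and add: "\<And>f g. [|f \<in> fin_supp_funs R I; g \<in> fin_supp_funs R I; P f; P g|] ==> P (\<lambda>i\<in>I. f i \<oplus> g i)"
  and basis: "\<And>i r. [|i \<in> I; r \<in> carrier R|] ==> P (basis_vector R I i r)"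
 shows "P f"
proof -
 have "finite J ==> (\<And>f. f \<in> fin_supp_funs R I ==> support_in R I f \<subseteq> J ==> P f)" for J
 proof (induction J rule: finite_induct)
  case empty
  hence "f = (\<lambda>i\<in>I. \<zero>)" by (intro fin_supp_funs_eqI[OF empty(1) zero_fun_closed]) (auto simp: support_in_def)
  thus ?case using zero by (simp only:)
 next
  case (insert j J)
  show ?case
  proof (cases "j \<in> I")
   case True
   let ?g = "\<lambda>i\<in>I. if i = j then \<zero> else f i"
   have g: "?g \<in> fin_supp_funs R I" by (rule fin_supp_funsI[of _ _ _ "support_in R I f"])
     (use fin_supp_funsD[OF insert(4)] in \<open>auto simp: support_in_def\<close>)
   have "support_in R I ?g \<subseteq> J" using insert(5) by (auto simp: support_in_def split: if_splits)
   hence "P ?g" using insert(3) g by blast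
   moreover have "P (basis_vector R I j (f j))" using basis[OF True] fin_supp_funsD(1)[OF insert(4) True] by blast
   ultimately have "P (\<lambda>i\<in>I. ?g i \<oplus> basis_vector R I j (f j) i)"
    using add[OF g basis_vector_closed] fin_supp_funsD(1)[OF insert(4) True] by blast
   moreover have "(\<lambda>i\<in>I. ?g i \<oplus> basis_vector R I j (f j) i) = f" by (rule extensionalityI[of _ I])
     (use fin_supp_funsD[OF insert(4)] in \<open>auto simp: basis_vector_def\<close>)
   ultimately show ?thesis by simp
  next
   case False
   hence "support_in R I f \<subseteq> J" using insert(5) by (auto simp: support_in_def)
   thus ?thesis using insert by blast
  qed
 qed
 thus ?thesis using fin_supp_funsD(2)[OF f] f by blast
qed

end

context left_module
begin

text \<open>The support of a sum can be smaller than the union of the supports, so sums over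
  different supports are compared over a common finite set.\<close>

lemma free_extend_superset:
 assumes f: "f \<in> fin_supp_funs R I" and \<phi>: "\<phi> \<in> I \<rightarrow> carrier M"
  and J: "finite J" "support_in R I f \<subseteq> J" "J \<subseteq> I"
 shows "free_extend R I M \<phi> f = (\<Oplus>\<^bsub>M\<^esub>i\<in>J. f i \<odot>\<^bsub>M\<^esub> \<phi> i)"
 unfolding free_extend_def
proof (rule M.finsum_mono_neutral[OF J(1,2)])
 show "(\<lambda>i. f i \<odot>\<^bsub>M\<^esub> \<phi> i) \<in> support_in R I f \<rightarrow> carrier M"
  using fin_supp_funsD(1)[OF f] \<phi> by (auto simp: support_in_def intro!: smult_closed)
 fix i assume "i \<in> J - support_in R I f"
 thus "f i \<odot>\<^bsub>M\<^esub> \<phi> i = \<zero>\<^bsub>M\<^esub>" using J(3) \<phi> by (auto simp: support_in_def intro!: smult_l_zero)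
qed

lemma free_extend_linear:
 assumes \<phi>: "\<phi> \<in> I \<rightarrow> carrier M"
 shows "free_extend R I M \<phi> \<in> linear_maps R (free_module R I) M"
proof (rule linearI)
 have sub: "support_in R I f \<subseteq> I" for f by (auto simp: support_in_def)
 have trm: "(\<lambda>i. f i \<odot>\<^bsub>M\<^esub> \<phi> i) \<in> I \<rightarrow> carrier M" if "f \<in> fin_supp_funs R I" for f
  using fin_supp_funsD(1)[OF that] \<phi> by (auto intro!: smult_closed)
 fix f assume "f \<in> carrier (free_module R I)"
 hence f: "f \<in> fin_supp_funs R I" by simp
 show "free_extend R I M \<phi> f \<in> carrier M"
  unfolding free_extend_def using trm[OF f] sub[of f] by (intro M.finsum_closed) auto
 {
  fix g assume "g \<in> carrier (free_module R I)"
  hence g: "g \<in> fin_supp_funs R I" by simp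
  let ?J = "support_in R I f \<union> support_in R I g"
  have J: "finite ?J" "?J \<subseteq> I" using fin_supp_funsD(2)[OF f] fin_supp_funsD(2)[OF g] sub by auto
  have fg: "(\<lambda>i\<in>I. f i \<oplus> g i) \<in> fin_supp_funs R I" by (rule add_fun_closed[OF f g])
  have "support_in R I (\<lambda>i\<in>I. f i \<oplus> g i) \<subseteq> ?J" by (auto simp: support_in_def)
  hence "free_extend R I M \<phi> (\<lambda>i\<in>I. f i \<oplus> g i) = (\<Oplus>\<^bsub>M\<^esub>i\<in>?J. (\<lambda>i\<in>I. f i \<oplus> g i) i \<odot>\<^bsub>M\<^esub> \<phi> i)"
   by (intro free_extend_superset[OF fg \<phi> J(1) _ J(2)])
  also have "\<dots> = (\<Oplus>\<^bsub>M\<^esub>i\<in>?J. f i \<odot>\<^bsub>M\<^esub> \<phi> i \<oplus>\<^bsub>M\<^esub> g i \<odot>\<^bsub>M\<^esub> \<phi> i)"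
  proof (rule M.finsum_cong'[OF refl])
   show "(\<lambda>i. f i \<odot>\<^bsub>M\<^esub> \<phi> i \<oplus>\<^bsub>M\<^esub> g i \<odot>\<^bsub>M\<^esub> \<phi> i) \<in> ?J \<rightarrow> carrier M"
    using trm[OF f] trm[OF g] J(2) by (fastforce intro: M.a_closed)
   fix i assume "i \<in> ?J"
   hence i: "i \<in> I" using J(2) by blast
   hence "(f i \<oplus> g i) \<odot>\<^bsub>M\<^esub> \<phi> i = f i \<odot>\<^bsub>M\<^esub> \<phi> i \<oplus>\<^bsub>M\<^esub> g i \<odot>\<^bsub>M\<^esub> \<phi> i"
    using fin_supp_funsD(1)[OF f] fin_supp_funsD(1)[OF g] \<phi> by (intro smult_l_distr) auto
   thus "(\<lambda>i\<in>I. f i \<oplus> g i) i \<odot>\<^bsub>M\<^esub> \<phi> i = f i \<odot>\<^bsub>M\<^esub> \<phi> i \<oplus>\<^bsub>M\<^esub> g i \<odot>\<^bsub>M\<^esub> \<phi> i"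
    using i by simp
  qed
  also have "\<dots> = (\<Oplus>\<^bsub>M\<^esub>i\<in>?J. f i \<odot>\<^bsub>M\<^esub> \<phi> i) \<oplus>\<^bsub>M\<^esub> (\<Oplus>\<^bsub>M\<^esub>i\<in>?J. g i \<odot>\<^bsub>M\<^esub> \<phi> i)"
   using trm[OF f] trm[OF g] J(2) by (intro M.finsum_addf) auto
  also have "\<dots> = free_extend R I M \<phi> f \<oplus>\<^bsub>M\<^esub> free_extend R I M \<phi> g"
   using free_extend_superset[OF f \<phi> J(1) _ J(2)] free_extend_superset[OF g \<phi> J(1) _ J(2)] by simp
  finally show "free_extend R I M \<phi> (f \<oplus>\<^bsub>free_module R I\<^esub> g) = free_extend R I M \<phi> f \<oplus>\<^bsub>M\<^esub> free_extend R I M \<phi> g"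
   by simp
 }
 fix r assume r: "r \<in> carrier R"
 let ?J = "support_in R I f"
 have rf: "(\<lambda>i\<in>I. r \<otimes> f i) \<in> fin_supp_funs R I" by (rule smult_fun_closed[OF r f])
 have "support_in R I (\<lambda>i\<in>I. r \<otimes> f i) \<subseteq> ?J" using r by (auto simp: support_in_def)
 hence "free_extend R I M \<phi> (\<lambda>i\<in>I. r \<otimes> f i) = (\<Oplus>\<^bsub>M\<^esub>i\<in>?J. (\<lambda>i\<in>I. r \<otimes> f i) i \<odot>\<^bsub>M\<^esub> \<phi> i)"
  by (intro free_extend_superset[OF rf \<phi> fin_supp_funsD(2)[OF f] _ sub])
 also have "\<dots> = (\<Oplus>\<^bsub>M\<^esub>i\<in>?J. r \<odot>\<^bsub>M\<^esub> (f i \<odot>\<^bsub>M\<^esub> \<phi> i))"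
 proof (rule M.finsum_cong'[OF refl])
  show "(\<lambda>i. r \<odot>\<^bsub>M\<^esub> (f i \<odot>\<^bsub>M\<^esub> \<phi> i)) \<in> ?J \<rightarrow> carrier M"
   using trm[OF f] sub[of f] r by (fastforce intro: smult_closed)
  fix i assume "i \<in> ?J"
  hence i: "i \<in> I" using sub by blast
  hence "(r \<otimes> f i) \<odot>\<^bsub>M\<^esub> \<phi> i = r \<odot>\<^bsub>M\<^esub> (f i \<odot>\<^bsub>M\<^esub> \<phi> i)"
   using fin_supp_funsD(1)[OF f] \<phi> r by (intro smult_assoc1) auto
  thus "(\<lambda>i\<in>I. r \<otimes> f i) i \<odot>\<^bsub>M\<^esub> \<phi> i = r \<odot>\<^bsub>M\<^esub> (f i \<odot>\<^bsub>M\<^esub> \<phi> i)" using i by simp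
 qed
 also have "\<dots> = r \<odot>\<^bsub>M\<^esub> free_extend R I M \<phi> f"
  unfolding free_extend_def using trm[OF f] sub[of f] r by (intro smult_r_finsum[symmetric]) auto
 finally show "free_extend R I M \<phi> (r \<odot>\<^bsub>free_module R I\<^esub> f) = r \<odot>\<^bsub>M\<^esub> free_extend R I M \<phi> f" by simp
qed

lemma free_extend_basis_vector:
 assumes \<phi>: "\<phi> \<in> I \<rightarrow> carrier M" and i: "i \<in> I" and r: "r \<in> carrier R"
 shows "free_extend R I M \<phi> (basis_vector R I i r) = r \<odot>\<^bsub>M\<^esub> \<phi> i"
proof -
 have "free_extend R I M \<phi> (basis_vector R I i r) = (\<Oplus>\<^bsub>M\<^esub>j\<in>{i}. basis_vector R I i r j \<odot>\<^bsub>M\<^esub> \<phi> j)"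
  by (rule free_extend_superset[OF basis_vector_closed[OF r] \<phi>])
   (use i in \<open>auto simp: support_in_def basis_vector_def\<close>)
 also have "\<dots> = basis_vector R I i r i \<odot>\<^bsub>M\<^esub> \<phi> i"
  using smult_closed[OF r funcset_mem[OF \<phi> i]] i by (subst M.finsum_insert) (auto simp: basis_vector_def)
 finally show ?thesis using i by (simp add: basis_vector_def)
qed

end

lemma (in ring) free_module_map_eqI:
 assumes N: "abelian_group N"
  and f: "f \<in> carrier (free_module R I) \<rightarrow> carrier N"
   "\<And>x y. [|x \<in> carrier (free_module R I); y \<in> carrier (free_module R I)|]
     ==> f (x \<oplus>\<^bsub>free_module R I\<^esub> y) = f x \<oplus>\<^bsub>N\<^esub> f y"
  and g: "g \<in> carrier (free_module R I) \<rightarrow> carrier N"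
   "\<And>x y. [|x \<in> carrier (free_module R I); y \<in> carrier (free_module R I)|]
     ==> g (x \<oplus>\<^bsub>free_module R I\<^esub> y) = g x \<oplus>\<^bsub>N\<^esub> g y"
  and eq: "\<And>i r. [|i \<in> I; r \<in> carrier R|] ==> f (basis_vector R I i r) = g (basis_vector R I i r)"
  and x: "x \<in> carrier (free_module R I)"
 shows "f x = g x"
proof -
 have "x \<in> fin_supp_funs R I" using x by simp
 thus ?thesis
 proof (induction x rule: fin_supp_funs_induct)
  case zero
  have "f \<zero>\<^bsub>free_module R I\<^esub> = \<zero>\<^bsub>N\<^esub>"
   by (rule additive_map_zero[OF abelian_group_free_module N f(1)]) (rule f(2))
  moreover have "g \<zero>\<^bsub>free_module R I\<^esub> = \<zero>\<^bsub>N\<^esub>"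
   by (rule additive_map_zero[OF abelian_group_free_module N g(1)]) (rule g(2))
  ultimately show ?case by (simp only: free_module_simps)
 next
  case (add x y)
  thus ?case using f(2)[of x y] g(2)[of x y] by (simp only: free_module_simps)
 next
  case (basis i r)
  thus ?case by (rule eq)
 qed
qed

lemma (in ring) free_module_linear_map_eqI:
 assumes N: "left_module R N" and f: "f \<in> linear_maps R (free_module R I) N" and g: "g \<in> linear_maps R (free_module R I) N"
  and eq: "\<And>i. i \<in> I ==> f (basis_vector R I i \<one>) = g (basis_vector R I i \<one>)"
  and x: "x \<in> carrier (free_module R I)"
 shows "f x = g x"
proof (rule free_module_map_eqI[OF _ _ _ _ _ _ x])
 show "abelian_group N" using N by (rule left_module.axioms(2))
 show "f \<in> carrier (free_module R I) \<rightarrow> carrier N" "g \<in> carrier (free_module R I) \<rightarrow> carrier N"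
  using linearD(1)[OF f] linearD(1)[OF g] by auto
 fix i r assume i: "i \<in> I" and r: "r \<in> carrier R"
 have b: "basis_vector R I i r = r \<odot>\<^bsub>free_module R I\<^esub> basis_vector R I i \<one>"
  using r by (auto simp: basis_vector_def intro!: restrict_ext)
 have e: "basis_vector R I i \<one> \<in> carrier (free_module R I)" by (simp add: basis_vector_closed)
 show "f (basis_vector R I i r) = g (basis_vector R I i r)"
  unfolding b linearD(3)[OF f r e] linearD(3)[OF g r e] using eq[OF i] by simp
qed (rule linearD(2)[OF f] linearD(2)[OF g]; assumption)+

text \<open>Projectivity is defined with a basis drawn from elements of the module itself. The
  retraction therefore goes through the free module on the whole carrier rather than on
  \<open>I\<close>.\<close>

lemma (in ring) projective_free_module: "projective_module R (free_module R I)"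
proof -
 let ?P = "free_module R I"
 interpret P: left_module R ?P by (rule left_module_free_module)
 interpret F: left_module R "free_module R (carrier ?P)" by (rule left_module_free_module)
 let ?e = "\<lambda>i. basis_vector R I i \<one>"
 have e: "?e i \<in> carrier ?P" for i by (simp add: basis_vector_closed)
 let ?\<phi> = "\<lambda>i. basis_vector R (carrier ?P) (?e i) \<one>"
 have \<phi>: "?\<phi> \<in> I \<rightarrow> carrier (free_module R (carrier ?P))" by (simp add: basis_vector_closed)
 let ?s = "free_extend R I (free_module R (carrier ?P)) ?\<phi>"
 let ?q = "free_extend R (carrier ?P) ?P (\<lambda>x. x)"
 have s: "?s \<in> linear_maps R ?P (free_module R (carrier ?P))" by (rule F.free_extend_linear[OF \<phi>])
 have q: "?q \<in> linear_maps R (free_module R (carrier ?P)) ?P" by (rule P.free_extend_linear) auto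
 have "?q (?s x) = x" if x: "x \<in> carrier ?P" for x
 proof (rule free_module_linear_map_eqI[OF left_module_free_module linear_maps_compose[OF s q] _ _ x])
  show "(\<lambda>x. x) \<in> linear_maps R ?P ?P" by (rule linearI) auto
  fix i assume i: "i \<in> I"
  have "?s (?e i) = \<one> \<odot>\<^bsub>free_module R (carrier ?P)\<^esub> ?\<phi> i" by (rule F.free_extend_basis_vector[OF \<phi> i]) simp
  also have "\<dots> = ?\<phi> i" using \<phi> i by (intro F.smult_one) auto
  finally have "?q (?s (?e i)) = \<one> \<odot>\<^bsub>?P\<^esub> ?e i"
   using P.free_extend_basis_vector[of "\<lambda>x. x" "carrier ?P" "?e i" \<one>] e by simp
  also have "\<dots> = ?e i" by (rule P.smult_one[OF e])
  finally show "?q (?s (?e i)) = ?e i" .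
 qed
 thus ?thesis unfolding projective_module_def using left_module_free_module s q by blast
qed

text \<open>Preimages under \<open>b\<close> are chosen on a basis of a free module retracting onto
  \<open>P\<close>, extended linearly and composed with the section. Containment of images replaces
  surjectivity of \<open>b\<close>, because later \<open>b\<close> is a differential that hits only
  cycles.\<close>

lemma projective_module_lifting:
 assumes P: "projective_module R P" and X: "left_module R X" and Y: "left_module R Y"
  and b: "b \<in> linear_maps R X Y" and g: "g \<in> linear_maps R P Y"
  and im: "g ` carrier P \<subseteq> b ` carrier X"
 obtains l where "l \<in> linear_maps R P X" "\<And>x. x \<in> carrier P ==> b (l x) = g x"
proof -
 interpret P: left_module R P using P by (simp add: projective_module_def)
 interpret X: left_module R X by fact
 interpret Y: left_module R Y by fact
 obtain I :: "'c set" and s q where s: "s \<in> linear_maps R P (free_module R I)" and q: "q \<in> linear_maps R (free_module R I) P"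
  and qs: "\<And>x. x \<in> carrier P ==> q (s x) = x" using P unfolding projective_module_def by blast
 let ?e = "\<lambda>i. basis_vector R I i \<one>\<^bsub>R\<^esub>"
 have e: "?e i \<in> carrier (free_module R I)" for i by (simp add: P.basis_vector_closed)
 have "\<exists>x\<in>carrier X. b x = g (q (?e i))" if "i \<in> I" for i
 proof -
  have "g (q (?e i)) \<in> b ` carrier X" using linearD(1)[OF q e] im by blast
  thus ?thesis by (metis imageE)
 qed
 then obtain \<phi> where \<phi>: "\<And>i. i \<in> I ==> \<phi> i \<in> carrier X" "\<And>i. i \<in> I ==> b (\<phi> i) = g (q (?e i))"
  by metis
 have \<phi>I: "\<phi> \<in> I \<rightarrow> carrier X" using \<phi>(1) by blast
 let ?l = "free_extend R I X \<phi>"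
 have l: "?l \<in> linear_maps R (free_module R I) X" by (rule X.free_extend_linear[OF \<phi>I])
 have bl: "b (?l y) = g (q y)" if y: "y \<in> carrier (free_module R I)" for y
 proof (rule P.free_module_linear_map_eqI[OF Y linear_maps_compose[OF l b] linear_maps_compose[OF q g] _ y])
  fix i assume i: "i \<in> I"
  show "b (?l (?e i)) = g (q (?e i))" using X.free_extend_basis_vector[OF \<phi>I i, of "\<one>\<^bsub>R\<^esub>"] X.smult_one[OF \<phi>(1)[OF i]] \<phi>(2)[OF i] by simp
 qed
 show ?thesis
 proof (rule that[OF linear_maps_compose[OF s l]])
  fix x assume x: "x \<in> carrier P"
  thus "b (?l (s x)) = g x" using bl[OF linearD(1)[OF s x]] qs by simp
 qed
qed

section \<open>Cohomology modules as cosets of cocycles\<close>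

locale cochain_complex =
 fixes K :: "('k, 'x) ring_scheme" and C :: "nat => ('k, 'a, 'y) module_scheme"
  and \<delta> :: "nat => 'a => 'a"
 assumes abelian_group: "abelian_group (C i)"
  and smult_closed: "[|k \<in> carrier K; x \<in> carrier (C i)|] ==> k \<odot>\<^bsub>C i\<^esub> x \<in> carrier (C i)"
  and smult_r_distr: "[|k \<in> carrier K; x \<in> carrier (C i); y \<in> carrier (C i)|] ==>
     k \<odot>\<^bsub>C i\<^esub> (x \<oplus>\<^bsub>C i\<^esub> y) = k \<odot>\<^bsub>C i\<^esub> x \<oplus>\<^bsub>C i\<^esub> k \<odot>\<^bsub>C i\<^esub> y"
  and coboundary_linear: "\<delta> i \<in> linear_maps K (C i) (C (Suc i))"
  and coboundary_coboundary: "x \<in> carrier (C i) ==> \<delta> (Suc i) (\<delta> i x) = \<zero>\<^bsub>C (Suc (Suc i))\<^esub>"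
begin

lemma smult_r_zero: "k \<in> carrier K ==> k \<odot>\<^bsub>C i\<^esub> \<zero>\<^bsub>C i\<^esub> = \<zero>\<^bsub>C i\<^esub>"
 by (rule additive_map_zero[OF abelian_group abelian_group]) (auto simp: smult_closed smult_r_distr)

lemma smult_r_minus:
 "[|k \<in> carrier K; x \<in> carrier (C i)|] ==> k \<odot>\<^bsub>C i\<^esub> (\<ominus>\<^bsub>C i\<^esub> x) = \<ominus>\<^bsub>C i\<^esub> (k \<odot>\<^bsub>C i\<^esub> x)"
 by (rule additive_map_minus[OF abelian_group abelian_group]) (auto simp: smult_closed smult_r_distr)

lemma cocycles_carrier: "x \<in> cocycles C \<delta> n ==> x \<in> carrier (C n)" by (simp add: cocycles_def)

lemma cocycles_smult:
 assumes "k \<in> carrier K" "x \<in> cocycles C \<delta> n"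
 shows "k \<odot>\<^bsub>C n\<^esub> x \<in> cocycles C \<delta> n"
 using assms linearD(3)[OF coboundary_linear, of k x n] smult_closed smult_r_zero by (auto simp: cocycles_def)

lemma cocycles_add:
 assumes "x \<in> cocycles C \<delta> n" "y \<in> cocycles C \<delta> n"
 shows "x \<oplus>\<^bsub>C n\<^esub> y \<in> cocycles C \<delta> n"
proof -
 interpret A: abelian_group "C n" by (rule abelian_group)
 interpret B: abelian_group "C (Suc n)" by (rule abelian_group)
 show ?thesis using assms linearD(2)[OF coboundary_linear, of x n y] by (auto simp: cocycles_def)
qed

lemma cocycles_diff:
 assumes "x \<in> cocycles C \<delta> n" "y \<in> cocycles C \<delta> n"
 shows "x \<ominus>\<^bsub>C n\<^esub> y \<in> cocycles C \<delta> n"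
proof -
 interpret A: abelian_group "C n" by (rule abelian_group)
 interpret B: abelian_group "C (Suc n)" by (rule abelian_group)
 show ?thesis using assms linear_maps_diff[OF abelian_group abelian_group coboundary_linear, of x n y]
  by (auto simp: cocycles_def B.minus_eq)
qed

lemma coboundaries_subset_cocycles: "coboundaries C \<delta> n \<subseteq> cocycles C \<delta> n"
proof -
 interpret A: abelian_group "C i" for i by (rule abelian_group)
 have "\<delta> n \<zero>\<^bsub>C n\<^esub> = \<zero>\<^bsub>C (Suc n)\<^esub>" by (rule linear_maps_zero[OF abelian_group abelian_group coboundary_linear])
 thus ?thesis using coboundary_coboundary linearD(1)[OF coboundary_linear] A.zero_closed
  by (auto simp: coboundaries_def cocycles_def split: nat.splits)
qed

lemma coboundaries_closed:
 shows "\<zero>\<^bsub>C n\<^esub> \<in> coboundaries C \<delta> n"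
  and "[|x \<in> coboundaries C \<delta> n; y \<in> coboundaries C \<delta> n|] ==> x \<oplus>\<^bsub>C n\<^esub> y \<in> coboundaries C \<delta> n"
  and "x \<in> coboundaries C \<delta> n ==> \<ominus>\<^bsub>C n\<^esub> x \<in> coboundaries C \<delta> n"
  and "[|k \<in> carrier K; x \<in> coboundaries C \<delta> n|] ==> k \<odot>\<^bsub>C n\<^esub> x \<in> coboundaries C \<delta> n"
proof -
 have "\<zero>\<^bsub>C n\<^esub> \<in> coboundaries C \<delta> n \<and>
  (\<forall>x\<in>coboundaries C \<delta> n. \<forall>y\<in>coboundaries C \<delta> n. x \<oplus>\<^bsub>C n\<^esub> y \<in> coboundaries C \<delta> n) \<and>
  (\<forall>x\<in>coboundaries C \<delta> n. \<ominus>\<^bsub>C n\<^esub> x \<in> coboundaries C \<delta> n) \<and>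
  (\<forall>k\<in>carrier K. \<forall>x\<in>coboundaries C \<delta> n. k \<odot>\<^bsub>C n\<^esub> x \<in> coboundaries C \<delta> n)"
 proof (cases n)
  case 0
  interpret A: abelian_group "C 0" by (rule abelian_group)
  show ?thesis using 0 smult_r_zero by (auto simp: coboundaries_def)
 next
  case (Suc m)
  interpret A: abelian_group "C m" by (rule abelian_group)
  note d = coboundary_linear[of m]
  have eq: "coboundaries C \<delta> n = \<delta> m ` carrier (C m)" by (simp add: coboundaries_def Suc)
  show ?thesis unfolding eq unfolding Suc ball_simps
  proof (intro conjI ballI)
   show "\<zero>\<^bsub>C (Suc m)\<^esub> \<in> \<delta> m ` carrier (C m)"
    using linear_maps_zero[OF abelian_group abelian_group d] A.zero_closed by (metis imageI)
  next
   fix x y assume "x \<in> carrier (C m)" "y \<in> carrier (C m)"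
   thus "\<delta> m x \<oplus>\<^bsub>C (Suc m)\<^esub> \<delta> m y \<in> \<delta> m ` carrier (C m)"
    using linearD(2)[OF d] A.a_closed by (metis imageI)
  next
   fix x assume "x \<in> carrier (C m)"
   thus "\<ominus>\<^bsub>C (Suc m)\<^esub> \<delta> m x \<in> \<delta> m ` carrier (C m)"
    using linear_maps_minus[OF abelian_group abelian_group d] A.a_inv_closed by (metis imageI)
  next
   fix k x assume "k \<in> carrier K" "x \<in> carrier (C m)"
   thus "k \<odot>\<^bsub>C (Suc m)\<^esub> \<delta> m x \<in> \<delta> m ` carrier (C m)"
    using linearD(3)[OF d] smult_closed by (metis imageI)
  qed
 qed
 thus "\<zero>\<^bsub>C n\<^esub> \<in> coboundaries C \<delta> n"
  and "[|x \<in> coboundaries C \<delta> n; y \<in> coboundaries C \<delta> n|] ==> x \<oplus>\<^bsub>C n\<^esub> y \<in> coboundaries C \<delta> n"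
  and "x \<in> coboundaries C \<delta> n ==> \<ominus>\<^bsub>C n\<^esub> x \<in> coboundaries C \<delta> n"
  and "[|k \<in> carrier K; x \<in> coboundaries C \<delta> n|] ==> k \<odot>\<^bsub>C n\<^esub> x \<in> coboundaries C \<delta> n"
  by auto
qed

lemma abelian_subgroup_coboundaries: "abelian_subgroup (coboundaries C \<delta> n) (C n)"
proof (rule abelian_subgroupI3[OF _ abelian_group])
 interpret A: abelian_group "C n" by (rule abelian_group)
 show "additive_subgroup (coboundaries C \<delta> n) (C n)"
 proof (rule additive_subgroup.intro, rule A.add.subgroupI)
  show "coboundaries C \<delta> n \<subseteq> carrier (C n)" using coboundaries_subset_cocycles cocycles_carrier by blast
  show "coboundaries C \<delta> n \<noteq> {}" using coboundaries_closed(1) by blast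
 qed (use coboundaries_closed in \<open>auto simp: a_inv_def[symmetric]\<close>)
qed

text \<open>Cosets are formed in \<open>C n\<close> instead of the module restricted to cocycles;
  the sets agree because a coset depends on the addition only.\<close>

definition coh_class :: "nat => 'a => 'a set" where
 "coh_class n x = coboundaries C \<delta> n +>\<^bsub>C n\<^esub> x"

lemma mem_coh_class:
 "[|x \<in> carrier (C n); y \<in> carrier (C n)|] ==> y \<in> coh_class n x \<longleftrightarrow> y \<ominus>\<^bsub>C n\<^esub> x \<in> coboundaries C \<delta> n"
 using abelian_subgroup.a_rcos_module[OF abelian_subgroup_coboundaries] by (simp add: coh_class_def a_minus_def)

lemma coh_class_subset:
 assumes "x \<in> carrier (C n)"
 shows "coh_class n x \<subseteq> carrier (C n)"
proof -
 interpret A: abelian_group "C n" by (rule abelian_group)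
 show ?thesis unfolding coh_class_def
  using coboundaries_subset_cocycles cocycles_carrier assms by (intro A.a_r_coset_subset_G) blast+
qed

lemma coh_class_eq_iff:
 assumes x: "x \<in> carrier (C n)" and y: "y \<in> carrier (C n)"
 shows "coh_class n y = coh_class n x \<longleftrightarrow> y \<ominus>\<^bsub>C n\<^esub> x \<in> coboundaries C \<delta> n"
proof -
 interpret A: abelian_group "C n" by (rule abelian_group)
 interpret S: abelian_subgroup "coboundaries C \<delta> n" "C n" by (rule abelian_subgroup_coboundaries)
 have "y \<in> coh_class n y" unfolding coh_class_def by (rule S.a_rcos_self[OF y])
 moreover have "coh_class n x = coh_class n y" if "y \<in> coh_class n x"
  using S.a_repr_independence'[OF _ x] that unfolding coh_class_def by blast
 ultimately show ?thesis using mem_coh_class[OF x y] by blast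
qed

lemma carrier_cohomology_module: "carrier (cohomology_module C \<delta> n) = coh_class n ` cocycles C \<delta> n"
 by (auto simp: cohomology_module_def quotient_module_def A_RCOSETS_def' a_r_coset_def' coh_class_def)

lemma add_cohomology_module:
 assumes "x \<in> carrier (C n)" "y \<in> carrier (C n)"
 shows "coh_class n x \<oplus>\<^bsub>cohomology_module C \<delta> n\<^esub> coh_class n y = coh_class n (x \<oplus>\<^bsub>C n\<^esub> y)"
proof -
 interpret S: abelian_subgroup "coboundaries C \<delta> n" "C n" by (rule abelian_subgroup_coboundaries)
 show ?thesis using S.a_rcos_sum[OF assms] by (simp add: cohomology_module_def quotient_module_def coh_class_def set_add_def')
qed

text \<open>The quotient takes the union over all representatives of a coset; since coboundaries are
  stable under scalars, every representative contributes the same coset.\<close>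

lemma smult_cohomology_module:
 assumes k: "k \<in> carrier K" and x: "x \<in> carrier (C n)"
 shows "k \<odot>\<^bsub>cohomology_module C \<delta> n\<^esub> coh_class n x = coh_class n (k \<odot>\<^bsub>C n\<^esub> x)"
proof -
 interpret A: abelian_group "C n" by (rule abelian_group)
 have const: "coh_class n (k \<odot>\<^bsub>C n\<^esub> y) = coh_class n (k \<odot>\<^bsub>C n\<^esub> x)" if y: "y \<in> coh_class n x" for y
 proof -
  have yc: "y \<in> carrier (C n)" using coh_class_subset[OF x] y by blast
  hence "y \<ominus>\<^bsub>C n\<^esub> x \<in> coboundaries C \<delta> n" using mem_coh_class[OF x yc] y by blast
  hence "k \<odot>\<^bsub>C n\<^esub> (y \<ominus>\<^bsub>C n\<^esub> x) \<in> coboundaries C \<delta> n" using coboundaries_closed(4)[OF k] by blast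
  hence "k \<odot>\<^bsub>C n\<^esub> y \<ominus>\<^bsub>C n\<^esub> k \<odot>\<^bsub>C n\<^esub> x \<in> coboundaries C \<delta> n"
   using smult_r_distr[OF k yc, of "\<ominus>\<^bsub>C n\<^esub> x"] smult_r_minus[OF k x] x by (simp add: a_minus_def)
  thus ?thesis using coh_class_eq_iff smult_closed[OF k] x yc by blast
 qed
 have self: "x \<in> coh_class n x" using mem_coh_class[OF x x] coboundaries_closed(1) x by (simp add: A.r_neg A.minus_eq)
 have "k \<odot>\<^bsub>cohomology_module C \<delta> n\<^esub> coh_class n x = (\<Union>y\<in>coh_class n x. coh_class n (k \<odot>\<^bsub>C n\<^esub> y))"
  by (simp add: cohomology_module_def quotient_module_def coh_class_def a_r_coset_def')
 also have "\<dots> = coh_class n (k \<odot>\<^bsub>C n\<^esub> x)" using const self by blast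
 finally show ?thesis .
qed

end

text \<open>The isomorphism is constructed in the direction opposite to \<open>F\<close>: taking preimages of
 cohomology classes requires no choice of representatives.\<close>

lemma modules_isomorphic_cohomologyI:
 assumes C: "cochain_complex K C \<delta>" and D: "cochain_complex K D \<delta>'"
  and F: "F \<in> linear_maps K (C n) (D n)"
  and coc: "\<And>x. x \<in> cocycles C \<delta> n ==> F x \<in> cocycles D \<delta>' n"
  and cob: "\<And>x. x \<in> cocycles C \<delta> n ==> F x \<in> coboundaries D \<delta>' n \<longleftrightarrow> x \<in> coboundaries C \<delta> n"
  and sur: "\<And>y. y \<in> cocycles D \<delta>' n ==> \<exists>x\<in>cocycles C \<delta> n. y \<ominus>\<^bsub>D n\<^esub> F x \<in> coboundaries D \<delta>' n"
 shows "modules_isomorphic K (cohomology_module D \<delta>' n) (cohomology_module C \<delta> n)"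
proof -
 interpret C: cochain_complex K C \<delta> by fact
 interpret D: cochain_complex K D \<delta>' by fact
 interpret Cn: abelian_group "C n" by (rule C.abelian_group)
 interpret Dn: abelian_group "D n" by (rule D.abelian_group)
 let ?G = "\<lambda>X. {x \<in> cocycles C \<delta> n. F x \<in> X}"
 note CZ = C.cocycles_carrier[of _ n]
 have FZ: "F x \<in> carrier (D n)" if "x \<in> cocycles C \<delta> n" for x using linearD(1)[OF F CZ[OF that]] .
 have Fdiff: "F y \<ominus>\<^bsub>D n\<^esub> F x \<in> coboundaries D \<delta>' n \<longleftrightarrow> y \<ominus>\<^bsub>C n\<^esub> x \<in> coboundaries C \<delta> n"
  if x: "x \<in> cocycles C \<delta> n" and y: "y \<in> cocycles C \<delta> n" for x y using cob[OF C.cocycles_diff[OF y x]]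
   linear_maps_diff[OF C.abelian_group D.abelian_group F CZ[OF y] CZ[OF x]] by simp
 have G: "?G (D.coh_class n (F x)) = C.coh_class n x" if x: "x \<in> cocycles C \<delta> n" for x
 proof (rule Set.set_eqI)
  fix y
  show "y \<in> ?G (D.coh_class n (F x)) \<longleftrightarrow> y \<in> C.coh_class n x"
  proof (cases "y \<in> cocycles C \<delta> n")
   case True
   thus ?thesis using D.mem_coh_class[OF FZ[OF x] FZ[OF True]] C.mem_coh_class[OF CZ[OF x] CZ[OF True]]
     Fdiff[OF x True] by simp
  next
   case False
   have "y \<in> cocycles C \<delta> n" if y: "y \<in> C.coh_class n x"
   proof -
    have yc: "y \<in> carrier (C n)" using C.coh_class_subset[OF CZ[OF x]] y by blast
    have "y \<ominus>\<^bsub>C n\<^esub> x \<in> cocycles C \<delta> n"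
     using C.mem_coh_class[OF CZ[OF x] yc] y C.coboundaries_subset_cocycles by blast
    hence "(y \<ominus>\<^bsub>C n\<^esub> x) \<oplus>\<^bsub>C n\<^esub> x \<in> cocycles C \<delta> n" using C.cocycles_add x by blast
    moreover have "(y \<ominus>\<^bsub>C n\<^esub> x) \<oplus>\<^bsub>C n\<^esub> x = y"
     using yc CZ[OF x] by (simp add: a_minus_def Cn.a_assoc Cn.l_neg)
    ultimately show ?thesis by simp
   qed
   thus ?thesis using False by blast
  qed
 qed
 have rep: "\<exists>x\<in>cocycles C \<delta> n. X = D.coh_class n (F x)" if X: "X \<in> carrier (cohomology_module D \<delta>' n)" for X
 proof -
  obtain y where y: "y \<in> cocycles D \<delta>' n" "X = D.coh_class n y"
   using X unfolding D.carrier_cohomology_module by blast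
  obtain x where x: "x \<in> cocycles C \<delta> n" "y \<ominus>\<^bsub>D n\<^esub> F x \<in> coboundaries D \<delta>' n" using sur[OF y(1)] by blast
  thus ?thesis using D.coh_class_eq_iff[OF FZ[OF x(1)] D.cocycles_carrier[OF y(1)]] y(2) by blast
 qed
 have "?G \<in> linear_maps K (cohomology_module D \<delta>' n) (cohomology_module C \<delta> n)"
 proof (rule linearI)
  fix X assume X: "X \<in> carrier (cohomology_module D \<delta>' n)"
  then obtain x where x: "x \<in> cocycles C \<delta> n" "X = D.coh_class n (F x)" using rep by blast
  show "?G X \<in> carrier (cohomology_module C \<delta> n)"
   unfolding x(2) G[OF x(1)] C.carrier_cohomology_module using x(1) by blast
  {
   fix Y assume "Y \<in> carrier (cohomology_module D \<delta>' n)"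
   then obtain y where y: "y \<in> cocycles C \<delta> n" "Y = D.coh_class n (F y)" using rep by blast
   have "X \<oplus>\<^bsub>cohomology_module D \<delta>' n\<^esub> Y = D.coh_class n (F (x \<oplus>\<^bsub>C n\<^esub> y))"
    unfolding x(2) y(2) linearD(2)[OF F CZ[OF x(1)] CZ[OF y(1)]] by (rule D.add_cohomology_module[OF FZ[OF x(1)] FZ[OF y(1)]])
   thus "?G (X \<oplus>\<^bsub>cohomology_module D \<delta>' n\<^esub> Y) = ?G X \<oplus>\<^bsub>cohomology_module C \<delta> n\<^esub> ?G Y"
    unfolding G[OF C.cocycles_add[OF x(1) y(1)]] x(2) y(2) G[OF x(1)] G[OF y(1)]
     C.add_cohomology_module[OF CZ[OF x(1)] CZ[OF y(1)]] using G[OF C.cocycles_add[OF x(1) y(1)]] by simp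
  }
  fix k assume k: "k \<in> carrier K"
  have "k \<odot>\<^bsub>cohomology_module D \<delta>' n\<^esub> X = D.coh_class n (F (k \<odot>\<^bsub>C n\<^esub> x))"
   unfolding x(2) linearD(3)[OF F k CZ[OF x(1)]] by (rule D.smult_cohomology_module[OF k FZ[OF x(1)]])
  thus "?G (k \<odot>\<^bsub>cohomology_module D \<delta>' n\<^esub> X) = k \<odot>\<^bsub>cohomology_module C \<delta> n\<^esub> ?G X"
   unfolding x(2) G[OF x(1)] C.smult_cohomology_module[OF k CZ[OF x(1)]] using G[OF C.cocycles_smult[OF k x(1)]] by simp
 qed
 moreover have "bij_betw ?G (carrier (cohomology_module D \<delta>' n)) (carrier (cohomology_module C \<delta> n))"
  unfolding bij_betw_def
 proof
  show "inj_on ?G (carrier (cohomology_module D \<delta>' n))"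
  proof (rule inj_onI)
   fix X Y assume "X \<in> carrier (cohomology_module D \<delta>' n)" "Y \<in> carrier (cohomology_module D \<delta>' n)" and eq: "?G X = ?G Y"
   then obtain x y where x: "x \<in> cocycles C \<delta> n" "X = D.coh_class n (F x)"
    and y: "y \<in> cocycles C \<delta> n" "Y = D.coh_class n (F y)" using rep by meson
   have "C.coh_class n x = C.coh_class n y" using eq G[OF x(1)] G[OF y(1)] x(2) y(2) by simp
   hence "F x \<ominus>\<^bsub>D n\<^esub> F y \<in> coboundaries D \<delta>' n"
    using C.coh_class_eq_iff[OF CZ[OF y(1)] CZ[OF x(1)]] Fdiff[OF y(1) x(1)] by simp
   thus "X = Y" using D.coh_class_eq_iff[OF FZ[OF y(1)] FZ[OF x(1)]] x(2) y(2) by simp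
  qed
  show "?G ` carrier (cohomology_module D \<delta>' n) = carrier (cohomology_module C \<delta> n)"
  proof (intro equalityI subsetI)
   fix X assume "X \<in> carrier (cohomology_module C \<delta> n)"
   then obtain x where x: "x \<in> cocycles C \<delta> n" "X = C.coh_class n x" unfolding C.carrier_cohomology_module by blast
   hence "X = ?G (D.coh_class n (F x))" "D.coh_class n (F x) \<in> carrier (cohomology_module D \<delta>' n)"
    using G[OF x(1)] coc[OF x(1)] unfolding D.carrier_cohomology_module by auto
   thus "X \<in> ?G ` carrier (cohomology_module D \<delta>' n)" by blast
  next
   fix X assume "X \<in> ?G ` carrier (cohomology_module D \<delta>' n)"
   thus "X \<in> carrier (cohomology_module C \<delta> n)"
    using linearD(1)[OF \<open>?G \<in> linear_maps K _ _\<close>] by blast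
  qed
 qed
 ultimately show ?thesis unfolding modules_isomorphic_def by blast
qed

lemma modules_isomorphic_trans:
 assumes "modules_isomorphic R A B" "modules_isomorphic R B C"
 shows "modules_isomorphic R A C"
proof -
 obtain f g where f: "f \<in> linear_maps R A B" "bij_betw f (carrier A) (carrier B)"
  and g: "g \<in> linear_maps R B C" "bij_betw g (carrier B) (carrier C)" using assms unfolding modules_isomorphic_def by blast
 hence "bij_betw (\<lambda>x. g (f x)) (carrier A) (carrier C)" using bij_betw_trans[OF f(2) g(2)] by (simp add: comp_def)
 thus ?thesis unfolding modules_isomorphic_def using linear_maps_compose[OF f(1) g(1)] by blast
qed

section \<open>Independence of Ext from the resolution\<close>

lemma resolutionD:
 assumes "projective_resolution R P d \<epsilon> A"
 shows "projective_module R (P i)" "left_module R (P i)" "d i \<in> linear_maps R (P (Suc i)) (P i)"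
  and "\<epsilon> \<in> linear_maps R (P 0) A" "\<epsilon> ` carrier (P 0) = carrier A"
  and "d 0 ` carrier (P (Suc 0)) = {x \<in> carrier (P 0). \<epsilon> x = \<zero>\<^bsub>A\<^esub>}"
  and "d (Suc i) ` carrier (P (Suc (Suc i))) = {x \<in> carrier (P (Suc i)). d i x = \<zero>\<^bsub>P i\<^esub>}"
 using assms by (simp_all add: projective_resolution_def projective_module_def)

lemma projective_resolution_compose_zero:
 assumes P: "projective_resolution R P d \<epsilon> A"
 shows "x \<in> carrier (P (Suc 0)) ==> \<epsilon> (d 0 x) = \<zero>\<^bsub>A\<^esub>"
  and "x \<in> carrier (P (Suc (Suc i))) ==> d i (d (Suc i) x) = \<zero>\<^bsub>P i\<^esub>"
proof -
 show "\<epsilon> (d 0 x) = \<zero>\<^bsub>A\<^esub>" if "x \<in> carrier (P (Suc 0))"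
 proof -
  have "d 0 x \<in> d 0 ` carrier (P (Suc 0))" using that by blast
  thus ?thesis unfolding resolutionD(6)[OF P] by simp
 qed
 show "d i (d (Suc i) x) = \<zero>\<^bsub>P i\<^esub>" if "x \<in> carrier (P (Suc (Suc i)))"
 proof -
  have "d (Suc i) x \<in> d (Suc i) ` carrier (P (Suc (Suc i)))" using that by blast
  thus ?thesis unfolding resolutionD(7)[OF P] by simp
 qed
qed

lemma projective_resolution_lift:
 assumes P: "projective_resolution R P d \<epsilon> A" and Q: "projective_resolution R Q d' \<epsilon>' A"
  and A: "left_module R A"
 obtains f where "\<And>i. f i \<in> linear_maps R (P i) (Q i)"
  "\<And>x. x \<in> carrier (P 0) ==> \<epsilon>' (f 0 x) = \<epsilon> x"
  "\<And>i x. x \<in> carrier (P (Suc i)) ==> d' i (f (Suc i) x) = f i (d i x)"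
proof -
 note P' = resolutionD[OF P] and Q' = resolutionD[OF Q]
 \<comment> \<open>Besides linearity, the invariant of the recursion records that the current map
   sends boundaries to cycles, which is the condition for lifting the next one; in degree 0 it
   records compatibility with the augmentations.\<close>
 let ?I = "\<lambda>i fi. fi \<in> linear_maps R (P i) (Q i) \<and>
   (case i of 0 => \<forall>x\<in>carrier (P 0). \<epsilon>' (fi x) = \<epsilon> x
   | Suc j => \<forall>x\<in>carrier (P (Suc (Suc j))). d' j (fi (d (Suc j) x)) = \<zero>\<^bsub>Q j\<^esub>)"
 let ?R = "\<lambda>i f f'. \<forall>x\<in>carrier (P (Suc i)). d' i (f' x) = f (d i x)"
 have "\<exists>f. ?I 0 f"
 proof -
  have "\<epsilon> ` carrier (P 0) \<subseteq> \<epsilon>' ` carrier (Q 0)" using P'(5) Q'(5) by simp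
  then obtain l where "l \<in> linear_maps R (P 0) (Q 0)" "\<And>x. x \<in> carrier (P 0) ==> \<epsilon>' (l x) = \<epsilon> x"
   using projective_module_lifting[OF P'(1) Q'(2) A Q'(4) P'(4)] by blast
  thus ?thesis by auto
 qed
 moreover have "\<exists>f'. ?I (Suc i) f' \<and> ?R i f f'" if I: "?I i f" for f i
 proof -
  have f: "f \<in> linear_maps R (P i) (Q i)" using I by blast
  have "f (d i x) \<in> d' i ` carrier (Q (Suc i))" if x: "x \<in> carrier (P (Suc i))" for x
  proof -
   have dx: "d i x \<in> carrier (P i)" by (rule linearD(1)[OF P'(3) x])
   have fdx: "f (d i x) \<in> carrier (Q i)" by (rule linearD(1)[OF f dx])
   show ?thesis
   proof (cases i)
    case 0
    thus ?thesis using I dx projective_resolution_compose_zero(1)[OF P] x fdx Q'(6) unfolding 0 by auto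
   next
    case (Suc j)
    thus ?thesis using I x fdx Q'(7)[of j] unfolding Suc by auto
   qed
  qed
  hence "(\<lambda>x. f (d i x)) ` carrier (P (Suc i)) \<subseteq> d' i ` carrier (Q (Suc i))" by blast
  from projective_module_lifting[OF P'(1) Q'(2) Q'(2) Q'(3) linear_maps_compose[OF P'(3) f] this]
  obtain l where l: "l \<in> linear_maps R (P (Suc i)) (Q (Suc i))" "\<And>x. x \<in> carrier (P (Suc i)) ==> d' i (l x) = f (d i x)"
   by blast
  have "d' i (l (d (Suc i) x)) = \<zero>\<^bsub>Q i\<^esub>" if x: "x \<in> carrier (P (Suc (Suc i)))" for x
  proof -
   have "d' i (l (d (Suc i) x)) = f (d i (d (Suc i) x))" by (rule l(2)[OF linearD(1)[OF P'(3) x]])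
   also have "\<dots> = f \<zero>\<^bsub>P i\<^esub>" by (simp add: projective_resolution_compose_zero(2)[OF P x])
   also have "\<dots> = \<zero>\<^bsub>Q i\<^esub>"
    by (rule linear_maps_zero[OF left_module.axioms(2)[OF P'(2)] left_module.axioms(2)[OF Q'(2)] f])
   finally show ?thesis .
  qed
  thus ?thesis using l by auto
 qed
 ultimately have "\<exists>f. \<forall>i. ?I i (f i) \<and> ?R i (f i) (f (Suc i))" by (rule dependent_nat_choice)
 then obtain f where f: "\<And>i. ?I i (f i)" "\<And>i. ?R i (f i) (f (Suc i))" by (elim exE) blast
 show ?thesis
 proof (rule that[of f])
  show "\<epsilon>' (f 0 x) = \<epsilon> x" if "x \<in> carrier (P 0)" for x using f(1)[of 0] that by simp
 qed (use f in blast)+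
qed

text \<open>In each degree the error left by the previous homotopy is a cycle, hence a boundary by
  exactness, and projectivity lifts it linearly.\<close>

lemma projective_resolution_homotopy:
 assumes P: "projective_resolution R P d \<epsilon> A" and Q: "projective_resolution R Q d' \<epsilon>' A"
  and u: "\<And>i. u i \<in> linear_maps R (P i) (Q i)"
  and u0: "\<And>x. x \<in> carrier (P 0) ==> \<epsilon>' (u 0 x) = \<zero>\<^bsub>A\<^esub>"
  and ud: "\<And>i x. x \<in> carrier (P (Suc i)) ==> d' i (u (Suc i) x) = u i (d i x)"
 obtains h where "\<And>i. h i \<in> linear_maps R (P i) (Q (Suc i))"
  "\<And>x. x \<in> carrier (P 0) ==> d' 0 (h 0 x) = u 0 x"
  "\<And>i x. x \<in> carrier (P (Suc i)) ==> d' (Suc i) (h (Suc i) x) = u (Suc i) x \<ominus>\<^bsub>Q (Suc i)\<^esub> h i (d i x)"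
proof -
 note P' = resolutionD[OF P] and Q' = resolutionD[OF Q]
 interpret Q: left_module R "Q i" for i by (rule Q'(2))
 interpret P: left_module R "P i" for i by (rule P'(2))
 let ?I = "\<lambda>i h. h \<in> linear_maps R (P i) (Q (Suc i)) \<and>
   (\<forall>x\<in>carrier (P (Suc i)). d' i (h (d i x)) = u i (d i x))"
 let ?R = "\<lambda>i h h'. \<forall>x\<in>carrier (P (Suc i)). d' (Suc i) (h' x) = u (Suc i) x \<ominus>\<^bsub>Q (Suc i)\<^esub> h (d i x)"
 have "u 0 ` carrier (P 0) \<subseteq> d' 0 ` carrier (Q (Suc 0))" using u0 linearD(1)[OF u] unfolding Q'(6) by auto
 from projective_module_lifting[OF P'(1) Q'(2) Q'(2) Q'(3) u this]
 obtain h0 where h0: "h0 \<in> linear_maps R (P 0) (Q (Suc 0))" "\<And>x. x \<in> carrier (P 0) ==> d' 0 (h0 x) = u 0 x" by blast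
 \<comment> \<open>The first homotopy is pinned to \<open>h0\<close>, since the uniform invariant
   \<open>?I\<close> controls it on boundaries only, while \<open>d' 0 (h 0 x) = u 0 x\<close> is
   wanted on all of \<open>P 0\<close>.\<close>
 let ?I0 = "\<lambda>i h. ?I i h \<and> (i = 0 --> h = h0)"
 have step: "\<exists>h'. ?I0 (Suc i) h' \<and> ?R i h h'" if I0: "?I0 i h" for h i
 proof -
  have I: "?I i h" using I0 by blast
  let ?v = "\<lambda>x. u (Suc i) x \<ominus>\<^bsub>Q (Suc i)\<^esub> h (d i x)"
  have h: "h \<in> linear_maps R (P i) (Q (Suc i))" using I by blast
  have hd: "(\<lambda>x. h (d i x)) \<in> linear_maps R (P (Suc i)) (Q (Suc i))" by (rule linear_maps_compose[OF P'(3) h])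
  have v: "?v \<in> linear_maps R (P (Suc i)) (Q (Suc i))"
  proof (rule linearI)
   fix x y assume x: "x \<in> carrier (P (Suc i))" and y: "y \<in> carrier (P (Suc i))"
   note c = linearD(1)[OF u x] linearD(1)[OF u y] linearD(1)[OF hd x] linearD(1)[OF hd y]
   show "?v (x \<oplus>\<^bsub>P (Suc i)\<^esub> y) = ?v x \<oplus>\<^bsub>Q (Suc i)\<^esub> ?v y"
    unfolding linearD(2)[OF u x y] linearD(2)[OF hd x y] a_minus_def using c by (simp add: Q.minus_add Q.a_ac)
  next
   fix r x assume r: "r \<in> carrier R" and x: "x \<in> carrier (P (Suc i))"
   show "?v (r \<odot>\<^bsub>P (Suc i)\<^esub> x) = r \<odot>\<^bsub>Q (Suc i)\<^esub> ?v x"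
    unfolding linearD(3)[OF u r x] linearD(3)[OF hd r x] a_minus_def
    using linearD(1)[OF u x] linearD(1)[OF hd x] r by (simp add: Q.smult_r_distr Q.smult_r_minus)
  qed (use linearD(1)[OF u] linearD(1)[OF hd] in \<open>auto simp: a_minus_def\<close>)
  have "?v ` carrier (P (Suc i)) \<subseteq> d' (Suc i) ` carrier (Q (Suc (Suc i)))"
  proof
   fix y assume "y \<in> ?v ` carrier (P (Suc i))"
   then obtain x where x: "x \<in> carrier (P (Suc i))" "y = ?v x" by blast
   have "d' i (?v x) = d' i (u (Suc i) x) \<ominus>\<^bsub>Q i\<^esub> d' i (h (d i x))"
    by (rule linear_maps_diff[OF Q.M.abelian_group_axioms Q.M.abelian_group_axioms Q'(3)
       linearD(1)[OF u x(1)] linearD(1)[OF hd x(1)]])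
   also have "\<dots> = u i (d i x) \<ominus>\<^bsub>Q i\<^esub> u i (d i x)" using ud[OF x(1)] I x(1) by simp
   also have "\<dots> = \<zero>\<^bsub>Q i\<^esub>"
    using linearD(1)[OF u linearD(1)[OF P'(3) x(1)]] by (simp add: Q.r_neg a_minus_def)
   finally show "y \<in> d' (Suc i) ` carrier (Q (Suc (Suc i)))" unfolding Q'(7) x(2) using linearD(1)[OF v x(1)] by simp
  qed
  from projective_module_lifting[OF P'(1) Q'(2) Q'(2) Q'(3) v this]
  obtain h' where h': "h' \<in> linear_maps R (P (Suc i)) (Q (Suc (Suc i)))"
   "\<And>x. x \<in> carrier (P (Suc i)) ==> d' (Suc i) (h' x) = ?v x" by blast
  have "d' (Suc i) (h' (d (Suc i) x)) = u (Suc i) (d (Suc i) x)" if x: "x \<in> carrier (P (Suc (Suc i)))" for x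
  proof -
   have dx: "d (Suc i) x \<in> carrier (P (Suc i))" by (rule linearD(1)[OF P'(3) x])
   have "h (d i (d (Suc i) x)) = \<zero>\<^bsub>Q (Suc i)\<^esub>" unfolding projective_resolution_compose_zero(2)[OF P x]
    by (rule linear_maps_zero[OF P.M.abelian_group_axioms Q.M.abelian_group_axioms h])
   thus ?thesis using h'(2)[OF dx] linearD(1)[OF u dx] by (simp add: a_minus_def)
  qed
  thus ?thesis using h' by auto
 qed
 have "\<exists>h. ?I0 0 h" using h0 linearD(1)[OF P'(3)] by blast
 hence "\<exists>h. \<forall>i. ?I0 i (h i) \<and> ?R i (h i) (h (Suc i))" using step by (rule dependent_nat_choice)
 then obtain h where h0': "\<forall>i. ?I0 i (h i) \<and> ?R i (h i) (h (Suc i))" by (rule exE)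
 have h: "?I0 i (h i)" "?R i (h i) (h (Suc i))" for i using spec[OF h0', of i] by (rule conjunct1, rule conjunct2)
 show ?thesis
 proof (rule that[of h])
  show "d' 0 (h 0 x) = u 0 x" if "x \<in> carrier (P 0)" for x using h(1)[of 0] h0(2) that by simp
 qed (use h in blast)+
qed

section \<open>Complexes of linear maps into a coefficient module\<close>

lemma hom_module_simps [simp]:
 "carrier (hom_module \<eta> R P N) = linear_maps R P N \<inter> extensional (carrier P)"
 "\<zero>\<^bsub>hom_module \<eta> R P N\<^esub> = (\<lambda>x\<in>carrier P. \<zero>\<^bsub>N\<^esub>)"
 by (simp_all add: hom_module_def)

lemma hom_module_ops:
 "f \<oplus>\<^bsub>hom_module \<eta> R P N\<^esub> g = (\<lambda>x\<in>carrier P. f x \<oplus>\<^bsub>N\<^esub> g x)"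
 "k \<odot>\<^bsub>hom_module \<eta> R P N\<^esub> f = (\<lambda>x\<in>carrier P. \<eta> k \<odot>\<^bsub>N\<^esub> f x)"
 by (simp_all add: hom_module_def)

lemma restrict_linear_maps:
 assumes P: "left_module R P" and f: "f \<in> linear_maps R P N"
 shows "restrict f (carrier P) \<in> linear_maps R P N"
proof -
 interpret P: left_module R P by fact
 show ?thesis by (rule linearI) (use linearD[OF f] in \<open>auto simp: P.smult_closed\<close>)
qed

text \<open>The scalars \<open>\<eta> k\<close> need to act on \<open>N\<close> by \<open>R\<close>-linear maps for \<open>hom_module\<close> to be closed
 under its scalar multiplication.\<close>

locale coefficient_module = N: left_module R N
 for K :: "('k, 'x) ring_scheme" and R :: "('r, 'w) ring_scheme" and N :: "('r, 'n, 'z) module_scheme" +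
 fixes \<eta> :: "'k => 'r"
 assumes scalar_closed: "k \<in> carrier K ==> \<eta> k \<in> carrier R"
  and scalar_commute: "[|k \<in> carrier K; r \<in> carrier R; x \<in> carrier N|] ==> \<eta> k \<odot>\<^bsub>N\<^esub> (r \<odot>\<^bsub>N\<^esub> x) = r \<odot>\<^bsub>N\<^esub> (\<eta> k \<odot>\<^bsub>N\<^esub> x)"
begin

abbreviation hom_complex :: "(nat => ('r, 'p, 'y) module_scheme) => nat => ('k, 'p => 'n) module" where
 "hom_complex P i \<equiv> hom_module \<eta> R (P i) N"

abbreviation hom_coboundary :: "(nat => ('r, 'p, 'y) module_scheme) => (nat => 'p => 'p) => nat => ('p => 'n) => 'p => 'n" where
 "hom_coboundary P d i f \<equiv> compose (carrier (P (Suc i))) f (d i)"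

context
 fixes P :: "('r, 'p, 'y) module_scheme"
 assumes P: "left_module R P"
begin

interpretation P: left_module R P by (rule P)

lemma hom_module_closed:
 shows "[|f \<in> linear_maps R P N; g \<in> linear_maps R P N|] ==> (\<lambda>x\<in>carrier P. f x \<oplus>\<^bsub>N\<^esub> g x) \<in> linear_maps R P N"
  and "f \<in> linear_maps R P N ==> (\<lambda>x\<in>carrier P. \<ominus>\<^bsub>N\<^esub> f x) \<in> linear_maps R P N"
  and "(\<lambda>x\<in>carrier P. \<zero>\<^bsub>N\<^esub>) \<in> linear_maps R P N"
  and "[|k \<in> carrier K; f \<in> linear_maps R P N|] ==> (\<lambda>x\<in>carrier P. \<eta> k \<odot>\<^bsub>N\<^esub> f x) \<in> linear_maps R P N"
proof -
 show "(\<lambda>x\<in>carrier P. f x \<oplus>\<^bsub>N\<^esub> g x) \<in> linear_maps R P N"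
  if "f \<in> linear_maps R P N" "g \<in> linear_maps R P N" by (rule linearI)
   (use linearD[OF that(1)] linearD[OF that(2)] in \<open>auto simp: N.smult_r_distr N.M.a_ac P.smult_closed\<close>)
 show "(\<lambda>x\<in>carrier P. \<ominus>\<^bsub>N\<^esub> f x) \<in> linear_maps R P N" if "f \<in> linear_maps R P N"
  by (rule linearI)
   (use linearD[OF that(1)] in \<open>auto simp: N.smult_r_minus N.M.minus_add P.smult_closed\<close>)
 show "(\<lambda>x\<in>carrier P. \<zero>\<^bsub>N\<^esub>) \<in> linear_maps R P N"
  by (rule linearI) (auto simp: N.smult_r_zero P.smult_closed)
 show "(\<lambda>x\<in>carrier P. \<eta> k \<odot>\<^bsub>N\<^esub> f x) \<in> linear_maps R P N" if "k \<in> carrier K" "f \<in> linear_maps R P N"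
  by (rule linearI)
   (use linearD[OF that(2)] that(1) in
    \<open>auto simp: N.smult_r_distr N.smult_closed P.smult_closed scalar_closed scalar_commute\<close>)
qed

lemma abelian_group_hom_module: "abelian_group (hom_module \<eta> R P N)"
 and minus_hom_module: "[|f \<in> carrier (hom_module \<eta> R P N); g \<in> carrier (hom_module \<eta> R P N); x \<in> carrier P|]
  ==> (f \<ominus>\<^bsub>hom_module \<eta> R P N\<^esub> g) x = f x \<ominus>\<^bsub>N\<^esub> g x"
proof -
 have "carrier (hom_module \<eta> R P N) \<subseteq> carrier P \<rightarrow>\<^sub>E carrier N"
  by (auto simp: PiE_def dest: linearD(1))
 note pw = abelian_group_pointwise[OF N.M.abelian_group_axioms this hom_module_ops(1) hom_module_simps(2)]
 show "abelian_group (hom_module \<eta> R P N)" by (rule pw(1)) (auto intro: hom_module_closed)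
 show "[|f \<in> carrier (hom_module \<eta> R P N); g \<in> carrier (hom_module \<eta> R P N); x \<in> carrier P|]
  ==> (f \<ominus>\<^bsub>hom_module \<eta> R P N\<^esub> g) x = f x \<ominus>\<^bsub>N\<^esub> g x" by (rule pw(2)) (auto intro: hom_module_closed)
qed

end

lemma compose_linear:
 assumes P: "left_module R P" and Q: "left_module R Q" and f: "f \<in> linear_maps R P Q"
 shows "(\<lambda>\<phi>. compose (carrier P) \<phi> f) \<in> linear_maps K (hom_module \<eta> R Q N) (hom_module \<eta> R P N)"
proof (rule linearI)
 fix \<phi> assume \<phi>: "\<phi> \<in> carrier (hom_module \<eta> R Q N)"
 thus "compose (carrier P) \<phi> f \<in> carrier (hom_module \<eta> R P N)"
  using restrict_linear_maps[OF P linear_maps_compose[OF f, of \<phi> N]] by (simp add: compose_def)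
qed (use linearD(1)[OF f] in \<open>auto simp: hom_module_ops compose_def intro!: restrict_ext\<close>)

lemma cochain_complex_hom_module:
 assumes P: "\<And>i. left_module R (P i)" and d: "\<And>i. d i \<in> linear_maps R (P (Suc i)) (P i)"
  and dd: "\<And>i x. x \<in> carrier (P (Suc (Suc i))) ==> d i (d (Suc i) x) = \<zero>\<^bsub>P i\<^esub>"
 shows "cochain_complex K (hom_complex P) (hom_coboundary P d)"
proof (rule cochain_complex.intro)
 fix i
 show "abelian_group (hom_module \<eta> R (P i) N)" by (rule abelian_group_hom_module[OF P])
 show "(\<lambda>f. compose (carrier (P (Suc i))) f (d i)) \<in> linear_maps K (hom_module \<eta> R (P i) N) (hom_module \<eta> R (P (Suc i)) N)"
  by (rule compose_linear[OF P P d])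
 fix \<phi> assume \<phi>: "\<phi> \<in> carrier (hom_module \<eta> R (P i) N)"
 hence lin: "\<phi> \<in> linear_maps R (P i) N" by simp
 have "\<phi> \<zero>\<^bsub>P i\<^esub> = \<zero>\<^bsub>N\<^esub>"
  by (rule linear_maps_zero[OF left_module.axioms(2)[OF P] N.M.abelian_group_axioms lin])
 thus "compose (carrier (P (Suc (Suc i)))) (compose (carrier (P (Suc i))) \<phi> (d i)) (d (Suc i))
  = \<zero>\<^bsub>hom_module \<eta> R (P (Suc (Suc i))) N\<^esub>" using dd linearD(1)[OF d] by (auto simp: compose_def)
 fix k assume k: "k \<in> carrier K"
 show "k \<odot>\<^bsub>hom_module \<eta> R (P i) N\<^esub> \<phi> \<in> carrier (hom_module \<eta> R (P i) N)"
  using hom_module_closed(4)[OF P k lin] by (simp add: hom_module_ops)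
 fix \<psi> assume \<psi>: "\<psi> \<in> carrier (hom_module \<eta> R (P i) N)"
 hence lin': "\<psi> \<in> linear_maps R (P i) N" by simp
 show "k \<odot>\<^bsub>hom_module \<eta> R (P i) N\<^esub> (\<phi> \<oplus>\<^bsub>hom_module \<eta> R (P i) N\<^esub> \<psi>) =
   k \<odot>\<^bsub>hom_module \<eta> R (P i) N\<^esub> \<phi> \<oplus>\<^bsub>hom_module \<eta> R (P i) N\<^esub> k \<odot>\<^bsub>hom_module \<eta> R (P i) N\<^esub> \<psi>"
  unfolding hom_module_ops using linearD(1)[OF lin] linearD(1)[OF lin'] scalar_closed[OF k]
  by (intro restrict_ext) (simp add: N.smult_r_distr)
qed

end

lemma (in abelian_group) minus_eq_zeroD:
 assumes x: "x \<in> carrier G" and y: "y \<in> carrier G" and eq: "x \<ominus> y = \<zero>"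
 shows "x = y"
proof -
 have "(x \<ominus> y) \<oplus> y = x" using x y by (simp add: a_minus_def a_assoc l_neg)
 thus ?thesis using eq y by simp
qed

context coefficient_module
begin

lemma cochain_complex_resolution:
 assumes "projective_resolution R P d \<epsilon> A"
 shows "cochain_complex K (hom_complex P) (hom_coboundary P d)"
 using resolutionD[OF assms] projective_resolution_compose_zero[OF assms] by (intro cochain_complex_hom_module) auto

lemma mem_cocycles_hom:
 "\<phi> \<in> cocycles (hom_complex P) (hom_coboundary P d) n \<longleftrightarrow>
   \<phi> \<in> linear_maps R (P n) N \<and> \<phi> \<in> extensional (carrier (P n)) \<and>
   (\<forall>x\<in>carrier (P (Suc n)). \<phi> (d n x) = \<zero>\<^bsub>N\<^esub>)"
 by (auto simp: cocycles_def compose_def fun_eq_iff split: if_splits)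

lemma compose_cocycles:
 assumes P: "projective_resolution R P d \<epsilon> A" and Q: "projective_resolution R Q d' \<epsilon>' A'"
  and f: "\<And>i. f i \<in> linear_maps R (P i) (Q i)"
  and fd: "\<And>i x. x \<in> carrier (P (Suc i)) ==> d' i (f (Suc i) x) = f i (d i x)"
  and \<phi>: "\<phi> \<in> cocycles (hom_complex Q) (hom_coboundary Q d') n"
 shows "compose (carrier (P n)) \<phi> (f n) \<in> cocycles (hom_complex P) (hom_coboundary P d) n"
proof -
 note \<phi>' = \<phi>[unfolded mem_cocycles_hom]
 have "\<phi> (f n (d n x)) = \<zero>\<^bsub>N\<^esub>" if "x \<in> carrier (P (Suc n))" for x
  using \<phi>' fd[OF that] linearD(1)[OF f that] by metis
 thus ?thesis unfolding mem_cocycles_hom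
  using linearD(1)[OF compose_linear[OF resolutionD(2)[OF P] resolutionD(2)[OF Q] f], of \<phi> n] \<phi>'
   linearD(1)[OF resolutionD(3)[OF P]] by (auto simp: compose_def)
qed

lemma compose_coboundaries:
 assumes P: "projective_resolution R P d \<epsilon> A" and Q: "projective_resolution R Q d' \<epsilon>' A'"
  and f: "\<And>i. f i \<in> linear_maps R (P i) (Q i)"
  and fd: "\<And>i x. x \<in> carrier (P (Suc i)) ==> d' i (f (Suc i) x) = f i (d i x)"
  and \<phi>: "\<phi> \<in> coboundaries (hom_complex Q) (hom_coboundary Q d') n"
 shows "compose (carrier (P n)) \<phi> (f n) \<in> coboundaries (hom_complex P) (hom_coboundary P d) n"
proof (cases n)
 case 0
 thus ?thesis using \<phi> linearD(1)[OF f] by (auto simp: coboundaries_def compose_def)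
next
 case (Suc m)
 then obtain \<psi> where \<psi>: "\<psi> \<in> carrier (hom_module \<eta> R (Q m) N)" "\<phi> = compose (carrier (Q n)) \<psi> (d' m)"
  using \<phi> by (auto simp: coboundaries_def)
 have "compose (carrier (P n)) \<phi> (f n) = compose (carrier (P n)) (compose (carrier (P m)) \<psi> (f m)) (d m)"
  unfolding \<psi>(2) compose_def Suc using fd linearD(1)[OF f] linearD(1)[OF resolutionD(3)[OF P]] by (intro restrict_ext) simp
 moreover have "compose (carrier (P m)) \<psi> (f m) \<in> carrier (hom_module \<eta> R (P m) N)"
  by (rule linearD(1)[OF compose_linear[OF resolutionD(2)[OF P] resolutionD(2)[OF Q] f] \<psi>(1)])
 ultimately show ?thesis unfolding Suc coboundaries_def by auto
qed

text \<open>The difference between \<open>v\<close> and the identity covers the zero map and is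
  null-homotopic. Composing a cocycle with the homotopy leaves a coboundary, as the cocycle kills
  the term in the image of the differential.\<close>

lemma compose_endomorphism:
 assumes P: "projective_resolution R P d \<epsilon> A" and A: "abelian_group A"
  and v: "\<And>i. v i \<in> linear_maps R (P i) (P i)"
  and v0: "\<And>x. x \<in> carrier (P 0) ==> \<epsilon> (v 0 x) = \<epsilon> x"
  and vd: "\<And>i x. x \<in> carrier (P (Suc i)) ==> d i (v (Suc i) x) = v i (d i x)"
  and \<phi>: "\<phi> \<in> cocycles (hom_complex P) (hom_coboundary P d) n"
 shows "compose (carrier (P n)) \<phi> (v n) \<ominus>\<^bsub>hom_module \<eta> R (P n) N\<^esub> \<phi>
  \<in> coboundaries (hom_complex P) (hom_coboundary P d) n"
proof -
 interpret A: abelian_group A by fact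
 interpret P: left_module R "P i" for i by (rule resolutionD(2)[OF P])
 note P' = resolutionD[OF P]
 note \<phi>' = \<phi>[unfolded mem_cocycles_hom]
 have \<phi>l: "\<phi> \<in> linear_maps R (P n) N" using \<phi>' by blast
 have \<phi>c: "\<phi> \<in> carrier (hom_module \<eta> R (P n) N)" using \<phi>' by simp
 let ?u = "\<lambda>i x. v i x \<ominus>\<^bsub>P i\<^esub> x"
 have u: "?u i \<in> linear_maps R (P i) (P i)" for i
 proof (rule linearI)
  fix x y assume x: "x \<in> carrier (P i)" and y: "y \<in> carrier (P i)"
  show "?u i (x \<oplus>\<^bsub>P i\<^esub> y) = ?u i x \<oplus>\<^bsub>P i\<^esub> ?u i y"
   unfolding linearD(2)[OF v x y] a_minus_def using x y linearD(1)[OF v x] linearD(1)[OF v y] by (simp add: P.minus_add P.a_ac)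
 next
  fix r x assume r: "r \<in> carrier R" and x: "x \<in> carrier (P i)"
  show "?u i (r \<odot>\<^bsub>P i\<^esub> x) = r \<odot>\<^bsub>P i\<^esub> ?u i x" unfolding linearD(3)[OF v r x] a_minus_def
   using linearD(1)[OF v x] x r by (simp add: P.smult_r_distr P.smult_r_minus)
 qed (use linearD(1)[OF v] in \<open>auto simp: a_minus_def\<close>)
 have u0: "\<epsilon> (?u 0 x) = \<zero>\<^bsub>A\<^esub>" if x: "x \<in> carrier (P 0)" for x
 proof -
  have "\<epsilon> (?u 0 x) = \<epsilon> (v 0 x) \<ominus>\<^bsub>A\<^esub> \<epsilon> x"
   by (rule linear_maps_diff[OF P.M.abelian_group_axioms A P'(4) linearD(1)[OF v x] x])
  thus ?thesis using v0[OF x] linearD(1)[OF P'(4) x] by (simp add: a_minus_def A.r_neg)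
 qed
 have ud: "d i (?u (Suc i) x) = ?u i (d i x)" if x: "x \<in> carrier (P (Suc i))" for i x
  using linear_maps_diff[OF P.M.abelian_group_axioms P.M.abelian_group_axioms P'(3) linearD(1)[OF v x] x] vd[OF x] by simp
 obtain h where h: "\<And>i. h i \<in> linear_maps R (P i) (P (Suc i))"
  "\<And>x. x \<in> carrier (P 0) ==> d 0 (h 0 x) = ?u 0 x"
  "\<And>i x. x \<in> carrier (P (Suc i)) ==> d (Suc i) (h (Suc i) x) = ?u (Suc i) x \<ominus>\<^bsub>P (Suc i)\<^esub> h i (d i x)"
  using projective_resolution_homotopy[OF P P u u0 ud] by blast
 let ?c = "compose (carrier (P n)) \<phi> (v n)"
 interpret C: cochain_complex K "hom_complex P" "hom_coboundary P d" by (rule cochain_complex_resolution[OF P])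
 interpret H: abelian_group "hom_module \<eta> R (P n) N" by (rule C.abelian_group)
 have cc: "?c \<in> carrier (hom_module \<eta> R (P n) N)" by (rule linearD(1)[OF compose_linear[OF P'(2) P'(2) v] \<phi>c])
 have ext: "?c \<ominus>\<^bsub>hom_module \<eta> R (P n) N\<^esub> \<phi> \<in> extensional (carrier (P n))"
  using H.minus_closed[OF cc \<phi>c] by simp
 have val: "(?c \<ominus>\<^bsub>hom_module \<eta> R (P n) N\<^esub> \<phi>) x = \<phi> (?u n x)" if x: "x \<in> carrier (P n)" for x
  using minus_hom_module[OF P'(2) cc \<phi>c x] x
   linear_maps_diff[OF P.M.abelian_group_axioms N.M.abelian_group_axioms \<phi>l linearD(1)[OF v x] x]
  by (simp add: compose_def)
 show ?thesis
 proof (cases n)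
  case 0
  have "?c \<ominus>\<^bsub>hom_module \<eta> R (P n) N\<^esub> \<phi> = \<zero>\<^bsub>hom_module \<eta> R (P n) N\<^esub>"
   unfolding hom_module_simps
  proof (rule extensionalityI[OF ext restrict_extensional])
   fix x assume x: "x \<in> carrier (P n)"
   \<comment> \<open>In degree 0 the only coboundary is 0; the whole difference is in the image of
     the differential and is killed by the cocycle.\<close>
   have "\<phi> (?u n x) = \<phi> (d 0 (h 0 x))" using h(2) x unfolding 0 by simp
   also have "\<dots> = \<zero>\<^bsub>N\<^esub>" using \<phi>' linearD(1)[OF h(1)] x unfolding 0 by blast
   finally show "(?c \<ominus>\<^bsub>hom_module \<eta> R (P n) N\<^esub> \<phi>) x = (\<lambda>x\<in>carrier (P n). \<zero>\<^bsub>N\<^esub>) x" using val[OF x] x by simp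
  qed
  thus ?thesis using C.coboundaries_closed(1)[of n] by simp
 next
  case (Suc m)
  let ?\<psi> = "compose (carrier (P m)) \<phi> (h m)"
  have h': "h m \<in> linear_maps R (P m) (P n)" using h(1)[of m] unfolding Suc .
  have \<psi>: "?\<psi> \<in> carrier (hom_module \<eta> R (P m) N)"
   by (rule linearD(1)[OF compose_linear[OF P'(2) P'(2) h'] \<phi>c])
  have "?c \<ominus>\<^bsub>hom_module \<eta> R (P n) N\<^esub> \<phi> = compose (carrier (P (Suc m))) ?\<psi> (d m)"
  proof (rule extensionalityI[OF ext])
   show "compose (carrier (P (Suc m))) ?\<psi> (d m) \<in> extensional (carrier (P n))" unfolding Suc by (rule compose_extensional)
   fix x assume x: "x \<in> carrier (P n)"
   hence xm: "x \<in> carrier (P (Suc m))" unfolding Suc .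
   have dx: "d m x \<in> carrier (P m)" by (rule linearD(1)[OF P'(3) xm])
   have ux: "?u n x \<in> carrier (P n)" by (rule linearD(1)[OF u x])
   have hx: "h m (d m x) \<in> carrier (P n)" by (rule linearD(1)[OF h' dx])
   have "\<phi> (?u n x) \<ominus>\<^bsub>N\<^esub> \<phi> (h m (d m x)) = \<phi> (?u n x \<ominus>\<^bsub>P n\<^esub> h m (d m x))"
    by (rule linear_maps_diff[OF P.M.abelian_group_axioms N.M.abelian_group_axioms \<phi>l ux hx, symmetric])
   also have "\<dots> = \<phi> (d n (h n x))" using h(3)[OF xm] unfolding Suc by simp
   also have "\<dots> = \<zero>\<^bsub>N\<^esub>" using \<phi>' linearD(1)[OF h(1) x] by blast
   finally have "\<phi> (?u n x) = \<phi> (h m (d m x))"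
    by (rule N.M.minus_eq_zeroD[OF linearD(1)[OF \<phi>l ux] linearD(1)[OF \<phi>l hx]])
   thus "(?c \<ominus>\<^bsub>hom_module \<eta> R (P n) N\<^esub> \<phi>) x = compose (carrier (P (Suc m))) ?\<psi> (d m) x"
    using val[OF x] xm dx by (simp add: compose_def)
  qed
  thus ?thesis using \<psi> unfolding coboundaries_def Suc by auto
 qed
qed

text \<open>Comparison maps in both directions compose to endomorphisms covering the identity, which
  act on cohomology as the identity. The resolutions may live on different types, so an arbitrary
  one can be compared with the bar resolution.\<close>

theorem modules_isomorphic_Ext_module:
 assumes P: "projective_resolution R P d \<epsilon> A" and Q: "projective_resolution R Q d' \<epsilon>' A"
  and A: "left_module R A"
 shows "modules_isomorphic K (Ext_module \<eta> R P d N n) (Ext_module \<eta> R Q d' N n)"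
proof -
 note P' = resolutionD[OF P] and Q' = resolutionD[OF Q]
 have A': "abelian_group A" by (rule left_module.axioms(2)[OF A])
 obtain f where f: "\<And>i. f i \<in> linear_maps R (P i) (Q i)"
  "\<And>x. x \<in> carrier (P 0) ==> \<epsilon>' (f 0 x) = \<epsilon> x"
  "\<And>i x. x \<in> carrier (P (Suc i)) ==> d' i (f (Suc i) x) = f i (d i x)"
  using projective_resolution_lift[OF P Q A] by blast
 obtain g where g: "\<And>i. g i \<in> linear_maps R (Q i) (P i)"
  "\<And>x. x \<in> carrier (Q 0) ==> \<epsilon> (g 0 x) = \<epsilon>' x"
  "\<And>i x. x \<in> carrier (Q (Suc i)) ==> d i (g (Suc i) x) = g i (d' i x)"
  using projective_resolution_lift[OF Q P A] by blast
 let ?C = "\<lambda>i. hom_module \<eta> R (Q i) N" and ?\<delta> = "\<lambda>i f. compose (carrier (Q (Suc i))) f (d' i)"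
 let ?D = "\<lambda>i. hom_module \<eta> R (P i) N" and ?\<delta>' = "\<lambda>i f. compose (carrier (P (Suc i))) f (d i)"
 interpret C: cochain_complex K ?C ?\<delta> by (rule cochain_complex_resolution[OF Q])
 interpret D: cochain_complex K ?D ?\<delta>' by (rule cochain_complex_resolution[OF P])
 interpret Cn: abelian_group "?C n" by (rule C.abelian_group)
 interpret Dn: abelian_group "?D n" by (rule D.abelian_group)
 let ?F = "\<lambda>\<phi>. compose (carrier (P n)) \<phi> (f n)" and ?G = "\<lambda>\<phi>. compose (carrier (Q n)) \<phi> (g n)"
 have FG: "?F (?G \<phi>) = compose (carrier (P n)) \<phi> (\<lambda>x. g n (f n x))" for \<phi>
  using linearD(1)[OF f(1)] by (auto simp: compose_def intro!: restrict_ext)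
 have GF: "?G (?F \<phi>) = compose (carrier (Q n)) \<phi> (\<lambda>x. f n (g n x))" for \<phi>
  using linearD(1)[OF g(1)] by (auto simp: compose_def intro!: restrict_ext)
 have Ghom: "?F (?G \<phi>) \<ominus>\<^bsub>?D n\<^esub> \<phi> \<in> coboundaries ?D ?\<delta>' n" if "\<phi> \<in> cocycles ?D ?\<delta>' n" for \<phi>
  unfolding FG using that linearD(1)[OF f(1)] linearD(1)[OF P'(3)] f(2,3) g(2,3)
  by (intro compose_endomorphism[OF P A' linear_maps_compose[OF f(1) g(1)]]) auto
 have Fhom: "?G (?F \<phi>) \<ominus>\<^bsub>?C n\<^esub> \<phi> \<in> coboundaries ?C ?\<delta> n" if "\<phi> \<in> cocycles ?C ?\<delta> n" for \<phi>
  unfolding GF using that linearD(1)[OF g(1)] linearD(1)[OF Q'(3)] f(2,3) g(2,3)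
  by (intro compose_endomorphism[OF Q A' linear_maps_compose[OF g(1) f(1)]]) auto
 show ?thesis unfolding Ext_module_def
 proof (rule modules_isomorphic_cohomologyI[OF C.cochain_complex_axioms D.cochain_complex_axioms
    compose_linear[OF P'(2) Q'(2) f(1)]])
  show coc: "?F \<phi> \<in> cocycles ?D ?\<delta>' n" if "\<phi> \<in> cocycles ?C ?\<delta> n" for \<phi>
   by (rule compose_cocycles[where f = f, OF P Q f(1,3) that])
  show "?F \<phi> \<in> coboundaries ?D ?\<delta>' n \<longleftrightarrow> \<phi> \<in> coboundaries ?C ?\<delta> n" if \<phi>: "\<phi> \<in> cocycles ?C ?\<delta> n" for \<phi>
  proof
   assume "?F \<phi> \<in> coboundaries ?D ?\<delta>' n"
   hence G: "?G (?F \<phi>) \<in> coboundaries ?C ?\<delta> n" by (intro compose_coboundaries[where f = g, OF Q P g(1,3)])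
   let ?b = "?G (?F \<phi>) \<ominus>\<^bsub>?C n\<^esub> \<phi>"
   have cl: "?G (?F \<phi>) \<in> carrier (?C n)" "\<phi> \<in> carrier (?C n)"
    using G C.coboundaries_subset_cocycles C.cocycles_carrier \<phi> by blast+
   have "?G (?F \<phi>) \<oplus>\<^bsub>?C n\<^esub> \<ominus>\<^bsub>?C n\<^esub> ?b \<in> coboundaries ?C ?\<delta> n"
    using C.coboundaries_closed(2)[OF G C.coboundaries_closed(3)[OF Fhom[OF \<phi>]]] .
   moreover have "?G (?F \<phi>) \<oplus>\<^bsub>?C n\<^esub> \<ominus>\<^bsub>?C n\<^esub> ?b = \<phi>"
    using cl unfolding a_minus_def by (simp only: Cn.minus_add Cn.minus_minus Cn.a_inv_closed Cn.r_neg2)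
   ultimately show "\<phi> \<in> coboundaries ?C ?\<delta> n" by simp
  qed (intro compose_coboundaries[where f = f, OF P Q f(1,3)])
  fix \<phi> assume \<phi>: "\<phi> \<in> cocycles ?D ?\<delta>' n"
  have G: "?G \<phi> \<in> cocycles ?C ?\<delta> n" by (rule compose_cocycles[where f = g, OF Q P g(1,3) \<phi>])
  have cl: "?F (?G \<phi>) \<in> carrier (?D n)" "\<phi> \<in> carrier (?D n)"
   using D.cocycles_carrier coc[OF G] \<phi> by blast+
  have "\<ominus>\<^bsub>?D n\<^esub> (?F (?G \<phi>) \<ominus>\<^bsub>?D n\<^esub> \<phi>) = \<phi> \<ominus>\<^bsub>?D n\<^esub> ?F (?G \<phi>)"
   using cl unfolding a_minus_def by (simp only: Dn.minus_add Dn.minus_minus Dn.a_inv_closed Dn.a_comm)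
  thus "\<exists>x\<in>cocycles ?C ?\<delta> n. \<phi> \<ominus>\<^bsub>?D n\<^esub> ?F x \<in> coboundaries ?D ?\<delta>' n"
   using D.coboundaries_closed(3)[OF Ghom[OF \<phi>]] G by (intro bexI[of _ "?G \<phi>"]) auto
 qed
qed

end

section \<open>The monoid algebra and the bar resolution\<close>

text \<open>That \<open>KM\<close> is a ring is part of the hypothesis that \<open>P\<close> is a resolution by \<open>KM\<close>-modules,
 so it is assumed here.\<close>

locale monoid_algebra_ring = K: cring K + M: monoid M + R: ring "monoid_algebra K M"
 for K :: "('k, 'x) ring_scheme" (structure) and M :: "('m, 'y) monoid_scheme"
begin

abbreviation R :: "('m => 'k) ring" where
 "R \<equiv> monoid_algebra K M"

definition single :: "'m => 'k => 'm => 'k" where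
 "single m k = basis_vector K (carrier M) m k"

lemma monoid_algebra_simps:
 "carrier R = carrier (free_module K (carrier M))"
 "\<zero>\<^bsub>R\<^esub> = \<zero>\<^bsub>free_module K (carrier M)\<^esub>"
 "a \<oplus>\<^bsub>R\<^esub> b = a \<oplus>\<^bsub>free_module K (carrier M)\<^esub> b" by (simp_all add: monoid_algebra_def)

lemma monoid_algebra_scalar_eq: "monoid_algebra_scalar K M k = single \<one>\<^bsub>M\<^esub> k"
 by (simp add: monoid_algebra_scalar_def single_def basis_vector_def)

lemma one_monoid_algebra: "\<one>\<^bsub>R\<^esub> = single \<one>\<^bsub>M\<^esub> \<one>"
 by (simp add: monoid_algebra_def single_def basis_vector_def)

lemma single_closed [simp, intro]: "k \<in> carrier K ==> single m k \<in> carrier R"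
 by (simp add: monoid_algebra_simps single_def K.basis_vector_closed)

lemma single_add:
 "[|k \<in> carrier K; l \<in> carrier K|] ==> single m (k \<oplus> l) = single m k \<oplus>\<^bsub>R\<^esub> single m l"
 by (auto simp: monoid_algebra_simps single_def basis_vector_def intro!: restrict_ext)

lemma single_zero: "single m \<zero> = \<zero>\<^bsub>R\<^esub>" by (simp add: monoid_algebra_simps single_def basis_vector_def)

lemma support_single:
 "m \<in> carrier M ==> support_in K (carrier M) (single m k) = (if k = \<zero> then {} else {m})"
 by (auto simp: support_in_def single_def basis_vector_def)

lemma single_mult:
 assumes m: "m \<in> carrier M" "m' \<in> carrier M" and k: "k \<in> carrier K" "k' \<in> carrier K"
 shows "single m k \<otimes>\<^bsub>R\<^esub> single m' k' = single (m \<otimes>\<^bsub>M\<^esub> m') (k \<otimes> k')"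
proof (rule extensionalityI[of _ "carrier M"])
 show "single m k \<otimes>\<^bsub>R\<^esub> single m' k' \<in> extensional (carrier M)" by (simp add: monoid_algebra_def)
 show "single (m \<otimes>\<^bsub>M\<^esub> m') (k \<otimes> k') \<in> extensional (carrier M)" by (simp add: single_def basis_vector_def)
 fix x assume x: "x \<in> carrier M"
 let ?S = "{(a, b). a \<in> support_in K (carrier M) (single m k) \<and> b \<in> support_in K (carrier M) (single m' k')
  \<and> a \<otimes>\<^bsub>M\<^esub> b = x}"
 have S: "?S = (if k \<noteq> \<zero> \<and> k' \<noteq> \<zero> \<and> m \<otimes>\<^bsub>M\<^esub> m' = x then {(m, m')} else {})"
  by (auto simp: support_single m split: if_splits)
 have v: "single m k m = k" "single m' k' m' = k'" using m by (auto simp: single_def basis_vector_def)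
 have "(single m k \<otimes>\<^bsub>R\<^esub> single m' k') x = finsum K (\<lambda>(a, b). single m k a \<otimes> single m' k' b) ?S"
  using x by (simp add: monoid_algebra_def)
 also have "\<dots> = (if m \<otimes>\<^bsub>M\<^esub> m' = x then k \<otimes> k' else \<zero>)" unfolding S using k v by auto
 also have "\<dots> = single (m \<otimes>\<^bsub>M\<^esub> m') (k \<otimes> k') x" using x by (auto simp: single_def basis_vector_def)
 finally show "(single m k \<otimes>\<^bsub>R\<^esub> single m' k') x = single (m \<otimes>\<^bsub>M\<^esub> m') (k \<otimes> k') x" .
qed

lemma monoid_algebra_induct [consumes 1, case_names zero add single]:
 assumes "a \<in> carrier R" and "P \<zero>\<^bsub>R\<^esub>"
  and "\<And>a b. [|a \<in> carrier R; b \<in> carrier R; P a; P b|] ==> P (a \<oplus>\<^bsub>R\<^esub> b)"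
  and "\<And>m k. [|m \<in> carrier M; k \<in> carrier K|] ==> P (single m k)"
 shows "P a"
proof -
 have "a \<in> fin_supp_funs K (carrier M)" using assms(1) by (simp add: monoid_algebra_simps)
 thus ?thesis
 proof (induction a rule: K.fin_supp_funs_induct)
  case zero
  thus ?case using assms(2) unfolding monoid_algebra_simps free_module_simps .
 next
  case (add f g)
  thus ?case using assms(3)[of f g] unfolding monoid_algebra_simps free_module_simps by blast
 next
  case (basis m k)
  thus ?case using assms(4) unfolding single_def by blast
 qed
qed

lemma scalar_central:
 assumes k: "k \<in> carrier K" and a: "a \<in> carrier R"
 shows "monoid_algebra_scalar K M k \<otimes>\<^bsub>R\<^esub> a = a \<otimes>\<^bsub>R\<^esub> monoid_algebra_scalar K M k"
 using a
proof (induction a rule: monoid_algebra_induct)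
 case (single m l)
 thus ?case using k by (simp add: monoid_algebra_scalar_eq single_mult K.m_comm)
qed (use k in \<open>simp_all add: monoid_algebra_scalar_eq R.l_distr R.r_distr\<close>)

text \<open>The scalar multiplication of \<open>action_module\<close> is an instance of
 \<open>free_extend\<close> over this module.\<close>

definition regular_module :: "('k, 'k) module" where
 "regular_module = \<lparr>carrier = carrier K, monoid.mult = undefined, one = undefined,
   zero = \<zero>, add = add K, smult = monoid.mult K\<rparr>"

lemma left_module_regular: "left_module K regular_module"
proof -
 have "abelian_group regular_module"
  by (rule abelian_groupI) (auto simp: regular_module_def K.a_ac intro: K.a_inv_closed K.l_neg)
 thus ?thesis by (intro left_module.intro[OF K.ring_axioms] left_module_axioms.intro)
   (auto simp: regular_module_def K.l_distr K.r_distr K.m_assoc)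
qed

context
 fixes act :: "'m => 'k => 'k"
 assumes act_closed: "[|m \<in> carrier M; x \<in> carrier K|] ==> act m x \<in> carrier K"
  and act_add: "[|m \<in> carrier M; x \<in> carrier K; y \<in> carrier K|] ==> act m (x \<oplus> y) = act m x \<oplus> act m y"
  and act_mult: "[|m \<in> carrier M; k \<in> carrier K; x \<in> carrier K|] ==> act m (k \<otimes> x) = k \<otimes> act m x"
  and act_one: "x \<in> carrier K ==> act \<one>\<^bsub>M\<^esub> x = x"
  and act_act: "[|m \<in> carrier M; m' \<in> carrier M; x \<in> carrier K|] ==> act (m \<otimes>\<^bsub>M\<^esub> m') x = act m (act m' x)"
begin

abbreviation (input) act_mod where "act_mod \<equiv> action_module K M act"

lemma action_module_simps:
 "carrier act_mod = carrier K" "\<zero>\<^bsub>act_mod\<^esub> = \<zero>" "x \<oplus>\<^bsub>act_mod\<^esub> y = x \<oplus> y"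
 by (simp_all add: action_module_def)

lemma action_module_smult:
 assumes x: "x \<in> carrier K"
 shows "a \<in> carrier R ==> a \<odot>\<^bsub>act_mod\<^esub> x \<in> carrier K"
  and "[|a \<in> carrier R; b \<in> carrier R|] ==> (a \<oplus>\<^bsub>R\<^esub> b) \<odot>\<^bsub>act_mod\<^esub> x = a \<odot>\<^bsub>act_mod\<^esub> x \<oplus> b \<odot>\<^bsub>act_mod\<^esub> x"
  and "[|m \<in> carrier M; k \<in> carrier K|] ==> single m k \<odot>\<^bsub>act_mod\<^esub> x = k \<otimes> act m x"
  and "\<zero>\<^bsub>R\<^esub> \<odot>\<^bsub>act_mod\<^esub> x = \<zero>"
proof -
 interpret L: left_module K regular_module by (rule left_module_regular)
 have \<phi>: "(\<lambda>m. act m x) \<in> carrier M \<rightarrow> carrier regular_module"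
  using x act_closed by (auto simp: regular_module_def)
 let ?e = "free_extend K (carrier M) regular_module (\<lambda>m. act m x)"
 have e: "a \<odot>\<^bsub>act_mod\<^esub> x = ?e a" for a
  by (simp add: action_module_def free_extend_def regular_module_def finsum_def finprod_def)
 note lin = L.free_extend_linear[OF \<phi>]
 show "a \<odot>\<^bsub>act_mod\<^esub> x \<in> carrier K" if "a \<in> carrier R"
  using linearD(1)[OF lin, of a] that by (simp add: e monoid_algebra_simps regular_module_def)
 show "(a \<oplus>\<^bsub>R\<^esub> b) \<odot>\<^bsub>act_mod\<^esub> x = a \<odot>\<^bsub>act_mod\<^esub> x \<oplus> b \<odot>\<^bsub>act_mod\<^esub> x" if "a \<in> carrier R" "b \<in> carrier R"
  using linearD(2)[OF lin, of a b] that unfolding e monoid_algebra_simps by (simp add: regular_module_def)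
 show s: "single m k \<odot>\<^bsub>act_mod\<^esub> x = k \<otimes> act m x" if "m \<in> carrier M" "k \<in> carrier K" for m k
  using L.free_extend_basis_vector[OF \<phi> that] by (simp add: e single_def regular_module_def)
 show "\<zero>\<^bsub>R\<^esub> \<odot>\<^bsub>act_mod\<^esub> x = \<zero>"
  using s[of "\<one>\<^bsub>M\<^esub>" "\<zero>"] act_closed[OF M.one_closed x] by (simp add: single_zero)
qed

lemma left_module_action_module: "left_module R act_mod"
proof (rule left_module.intro[OF R.ring_axioms _ left_module_axioms.intro])
 show "abelian_group act_mod" by (rule abelian_groupI) (auto simp: action_module_simps K.a_ac intro: K.a_inv_closed K.l_neg)
 fix x assume "x \<in> carrier act_mod"
 hence x: "x \<in> carrier K" by (simp add: action_module_simps)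
 show "\<one>\<^bsub>R\<^esub> \<odot>\<^bsub>act_mod\<^esub> x = x"
  using x by (simp add: one_monoid_algebra action_module_smult act_one)
 fix a assume a: "a \<in> carrier R"
 show "a \<odot>\<^bsub>act_mod\<^esub> x \<in> carrier act_mod" using a x by (simp add: action_module_simps action_module_smult)
 { fix y assume "y \<in> carrier act_mod"
  hence y: "y \<in> carrier K" by (simp add: action_module_simps)
  have "a \<odot>\<^bsub>act_mod\<^esub> (x \<oplus> y) = a \<odot>\<^bsub>act_mod\<^esub> x \<oplus> a \<odot>\<^bsub>act_mod\<^esub> y"
   using a
  proof (induction a rule: monoid_algebra_induct)
   case (single m k)
   thus ?case using x y by (simp add: action_module_smult act_add act_closed K.r_distr)
  qed (use x y in \<open>simp_all add: action_module_smult K.a_ac\<close>)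
  thus "a \<odot>\<^bsub>act_mod\<^esub> (x \<oplus>\<^bsub>act_mod\<^esub> y) = a \<odot>\<^bsub>act_mod\<^esub> x \<oplus>\<^bsub>act_mod\<^esub> a \<odot>\<^bsub>act_mod\<^esub> y" by (simp add: action_module_simps) }
 note r_distr = this
 fix b assume b: "b \<in> carrier R"
 show "(a \<oplus>\<^bsub>R\<^esub> b) \<odot>\<^bsub>act_mod\<^esub> x = a \<odot>\<^bsub>act_mod\<^esub> x \<oplus>\<^bsub>act_mod\<^esub> b \<odot>\<^bsub>act_mod\<^esub> x"
  using a b x by (simp add: action_module_simps action_module_smult)
 have bs: "(single m k \<otimes>\<^bsub>R\<^esub> b) \<odot>\<^bsub>act_mod\<^esub> x = single m k \<odot>\<^bsub>act_mod\<^esub> (b \<odot>\<^bsub>act_mod\<^esub> x)" if mk: "m \<in> carrier M" "k \<in> carrier K" for m k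
  using b
 proof (induction b rule: monoid_algebra_induct)
  case zero
  have "act m \<zero> = \<zero>" using act_mult[OF mk(1) K.zero_closed K.zero_closed] act_closed[OF mk(1) K.zero_closed] by simp
  thus ?case using x mk by (simp add: action_module_smult)
 next
  case (add b c)
  thus ?case using x mk by (simp add: R.r_distr action_module_smult act_add act_closed K.r_distr)
 next
  case (single m' k')
  thus ?case using x mk by (simp add: single_mult action_module_smult act_act act_mult act_closed K.m_assoc)
 qed
 show "(a \<otimes>\<^bsub>R\<^esub> b) \<odot>\<^bsub>act_mod\<^esub> x = a \<odot>\<^bsub>act_mod\<^esub> (b \<odot>\<^bsub>act_mod\<^esub> x)"
  using a
 proof (induction a rule: monoid_algebra_induct)
  case (single m k)
  thus ?case by (rule bs)
 qed (use x b in \<open>simp_all add: R.l_distr action_module_smult\<close>)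
qed

lemma coefficient_module_action_module:
 "coefficient_module K R act_mod (monoid_algebra_scalar K M)"
proof -
 interpret N: left_module R act_mod by (rule left_module_action_module)
 show ?thesis
 proof
  fix k assume k: "k \<in> carrier K"
  thus kc: "monoid_algebra_scalar K M k \<in> carrier R" by (simp add: monoid_algebra_scalar_eq)
  fix r x assume r: "r \<in> carrier R" and x: "x \<in> carrier act_mod"
  show "monoid_algebra_scalar K M k \<odot>\<^bsub>act_mod\<^esub> (r \<odot>\<^bsub>act_mod\<^esub> x) = r \<odot>\<^bsub>act_mod\<^esub> (monoid_algebra_scalar K M k \<odot>\<^bsub>act_mod\<^esub> x)"
   using N.smult_assoc1[OF kc r x] N.smult_assoc1[OF r kc x] scalar_central[OF k r] by simp
 qed
qed

end

end

text \<open>The sign (-1)^i expressed by negation only, so that one notation serves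
  \<open>K\<close>, the bar modules and values of cochains.\<close>

definition alternate :: "('a, 'x) ring_scheme => nat => 'a => 'a" where
 "alternate A i x = (if even i then x else \<ominus>\<^bsub>A\<^esub> x)"

context abelian_group
begin

lemma alternate_closed [simp, intro]: "x \<in> carrier G ==> alternate G i x \<in> carrier G"
 by (simp add: alternate_def)

lemma alternate_add:
 "[|x \<in> carrier G; y \<in> carrier G|] ==> alternate G i (x \<oplus> y) = alternate G i x \<oplus> alternate G i y"
 by (simp add: alternate_def minus_add a_comm)

lemma alternate_zero [simp]: "alternate G i \<zero> = \<zero>" by (simp add: alternate_def)

lemma alternate_alternate: "x \<in> carrier G ==> alternate G i (alternate G i x) = x" by (simp add: alternate_def)

lemma alternate_Suc_cancel: "x \<in> carrier G ==> alternate G i x \<oplus> alternate G (Suc i) x = \<zero>"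
 by (simp add: alternate_def r_neg l_neg)

end

lemma additive_map_alternate:
 assumes "abelian_group A" "abelian_group B"
  and "f \<in> carrier A \<rightarrow> carrier B" "\<And>x y. [|x \<in> carrier A; y \<in> carrier A|] ==> f (x \<oplus>\<^bsub>A\<^esub> y) = f x \<oplus>\<^bsub>B\<^esub> f y"
  and "x \<in> carrier A"
 shows "f (alternate A i x) = alternate B i (f x)" unfolding alternate_def by (auto intro!: additive_map_minus assms)

section \<open>The bar resolution\<close>

context monoid_algebra_ring
begin

definition words :: "nat => 'm list set" where
 "words n = {w. length w = n \<and> set w \<subseteq> carrier M}"

text \<open>The word \<open>[m\<^sub>1, \<dots>, m\<^sub>n]\<close> stands for the simplex of the nerve of \<open>U(M) \<rtimes> M\<close> with last
 vertex \<open>1\<close> whose arrow from the \<open>(i - 1)\<close>-st to the \<open>i\<close>-th vertex is labelled \<open>m\<^sub>i\<close>.\<close>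

definition bar :: "nat => ('m => 'k, 'm list => 'm => 'k) module" where
 "bar n = free_module R (words n)"

definition bar_cell :: "nat => 'm list => 'm => 'k => 'm list => 'm => 'k" where
 "bar_cell n w m k = basis_vector R (words n) w (single m k)"

abbreviation bar_generator :: "nat => 'm list => 'm list => 'm => 'k" where
 "bar_generator n w \<equiv> bar_cell n w \<one>\<^bsub>M\<^esub> \<one>"

text \<open>The later letter stands on the left because arrows of the nerve compose that way.
  Deleting the last vertex moves the last letter into the coefficient; the result is the usual bar
  resolution with words read backwards.\<close>

definition word_face :: "nat => 'm list => 'm list" where
 "word_face i w = (if i = 0 then tl w else if i = length w then butlast w
   else take (i - 1) w @ (w ! i \<otimes>\<^bsub>M\<^esub> w ! (i - 1)) # drop (Suc i) w)"

definition word_coeff :: "nat => 'm list => 'm" where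
 "word_coeff i w = (if i = length w then last w else \<one>\<^bsub>M\<^esub>)"

definition bar_d :: "nat => ('m list => 'm => 'k) => 'm list => 'm => 'k" where
 "bar_d n = free_extend R (words (Suc n)) (bar n)
   (\<lambda>w. \<Oplus>\<^bsub>bar n\<^esub>i\<in>{..Suc n}. bar_cell n (word_face i w) (word_coeff i w) (alternate K i \<one>))"

definition bar_aug :: "('m list => 'm => 'k) => 'k" where
 "bar_aug = free_extend R (words 0) (trivial_module K M) (\<lambda>w. \<one>)"

text \<open>The classical contraction, additive but not linear over the monoid algebra: a
  coefficient \<open>m\<close> in front of a word \<open>w\<close> becomes the last letter of
  \<open>w @ [m]\<close>. It is written through values, where \<open>last v\<close> is the argument
  at which the old coefficient function is read.\<close>

definition bar_contr :: "nat => ('m list => 'm => 'k) => 'm list => 'm => 'k" where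
 "bar_contr n F = (\<lambda>v\<in>words (Suc n). single \<one>\<^bsub>M\<^esub> (F (butlast v) (last v)))"

lemma words_snoc: "w @ [m] \<in> words (Suc n) \<longleftrightarrow> w \<in> words n \<and> m \<in> carrier M"
 by (auto simp: words_def)

lemma words_SucE:
 assumes "v \<in> words (Suc n)"
 obtains w m where "v = w @ [m]" "w \<in> words n" "m \<in> carrier M"
proof -
 have "v \<noteq> []" using assms by (auto simp: words_def)
 hence "v = butlast v @ [last v]" by simp
 thus thesis using that assms words_snoc by metis
qed

lemma word_face_closed:
 assumes w: "w \<in> words (Suc n)" and i: "i \<le> Suc n"
 shows "word_face i w \<in> words n"
proof -
 have l: "length w = Suc n" and s: "set w \<subseteq> carrier M" using w by (auto simp: words_def)
 consider "i = 0" | "i = Suc n" | "0 < i" "i < Suc n" using i by linarith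
 thus ?thesis
 proof cases
  case 1
  thus ?thesis using l s by (cases w) (auto simp: word_face_def words_def)
 next
  case 2
  thus ?thesis using l s in_set_butlastD[of _ w] by (auto simp: word_face_def words_def)
 next
  case 3
  have "w ! i \<in> carrier M" "w ! (i - 1) \<in> carrier M" using 3 l s nth_mem by (metis less_imp_diff_less subsetD)+
  thus ?thesis using 3 l s set_take_subset[of "i - 1" w] set_drop_subset[of "Suc i" w] by (auto simp: word_face_def words_def)
 qed
qed

lemma word_coeff_closed: "w \<in> words (Suc n) ==> word_coeff i w \<in> carrier M"
 by (erule words_SucE) (simp add: word_coeff_def)

text \<open>The source of the homotopy identity: appending a coefficient to a word commutes with all
  faces but the last, the new letter absorbing the coefficient of the face.\<close>

lemma word_face_snoc:
 assumes "length w = Suc n" "i \<le> Suc n" and that: "m \<in> carrier M"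
 shows "word_face i (w @ [m]) = word_face i w @ [m \<otimes>\<^bsub>M\<^esub> word_coeff i w]"
proof -
 have w: "w \<noteq> []" using assms(1) by auto
 consider "i = 0" | "i = Suc n" | "0 < i" "i < Suc n" using assms(2) by linarith
 thus ?thesis
 proof cases
  case 1
  thus ?thesis using w that by (simp add: word_face_def word_coeff_def)
 next
  case 2
  thus ?thesis using w assms(1) by (simp add: word_face_def word_coeff_def nth_append butlast_conv_take last_conv_nth)
 next
  case 3
  moreover have "i - Suc 0 < Suc n" using 3 by linarith
  ultimately show ?thesis using assms(1) that by (simp add: word_face_def word_coeff_def nth_append)
 qed
qed

lemma left_module_bar: "left_module R (bar n)" unfolding bar_def by (rule R.left_module_free_module)

lemma abelian_group_bar: "abelian_group (bar n)" by (rule left_module.axioms(2)[OF left_module_bar])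

lemma bar_cell_closed [simp, intro]: "k \<in> carrier K ==> bar_cell n w m k \<in> carrier (bar n)"
 by (simp add: bar_def bar_cell_def R.basis_vector_closed)

lemma bar_cell_add:
 "[|k \<in> carrier K; l \<in> carrier K|] ==> bar_cell n w m (k \<oplus> l) = bar_cell n w m k \<oplus>\<^bsub>bar n\<^esub> bar_cell n w m l"
 by (auto simp: bar_def bar_cell_def single_add basis_vector_def)

lemma bar_cell_zero: "bar_cell n w m \<zero> = \<zero>\<^bsub>bar n\<^esub>"
 by (simp add: bar_def bar_cell_def basis_vector_def single_zero)

lemma bar_cell_minus:
 "k \<in> carrier K ==> bar_cell n w m (\<ominus> k) = \<ominus>\<^bsub>bar n\<^esub> bar_cell n w m k"
 using additive_map_minus[OF K.is_abelian_group abelian_group_bar, of "bar_cell n w m" n k] by (auto simp: bar_cell_add)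

lemma bar_cell_alternate:
 "k \<in> carrier K ==> bar_cell n w m (alternate K i k) = alternate (bar n) i (bar_cell n w m k)"
 by (simp add: alternate_def bar_cell_minus)

text \<open>Since the contraction is only additive, its identities cannot be tested on generators
  alone; all elements \<open>bar_cell n w m k\<close> are needed.\<close>

lemma bar_map_eqI:
 assumes N: "abelian_group N"
  and f: "f \<in> carrier (bar n) \<rightarrow> carrier N"
   "\<And>x y. [|x \<in> carrier (bar n); y \<in> carrier (bar n)|] ==> f (x \<oplus>\<^bsub>bar n\<^esub> y) = f x \<oplus>\<^bsub>N\<^esub> f y"
  and g: "g \<in> carrier (bar n) \<rightarrow> carrier N"
   "\<And>x y. [|x \<in> carrier (bar n); y \<in> carrier (bar n)|] ==> g (x \<oplus>\<^bsub>bar n\<^esub> y) = g x \<oplus>\<^bsub>N\<^esub> g y"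
  and eq: "\<And>w m k. [|w \<in> words n; m \<in> carrier M; k \<in> carrier K|] ==> f (bar_cell n w m k) = g (bar_cell n w m k)"
  and x: "x \<in> carrier (bar n)"
 shows "f x = g x"
proof (rule R.free_module_map_eqI[OF N f[unfolded bar_def] g[unfolded bar_def] _ x[unfolded bar_def]])
 fix w r assume w: "w \<in> words n" and r: "r \<in> carrier R"
 have b: "basis_vector R (words n) w r \<in> carrier (bar n)" if "r \<in> carrier R" for r
  using that by (simp add: bar_def R.basis_vector_closed)
 show "f (basis_vector R (words n) w r) = g (basis_vector R (words n) w r)" using r
 proof (induction r rule: monoid_algebra_induct)
  case zero
  have "basis_vector R (words n) w \<zero>\<^bsub>R\<^esub> = \<zero>\<^bsub>bar n\<^esub>" by (simp add: basis_vector_def bar_def)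
  moreover have "f \<zero>\<^bsub>bar n\<^esub> = \<zero>\<^bsub>N\<^esub>" by (rule additive_map_zero[OF abelian_group_bar N f(1)]) (rule f(2))
  moreover have "g \<zero>\<^bsub>bar n\<^esub> = \<zero>\<^bsub>N\<^esub>" by (rule additive_map_zero[OF abelian_group_bar N g(1)]) (rule g(2))
  ultimately show ?case by simp
 next
  case (add r s)
  have "basis_vector R (words n) w (r \<oplus>\<^bsub>R\<^esub> s) = basis_vector R (words n) w r \<oplus>\<^bsub>bar n\<^esub> basis_vector R (words n) w s"
   by (auto simp: basis_vector_def bar_def)
  thus ?case using add f(2)[OF b b, of r s] g(2)[OF b b, of r s] by simp
 next
  case (single m k)
  thus ?case using eq[OF w] unfolding bar_cell_def by blast
 qed
qed auto

lemma bar_linear_map_eqI: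
 assumes "left_module R N" "f \<in> linear_maps R (bar n) N" "g \<in> linear_maps R (bar n) N"
  and "\<And>w. w \<in> words n ==> f (bar_cell n w \<one>\<^bsub>M\<^esub> \<one>) = g (bar_cell n w \<one>\<^bsub>M\<^esub> \<one>)"
  and "x \<in> carrier (bar n)"
 shows "f x = g x" using R.free_module_linear_map_eqI[of N f "words n" g x] assms
 by (simp add: bar_def bar_cell_def one_monoid_algebra)

lemma smult_bar_cell:
 assumes "m \<in> carrier M" "m' \<in> carrier M" "k \<in> carrier K" "k' \<in> carrier K"
 shows "single m k \<odot>\<^bsub>bar n\<^esub> bar_cell n w m' k' = bar_cell n w (m \<otimes>\<^bsub>M\<^esub> m') (k \<otimes> k')"
 using assms by (auto simp: bar_def bar_cell_def basis_vector_def single_mult)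

lemma bar_d_linear: "bar_d n \<in> linear_maps R (bar (Suc n)) (bar n)"
proof -
 interpret B: left_module R "bar n" by (rule left_module_bar)
 show ?thesis unfolding bar_d_def bar_def[of "Suc n"] by (rule B.free_extend_linear) auto
qed

lemma bar_d_cell:
 assumes w: "w \<in> words (Suc n)" and m: "m \<in> carrier M" and k: "k \<in> carrier K"
 shows "bar_d n (bar_cell (Suc n) w m k)
  = (\<Oplus>\<^bsub>bar n\<^esub>i\<in>{..Suc n}. bar_cell n (word_face i w) (m \<otimes>\<^bsub>M\<^esub> word_coeff i w) (alternate K i k))"
proof -
 interpret B: left_module R "bar n" by (rule left_module_bar)
 let ?\<phi> = "\<lambda>w. \<Oplus>\<^bsub>bar n\<^esub>i\<in>{..Suc n}. bar_cell n (word_face i w) (word_coeff i w) (alternate K i \<one>)"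
 have "bar_d n (bar_cell (Suc n) w m k) = single m k \<odot>\<^bsub>bar n\<^esub> ?\<phi> w"
  unfolding bar_d_def bar_cell_def[of "Suc n"] by (rule B.free_extend_basis_vector) (use w k in auto)
 also have "\<dots> = (\<Oplus>\<^bsub>bar n\<^esub>i\<in>{..Suc n}. single m k \<odot>\<^bsub>bar n\<^esub>
   bar_cell n (word_face i w) (word_coeff i w) (alternate K i \<one>))" by (rule B.smult_r_finsum) (use k in auto)
 also have "\<dots> = (\<Oplus>\<^bsub>bar n\<^esub>i\<in>{..Suc n}. bar_cell n (word_face i w) (m \<otimes>\<^bsub>M\<^esub> word_coeff i w) (alternate K i k))"
  using k smult_bar_cell[OF m word_coeff_closed[OF w] k] by (fastforce simp: alternate_def K.r_minus intro: B.M.finsum_cong'[OF refl])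
 finally show ?thesis .
qed

lemma left_module_trivial: "left_module R (trivial_module K M)"
 unfolding trivial_module_def by (rule left_module_action_module) auto

lemma smult_trivial:
 assumes "m \<in> carrier M" "k \<in> carrier K" "x \<in> carrier K"
 shows "single m k \<odot>\<^bsub>trivial_module K M\<^esub> x = k \<otimes> x"
 unfolding trivial_module_def by (rule action_module_smult(3)) (use assms in auto)

lemma trivial_module_simps:
 "carrier (trivial_module K M) = carrier K" "\<zero>\<^bsub>trivial_module K M\<^esub> = \<zero>"
 "x \<oplus>\<^bsub>trivial_module K M\<^esub> y = x \<oplus> y" by (simp_all add: trivial_module_def action_module_def)

lemma bar_aug_linear: "bar_aug \<in> linear_maps R (bar 0) (trivial_module K M)" unfolding bar_aug_def bar_def
 by (rule left_module.free_extend_linear[OF left_module_trivial]) (simp add: trivial_module_simps)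

lemma bar_aug_cell:
 assumes "w \<in> words 0" "m \<in> carrier M" "k \<in> carrier K"
 shows "bar_aug (bar_cell 0 w m k) = k"
proof -
 have "bar_aug (bar_cell 0 w m k) = single m k \<odot>\<^bsub>trivial_module K M\<^esub> \<one>"
  unfolding bar_aug_def bar_cell_def by (rule left_module.free_extend_basis_vector[OF left_module_trivial])
   (use assms in \<open>auto simp: trivial_module_simps\<close>)
 thus ?thesis using assms smult_trivial by simp
qed

lemma bar_contr_closed:
 assumes F: "F \<in> carrier (bar n)"
 shows "bar_contr n F \<in> carrier (bar (Suc n))"
proof -
 have F': "F \<in> fin_supp_funs R (words n)" using F by (simp add: bar_def)
 have Fw: "F w \<in> fin_supp_funs K (carrier M)" if "w \<in> words n" for w
  using fin_supp_funsD(1)[OF F' that] by (simp add: monoid_algebra_simps)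
 let ?J = "\<Union>w\<in>support_in R (words n) F. (\<lambda>m. w @ [m]) ` support_in K (carrier M) (F w)"
 have "bar_contr n F \<in> fin_supp_funs R (words (Suc n))"
 proof (rule fin_supp_funsI[of _ _ _ ?J])
  show "finite ?J" using fin_supp_funsD(2)[OF F'] fin_supp_funsD(2)[OF Fw] by (auto simp: support_in_def)
  show "bar_contr n F \<in> extensional (words (Suc n))" by (simp add: bar_contr_def)
  fix v assume v: "v \<in> words (Suc n)"
  then obtain w m where wm: "v = w @ [m]" "w \<in> words n" "m \<in> carrier M" by (rule words_SucE)
  show "bar_contr n F v \<in> carrier R" using v wm fin_supp_funsD(1)[OF Fw[OF wm(2)] wm(3)] by (simp add: bar_contr_def)
  assume "v \<notin> ?J"
  hence "F w m = \<zero>" using wm by (auto simp: support_in_def monoid_algebra_simps)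
  thus "bar_contr n F v = \<zero>\<^bsub>R\<^esub>" using v wm by (simp add: bar_contr_def single_zero)
 qed
 thus ?thesis by (simp add: bar_def)
qed

lemma bar_contr_add:
 assumes F: "F \<in> carrier (bar n)" and G: "G \<in> carrier (bar n)"
 shows "bar_contr n (F \<oplus>\<^bsub>bar n\<^esub> G) = bar_contr n F \<oplus>\<^bsub>bar (Suc n)\<^esub> bar_contr n G"
proof -
 have "single \<one>\<^bsub>M\<^esub> ((F \<oplus>\<^bsub>bar n\<^esub> G) (butlast v) (last v))
   = single \<one>\<^bsub>M\<^esub> (F (butlast v) (last v)) \<oplus>\<^bsub>R\<^esub> single \<one>\<^bsub>M\<^esub> (G (butlast v) (last v))" if v: "v \<in> words (Suc n)" for v
 proof -
  obtain w m where wm: "v = w @ [m]" "w \<in> words n" "m \<in> carrier M" using v by (rule words_SucE)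
  have "F w m \<in> carrier K" "G w m \<in> carrier K"
   using fin_supp_funsD(1)[of F R "words n" w] fin_supp_funsD(1)[of G R "words n" w] F G wm
    fin_supp_funsD(1)[of _ K "carrier M" m] by (auto simp: bar_def monoid_algebra_simps)
  thus ?thesis using wm by (simp add: bar_def single_add[symmetric]) (simp add: monoid_algebra_simps)
 qed
 thus ?thesis by (auto simp: bar_contr_def bar_def)
qed

lemma bar_contr_zero: "bar_contr n \<zero>\<^bsub>bar n\<^esub> = \<zero>\<^bsub>bar (Suc n)\<^esub>"
 by (rule additive_map_zero[OF abelian_group_bar abelian_group_bar])
  (auto simp: bar_contr_closed bar_contr_add)

lemma bar_contr_cell:
 assumes w: "w \<in> words n" and m: "m \<in> carrier M" and k: "k \<in> carrier K"
 shows "bar_contr n (bar_cell n w m k) = bar_cell (Suc n) (w @ [m]) \<one>\<^bsub>M\<^esub> k"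
 unfolding bar_contr_def bar_cell_def basis_vector_def[of R "words (Suc n)"]
 by (fastforce simp: basis_vector_def single_def monoid_algebra_simps intro: words_SucE)

lemma words_0 [simp]: "words 0 = {[]}" by (auto simp: words_def)

lemma bar_homotopy_0:
 assumes x: "x \<in> carrier (bar 0)"
 shows "bar_d 0 (bar_contr 0 x) = bar_cell 0 [] \<one>\<^bsub>M\<^esub> (bar_aug x) \<ominus>\<^bsub>bar 0\<^esub> x"
proof -
 interpret B: abelian_group "bar 0" by (rule abelian_group_bar)
 interpret B1: abelian_group "bar (Suc 0)" by (rule abelian_group_bar)
 note ea = linearD(1,2)[OF bar_aug_linear, unfolded trivial_module_simps]
 note dl = linearD(1,2)[OF bar_d_linear[of 0]]
 show ?thesis
 proof (rule bar_map_eqI[OF abelian_group_bar _ _ _ _ _ x])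
  fix x y assume "x \<in> carrier (bar 0)" "y \<in> carrier (bar 0)"
  thus "bar_d 0 (bar_contr 0 (x \<oplus>\<^bsub>bar 0\<^esub> y)) =
    bar_d 0 (bar_contr 0 x) \<oplus>\<^bsub>bar 0\<^esub> bar_d 0 (bar_contr 0 y)"
   and "bar_cell 0 [] \<one>\<^bsub>M\<^esub> (bar_aug (x \<oplus>\<^bsub>bar 0\<^esub> y)) \<ominus>\<^bsub>bar 0\<^esub> (x \<oplus>\<^bsub>bar 0\<^esub> y) =
    (bar_cell 0 [] \<one>\<^bsub>M\<^esub> (bar_aug x) \<ominus>\<^bsub>bar 0\<^esub> x) \<oplus>\<^bsub>bar 0\<^esub> (bar_cell 0 [] \<one>\<^bsub>M\<^esub> (bar_aug y) \<ominus>\<^bsub>bar 0\<^esub> y)"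
   by (simp_all add: bar_contr_add bar_contr_closed dl ea bar_cell_add a_minus_def B.minus_add B.a_ac)
 next
  fix w m k assume w: "w \<in> words 0" and m: "m \<in> carrier M" and k: "k \<in> carrier K"
  have w1: "[m] \<in> words (Suc 0)" using m by (simp add: words_def)
  have "bar_d 0 (bar_contr 0 (bar_cell 0 w m k)) = bar_d 0 (bar_cell (Suc 0) [m] \<one>\<^bsub>M\<^esub> k)"
   using bar_contr_cell[OF w m k] w by simp
  also have "\<dots> = (\<Oplus>\<^bsub>bar 0\<^esub>i\<in>{0, Suc 0}. bar_cell 0 (word_face i [m]) (\<one>\<^bsub>M\<^esub> \<otimes>\<^bsub>M\<^esub> word_coeff i [m]) (alternate K i k))"
   unfolding bar_d_cell[OF w1 M.one_closed k] by (simp add: atMost_Suc insert_commute)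
  also have "\<dots> = bar_cell 0 [] \<one>\<^bsub>M\<^esub> k \<oplus>\<^bsub>bar 0\<^esub> bar_cell 0 [] m (\<ominus> k)"
   using m k by (simp add: word_face_def word_coeff_def alternate_def)
  also have "\<dots> = bar_cell 0 [] \<one>\<^bsub>M\<^esub> (bar_aug (bar_cell 0 w m k)) \<ominus>\<^bsub>bar 0\<^esub> bar_cell 0 w m k"
   unfolding bar_aug_cell[OF w m k] using w k by (simp add: bar_cell_minus a_minus_def)
  finally show "bar_d 0 (bar_contr 0 (bar_cell 0 w m k)) =
    bar_cell 0 [] \<one>\<^bsub>M\<^esub> (bar_aug (bar_cell 0 w m k)) \<ominus>\<^bsub>bar 0\<^esub> bar_cell 0 w m k" .
 qed (auto simp: dl ea bar_contr_closed)
qed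

text \<open>The new letter is appended at the end, so the face returning the original cell is the
  last one, of index \<open>n + 2\<close>. Its sign is (-1)^n, and the usual homotopy formula holds
  up to this sign.\<close>

lemma bar_homotopy_Suc:
 assumes x: "x \<in> carrier (bar (Suc n))"
 shows "bar_d (Suc n) (bar_contr (Suc n) x)
  = bar_contr n (bar_d n x) \<oplus>\<^bsub>bar (Suc n)\<^esub> alternate (bar (Suc n)) n x"
proof -
 interpret B: abelian_group "bar i" for i by (rule abelian_group_bar)
 note dl = linearD(1,2)[OF bar_d_linear]
 show ?thesis
 proof (rule bar_map_eqI[OF abelian_group_bar _ _ _ _ _ x])
  fix x y assume "x \<in> carrier (bar (Suc n))" "y \<in> carrier (bar (Suc n))"
  thus "bar_d (Suc n) (bar_contr (Suc n) (x \<oplus>\<^bsub>bar (Suc n)\<^esub> y)) =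
    bar_d (Suc n) (bar_contr (Suc n) x) \<oplus>\<^bsub>bar (Suc n)\<^esub> bar_d (Suc n) (bar_contr (Suc n) y)"
   and "bar_contr n (bar_d n (x \<oplus>\<^bsub>bar (Suc n)\<^esub> y)) \<oplus>\<^bsub>bar (Suc n)\<^esub> alternate (bar (Suc n)) n (x \<oplus>\<^bsub>bar (Suc n)\<^esub> y) =
    (bar_contr n (bar_d n x) \<oplus>\<^bsub>bar (Suc n)\<^esub> alternate (bar (Suc n)) n x) \<oplus>\<^bsub>bar (Suc n)\<^esub>
    (bar_contr n (bar_d n y) \<oplus>\<^bsub>bar (Suc n)\<^esub> alternate (bar (Suc n)) n y)"
   by (simp_all add: bar_contr_add bar_contr_closed dl B.alternate_add B.a_ac)
 next
  fix w m k assume w: "w \<in> words (Suc n)" and m: "m \<in> carrier M" and k: "k \<in> carrier K"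
  have lw: "length w = Suc n" using w by (simp add: words_def)
  have wm: "w @ [m] \<in> words (Suc (Suc n))" using w m by (simp add: words_snoc)
  let ?t = "\<lambda>i. bar_cell (Suc n) (word_face i (w @ [m])) (\<one>\<^bsub>M\<^esub> \<otimes>\<^bsub>M\<^esub> word_coeff i (w @ [m])) (alternate K i k)"
  have t: "?t i = bar_contr n (bar_cell n (word_face i w) (m \<otimes>\<^bsub>M\<^esub> word_coeff i w) (alternate K i k))"
   if "i \<in> {..Suc n}" for i
  proof -
   have i: "i \<le> Suc n" using that by simp
   have c: "word_coeff i (w @ [m]) = \<one>\<^bsub>M\<^esub>" using i lw by (simp add: word_coeff_def)
   show ?thesis
    using bar_contr_cell[OF word_face_closed[OF w i] M.m_closed[OF m word_coeff_closed[OF w]], of "alternate K i k" i] k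
    unfolding c word_face_snoc[OF lw i m] by simp
  qed
  have "bar_d (Suc n) (bar_contr (Suc n) (bar_cell (Suc n) w m k))
    = (\<Oplus>\<^bsub>bar (Suc n)\<^esub>i\<in>{..Suc (Suc n)}. ?t i)"
   unfolding bar_contr_cell[OF w m k] by (rule bar_d_cell[OF wm M.one_closed k])
  also have "\<dots> = ?t (Suc (Suc n)) \<oplus>\<^bsub>bar (Suc n)\<^esub> (\<Oplus>\<^bsub>bar (Suc n)\<^esub>i\<in>{..Suc n}. ?t i)"
   unfolding atMost_Suc[of "Suc n"] by (rule B.finsum_insert) (use k in auto)
  also have "?t (Suc (Suc n)) = alternate (bar (Suc n)) n (bar_cell (Suc n) w m k)"
   using m k lw by (simp add: word_face_def word_coeff_def bar_cell_alternate) (simp add: alternate_def)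
  also have "(\<Oplus>\<^bsub>bar (Suc n)\<^esub>i\<in>{..Suc n}. ?t i) = (\<Oplus>\<^bsub>bar (Suc n)\<^esub>i\<in>{..Suc n}.
    bar_contr n (bar_cell n (word_face i w) (m \<otimes>\<^bsub>M\<^esub> word_coeff i w) (alternate K i k)))"
   by (rule B.finsum_cong'[OF refl _ t]) (use k in \<open>auto intro: bar_contr_closed\<close>)
  also have "\<dots> = bar_contr n (bar_d n (bar_cell (Suc n) w m k))" unfolding bar_d_cell[OF w m k]
   by (rule additive_map_finsum[symmetric, OF abelian_group_bar abelian_group_bar])
    (use k in \<open>auto simp: bar_contr_closed bar_contr_add\<close>)
  finally show "bar_d (Suc n) (bar_contr (Suc n) (bar_cell (Suc n) w m k)) =
    bar_contr n (bar_d n (bar_cell (Suc n) w m k)) \<oplus>\<^bsub>bar (Suc n)\<^esub> alternate (bar (Suc n)) n (bar_cell (Suc n) w m k)"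
   using k dl(1)[of "bar_cell (Suc n) w m k" n] by (simp add: B.a_comm bar_contr_closed)
 qed (auto simp: dl bar_contr_closed)
qed

text \<open>Every generator of positive degree is in the image of the contraction; hence identities
  between linear maps need checking on that image only.\<close>

lemma bar_cell_snoc:
 assumes "v \<in> words (Suc n)"
 obtains x where "x \<in> carrier (bar n)" "bar_cell (Suc n) v \<one>\<^bsub>M\<^esub> \<one> = bar_contr n x"
proof -
 obtain w m where wm: "v = w @ [m]" "w \<in> words n" "m \<in> carrier M" using assms by (rule words_SucE)
 show thesis by (rule that[of "bar_cell n w m \<one>"]) (use bar_contr_cell[OF wm(2,3)] wm(1) in auto)
qed

lemma bar_aug_boundary:
 assumes x: "x \<in> carrier (bar (Suc 0))"
 shows "bar_aug (bar_d 0 x) = \<zero>"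
proof -
 interpret T: left_module R "trivial_module K M" by (rule left_module_trivial)
 interpret B: abelian_group "bar i" for i by (rule abelian_group_bar)
 note ea = linearD(1,2)[OF bar_aug_linear, unfolded trivial_module_simps]
 have zero: "(\<lambda>x. \<zero>\<^bsub>trivial_module K M\<^esub>) \<in> linear_maps R (bar (Suc 0)) (trivial_module K M)"
  by (rule linearI) (auto simp: T.smult_r_zero)
 have "bar_aug (bar_d 0 x) = \<zero>\<^bsub>trivial_module K M\<^esub>"
 proof (rule bar_linear_map_eqI[OF left_module_trivial linear_maps_compose[OF bar_d_linear bar_aug_linear] zero _ x])
  fix v assume "v \<in> words (Suc 0)"
  then obtain y where y: "y \<in> carrier (bar 0)" "bar_cell (Suc 0) v \<one>\<^bsub>M\<^esub> \<one> = bar_contr 0 y" by (rule bar_cell_snoc)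
  let ?e = "bar_cell 0 [] \<one>\<^bsub>M\<^esub> (bar_aug y)"
  have e: "?e \<in> carrier (bar 0)" using ea(1)[OF y(1)] by simp
  have "bar_aug (?e \<ominus>\<^bsub>bar 0\<^esub> y) = bar_aug ?e \<ominus>\<^bsub>trivial_module K M\<^esub> bar_aug y"
   by (rule linear_maps_diff[OF abelian_group_bar T.M.abelian_group_axioms bar_aug_linear e y(1)])
  also have "bar_aug ?e = bar_aug y" using bar_aug_cell[of "[]" "\<one>\<^bsub>M\<^esub>" "bar_aug y"] ea(1)[OF y(1)] by simp
  also have "bar_aug y \<ominus>\<^bsub>trivial_module K M\<^esub> bar_aug y = \<zero>\<^bsub>trivial_module K M\<^esub>"
   using ea(1)[OF y(1)] unfolding a_minus_def by (intro T.M.r_neg) (simp add: trivial_module_simps)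
  finally show "bar_aug (bar_d 0 (bar_cell (Suc 0) v \<one>\<^bsub>M\<^esub> \<one>)) = \<zero>\<^bsub>trivial_module K M\<^esub>"
   unfolding y(2) bar_homotopy_0[OF y(1)] .
 qed
 thus ?thesis by (simp add: trivial_module_simps)
qed

lemma bar_d_dI:
 assumes "\<And>y. y \<in> carrier (bar (Suc n)) ==> bar_d n (bar_d (Suc n) (bar_contr (Suc n) y)) = \<zero>\<^bsub>bar n\<^esub>"
  and x: "x \<in> carrier (bar (Suc (Suc n)))"
 shows "bar_d n (bar_d (Suc n) x) = \<zero>\<^bsub>bar n\<^esub>"
proof (rule bar_linear_map_eqI[OF left_module_bar linear_maps_compose[OF bar_d_linear bar_d_linear] _ _ x])
 interpret B: left_module R "bar n" by (rule left_module_bar)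
 show "(\<lambda>x. \<zero>\<^bsub>bar n\<^esub>) \<in> linear_maps R (bar (Suc (Suc n))) (bar n)"
  by (rule linearI) (auto simp: B.smult_r_zero)
 fix v assume "v \<in> words (Suc (Suc n))"
 then obtain y where y: "y \<in> carrier (bar (Suc n))" "bar_cell (Suc (Suc n)) v \<one>\<^bsub>M\<^esub> \<one> = bar_contr (Suc n) y"
  by (rule bar_cell_snoc)
 show "bar_d n (bar_d (Suc n) (bar_cell (Suc (Suc n)) v \<one>\<^bsub>M\<^esub> \<one>)) = \<zero>\<^bsub>bar n\<^esub>"
  unfolding y(2) by (rule assms(1)[OF y(1)])
qed

text \<open>The induction avoids faces of faces. With z the boundary of y, applying the differential
  twice to the contraction of y gives the boundary of the contraction of z plus a signed z. Since z
  is a cycle by induction, the homotopy identity cancels the two terms; in degree 0 the augmentation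
  replaces the lower differential.\<close>

lemma bar_d_d:
 "x \<in> carrier (bar (Suc (Suc n))) ==> bar_d n (bar_d (Suc n) x) = \<zero>\<^bsub>bar n\<^esub>"
proof (induction n arbitrary: x)
 case 0
 have "bar_d 0 (bar_d (Suc 0) (bar_contr (Suc 0) y)) = \<zero>\<^bsub>bar 0\<^esub>"
  if y: "y \<in> carrier (bar (Suc 0))" for y
 proof -
  interpret B: abelian_group "bar 0" by (rule abelian_group_bar)
  let ?z = "bar_d 0 y"
  have z: "?z \<in> carrier (bar 0)" by (rule linearD(1)[OF bar_d_linear y])
  have "bar_d 0 (bar_d (Suc 0) (bar_contr (Suc 0) y))
    = bar_d 0 (bar_contr 0 ?z) \<oplus>\<^bsub>bar 0\<^esub> ?z"
   unfolding bar_homotopy_Suc[OF y] using linearD(2)[OF bar_d_linear bar_contr_closed[OF z] y] by (simp add: alternate_def)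
  also have "bar_d 0 (bar_contr 0 ?z) = \<zero>\<^bsub>bar 0\<^esub> \<ominus>\<^bsub>bar 0\<^esub> ?z"
   unfolding bar_homotopy_0[OF z] bar_aug_boundary[OF y] by (simp only: bar_cell_zero)
  finally show ?thesis using z by (simp add: a_minus_def B.l_neg)
 qed
 thus ?case by (rule bar_d_dI[OF _ 0])
next
 case (Suc n)
 have "bar_d (Suc n) (bar_d (Suc (Suc n)) (bar_contr (Suc (Suc n)) y)) = \<zero>\<^bsub>bar (Suc n)\<^esub>"
  if y: "y \<in> carrier (bar (Suc (Suc n)))" for y
 proof -
  interpret B: abelian_group "bar i" for i by (rule abelian_group_bar)
  let ?z = "bar_d (Suc n) y"
  have z: "?z \<in> carrier (bar (Suc n))" by (rule linearD(1)[OF bar_d_linear y])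
  have ay: "alternate (bar (Suc (Suc n))) (Suc n) y \<in> carrier (bar (Suc (Suc n)))" using y by simp
  have az: "bar_d (Suc n) (alternate (bar (Suc (Suc n))) (Suc n) y) = alternate (bar (Suc n)) (Suc n) ?z"
   using linearD(1,2)[OF bar_d_linear] by (intro additive_map_alternate[OF abelian_group_bar abelian_group_bar _ _ y]) auto
  have "bar_d (Suc n) (bar_d (Suc (Suc n)) (bar_contr (Suc (Suc n)) y))
    = bar_d (Suc n) (bar_contr (Suc n) ?z) \<oplus>\<^bsub>bar (Suc n)\<^esub> alternate (bar (Suc n)) (Suc n) ?z"
   unfolding bar_homotopy_Suc[OF y] az[symmetric] by (rule linearD(2)[OF bar_d_linear bar_contr_closed[OF z] ay])
  also have "bar_d (Suc n) (bar_contr (Suc n) ?z) = alternate (bar (Suc n)) n ?z"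
   unfolding bar_homotopy_Suc[OF z] Suc.IH[OF y] bar_contr_zero using z by simp
  finally show ?thesis using B.alternate_Suc_cancel[OF z, of n] by simp
 qed
 thus ?case by (rule bar_d_dI[OF _ Suc.prems])
qed

theorem projective_resolution_bar:
 "projective_resolution R bar bar_d bar_aug (trivial_module K M)" unfolding projective_resolution_def
proof (intro conjI allI)
 interpret B: abelian_group "bar i" for i by (rule abelian_group_bar)
 fix n
 show "projective_module R (bar n)" unfolding bar_def by (rule R.projective_free_module)
 show "bar_d n \<in> linear_maps R (bar (Suc n)) (bar n)" by (rule bar_d_linear)
 show "bar_aug \<in> linear_maps R (bar 0) (trivial_module K M)" by (rule bar_aug_linear)
 show "bar_aug ` carrier (bar 0) = carrier (trivial_module K M)"
 proof (intro equalityI subsetI)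
  fix k assume "k \<in> carrier (trivial_module K M)"
  hence k: "k \<in> carrier K" by (simp add: trivial_module_simps)
  have "k = bar_aug (bar_cell 0 [] \<one>\<^bsub>M\<^esub> k)" using bar_aug_cell[of "[]" "\<one>\<^bsub>M\<^esub>" k] k by simp
  thus "k \<in> bar_aug ` carrier (bar 0)" using bar_cell_closed[OF k] by blast
 qed (use linearD(1)[OF bar_aug_linear] in auto)
 show "bar_d 0 ` carrier (bar 1) = {x \<in> carrier (bar 0). bar_aug x = \<zero>\<^bsub>trivial_module K M\<^esub>}"
 proof (intro equalityI subsetI)
  fix x assume "x \<in> {x \<in> carrier (bar 0). bar_aug x = \<zero>\<^bsub>trivial_module K M\<^esub>}"
  hence x: "x \<in> carrier (bar 0)" "bar_aug x = \<zero>" by (simp_all add: trivial_module_simps)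
  have c: "bar_contr 0 x \<in> carrier (bar (Suc 0))" by (rule bar_contr_closed[OF x(1)])
  have "bar_d 0 (bar_contr 0 x) = \<ominus>\<^bsub>bar 0\<^esub> x"
   unfolding bar_homotopy_0[OF x(1)] x(2) bar_cell_zero using x(1) by (simp add: a_minus_def)
  hence "bar_d 0 (\<ominus>\<^bsub>bar (Suc 0)\<^esub> bar_contr 0 x) = x"
   using linear_maps_minus[OF abelian_group_bar abelian_group_bar bar_d_linear c] x(1) by simp
  thus "x \<in> bar_d 0 ` carrier (bar 1)" using B.a_inv_closed[OF c] unfolding One_nat_def by (metis imageI)
 qed (use linearD(1)[OF bar_d_linear[of 0]] bar_aug_boundary in \<open>auto simp: trivial_module_simps\<close>)
 show "bar_d (Suc n) ` carrier (bar (Suc (Suc n))) = {x \<in> carrier (bar (Suc n)). bar_d n x = \<zero>\<^bsub>bar n\<^esub>}"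
 proof (intro equalityI subsetI)
  fix x assume "x \<in> {x \<in> carrier (bar (Suc n)). bar_d n x = \<zero>\<^bsub>bar n\<^esub>}"
  hence x: "x \<in> carrier (bar (Suc n))" "bar_d n x = \<zero>\<^bsub>bar n\<^esub>" by simp_all
  have c: "bar_contr (Suc n) x \<in> carrier (bar (Suc (Suc n)))" by (rule bar_contr_closed[OF x(1)])
  let ?y = "alternate (bar (Suc (Suc n))) n (bar_contr (Suc n) x)"
  have "bar_d (Suc n) ?y = alternate (bar (Suc n)) n (bar_d (Suc n) (bar_contr (Suc n) x))" using linearD(1,2)[OF bar_d_linear]
   by (intro additive_map_alternate[OF abelian_group_bar abelian_group_bar _ _ c]) auto
  also have "\<dots> = x" unfolding bar_homotopy_Suc[OF x(1)] x(2) bar_contr_zero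
   using x(1) by (simp add: B.alternate_alternate)
  finally show "x \<in> bar_d (Suc n) ` carrier (bar (Suc (Suc n)))" using B.alternate_closed[OF c] by (metis imageI)
 next
  fix x assume "x \<in> bar_d (Suc n) ` carrier (bar (Suc (Suc n)))"
  then obtain y where y: "y \<in> carrier (bar (Suc (Suc n)))" "x = bar_d (Suc n) y" by (rule imageE)
  show "x \<in> {x \<in> carrier (bar (Suc n)). bar_d n x = \<zero>\<^bsub>bar n\<^esub>}"
   unfolding y(2) using linearD(1)[OF bar_d_linear y(1)] bar_d_d[OF y(1)] by simp
 qed
qed

end

section \<open>Relative cochains\<close>

lemma cochain_simps:
 "\<phi> \<in> carrier (relative_cochain_module K X A n) \<longleftrightarrow>
   \<phi> \<in> hom (chain_group n X) (add_monoid K) \<and> \<phi> \<in> extensional (singular_chain_set n X) \<and>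
   (\<forall>c. singular_chain n (subtopology X A) c --> \<phi> c = \<zero>\<^bsub>K\<^esub>)"
 "\<zero>\<^bsub>relative_cochain_module K X A n\<^esub> = (\<lambda>c\<in>singular_chain_set n X. \<zero>\<^bsub>K\<^esub>)"
 "\<phi> \<oplus>\<^bsub>relative_cochain_module K X A n\<^esub> \<psi> = (\<lambda>c\<in>singular_chain_set n X. \<phi> c \<oplus>\<^bsub>K\<^esub> \<psi> c)"
 "k \<odot>\<^bsub>relative_cochain_module K X A n\<^esub> \<phi> = (\<lambda>c\<in>singular_chain_set n X. k \<otimes>\<^bsub>K\<^esub> \<phi> c)"
 by (auto simp: relative_cochain_module_def)

lemma singular_chain_subtopologyD: "singular_chain n (subtopology X A) c ==> singular_chain n X c"
 by (simp add: singular_chain_subtopology)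

locale relative_cochains = K: cring K for K :: "('k, 'x) ring_scheme" (structure) +
 fixes X :: "'a topology" and A :: "'a set"
begin

abbreviation cochains :: "nat => ('k, 'a chain => 'k) module" where
 "cochains \<equiv> relative_cochain_module K X A"

lemma cochainI:
 assumes "\<And>c. singular_chain n X c ==> \<phi> c \<in> carrier K"
  and "\<And>a b. [|singular_chain n X a; singular_chain n X b|] ==> \<phi> (a + b) = \<phi> a \<oplus> \<phi> b"
  and "\<And>c. singular_chain n (subtopology X A) c ==> \<phi> c = \<zero>"
 shows "restrict \<phi> (singular_chain_set n X) \<in> carrier (cochains n)" unfolding cochain_simps
 using assms by (auto simp: hom_def singular_chain_add dest: singular_chain_subtopologyD)

lemma cochainD:
 assumes "\<phi> \<in> carrier (cochains n)"
 shows "singular_chain n X c ==> \<phi> c \<in> carrier K"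
  and "[|singular_chain n X a; singular_chain n X b|] ==> \<phi> (a + b) = \<phi> a \<oplus> \<phi> b"
  and "singular_chain n (subtopology X A) c ==> \<phi> c = \<zero>"
  and "\<phi> \<in> extensional (singular_chain_set n X)" using assms unfolding cochain_simps by (auto simp: hom_def)

lemma cochain_zero: "\<phi> \<in> carrier (cochains n) ==> \<phi> 0 = \<zero>" by (rule cochainD(3)) auto

lemma cochain_minus:
 assumes \<phi>: "\<phi> \<in> carrier (cochains n)" and c: "singular_chain n X c"
 shows "\<phi> (- c) = \<ominus> \<phi> c"
proof -
 have m: "singular_chain n X (- c)" using c by (rule singular_chain_minus[THEN iffD2])
 have "\<phi> (- c) \<oplus> \<phi> c = \<zero>" using cochainD(2)[OF \<phi> m c] cochain_zero[OF \<phi>] by simp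
 thus ?thesis using cochainD(1)[OF \<phi>] m c by (intro K.minus_equality[symmetric])
qed

lemma cochain_diff:
 assumes \<phi>: "\<phi> \<in> carrier (cochains n)" and "singular_chain n X a" "singular_chain n X b"
 shows "\<phi> (a - b) = \<phi> a \<ominus> \<phi> b"
 using cochainD(2)[OF \<phi>, of a "- b"] cochain_minus[OF \<phi>, of b] assms(2,3)
 by (simp add: a_minus_def singular_chain_minus)

lemma cochain_alternate:
 assumes \<phi>: "\<phi> \<in> carrier (cochains n)" and c: "singular_chain n X c"
 shows "\<phi> (frag_cmul ((- 1) ^ i) c) = alternate K i (\<phi> c)"
 using cochain_minus[OF \<phi> c] by (simp add: alternate_def)

lemma cochain_sum:
 assumes \<phi>: "\<phi> \<in> carrier (cochains n)" and "finite I" "\<And>i. i \<in> I ==> singular_chain n X (f i)"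
 shows "\<phi> (sum f I) = (\<Oplus>i\<in>I. \<phi> (f i))" using assms(2,3)
proof (induction I rule: finite_induct)
 case empty
 thus ?case by (simp add: cochain_zero[OF \<phi>])
next
 case (insert i I)
 have "singular_chain n X (sum f I)" using insert(4) by (intro singular_chain_sum) auto
 thus ?case using insert cochainD(1)[OF \<phi>] cochainD(2)[OF \<phi>, of "f i" "sum f I"] by (simp)
qed

lemma cochain_boundary_simplex:
 assumes \<phi>: "\<phi> \<in> carrier (cochains n)" and s: "singular_simplex (Suc n) X s"
 shows "\<phi> (chain_boundary (Suc n) (frag_of s))
  = (\<Oplus>i\<in>{..Suc n}. alternate K i (\<phi> (frag_of (singular_face (Suc n) i s))))"
proof -
 have f: "singular_chain n X (frag_of (singular_face (Suc n) i s))" if "i \<le> Suc n" for i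
  using singular_simplex_singular_face[OF s _ that] by (simp add: singular_chain_of)
 have b: "chain_boundary (Suc n) (frag_of s) = (\<Sum>i\<le>Suc n. frag_cmul ((- 1) ^ i) (frag_of (singular_face (Suc n) i s)))"
  by (simp add: chain_boundary_of)
 have "\<phi> (chain_boundary (Suc n) (frag_of s))
   = (\<Oplus>i\<in>{..Suc n}. \<phi> (frag_cmul ((- 1) ^ i) (frag_of (singular_face (Suc n) i s))))"
  unfolding b by (rule cochain_sum[OF \<phi>]) (use f in \<open>auto intro: singular_chain_cmul\<close>)
 also have "\<dots> = (\<Oplus>i\<in>{..Suc n}. alternate K i (\<phi> (frag_of (singular_face (Suc n) i s))))"
  using f cochain_alternate[OF \<phi>] cochainD(1)[OF \<phi>] by (intro K.finsum_cong') auto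
 finally show ?thesis .
qed

lemma cochain_eq_zeroI:
 assumes \<phi>: "\<phi> \<in> carrier (cochains n)" and c: "keys c \<subseteq> T" and T: "T \<subseteq> singular_simplex_set n X"
  and eq: "\<And>s. s \<in> T ==> \<phi> (frag_of s) = \<zero>"
 shows "\<phi> c = \<zero>"
proof -
 have "singular_chain n X c \<and> \<phi> c = \<zero>" using c
 proof (induction c rule: frag_induction)
  case zero
  thus ?case by (simp add: cochain_zero[OF \<phi>])
 next
  case (one s)
  thus ?case using T eq by (auto simp: singular_chain_of)
 next
  case (diff a b)
  thus ?case using cochain_diff[OF \<phi>, of a b] by (simp add: singular_chain_diff)
 qed
 thus ?thesis ..
qed

text \<open>The chain group is free on the singular simplices, so values on simplices may be
  prescribed at will; vanishing on chains of \<open>A\<close> follows from vanishing on their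
  simplices.\<close>

lemma cochain_extend:
 assumes f: "\<And>s. singular_simplex n X s ==> f s \<in> carrier K"
  and A: "\<And>s. singular_simplex n (subtopology X A) s ==> f s = \<zero>"
 obtains \<phi> where "\<phi> \<in> carrier (cochains n)" "\<And>s. singular_simplex n X s ==> \<phi> (frag_of s) = f s"
proof -
 obtain \<phi> where \<phi>: "\<phi> \<in> hom (chain_group n X) (add_monoid K)" "\<And>s. singular_simplex n X s ==> \<phi> (frag_of s) = f s"
  using comm_group.free_Abelian_group_universal[OF K.a_comm_group, of f "singular_simplex_set n X"] f
  unfolding chain_group_def by auto
 have hc: "\<phi> c \<in> carrier K" if "singular_chain n X c" for c using \<phi>(1) that by (auto simp: hom_def)
 have ha: "\<phi> (a + b) = \<phi> a \<oplus> \<phi> b" if "singular_chain n X a" "singular_chain n X b" for a b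
  using \<phi>(1) that by (simp add: hom_def)
 have h0: "\<phi> 0 = \<zero>" using hom_one[OF \<phi>(1)] by (simp)
 have hm: "\<phi> (a - b) = \<zero>" if ab: "singular_chain n X a" "singular_chain n X b" "\<phi> a = \<zero>" "\<phi> b = \<zero>" for a b
 proof -
  have "singular_chain n X (a - b)" using ab(1,2) by (rule singular_chain_diff)
  hence "\<phi> (a - b) \<in> carrier K" "\<phi> (a - b + b) = \<phi> (a - b) \<oplus> \<phi> b" using hc ha ab(2) by blast+
  thus ?thesis using ab(3,4) by simp
 qed
 have "singular_chain n X c \<and> \<phi> c = \<zero>" if "singular_chain n (subtopology X A) c" for c
  using that unfolding singular_chain_def[of n "subtopology X A"]
 proof (induction c rule: frag_induction)
  case (one s)
  hence s: "singular_simplex n (subtopology X A) s" by simp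
  thus ?case using \<phi>(2) A[OF s] by (simp add: singular_simplex_subtopology singular_chain_of)
 qed (use h0 hm in \<open>auto intro: singular_chain_diff\<close>)
 hence "restrict \<phi> (singular_chain_set n X) \<in> carrier (cochains n)" using hc ha by (intro cochainI) auto
 thus ?thesis using \<phi>(2) by (intro that) (auto simp: singular_chain_of)
qed

lemma abelian_group_cochains: "abelian_group (cochains n)"
proof (rule abelian_group_pointwise(1)[OF K.is_abelian_group _ cochain_simps(3,2)])
 show "carrier (cochains n) \<subseteq> singular_chain_set n X \<rightarrow>\<^sub>E carrier K"
  using cochainD by (auto simp: PiE_def Pi_def)
 fix \<phi> assume "\<phi> \<in> carrier (cochains n)"
 note c = cochainD[OF this]
 show "(\<lambda>c\<in>singular_chain_set n X. \<ominus> \<phi> c) \<in> carrier (cochains n)"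
  by (rule cochainI) (auto simp: c K.minus_add)
 fix \<psi> assume "\<psi> \<in> carrier (cochains n)"
 note c' = cochainD[OF this]
 show "(\<lambda>c\<in>singular_chain_set n X. \<phi> c \<oplus> \<psi> c) \<in> carrier (cochains n)"
  by (rule cochainI) (auto simp: c c' K.a_ac)
qed (rule cochainI; auto)

lemma singular_chain_boundary_Suc: "singular_chain (Suc n) X c ==> singular_chain n X (chain_boundary (Suc n) c)"
 using singular_chain_boundary[of "Suc n" X c] by simp

lemma singular_coboundary_closed:
 assumes \<phi>: "\<phi> \<in> carrier (cochains n)"
 shows "singular_coboundary X n \<phi> \<in> carrier (cochains (Suc n))" unfolding singular_coboundary_def
proof (rule cochainI)
 fix c assume "singular_chain (Suc n) (subtopology X A) c"
 hence "singular_chain n (subtopology X A) (chain_boundary (Suc n) c)" using singular_chain_boundary by fastforce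
 thus "\<phi> (chain_boundary (Suc n) c) = \<zero>" by (rule cochainD(3)[OF \<phi>])
qed (use cochainD[OF \<phi>] singular_chain_boundary_Suc in \<open>auto simp: chain_boundary_add\<close>)

lemma singular_coboundary_apply:
 "singular_chain (Suc n) X c ==> singular_coboundary X n \<phi> c = \<phi> (chain_boundary (Suc n) c)"
 by (simp add: singular_coboundary_def)

lemma cochain_complex_relative: "cochain_complex K cochains (singular_coboundary X)"
proof (rule cochain_complex.intro)
 fix n
 show "abelian_group (cochains n)" by (rule abelian_group_cochains)
 show "singular_coboundary X n \<in> linear_maps K (cochains n) (cochains (Suc n))"
  by (rule linearI[OF singular_coboundary_closed])
   (auto simp: cochain_simps(3,4) singular_coboundary_def singular_chain_boundary_Suc)
 fix \<phi> assume \<phi>: "\<phi> \<in> carrier (cochains n)"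
 show "singular_coboundary X (Suc n) (singular_coboundary X n \<phi>) = \<zero>\<^bsub>cochains (Suc (Suc n))\<^esub>"
  unfolding cochain_simps(2) singular_coboundary_def[of X "Suc n"]
 proof (rule restrict_ext)
  fix c assume "c \<in> singular_chain_set (Suc (Suc n)) X"
  hence c: "singular_chain (Suc (Suc n)) X c" by simp
  show "singular_coboundary X n \<phi> (chain_boundary (Suc (Suc n)) c) = \<zero>"
   using chain_boundary_boundary_alt[of "Suc n" X c] c singular_coboundary_apply[OF singular_chain_boundary_Suc[OF c], of \<phi>] cochain_zero[OF \<phi>] by simp
 qed
 fix k assume k: "k \<in> carrier K"
 show "k \<odot>\<^bsub>cochains n\<^esub> \<phi> \<in> carrier (cochains n)"
  unfolding cochain_simps(4) by (rule cochainI) (auto simp: k cochainD[OF \<phi>] K.r_distr)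
 fix \<psi> assume \<psi>: "\<psi> \<in> carrier (cochains n)"
 show "k \<odot>\<^bsub>cochains n\<^esub> (\<phi> \<oplus>\<^bsub>cochains n\<^esub> \<psi>) = k \<odot>\<^bsub>cochains n\<^esub> \<phi> \<oplus>\<^bsub>cochains n\<^esub> k \<odot>\<^bsub>cochains n\<^esub> \<psi>"
  unfolding cochain_simps(3,4) by (rule restrict_ext) (simp add: k cochainD[OF \<phi>] cochainD[OF \<psi>] K.r_distr)
qed

lemma mem_cocycles_relative:
 "\<phi> \<in> cocycles cochains (singular_coboundary X) n \<longleftrightarrow>
   \<phi> \<in> carrier (cochains n) \<and> (\<forall>c. singular_chain (Suc n) X c --> \<phi> (chain_boundary (Suc n) c) = \<zero>)"
 unfolding cocycles_def cochain_simps(2) singular_coboundary_def by (auto simp: fun_eq_iff split: if_splits)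

end

text \<open>A family \<open>T\<close> of simplices which is acyclic modulo itself carries the cohomology: the
 retraction \<open>id - \<partial>h - h\<partial>\<close> extends cocycles from \<open>T\<close>, and \<open>h\<close> trivialises those vanishing on \<open>T\<close>.\<close>

locale carrying_family = relative_cochains K X A for K :: "('k, 'x) ring_scheme" (structure) and X :: "'a topology" and A +
 fixes T :: "nat => ((nat => real) => 'a) set"
 assumes face_closed: "face_closed X T" and acyclic: "acyclic_modulo X T"
  and subspace: "singular_simplex n (subtopology X A) s ==> s \<in> T n"
begin

lemma T_singular: "T n \<subseteq> singular_simplex_set n X" using face_closed by (simp add: face_closed_def)

lemma contraction:
 obtains h where "\<And>n. \<forall>s\<in>T n. h n s = 0"
  and "\<And>n c. singular_chain n X c ==> singular_chain (Suc n) X (frag_extend (h n) c)"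
  and "\<And>n c. singular_chain n X c ==>
      keys (chain_remainder h n c) \<subseteq> T n"
proof -
 obtain h where h: "\<And>n s. s \<in> T n ==> h n s = 0" "\<And>n s. singular_simplex n X s ==> singular_chain (Suc n) X (h n s)"
  and rest: "\<And>n c. singular_chain n X c ==>
      keys (chain_remainder h n c) \<subseteq> T n" using acyclic_modulo_chain_contraction[OF face_closed acyclic] by blast
 have "singular_chain (Suc n) X (frag_extend (h n) c)" if "singular_chain n X c" for n c
  using that h(2) by (intro singular_chain_extend) (auto simp: singular_chain_def)
 thus thesis using that[of h] h(1) rest by blast
qed

lemma frag_extend_vanish:
 assumes "\<forall>s\<in>T n. h s = 0" "keys c \<subseteq> T n"
 shows "frag_extend h c = 0" using assms by (intro frag_extend_zero) blast

lemma keys_subspace: "singular_chain n (subtopology X A) c ==> keys c \<subseteq> T n"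
 using subspace by (auto simp: singular_chain_def)

lemma keys_boundary: "keys c \<subseteq> T (Suc n) ==> keys (chain_boundary (Suc n) c) \<subseteq> T n"
 using face_closed_chain_boundary[OF face_closed, of c "Suc n"] by simp

lemma coboundary_if_vanishes:
 assumes \<xi>: "\<xi> \<in> cocycles cochains (singular_coboundary X) n"
  and T: "\<And>s. s \<in> T n ==> \<xi> (frag_of s) = \<zero>"
 shows "\<xi> \<in> coboundaries cochains (singular_coboundary X) n"
proof -
 note \<xi>' = \<xi>[unfolded mem_cocycles_relative]
 have \<xi>c: "\<xi> \<in> carrier (cochains n)" using \<xi>' by blast
 obtain h where h: "\<And>n. \<forall>s\<in>T n. h n s = 0"
  and hs: "\<And>n c. singular_chain n X c ==> singular_chain (Suc n) X (frag_extend (h n) c)"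
  and rest: "\<And>n c. singular_chain n X c ==>
      keys (chain_remainder h n c) \<subseteq> T n" using contraction by blast
 \<comment> \<open>The remainder of \<open>c\<close> lies on \<open>T\<close>, where
   \<open>\<xi>\<close> vanishes, and \<open>\<xi>\<close> kills boundaries. What is left says that
   \<open>\<xi>\<close> is the coboundary of its composite with the homotopy.\<close>
 have val: "\<xi> c = \<xi> (frag_extend (h (n - 1)) (chain_boundary n c))"
  if c: "singular_chain n X c" and s: "singular_chain n X (frag_extend (h (n - 1)) (chain_boundary n c))" for c
 proof -
  let ?b = "chain_boundary (Suc n) (frag_extend (h n) c)" and ?e = "frag_extend (h (n - 1)) (chain_boundary n c)"
  have b: "singular_chain n X ?b" by (rule singular_chain_boundary_Suc[OF hs[OF c]])
  have "\<zero> = \<xi> (c - ?b - ?e)" by (rule cochain_eq_zeroI[OF \<xi>c rest[OF c] T_singular T, symmetric])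
  also have "\<dots> = \<xi> c \<ominus> \<xi> ?b \<ominus> \<xi> ?e"
   using cochain_diff[OF \<xi>c singular_chain_diff[OF c b] s] cochain_diff[OF \<xi>c c b] by simp
  also have "\<xi> ?b = \<zero>" using \<xi>' hs[OF c] by blast
  finally have "\<xi> c \<ominus> \<xi> ?e = \<zero>" using cochainD(1)[OF \<xi>c c] by (simp add: a_minus_def)
  thus ?thesis by (rule K.minus_eq_zeroD[OF cochainD(1)[OF \<xi>c c] cochainD(1)[OF \<xi>c s]])
 qed
 show ?thesis
 proof (cases n)
  case 0
  have "\<xi> c = \<zero>" if "singular_chain n X c" for c
   using val[OF that] cochain_zero[OF \<xi>c] by (simp add: 0 chain_boundary_def)
  hence "\<xi> = \<zero>\<^bsub>cochains n\<^esub>"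
   unfolding cochain_simps(2) by (intro extensionalityI[OF cochainD(4)[OF \<xi>c]]) auto
  thus ?thesis by (simp add: 0 coboundaries_def)
 next
  case (Suc m)
  let ?\<mu> = "\<lambda>c\<in>singular_chain_set m X. \<xi> (frag_extend (h m) c)"
  have hs': "singular_chain n X (frag_extend (h m) c)" if "singular_chain m X c" for c using hs[OF that] unfolding Suc .
  have \<mu>: "?\<mu> \<in> carrier (cochains m)"
  proof (rule cochainI)
   fix c assume "singular_chain m (subtopology X A) c"
   hence "frag_extend (h m) c = 0" by (intro frag_extend_vanish[OF h] keys_subspace)
   thus "\<xi> (frag_extend (h m) c) = \<zero>" by (simp add: cochain_zero[OF \<xi>c])
  qed (use cochainD[OF \<xi>c] hs' in \<open>auto simp: frag_extend_add\<close>)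
  have "\<xi> = singular_coboundary X m ?\<mu>"
  proof (rule extensionalityI[OF cochainD(4)[OF \<xi>c]])
   show "singular_coboundary X m ?\<mu> \<in> extensional (singular_chain_set n X)" by (simp add: singular_coboundary_def Suc)
   fix c assume "c \<in> singular_chain_set n X"
   hence c: "singular_chain (Suc m) X c" by (simp add: Suc)
   thus "\<xi> c = singular_coboundary X m ?\<mu> c"
    using val[of c] hs'[OF singular_chain_boundary_Suc[OF c]] singular_chain_boundary_Suc[OF c]
    by (simp add: singular_coboundary_apply Suc)
  qed
  thus ?thesis using \<mu> by (simp add: Suc coboundaries_def)
 qed
qed

lemma cocycle_extends:
 assumes \<phi>: "\<phi> \<in> carrier (cochains n)"
  and T: "\<And>s. s \<in> T (Suc n) ==> \<phi> (chain_boundary (Suc n) (frag_of s)) = \<zero>"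
 obtains \<psi> where "\<psi> \<in> cocycles cochains (singular_coboundary X) n" "\<And>s. s \<in> T n ==> \<psi> (frag_of s) = \<phi> (frag_of s)"
proof -
 obtain h where h: "\<And>n. \<forall>s\<in>T n. h n s = 0"
  and hs: "\<And>n c. singular_chain n X c ==> singular_chain (Suc n) X (frag_extend (h n) c)"
  and rest: "\<And>n c. singular_chain n X c ==>
      keys (chain_remainder h n c) \<subseteq> T n" using contraction by blast
 define \<rho> where "\<rho> = (\<lambda>n c. c - chain_boundary (Suc n) (frag_extend (h n) c) - frag_extend (h (n - 1)) (chain_boundary n c))"
 have \<rho>T: "keys (\<rho> n c) \<subseteq> T n" if "singular_chain n X c" for n c unfolding \<rho>_def by (rule rest[OF that])
 have \<rho>s: "singular_chain n X (\<rho> n c)" if "singular_chain n X c" for n c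
  by (rule face_closed_singular_chain[OF face_closed \<rho>T[OF that]])
 have \<rho>add: "\<rho> n (a + b) = \<rho> n a + \<rho> n b" for n a b
  by (simp add: \<rho>_def frag_extend_add chain_boundary_add)
 have \<rho>id: "\<rho> n c = c" if c: "keys c \<subseteq> T n" for n c
 proof -
  have "frag_extend (h n) c = 0" by (rule frag_extend_vanish[OF h c])
  moreover have "frag_extend (h (n - 1)) (chain_boundary n c) = 0"
  proof (cases n)
   case 0
   thus ?thesis by (simp add: chain_boundary_def)
  next
   case (Suc m)
   have "keys (chain_boundary n c) \<subseteq> T (n - 1)" using keys_boundary[of c m] c by (simp add: Suc)
   thus ?thesis by (rule frag_extend_vanish[OF h])
  qed
  ultimately show ?thesis by (simp add: \<rho>_def)
 qed
 have \<rho>bd: "\<rho> n (chain_boundary (Suc n) c) = chain_boundary (Suc n) (\<rho> (Suc n) c)" if c: "singular_chain (Suc n) X c" for c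
  using chain_boundary_boundary_alt[of n X c] c chain_boundary_boundary_alt[OF hs[OF c]] by (auto simp: \<rho>_def chain_boundary_diff)
 let ?\<psi> = "\<lambda>c\<in>singular_chain_set n X. \<phi> (\<rho> n c)"
 have \<psi>c: "?\<psi> \<in> carrier (cochains n)"
 proof (rule cochainI)
  fix c assume c: "singular_chain n (subtopology X A) c"
  thus "\<phi> (\<rho> n c) = \<zero>" using cochainD(3)[OF \<phi> c] \<rho>id[OF keys_subspace[OF c]] by simp
 qed (use cochainD[OF \<phi>] \<rho>s in \<open>auto simp: \<rho>add\<close>)
 \<comment> \<open>The retraction commutes with boundaries, so the value is the coboundary of
   \<open>\<phi>\<close> on the retracted chain, which lies on \<open>T\<close>.\<close>
 have "?\<psi> (chain_boundary (Suc n) c) = \<zero>" if c: "singular_chain (Suc n) X c" for c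
 proof -
  have "singular_coboundary X n \<phi> (\<rho> (Suc n) c) = \<zero>"
  proof (rule cochain_eq_zeroI[OF singular_coboundary_closed[OF \<phi>] \<rho>T[OF c] T_singular])
   fix s assume s: "s \<in> T (Suc n)"
   hence "singular_chain (Suc n) X (frag_of s)" using T_singular by (auto simp: singular_chain_of)
   thus "singular_coboundary X n \<phi> (frag_of s) = \<zero>" using T[OF s] by (simp add: singular_coboundary_apply)
  qed
  thus ?thesis using \<rho>bd[OF c] singular_chain_boundary_Suc[OF c] by (simp add: singular_coboundary_apply[OF \<rho>s[OF c]])
 qed
 hence "?\<psi> \<in> cocycles cochains (singular_coboundary X) n" unfolding mem_cocycles_relative using \<psi>c by blast
 moreover have "?\<psi> (frag_of s) = \<phi> (frag_of s)" if s: "s \<in> T n" for s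
  using \<rho>id[of "frag_of s" n] s T_singular by (auto simp: singular_chain_of)
 ultimately show thesis using that by blast
qed

end

section \<open>Words and cells\<close>

locale dedekind_monoid_algebra = dedekind_monoid M + monoid_algebra_ring K M
 for K :: "('k, 'x) ring_scheme" (structure) and M :: "('m, 'y) monoid_scheme"
begin

text \<open>Letters are multiplied in reverse order, as labels are under composition of
  arrows.\<close>

primrec word_product :: "'m list => 'm" where
 "word_product [] = \<one>\<^bsub>M\<^esub>"
| "word_product (m # w) = word_product w \<otimes>\<^bsub>M\<^esub> m"

lemma word_product_closed: "set w \<subseteq> carrier M ==> word_product w \<in> carrier M" by (induction w) auto

lemma word_product_append:
 "[|set v \<subseteq> carrier M; set w \<subseteq> carrier M|] ==> word_product (v @ w) = word_product w \<otimes>\<^bsub>M\<^esub> word_product v"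
 by (induction v) (auto simp: word_product_closed m_assoc)

definition word_simplex :: "'m list => nat \<times> nat => 'm \<times> 'm" where
 "word_simplex w = (\<lambda>(i, j)\<in>ordinal_pairs (length w).
   (word_product (drop j w), word_product (take (j - i) (drop i w))))"

lemma word_simplex_apply:
 assumes "i \<le> j" "j \<le> length w"
 shows "word_simplex w (i, j) = (word_product (drop j w), word_product (take (j - i) (drop i w)))"
 using assms by (simp add: word_simplex_def ordinal_pairs_def)

lemma vertex_word_simplex: "i \<le> length w ==> vertex (word_simplex w) i = word_product (drop i w)"
 by (simp add: vertex_def word_simplex_apply)

lemma label_word_simplex:
 "[|i \<le> j; j \<le> length w|] ==> label (word_simplex w) i j = word_product (take (j - i) (drop i w))"
 by (simp add: label_def word_simplex_apply)

lemma word_simplex_closed: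
 assumes w: "w \<in> words n"
 shows "word_simplex w \<in> EM_simplices n"
proof -
 have l: "length w = n" and s: "set w \<subseteq> carrier M" using w by (auto simp: words_def)
 have sd: "set (drop i w) \<subseteq> carrier M" "set (take j (drop i w)) \<subseteq> carrier M" for i j
  using s set_drop_subset[of i w] set_take_subset[of j "drop i w"] by blast+
 have c: "drop i w = take (j - i) (drop i w) @ drop j w" if "i \<le> j" for i j
  using that by (metis append_take_drop_id drop_drop le_add_diff_inverse2)
 have c': "take (k - i) (drop i w) = take (j - i) (drop i w) @ take (k - j) (drop j w)" if "i \<le> j" "j \<le> k" for i j k
 proof -
  have "take (j - i + (k - j)) (drop i w) = take (j - i) (drop i w) @ take (k - j) (drop (j - i) (drop i w))" by (rule take_add)
  thus ?thesis using that by simp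
 qed
 show ?thesis unfolding EM_simplices_iff
 proof (intro conjI allI impI)
  show "word_simplex w \<in> extensional (ordinal_pairs n)" by (simp add: word_simplex_def l)
  fix i assume "i \<le> n"
  thus "vertex (word_simplex w) i \<in> carrier M" "label (word_simplex w) i i = \<one>\<^bsub>M\<^esub>"
   by (simp_all add: vertex_word_simplex label_word_simplex l word_product_closed sd)
 next
  fix i j assume ij: "i \<le> j" "j \<le> n"
  thus "word_simplex w (i, j) = (vertex (word_simplex w) j, label (word_simplex w) i j)"
   "label (word_simplex w) i j \<in> carrier M"
   by (simp_all add: vertex_word_simplex label_word_simplex word_simplex_apply l word_product_closed sd)
  show "vertex (word_simplex w) j \<otimes>\<^bsub>M\<^esub> label (word_simplex w) i j = vertex (word_simplex w) i"
   using ij word_product_append[OF sd(2) sd(1), of "j - i" i j] c[OF ij(1)]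
   by (simp add: vertex_word_simplex label_word_simplex l)
 next
  fix i j k assume ijk: "i \<le> j" "j \<le> k" "k \<le> n"
  thus "label (word_simplex w) i k = label (word_simplex w) j k \<otimes>\<^bsub>M\<^esub> label (word_simplex w) i j"
   using word_product_append[OF sd(2) sd(2), of "j - i" i "k - j" j] c'[OF ijk(1,2)] by (simp add: label_word_simplex l)
 qed
qed

lemma last_vertex_word_simplex: "w \<in> words n ==> vertex (word_simplex w) n = \<one>\<^bsub>M\<^esub>"
 by (auto simp: words_def vertex_word_simplex)

lemma label_Suc_word_simplex:
 assumes "w \<in> words n" "i < n"
 shows "label (word_simplex w) i (Suc i) = w ! i"
proof -
 have l: "length w = n" "w ! i \<in> carrier M" using assms nth_mem by (auto simp: words_def)
 hence "take (Suc i - i) (drop i w) = [w ! i]" using assms(2) by (simp add: take_Suc hd_drop_conv_nth)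
 thus ?thesis using assms(2) l by (simp add: label_word_simplex)
qed

lemma EM_simplex_eqI:
 assumes F: "F \<in> EM_simplices n" and G: "G \<in> EM_simplices n" and last: "vertex F n = vertex G n"
  and lab: "\<And>i. i < n ==> label F i (Suc i) = label G i (Suc i)"
 shows "F = G"
proof -
 have l: "i + k \<le> n ==> label F i (i + k) = label G i (i + k)" for i k
 proof (induction k)
  case 0
  thus ?case using EM_simplexD(3)[OF F, of i] EM_simplexD(3)[OF G, of i] by simp
 next
  case (Suc k)
  hence "label F (i + k) (Suc (i + k)) = label G (i + k) (Suc (i + k))" using lab by simp
  thus ?case using Suc EM_simplexD(7)[OF F, of i "i + k" "Suc (i + k)"] EM_simplexD(7)[OF G, of i "i + k" "Suc (i + k)"] by simp
 qed
 have lab': "label F i j = label G i j" if "i \<le> j" "j \<le> n" for i j using l[of i "j - i"] that by simp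
 have v: "vertex F j = vertex G j" if "j \<le> n" for j
  using EM_simplexD(6)[OF F that] EM_simplexD(6)[OF G that] lab'[OF that] last by simp
 show ?thesis
 proof (rule extensionalityI[OF EM_simplexD(1)[OF F] EM_simplexD(1)[OF G]])
  fix p assume "p \<in> ordinal_pairs n"
  then obtain i j where p: "p = (i, j)" "i \<le> j" "j \<le> n" by (auto simp: ordinal_pairs_def)
  thus "F p = G p" using EM_simplexD(4)[OF F, of i j] EM_simplexD(4)[OF G, of i j] lab' v by simp
 qed
qed

definition word_cell :: "'m list => (nat => real) => 'm EM_point set" where
 "word_cell w = orbit_cell (length w) (word_simplex w)"

lemma length_words: "w \<in> words n ==> length w = n" by (simp add: words_def)

text \<open>A simplex whose last vertex is a unit is the translate, by that unit, of the simplex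
  with the same labels and last vertex 1. Thus labels alone determine the orbit.\<close>

lemma word_cell_orbit_cell:
 assumes w: "w \<in> words n" and F: "F \<in> EM_simplices n" and unit: "vertex F n \<in> Units M"
  and lab: "\<And>i. i < n ==> label F i (Suc i) = w ! i"
 shows "orbit_cell n F = word_cell w"
proof -
 let ?g = "vertex F n"
 have g: "?g \<in> carrier M" by (rule EM_simplexD(2)[OF F]) simp
 have W: "word_simplex w \<in> EM_simplices n" by (rule word_simplex_closed[OF w])
 have "F = translate n ?g (word_simplex w)" by (rule EM_simplex_eqI[OF F translate_closed[OF W g]])
   (use g lab label_Suc_word_simplex[OF w] last_vertex_word_simplex[OF w] in
    \<open>simp_all add: translate_vertex translate_label\<close>)
 hence "orbit_cell n F = orbit_cell n (translate n ?g (word_simplex w))" by simp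
 also have "\<dots> = orbit_cell n (word_simplex w)" by (rule orbit_cell_translate[OF unit W])
 finally show ?thesis by (simp add: word_cell_def length_words[OF w])
qed

lemma orbit_cells_eq: "orbit_cells n = word_cell ` words n"
proof (intro equalityI subsetI)
 fix s assume "s \<in> orbit_cells n"
 then obtain F where F: "s = orbit_cell n F" "F \<in> EM_simplices n" "vertex F n \<in> Units M" by (auto simp: orbit_cells_def)
 let ?w = "map (\<lambda>i. label F i (Suc i)) [0..<n]"
 have w: "?w \<in> words n" using EM_simplexD(5)[OF F(2)] by (auto simp: words_def)
 have "orbit_cell n F = word_cell ?w" by (rule word_cell_orbit_cell[OF w F(2,3)]) simp
 thus "s \<in> word_cell ` words n" using w F(1) by blast
next
 fix s assume "s \<in> word_cell ` words n"
 then obtain w where w: "w \<in> words n" "s = word_cell w" by blast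
 thus "s \<in> orbit_cells n" using word_simplex_closed[OF w(1)] last_vertex_word_simplex[OF w(1)] length_words[OF w(1)]
  by (auto simp: orbit_cells_def word_cell_def)
qed

lemma inj_on_word_cell: "inj_on word_cell (words n)"
proof (rule inj_onI)
 fix v w assume v: "v \<in> words n" and w: "w \<in> words n" and eq: "word_cell v = word_cell w"
 have "orbit_cell n (word_simplex v) = orbit_cell n (word_simplex w)"
  using eq by (simp add: word_cell_def length_words[OF v] length_words[OF w])
 then obtain g where g: "g \<in> Units M" "word_simplex w = translate n g (word_simplex v)"
  by (rule orbit_cell_eqD[OF word_simplex_closed[OF v] word_simplex_closed[OF w]])
 show "v = w"
 proof (rule nth_equalityI)
  show "length v = length w" using v w by (simp add: length_words)
  fix i assume "i < length v"
  hence i: "i < n" using length_words[OF v] by simp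
  hence "label (word_simplex w) i (Suc i) = label (word_simplex v) i (Suc i)" unfolding g(2) by (intro translate_label) auto
  thus "v ! i = w ! i" by (simp add: label_Suc_word_simplex[OF v i] label_Suc_word_simplex[OF w i])
 qed
qed

lemma singular_simplex_word_cell: "w \<in> words n ==> singular_simplex n (orbit_EM M) (word_cell w)"
 using singular_simplex_orbit_cell[OF word_simplex_closed] by (simp add: word_cell_def length_words)

lemma nth_word_face:
 assumes w: "w \<in> words (Suc n)" and i: "i \<le> Suc n" and j: "j < n"
 shows "label (word_simplex w) (coface i j) (coface i (Suc j)) = word_face i w ! j"
proof -
 have l: "length w = Suc n" by (rule length_words[OF w])
 note lab = label_Suc_word_simplex[OF w]
 consider "i = Suc n" | "i = 0" | "0 < i" "i \<le> n" "Suc j < i" | "0 < i" "i \<le> n" "Suc j = i" | "0 < i" "i \<le> n" "i \<le> j" using i by linarith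
 thus ?thesis
 proof cases
  case 4
  have "label (word_simplex w) j (Suc (Suc j)) = label (word_simplex w) (Suc j) (Suc (Suc j)) \<otimes>\<^bsub>M\<^esub> label (word_simplex w) j (Suc j)"
   by (rule EM_simplexD(7)[OF word_simplex_closed[OF w]]) (use j in auto)
  thus ?thesis using 4 j l lab[of j] lab[of "Suc j"] by (auto simp: coface_def word_face_def nth_append)
 qed (use j l lab[of j] lab[of "Suc j"] in \<open>auto simp: coface_def word_face_def nth_append nth_tl nth_butlast\<close>)
qed

text \<open>The last vertex of the \<open>i\<close>-th face is \<open>word_coeff i w\<close>. A unit
  is normalised away by translation, a singular element puts the face into the orbits of the
  singular part.\<close>

lemma singular_face_word_cell:
 assumes w: "w \<in> words (Suc n)" and i: "i \<le> Suc n"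
 shows "singular_face (Suc n) i (word_cell w) = word_cell (word_face i w) \<and> word_coeff i w \<in> Units M \<or>
  singular_simplex n (subtopology (orbit_EM M) (orbit_SEM M)) (singular_face (Suc n) i (word_cell w)) \<and>
  word_coeff i w \<notin> Units M"
proof -
 let ?F = "EM_pull n (coface i) (word_simplex w)"
 have W: "word_simplex w \<in> EM_simplices (Suc n)" by (rule word_simplex_closed[OF w])
 have F: "?F \<in> EM_simplices n" by (rule EM_pull_closed[OF W coface_in_ordinal_maps])
 have face: "singular_face (Suc n) i (word_cell w) = orbit_cell n ?F"
  unfolding word_cell_def length_words[OF w] singular_face_eq_singular_pull[OF i]
  by (rule singular_pull_orbit_cell[OF W coface_in_ordinal_maps])
 have lab: "label ?F j (Suc j) = word_face i w ! j" if "j < n" for j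
  using that nth_word_face[OF w i that] by (simp add: EM_pull_label)
 have last: "vertex ?F n = word_coeff i w"
 proof -
  have l: "length w = Suc n" by (rule length_words[OF w])
  obtain v m where wv: "w = v @ [m]" "v \<in> words n" "m \<in> carrier M" using w by (rule words_SucE)
  have "vertex ?F n = word_product (drop (coface i n) w)" by (simp add: EM_pull_vertex vertex_word_simplex l coface_def)
  also have "\<dots> = word_coeff i w" using i l wv by (auto simp: coface_def word_coeff_def)
  finally show ?thesis .
 qed
 show ?thesis
 proof (cases "word_coeff i w \<in> Units M")
  case True
  hence "orbit_cell n ?F = word_cell (word_face i w)" using word_cell_orbit_cell[OF word_face_closed[OF w i] F] lab last by simp
  thus ?thesis using True face by simp
 next
  case False
  hence "vertex ?F n \<in> singular_elements M" using vertex_units_or_singular[OF F, of n] last by auto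
  hence "orbit_cell n ?F ` \<Delta> n \<subseteq> orbit_SEM M" using F by (auto simp: orbit_SEM_eq orbit_cell_def)
  hence "singular_simplex n (subtopology (orbit_EM M) (orbit_SEM M)) (orbit_cell n ?F)"
   using singular_simplex_orbit_cell[OF F] by (simp add: singular_simplex_subtopology)
  thus ?thesis using False face by simp
 qed
qed

lemma word_cell_not_subspace:
 assumes w: "w \<in> words n"
 shows "\<not> singular_simplex n (subtopology (orbit_EM M) (orbit_SEM M)) (word_cell w)"
proof
 assume "singular_simplex n (subtopology (orbit_EM M) (orbit_SEM M)) (word_cell w)"
 hence sub: "word_cell w ` \<Delta> n \<subseteq> orbit_SEM M" by (simp add: singular_simplex_subtopology)
 obtain t where t: "t \<in> \<Delta> n" "simplex_min n t > 0" using standard_simplex_interior by blast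
 have "orbit_point n (word_simplex w) t \<notin> orbit_SEM M"
  using orbit_point_notin_orbit_SEM[OF word_simplex_closed[OF w] _ t] last_vertex_word_simplex[OF w] by simp
 thus False using sub t(1) by (auto simp: word_cell_def orbit_cell_def length_words[OF w])
qed

end

section \<open>Relative cochains against linear maps on the bar resolution\<close>

context dedekind_monoid_algebra
begin

interpretation cells: simplicial_cells "orbit_EM M" "orbit_SEM M" orbit_cells nondegenerate_cells
 by (rule simplicial_cells_orbit_EM)

interpretation C: carrying_family K "orbit_EM M" "orbit_SEM M" cells.simplex_family
proof (rule carrying_family.intro[OF relative_cochains.intro[OF K.cring_axioms] carrying_family_axioms.intro])
 show "face_closed (orbit_EM M) cells.simplex_family" by (rule cells.face_closed_simplex_family)
 show "acyclic_modulo (orbit_EM M) cells.simplex_family" by (rule cells.acyclic_modulo_simplex_family)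
qed (simp add: cells.simplex_family_def)

text \<open>Multiplicativity of the action is the statement that a product is a unit exactly when
  both factors are.\<close>

lemma coefficient_module_units: "coefficient_module K R (units_module K M) (monoid_algebra_scalar K M)" unfolding units_module_def
 by (rule coefficient_module_action_module) (auto simp: Units_mult_iff)

lemma smult_units:
 assumes "m \<in> carrier M" "k \<in> carrier K" "x \<in> carrier K"
 shows "single m k \<odot>\<^bsub>units_module K M\<^esub> x = (if m \<in> Units M then k \<otimes> x else \<zero>)"
proof -
 have "single m k \<odot>\<^bsub>units_module K M\<^esub> x = k \<otimes> (if m \<in> Units M then x else \<zero>)"
  unfolding units_module_def by (rule action_module_smult(3)) (use assms in \<open>auto simp: Units_mult_iff\<close>)
 thus ?thesis using assms by simp
qed

lemma units_module_simps:
 "carrier (units_module K M) = carrier K" "\<zero>\<^bsub>units_module K M\<^esub> = \<zero>"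
 "x \<oplus>\<^bsub>units_module K M\<^esub> y = x \<oplus> y" by (simp_all add: units_module_def action_module_def)

lemma finsum_units_module: "finsum (units_module K M) f I = finsum K f I"
 by (simp add: units_module_def action_module_def finsum_def finprod_def)

interpretation N: coefficient_module K R "units_module K M" "monoid_algebra_scalar K M" by (rule coefficient_module_units)

abbreviation bar_cochains :: "nat => ('k, ('m list => 'm => 'k) => 'k) module" where
 "bar_cochains n \<equiv> hom_module (monoid_algebra_scalar K M) R (bar n) (units_module K M)"

text \<open>Keeps of a cochain only its values on word cells, read as values of a linear map on the
  basis of words.\<close>

definition evaluate :: "nat => ('m EM_point set chain => 'k) => ('m list => 'm => 'k) => 'k" where
 "evaluate n \<phi> = restrict (free_extend R (words n) (units_module K M) (\<lambda>w. \<phi> (frag_of (word_cell w)))) (carrier (bar n))"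

lemma word_cell_chain: "w \<in> words n ==> singular_chain n (orbit_EM M) (frag_of (word_cell w))"
 by (simp add: singular_chain_of singular_simplex_word_cell)

lemma evaluate_closed:
 assumes \<phi>: "\<phi> \<in> carrier (C.cochains n)"
 shows "evaluate n \<phi> \<in> carrier (bar_cochains n)"
proof -
 have "(\<lambda>w. \<phi> (frag_of (word_cell w))) \<in> words n \<rightarrow> carrier (units_module K M)"
  using C.cochainD(1)[OF \<phi> word_cell_chain] by (simp add: units_module_simps)
 from N.N.free_extend_linear[OF this] show ?thesis
  using restrict_linear_maps[OF left_module_bar] by (simp add: evaluate_def bar_def)
qed

lemma evaluate_cell:
 assumes \<phi>: "\<phi> \<in> carrier (C.cochains n)" and w: "w \<in> words n" and m: "m \<in> carrier M" and k: "k \<in> carrier K"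
 shows "evaluate n \<phi> (bar_cell n w m k) = (if m \<in> Units M then k \<otimes> \<phi> (frag_of (word_cell w)) else \<zero>)"
proof -
 have c: "(\<lambda>w. \<phi> (frag_of (word_cell w))) \<in> words n \<rightarrow> carrier (units_module K M)"
  using C.cochainD(1)[OF \<phi> word_cell_chain] by (simp add: units_module_simps)
 have "evaluate n \<phi> (bar_cell n w m k) = single m k \<odot>\<^bsub>units_module K M\<^esub> \<phi> (frag_of (word_cell w))"
  using N.N.free_extend_basis_vector[OF c w single_closed[OF k, of m]] bar_cell_closed[OF k, of n w m]
  by (simp add: evaluate_def bar_cell_def)
 thus ?thesis using smult_units[OF m k C.cochainD(1)[OF \<phi> word_cell_chain[OF w]]] by simp
qed

lemma evaluate_generator:
 "[|\<phi> \<in> carrier (C.cochains n); w \<in> words n|]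
   ==> evaluate n \<phi> (bar_cell n w \<one>\<^bsub>M\<^esub> \<one>) = \<phi> (frag_of (word_cell w))"
 using C.cochainD(1)[OF _ word_cell_chain, of \<phi> n w] by (simp add: evaluate_cell)

lemma bar_cochain_eqI:
 assumes f: "f \<in> carrier (bar_cochains n)" and g: "g \<in> carrier (bar_cochains n)"
  and eq: "\<And>w. w \<in> words n ==> f (bar_cell n w \<one>\<^bsub>M\<^esub> \<one>) = g (bar_cell n w \<one>\<^bsub>M\<^esub> \<one>)"
 shows "f = g"
proof (rule extensionalityI)
 show "f \<in> extensional (carrier (bar n))" "g \<in> extensional (carrier (bar n))" using f g by simp_all
 have lin: "f \<in> linear_maps R (bar n) (units_module K M)" "g \<in> linear_maps R (bar n) (units_module K M)"
  using f g by simp_all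
 show "f x = g x" if "x \<in> carrier (bar n)" for x using eq by (intro bar_linear_map_eqI[OF N.N.left_module_axioms lin _ that])
qed

lemma evaluate_linear: "evaluate n \<in> linear_maps K (C.cochains n) (bar_cochains n)"
proof (rule linearI)
 interpret CC: cochain_complex K C.cochains "singular_coboundary (orbit_EM M)" by (rule C.cochain_complex_relative)
 interpret Cn: abelian_group "C.cochains n" by (rule C.abelian_group_cochains)
 interpret H: abelian_group "bar_cochains n" by (rule N.abelian_group_hom_module[OF left_module_bar])
 fix \<phi> assume \<phi>: "\<phi> \<in> carrier (C.cochains n)"
 show "evaluate n \<phi> \<in> carrier (bar_cochains n)" by (rule evaluate_closed[OF \<phi>])
 { fix \<psi> assume \<psi>: "\<psi> \<in> carrier (C.cochains n)"
  show "evaluate n (\<phi> \<oplus>\<^bsub>C.cochains n\<^esub> \<psi>) = evaluate n \<phi> \<oplus>\<^bsub>bar_cochains n\<^esub> evaluate n \<psi>"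
  proof (rule bar_cochain_eqI)
   fix w assume w: "w \<in> words n"
   show "evaluate n (\<phi> \<oplus>\<^bsub>C.cochains n\<^esub> \<psi>) (bar_cell n w \<one>\<^bsub>M\<^esub> \<one>)
    = (evaluate n \<phi> \<oplus>\<^bsub>bar_cochains n\<^esub> evaluate n \<psi>) (bar_cell n w \<one>\<^bsub>M\<^esub> \<one>)"
    using evaluate_generator[OF Cn.a_closed[OF \<phi> \<psi>] w] evaluate_generator[OF \<phi> w] evaluate_generator[OF \<psi> w]
     word_cell_chain[OF w] by (simp add: hom_module_ops cochain_simps(3) units_module_simps)
  qed (use evaluate_closed \<phi> \<psi> in \<open>blast intro: Cn.a_closed H.a_closed\<close>)+ }
 fix k assume k: "k \<in> carrier K"
 show "evaluate n (k \<odot>\<^bsub>C.cochains n\<^esub> \<phi>) = k \<odot>\<^bsub>bar_cochains n\<^esub> evaluate n \<phi>"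
 proof (rule bar_cochain_eqI)
  show "evaluate n (k \<odot>\<^bsub>C.cochains n\<^esub> \<phi>) \<in> carrier (bar_cochains n)"
   by (rule evaluate_closed[OF CC.smult_closed[OF k \<phi>]])
  have "evaluate n \<phi> \<in> linear_maps R (bar n) (units_module K M)" using evaluate_closed[OF \<phi>] by simp
  from N.hom_module_closed(4)[OF left_module_bar k this]
  show "k \<odot>\<^bsub>bar_cochains n\<^esub> evaluate n \<phi> \<in> carrier (bar_cochains n)" by (simp add: hom_module_ops)
  fix w assume w: "w \<in> words n"
  have v: "\<phi> (frag_of (word_cell w)) \<in> carrier K" by (rule C.cochainD(1)[OF \<phi> word_cell_chain[OF w]])
  show "evaluate n (k \<odot>\<^bsub>C.cochains n\<^esub> \<phi>) (bar_cell n w \<one>\<^bsub>M\<^esub> \<one>)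
    = (k \<odot>\<^bsub>bar_cochains n\<^esub> evaluate n \<phi>) (bar_cell n w \<one>\<^bsub>M\<^esub> \<one>)"
   using evaluate_generator[OF CC.smult_closed[OF k \<phi>] w] evaluate_generator[OF \<phi> w]
    word_cell_chain[OF w] v k smult_units[OF one_closed k v]
   by (simp add: hom_module_ops cochain_simps(4) monoid_algebra_scalar_eq)
 qed
qed

text \<open>Faces of a word cell that leave the unit orbit lie in the singular part, where relative cochains
 vanish; on the algebraic side their coefficient acts on the coefficient module as zero.\<close>

lemma evaluate_coboundary:
 assumes \<phi>: "\<phi> \<in> carrier (C.cochains n)"
 shows "evaluate (Suc n) (singular_coboundary (orbit_EM M) n \<phi>)
  = compose (carrier (bar (Suc n))) (evaluate n \<phi>) (bar_d n)"
proof (rule bar_cochain_eqI)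
 show "evaluate (Suc n) (singular_coboundary (orbit_EM M) n \<phi>) \<in> carrier (bar_cochains (Suc n))"
  by (rule evaluate_closed[OF C.singular_coboundary_closed[OF \<phi>]])
 show "compose (carrier (bar (Suc n))) (evaluate n \<phi>) (bar_d n) \<in> carrier (bar_cochains (Suc n))"
  by (rule linearD(1)[OF N.compose_linear[OF left_module_bar left_module_bar bar_d_linear] evaluate_closed[OF \<phi>]])
 fix w assume w: "w \<in> words (Suc n)"
 have lin: "evaluate n \<phi> \<in> linear_maps R (bar n) (units_module K M)" using evaluate_closed[OF \<phi>] by simp
 have c: "bar_cell (Suc n) w \<one>\<^bsub>M\<^esub> \<one> \<in> carrier (bar (Suc n))" by simp
 let ?t = "\<lambda>i. bar_cell n (word_face i w) (\<one>\<^bsub>M\<^esub> \<otimes>\<^bsub>M\<^esub> word_coeff i w) (alternate K i \<one>)"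
 have "compose (carrier (bar (Suc n))) (evaluate n \<phi>) (bar_d n) (bar_cell (Suc n) w \<one>\<^bsub>M\<^esub> \<one>)
   = evaluate n \<phi> (\<Oplus>\<^bsub>bar n\<^esub>i\<in>{..Suc n}. ?t i)"
  using c bar_d_cell[OF w one_closed K.one_closed] by (simp add: compose_def)
 also have "\<dots> = (\<Oplus>\<^bsub>units_module K M\<^esub>i\<in>{..Suc n}. evaluate n \<phi> (?t i))"
  by (rule linear_maps_finsum[OF abelian_group_bar N.N.M.abelian_group_axioms lin]) auto
 also have "\<dots> = (\<Oplus>i\<in>{..Suc n}. evaluate n \<phi> (?t i))" by (rule finsum_units_module)
 also have "\<dots> = (\<Oplus>i\<in>{..Suc n}. alternate K i (\<phi> (frag_of (singular_face (Suc n) i (word_cell w)))))"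
 proof (rule K.finsum_cong'[OF refl])
  have f: "singular_simplex n (orbit_EM M) (singular_face (Suc n) i (word_cell w))" if "i \<le> Suc n" for i
   using singular_simplex_singular_face[OF singular_simplex_word_cell[OF w] _ that] by simp
  thus "(\<lambda>i. alternate K i (\<phi> (frag_of (singular_face (Suc n) i (word_cell w))))) \<in> {..Suc n} \<rightarrow> carrier K"
   using C.cochainD(1)[OF \<phi>] by (auto simp: singular_chain_of)
  fix i assume "i \<in> {..Suc n}"
  hence i: "i \<le> Suc n" by simp
  have v: "word_face i w \<in> words n" by (rule word_face_closed[OF w i])
  have vc: "\<phi> (frag_of (word_cell (word_face i w))) \<in> carrier K" by (rule C.cochainD(1)[OF \<phi> word_cell_chain[OF v]])
  have m: "word_coeff i w \<in> carrier M" by (rule word_coeff_closed[OF w])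
  have "evaluate n \<phi> (?t i) = (if word_coeff i w \<in> Units M
    then alternate K i \<one> \<otimes> \<phi> (frag_of (word_cell (word_face i w))) else \<zero>)"
   using evaluate_cell[OF \<phi> v m_closed[OF one_closed m], of "alternate K i \<one>"] m by simp
  also have "alternate K i \<one> \<otimes> \<phi> (frag_of (word_cell (word_face i w)))
    = alternate K i (\<phi> (frag_of (word_cell (word_face i w))))" using vc by (simp add: alternate_def K.l_minus)
  finally have e: "evaluate n \<phi> (?t i) = (if word_coeff i w \<in> Units M
    then alternate K i (\<phi> (frag_of (word_cell (word_face i w)))) else \<zero>)" .
  show "evaluate n \<phi> (?t i) = alternate K i (\<phi> (frag_of (singular_face (Suc n) i (word_cell w))))"
  proof (cases "word_coeff i w \<in> Units M")
   case True
   thus ?thesis using e singular_face_word_cell[OF w i] by auto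
  next
   case False
   hence "\<phi> (frag_of (singular_face (Suc n) i (word_cell w))) = \<zero>"
    using singular_face_word_cell[OF w i] by (intro C.cochainD(3)[OF \<phi>]) (auto simp: singular_chain_of)
   thus ?thesis using e False by simp
  qed
 qed
 also have "\<dots> = \<phi> (chain_boundary (Suc n) (frag_of (word_cell w)))"
  by (rule C.cochain_boundary_simplex[OF \<phi> singular_simplex_word_cell[OF w], symmetric])
 also have "\<dots> = evaluate (Suc n) (singular_coboundary (orbit_EM M) n \<phi>) (bar_cell (Suc n) w \<one>\<^bsub>M\<^esub> \<one>)"
  using evaluate_generator[OF C.singular_coboundary_closed[OF \<phi>] w] word_cell_chain[OF w]
  by (simp add: C.singular_coboundary_apply)
 finally show "evaluate (Suc n) (singular_coboundary (orbit_EM M) n \<phi>) (bar_cell (Suc n) w \<one>\<^bsub>M\<^esub> \<one>)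
  = compose (carrier (bar (Suc n))) (evaluate n \<phi>) (bar_d n) (bar_cell (Suc n) w \<one>\<^bsub>M\<^esub> \<one>)" by simp
qed

lemma evaluate_surj:
 assumes y: "y \<in> carrier (bar_cochains n)"
 obtains \<phi> where "\<phi> \<in> carrier (C.cochains n)" "evaluate n \<phi> = y"
proof -
 \<comment> \<open>The prescribed values are placed on word cells, which is unambiguous by
   injectivity of \<open>word_cell\<close>, and extended by 0 to all other singular
   simplices.\<close>
 let ?f = "\<lambda>s. if s \<in> word_cell ` words n then y (bar_cell n (the_inv_into (words n) word_cell s) \<one>\<^bsub>M\<^esub> \<one>) else \<zero>"
 have yc: "y (bar_cell n w \<one>\<^bsub>M\<^esub> \<one>) \<in> carrier K" for w
  using linearD(1)[of y R "bar n" "units_module K M"] y by (simp add: units_module_simps)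
 obtain \<phi> where \<phi>: "\<phi> \<in> carrier (C.cochains n)" "\<And>s. singular_simplex n (orbit_EM M) s ==> \<phi> (frag_of s) = ?f s"
 proof (rule C.cochain_extend[of n ?f])
  show "?f s = \<zero>" if "singular_simplex n (subtopology (orbit_EM M) (orbit_SEM M)) s" for s
   using word_cell_not_subspace that by auto
 qed (use yc in auto)
 have "evaluate n \<phi> = y"
 proof (rule bar_cochain_eqI[OF evaluate_closed[OF \<phi>(1)] y])
  fix w assume w: "w \<in> words n"
  show "evaluate n \<phi> (bar_cell n w \<one>\<^bsub>M\<^esub> \<one>) = y (bar_cell n w \<one>\<^bsub>M\<^esub> \<one>)"
   using evaluate_generator[OF \<phi>(1) w] \<phi>(2)[OF singular_simplex_word_cell[OF w]] w
    the_inv_into_f_f[OF inj_on_word_cell w] by simp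
 qed
 thus thesis by (rule that[OF \<phi>(1)])
qed

text \<open>The family consists of word cells and simplices of the subspace; the former are
  controlled by \<open>evaluate\<close>, the latter by relativity of the cochain.\<close>

lemma vanishes_on_simplex_family:
 assumes \<phi>: "\<phi> \<in> carrier (C.cochains n)" and z: "evaluate n \<phi> = \<zero>\<^bsub>bar_cochains n\<^esub>"
  and s: "s \<in> cells.simplex_family n"
 shows "\<phi> (frag_of s) = \<zero>"
proof (cases "s \<in> orbit_cells n")
 case True
 then obtain w where w: "w \<in> words n" "s = word_cell w" unfolding orbit_cells_eq by blast
 thus ?thesis using evaluate_generator[OF \<phi> w(1)] z by (simp add: units_module_simps)
next
 case False
 hence "singular_simplex n (subtopology (orbit_EM M) (orbit_SEM M)) s" using s by (simp add: cells.simplex_family_def)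
 thus ?thesis by (intro C.cochainD(3)[OF \<phi>]) (simp add: singular_chain_of)
qed

theorem modules_isomorphic_Ext_bar:
 "modules_isomorphic K (Ext_module (monoid_algebra_scalar K M) R bar bar_d (units_module K M) n)
   (relative_cohomology_module K n (orbit_EM M) (orbit_SEM M))"
proof -
 let ?\<delta> = "singular_coboundary (orbit_EM M)" and ?d = "\<lambda>i f. compose (carrier (bar (Suc i))) f (bar_d i)"
 interpret CC: cochain_complex K C.cochains ?\<delta> by (rule C.cochain_complex_relative)
 interpret DC: cochain_complex K bar_cochains ?d by (rule N.cochain_complex_resolution[OF projective_resolution_bar])
 interpret Cn: abelian_group "C.cochains i" for i by (rule CC.abelian_group)
 interpret Dn: abelian_group "bar_cochains i" for i by (rule DC.abelian_group)
 have ev0: "evaluate i \<zero>\<^bsub>C.cochains i\<^esub> = \<zero>\<^bsub>bar_cochains i\<^esub>" for i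
  by (rule linear_maps_zero[OF CC.abelian_group DC.abelian_group evaluate_linear])
 show ?thesis unfolding Ext_module_def relative_cohomology_module_def
 proof (rule modules_isomorphic_cohomologyI[OF CC.cochain_complex_axioms DC.cochain_complex_axioms evaluate_linear])
  fix \<phi> assume \<phi>: "\<phi> \<in> cocycles C.cochains ?\<delta> n"
  hence \<phi>c: "\<phi> \<in> carrier (C.cochains n)" by (rule CC.cocycles_carrier)
  show "evaluate n \<phi> \<in> cocycles bar_cochains ?d n"
   using \<phi> evaluate_coboundary[OF \<phi>c] evaluate_closed[OF \<phi>c] ev0[of "Suc n"] by (simp only: cocycles_def mem_Collect_eq)
  show "evaluate n \<phi> \<in> coboundaries bar_cochains ?d n \<longleftrightarrow> \<phi> \<in> coboundaries C.cochains ?\<delta> n"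
  proof
   assume "\<phi> \<in> coboundaries C.cochains ?\<delta> n"
   thus "evaluate n \<phi> \<in> coboundaries bar_cochains ?d n" using ev0[of 0] evaluate_coboundary evaluate_closed
    by (cases n) (auto simp del: hom_module_simps simp: coboundaries_def)
  next
   assume b: "evaluate n \<phi> \<in> coboundaries bar_cochains ?d n"
   \<comment> \<open>A bounding cochain on the algebraic side is realised by a singular one.
     Subtracting its coboundary leaves a cocycle vanishing on the whole family, hence a
     coboundary.\<close>
   have "\<exists>\<psi>\<in>coboundaries C.cochains ?\<delta> n. evaluate n \<psi> = evaluate n \<phi>"
   proof (cases n)
    case 0
    thus ?thesis using b ev0[of 0] by (auto simp del: hom_module_simps simp: coboundaries_def)
   next
    case (Suc m)
    then obtain y where y: "y \<in> carrier (bar_cochains m)" "evaluate n \<phi> = ?d m y"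
     using b by (auto simp del: hom_module_simps simp: coboundaries_def)
    obtain \<psi> where \<psi>: "\<psi> \<in> carrier (C.cochains m)" "evaluate m \<psi> = y" by (rule evaluate_surj[OF y(1)])
    have "evaluate n (?\<delta> m \<psi>) = evaluate n \<phi>"
     using evaluate_coboundary[OF \<psi>(1)] y(2) \<psi>(2) Suc by simp
    moreover have "?\<delta> m \<psi> \<in> coboundaries C.cochains ?\<delta> n" using \<psi>(1) by (simp add: coboundaries_def Suc)
    ultimately show ?thesis by blast
   qed
   then obtain \<psi> where \<psi>: "\<psi> \<in> coboundaries C.cochains ?\<delta> n" "evaluate n \<psi> = evaluate n \<phi>" by blast
   have \<psi>z: "\<psi> \<in> cocycles C.cochains ?\<delta> n" using \<psi>(1) CC.coboundaries_subset_cocycles by blast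
   have \<psi>c: "\<psi> \<in> carrier (C.cochains n)" by (rule CC.cocycles_carrier[OF \<psi>z])
   let ?x = "\<phi> \<ominus>\<^bsub>C.cochains n\<^esub> \<psi>"
   have xz: "?x \<in> cocycles C.cochains ?\<delta> n" by (rule CC.cocycles_diff[OF \<phi> \<psi>z])
   have "evaluate n ?x = evaluate n \<phi> \<ominus>\<^bsub>bar_cochains n\<^esub> evaluate n \<psi>"
    by (rule linear_maps_diff[OF CC.abelian_group DC.abelian_group evaluate_linear \<phi>c \<psi>c])
   also have "\<dots> = \<zero>\<^bsub>bar_cochains n\<^esub>"
    unfolding \<psi>(2) a_minus_def by (rule Dn.r_neg[OF evaluate_closed[OF \<phi>c]])
   finally have "?x \<in> coboundaries C.cochains ?\<delta> n"
    using C.coboundary_if_vanishes[OF xz] vanishes_on_simplex_family[OF CC.cocycles_carrier[OF xz]] by blast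
   hence "?x \<oplus>\<^bsub>C.cochains n\<^esub> \<psi> \<in> coboundaries C.cochains ?\<delta> n" using CC.coboundaries_closed(2) \<psi>(1) by blast
   moreover have "?x \<oplus>\<^bsub>C.cochains n\<^esub> \<psi> = \<phi>"
    using \<phi>c \<psi>c unfolding a_minus_def by (simp only: Cn.a_assoc Cn.a_inv_closed Cn.l_neg Cn.r_zero)
   ultimately show "\<phi> \<in> coboundaries C.cochains ?\<delta> n" by simp
  qed
 next
  fix y assume y: "y \<in> cocycles bar_cochains ?d n"
  hence yc: "y \<in> carrier (bar_cochains n)" by (rule DC.cocycles_carrier)
  obtain \<phi> where \<phi>: "\<phi> \<in> carrier (C.cochains n)" "evaluate n \<phi> = y" by (rule evaluate_surj[OF yc])
  \<comment> \<open>The chosen \<open>\<phi>\<close> need not be a cocycle, but its coboundary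
    vanishes on the family. Restricting it to the family and extending along the retraction produces
    a cocycle with the same values on word cells.\<close>
  have "evaluate (Suc n) (?\<delta> n \<phi>) = \<zero>\<^bsub>bar_cochains (Suc n)\<^esub>"
   unfolding evaluate_coboundary[OF \<phi>(1)] \<phi>(2) using y by (simp only: cocycles_def mem_Collect_eq)
  note van = vanishes_on_simplex_family[OF C.singular_coboundary_closed[OF \<phi>(1)] this]
  have "\<phi> (chain_boundary (Suc n) (frag_of s)) = \<zero>" if s: "s \<in> cells.simplex_family (Suc n)" for s
  proof -
   have "singular_chain (Suc n) (orbit_EM M) (frag_of s)" using C.T_singular s by (auto simp: singular_chain_of)
   thus ?thesis using van[OF s] C.singular_coboundary_apply[of n "frag_of s" \<phi>] by simp
  qed
  from C.cocycle_extends[OF \<phi>(1) this]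
  obtain \<psi> where \<psi>: "\<psi> \<in> cocycles C.cochains ?\<delta> n" "\<And>s. s \<in> cells.simplex_family n ==> \<psi> (frag_of s) = \<phi> (frag_of s)" by blast
  have \<psi>c: "\<psi> \<in> carrier (C.cochains n)" by (rule CC.cocycles_carrier[OF \<psi>(1)])
  have "evaluate n \<psi> = y" unfolding \<phi>(2)[symmetric]
  proof (rule bar_cochain_eqI[OF evaluate_closed[OF \<psi>c] evaluate_closed[OF \<phi>(1)]])
   fix w assume w: "w \<in> words n"
   hence "word_cell w \<in> cells.simplex_family n" by (simp add: cells.simplex_family_def orbit_cells_eq)
   thus "evaluate n \<psi> (bar_cell n w \<one>\<^bsub>M\<^esub> \<one>) = evaluate n \<phi> (bar_cell n w \<one>\<^bsub>M\<^esub> \<one>)"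
    using evaluate_generator[OF \<psi>c w] evaluate_generator[OF \<phi>(1) w] \<psi>(2) by simp
  qed
  hence "y \<ominus>\<^bsub>bar_cochains n\<^esub> evaluate n \<psi> = \<zero>\<^bsub>bar_cochains n\<^esub>"
   unfolding a_minus_def by (simp only: Dn.r_neg[OF yc])
  thus "\<exists>x\<in>cocycles C.cochains ?\<delta> n. y \<ominus>\<^bsub>bar_cochains n\<^esub> evaluate n x \<in> coboundaries bar_cochains ?d n"
   using \<psi>(1) DC.coboundaries_closed(1)[of n] by (intro bexI[of _ \<psi>]) (simp only:)
 qed
qed

end

theorem theorem3p11:
  fixes M :: "('m, 'y) monoid_scheme"
    and K :: "('k, 'x) ring_scheme"
    and P :: "nat \<Rightarrow> ('m \<Rightarrow> 'k, 'p, 'z) module_scheme"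
    and d :: "nat \<Rightarrow> 'p \<Rightarrow> 'p"
    and \<epsilon> :: "'p \<Rightarrow> 'k"
    and n :: nat
  assumes "monoid M"
    and "dedekind_finite M"
    and "cring K"
    and "projective_resolution (monoid_algebra K M) P d \<epsilon> (trivial_module K M)"
  shows "modules_isomorphic K
           (Ext_module (monoid_algebra_scalar K M) (monoid_algebra K M) P d (units_module K M) n)
           (relative_cohomology_module K n (orbit_EM M) (orbit_SEM M))"
proof -
  have "ring (monoid_algebra K M)"
    using resolutionD(2)[OF assms(4)] by (rule left_module.axioms(1))
  then interpret dedekind_monoid_algebra K M
    using assms(1-3)
    by (simp add: dedekind_monoid_algebra_def dedekind_monoid_def dedekind_monoid_axioms_def monoid_algebra_ring_def)
  interpret N: coefficient_module K R "units_module K M" "monoid_algebra_scalar K M"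
    by (rule coefficient_module_units)
  show ?thesis
    by (rule modules_isomorphic_trans[OF N.modules_isomorphic_Ext_module[OF assms(4) projective_resolution_bar left_module_trivial]
          modules_isomorphic_Ext_bar])
qed

end
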